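(* Let $G$ be a $\mathbb Z^2$-periodic, minimal, non-degenerate bipartite planar graph, and let $\tau\in i\mathbb R_{>0}$, $t\in\mathbb R+\frac{\pi}{2}\tau$. The image of the map $\varphi:X^{per}_G\to\mathbb R^2$ is equal to the interior of the geometric Newton polygon $N(G)$ of $G$. Moreover, a periodic half-angle map $\alpha\in X_G^{per}$ induces a periodic elliptic Kasteleyn operator $K=K^{(t)}$ if and only if $\varphi(\alpha)$ lies in $\mathbb Z^2$.
   Context: Graphs. $G$ is an infinite, locally finite bipartite graph with vertex set $V=B\sqcup W$, embedded in the plane so that its faces are bounded topological discs; $G^*$ is the dual graph, with vertex set $V^*$. The quad-graph $G^\diamond$ has vertex set $V\sqcup V^*$, with $v\in V$ joined to $f\in V^*$ each time $v$ lies on the boundary of the face $f$; its faces are quadrilaterals whose diagonals are an edge of $G$ and its dual edge. A train-track is a maximal chain of adjacent quadrilaterals of $G^\diamond$ such that when it enters a quadrilateral it exits through the opposite edge; it is viewed as a path crossing these opposite edges, oriented so that black vertices are on its right and white vertices on its left. $\mathcal T$ is the set of oriented train-tracks. $G$ is minimal if no train-track self-intersects and no two oriented train-tracks intersect twice joining the two intersection points in the same direction. Periodicity. $\mathbb Z^2$ acts freely by translation on coloured vertices, edges and faces; $\mathcal T_1=\mathcal T/\mathbb Z^2$. Fix a face $f$ and simple dual paths from $f$ to $f+(1,0)$ and to $f+(0,1)$, intersecting only at $f$; their projections $\gamma_x,\gamma_y$ form a basis of $H_1$ of the torus, and $[T]=h_T[\gamma_x]+v_T[\gamma_y]\in\mathbb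 Z^2$ with $h_T,v_T$ coprime. $\mathcal T_1$ is cyclically ordered by the directions of the vectors $[T]$ around the origin. One has $\sum_{T\in\mathcal T_1}[T]=0$; the vectors $[T]$, $T\in\mathcal T_1$, put one after the other in this cyclic order, form the boundary of a convex polygon, the geometric Newton polygon $N(G)$, defined up to translation by $\mathbb Z^2$ (a translate is fixed; the result holds for any choice). $G$ is non-degenerate if $N(G)$ has positive area. $X^{per}_G$ is the set of maps $\alpha:\mathcal T_1\to\mathbb R/\pi\mathbb Z$ monotone for the cyclic orders and with $\alpha_T\neq\alpha_{T'}$ whenever $[T]\ne[T']$. The map $\varphi$. Enumerate $\mathcal T_1$ as $T_1,\dots,T_r$ respecting the cyclic order (for parallel train-tracks, consistently with the cyclic order of their images under $\alpha$), and let $P_1,\dots,P_r$ be the integer points on the boundary of $N(G)$ numbered so that $P_{j+1}-P_j=[T_j]$ (cyclic indices). With $\alpha_j=\alpha_{T_j}$, $\alpha_0=\alpha_r$ and $\widetilde{\alpha_j-\alpha_{j-1}}$ the unique lift in $[0,\pi)$ of $\alpha_j-\alpha_{j-1}\in\mathbb R/\pi\mathbb Z$, set $\varphi(\alpha)=\sum_{j=1}^r\frac{\widetilde{\alpha_j-\alpha_{j-1}}}{\pi}P_j$. Fock's operator. $\theta(z)=2\sum_{n\ge0}(-1)^nq^{(n+1/2)^2}\sin((2n+1)z)$ with $q=e^{i\pi\tau}$. The discrete Abel map $\eta$ assigns to vertices of $G^\diamond$ elements of $\mathbb R/\pi\mathbb Z$: $\eta(v_0)=0$ at a fixed vertex $v_0$,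 and when traversing an edge of $G^\diamond$ crossed by $T$, $\eta$ increases by $\alpha_T$ if $T$ goes from right to left and decreases by $\alpha_T$ if $T$ goes from left to right. For an edge $wb$, let $w,f',b,f$ be the vertices in counterclockwise order of the face of $G^\diamond$ containing $wb$, $\alpha$ the half-angle of the train-track crossing $wf'$ and $bf$, and $\beta$ that of the train-track crossing $wf$ and $bf'$. Then $K^{(t)}_{w,b}=\dfrac{\theta(\beta-\alpha)}{\theta(t+\eta(b)-\beta)\theta(t+\eta(b)-\alpha)}$; all other coefficients are $0$. $K$ is periodic if $K_{w+(m,n),b+(m,n)}=K_{w,b}$ for all $w,b$ and $(m,n)\in\mathbb Z^2$. *)

theory Defs
  imports
    "HOL-Complex_Analysis.Complex_Analysis"
    "HOL-Library.Real_Mod"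
begin

section \<open>Half-angles: the circle of reals modulo pi\<close>

quotient_type halfangle = real / "\<lambda>x y. [x = y] (rmod pi)"
  by (intro equivpI reflpI sympI transpI) (auto intro: rcong_sym rcong_trans)

instantiation halfangle :: ab_group_add
begin

lift_definition zero_halfangle :: halfangle is "0" .
lift_definition plus_halfangle :: "halfangle \<Rightarrow> halfangle \<Rightarrow> halfangle" is "(+)"
  by (rule rcong_add)
lift_definition minus_halfangle :: "halfangle \<Rightarrow> halfangle \<Rightarrow> halfangle" is "(-)"
  by (rule rcong_diff)
lift_definition uminus_halfangle :: "halfangle \<Rightarrow> halfangle" is "uminus"
  by (rule rcong_uminus)

instance
  by standard (transfer; simp add: algebra_simps)+

end

lift_definition lift_angle :: "halfangle \<Rightarrow> real" is "\<lambda>x. x rmod pi"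
  by (simp add: rcong_def)

lemma lift_angle_bounds: "0 \<le> lift_angle a" "lift_angle a < pi"
  by (transfer; simp add: rmod_nonneg rmod_less)+

section \<open>Cyclic orders\<close>

definition cyc_angle :: "halfangle \<Rightarrow> halfangle \<Rightarrow> halfangle \<Rightarrow> bool" where
  "cyc_angle a b c \<longleftrightarrow>
     0 < lift_angle (b - a) \<and> lift_angle (b - a) < lift_angle (c - a)"

text \<open>The strict (partial) cyclic order of the directions of nonzero vectors of the plane:
  the counterclockwise angle from \<open>u\<close> to \<open>v\<close> is positive and smaller than the one from
  \<open>u\<close> to \<open>w\<close>.\<close>

definition cvec :: "int \<times> int \<Rightarrow> complex" where
  "cvec v = Complex (of_int (fst v)) (of_int (snd v))"

definition cyc_direction :: "int \<times> int \<Rightarrow> int \<times> int \<Rightarrow> int \<times> int \<Rightarrow> bool" where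
  "cyc_direction u v w \<longleftrightarrow>
     0 < Arg2pi (cvec v / cvec u) \<and> Arg2pi (cvec v / cvec u) < Arg2pi (cvec w / cvec u)"

text \<open>\<open>f 0, \<dots>, f (r - 1)\<close> is a weakly monotone cyclic sequence: no triple is in
  the reverse cyclic order.\<close>

definition cyc_sorted :: "('a \<Rightarrow> 'a \<Rightarrow> 'a \<Rightarrow> bool) \<Rightarrow> nat \<Rightarrow> (nat \<Rightarrow> 'a) \<Rightarrow> bool" where
  "cyc_sorted C r f \<longleftrightarrow> (\<forall>i j k. i < j \<longrightarrow> j < k \<longrightarrow> k < r \<longrightarrow> \<not> C (f i) (f k) (f j))"

section \<open>Bipartite plane graphs\<close>

text \<open>
  The elements of the type \<open>'e\<close> are the edges (multiple edges are allowed). The plane is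
  \<open>\<complex>\<close>, a vertex is a point of the plane, and \<open>curve G e\<close> is a parametrisation of the
  edge \<open>e\<close> from its white to its black endpoint. The fields \<open>rotB\<close> and \<open>rotW\<close> map an edge to
  the next one counterclockwise around its black, respectively white, endpoint.\<close>

record 'e plane_graph =
  curve :: "'e \<Rightarrow> real \<Rightarrow> complex"
  rotB :: "'e \<Rightarrow> 'e"
  rotW :: "'e \<Rightarrow> 'e"

definition white :: "('e, 'm) plane_graph_scheme \<Rightarrow> 'e \<Rightarrow> complex" where
  "white G e = pathstart (curve G e)"

definition black :: "('e, 'm) plane_graph_scheme \<Rightarrow> 'e \<Rightarrow> complex" where
  "black G e = pathfinish (curve G e)"

definition white_vertices :: "('e, 'm) plane_graph_scheme \<Rightarrow> complex set" where
  "white_vertices G = range (white G)"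

definition black_vertices :: "('e, 'm) plane_graph_scheme \<Rightarrow> complex set" where
  "black_vertices G = range (black G)"

definition vertices :: "('e, 'm) plane_graph_scheme \<Rightarrow> complex set" where
  "vertices G = black_vertices G \<union> white_vertices G"

definition support :: "('e, 'm) plane_graph_scheme \<Rightarrow> complex set" where
  "support G = (\<Union>e. path_image (curve G e))"

definition faces :: "('e, 'm) plane_graph_scheme \<Rightarrow> complex set set" where
  "faces G = components (- support G)"

text \<open>
  Walk along the boundary of the face on the left of \<open>e\<close> (traversed from white to black),
  keeping this face on the left: at each vertex one continues with the next edge in the
  clockwise order. Two consecutive edges of the walk are traversed by one step of
  \<open>next_left\<close>.\<close>

definition next_left :: "('e, 'm) plane_graph_scheme \<Rightarrow> 'e \<Rightarrow> 'e" where
  "next_left G e = inv (rotW G) (inv (rotB G) e)"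

primrec left_walk :: "('e, 'm) plane_graph_scheme \<Rightarrow> nat \<Rightarrow> 'e \<Rightarrow> real \<Rightarrow> complex" where
  "left_walk G 0 e = linepath (white G e) (white G e)"
| "left_walk G (Suc n) e =
     curve G e +++ (reversepath (curve G (inv (rotB G) e)) +++ left_walk G n (next_left G e))"

definition left_boundary :: "('e, 'm) plane_graph_scheme \<Rightarrow> 'e \<Rightarrow> real \<Rightarrow> complex" where
  "left_boundary G e = left_walk G (LEAST n. n > 0 \<and> (next_left G ^^ n) e = e) e"

text \<open>The boundary walk of a face is counterclockwise, so that it winds once around the points
  of this face and zero times around those of the other faces.\<close>

definition left_face :: "('e, 'm) plane_graph_scheme \<Rightarrow> 'e \<Rightarrow> complex set" where
  "left_face G e = {z \<in> - support G. winding_number (left_boundary G e) z = 1}"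

definition right_face :: "('e, 'm) plane_graph_scheme \<Rightarrow> 'e \<Rightarrow> complex set" where
  "right_face G e = left_face G (rotB G e)"

text \<open>
  Local finiteness is that of an embedded graph: a compact set meets finitely many edges, which
  excludes accumulation of the graph in the plane and implies that the degrees are finite.
  The faces correspond to the orbits of \<open>next_left\<close>; together with the winding numbers, this
  expresses that the rotations are those of the embedding.\<close>

definition bipartite_plane_graph :: "('e, 'm) plane_graph_scheme \<Rightarrow> bool" where
  "bipartite_plane_graph G \<longleftrightarrow>
     infinite (UNIV :: 'e set) \<and>
     (\<forall>e. arc (curve G e)) \<and>
     black_vertices G \<inter> white_vertices G = {} \<and>
     (\<forall>e. path_image (curve G e) \<inter> vertices G = {white G e, black G e}) \<and>
     (\<forall>e e'. e \<noteq> e' \<longrightarrow> path_image (curve G e) \<inter> path_image (curve G e') \<subseteq> vertices G) \<and>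
     (\<forall>S. compact S \<longrightarrow> finite {e. path_image (curve G e) \<inter> S \<noteq> {}}) \<and>
     bij (rotB G) \<and> (\<forall>e e'. black G e = black G e' \<longleftrightarrow> (\<exists>n. e' = (rotB G ^^ n) e)) \<and>
     bij (rotW G) \<and> (\<forall>e e'. white G e = white G e' \<longleftrightarrow> (\<exists>n. e' = (rotW G ^^ n) e)) \<and>
     (\<forall>F\<in>faces G. bounded F \<and> F homeomorphic (ball 0 1 :: complex set)) \<and>
     (\<forall>e. \<exists>n>0. (next_left G ^^ n) e = e) \<and>
     (\<forall>e. \<forall>z\<in>- support G. winding_number (left_boundary G e) z \<in> {0, 1}) \<and>
     range (left_face G) = faces G \<and>
     (\<forall>e e'. left_face G e = left_face G e' \<longleftrightarrow> (\<exists>n. e' = (next_left G ^^ n) e))"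

section \<open>The quad-graph and the train-tracks\<close>

text \<open>
  An edge of the quad-graph is a corner of the graph, i.e. a sector at a vertex between two
  consecutive edges: \<open>CornerB e\<close> is the sector at the black endpoint of \<open>e\<close> between \<open>e\<close> and
  \<open>rotB G e\<close>, so that it joins \<open>black G e\<close> and \<open>right_face G e\<close>; \<open>CornerW e\<close> is the sector at
  the white endpoint of \<open>e\<close> between \<open>e\<close> and \<open>rotW G e\<close>, so that it joins \<open>white G e\<close> and
  \<open>left_face G e\<close>.\<close>

datatype 'e corner = CornerB 'e | CornerW 'e

datatype quad_vertex = Vertex complex | Face "complex set"

definition quad_vertices :: "('e, 'm) plane_graph_scheme \<Rightarrow> quad_vertex set" where
  "quad_vertices G = Vertex ` vertices G \<union> Face ` faces G"

text \<open>
  The quadrilateral of the edge \<open>e\<close> has the vertices \<open>w, f', b, f\<close> in counterclockwise order,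
  where \<open>w\<close> and \<open>b\<close> are the endpoints of \<open>e\<close>, \<open>f' = right_face G e\<close> and \<open>f = left_face G e\<close>.
  Its sides are, in this order, \<open>w f'\<close>, \<open>f' b\<close>, \<open>b f\<close> and \<open>f w\<close>.\<close>

definition side_wr :: "('e, 'm) plane_graph_scheme \<Rightarrow> 'e \<Rightarrow> 'e corner" where
  "side_wr G e = CornerW (inv (rotW G) e)"

definition side_br :: "('e, 'm) plane_graph_scheme \<Rightarrow> 'e \<Rightarrow> 'e corner" where
  "side_br G e = CornerB e"

definition side_bl :: "('e, 'm) plane_graph_scheme \<Rightarrow> 'e \<Rightarrow> 'e corner" where
  "side_bl G e = CornerB (inv (rotB G) e)"

definition side_wl :: "('e, 'm) plane_graph_scheme \<Rightarrow> 'e \<Rightarrow> 'e corner" where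
  "side_wl G e = CornerW e"

text \<open>
  A train-track enters a quadrilateral through one side and exits through the opposite one.
  As it has the black vertices on its right and the white ones on its left, it enters through
  one of the two sides at \<open>f' = right_face G e\<close>: from \<open>w f'\<close> to \<open>b f\<close>, or from \<open>f' b\<close> to
  \<open>f w\<close>.\<close>

definition track_step :: "('e, 'm) plane_graph_scheme \<Rightarrow> ('e corner \<times> 'e corner) set" where
  "track_step G = (\<Union>e. {(side_wr G e, side_bl G e), (side_br G e, side_wl G e)})"

text \<open>A train-track is represented by the set of edges of the quad-graph that it crosses; each
  of them is crossed by exactly one train-track, which is oriented by \<open>track_step\<close>.\<close>

definition track_of :: "('e, 'm) plane_graph_scheme \<Rightarrow> 'e corner \<Rightarrow> 'e corner set" where
  "track_of G c = {d. (c, d) \<in> (track_step G \<union> (track_step G)\<inverse>)\<^sup>*}"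

definition tracks :: "('e, 'm) plane_graph_scheme \<Rightarrow> 'e corner set set" where
  "tracks G = range (track_of G)"

text \<open>Two strands cross in each quadrilateral; their entry sides are \<open>side_wr G e\<close> and
  \<open>side_br G e\<close>.\<close>

definition minimal_graph :: "('e, 'm) plane_graph_scheme \<Rightarrow> bool" where
  "minimal_graph G \<longleftrightarrow>
     (\<forall>e. track_of G (side_wr G e) \<noteq> track_of G (side_br G e)) \<and>
     \<not> (\<exists>e e' c d c' d'. e \<noteq> e' \<and>
          {c, d} = {side_wr G e, side_br G e} \<and> {c', d'} = {side_wr G e', side_br G e'} \<and>
          (c, c') \<in> (track_step G)\<^sup>* \<and> (d, d') \<in> (track_step G)\<^sup>*)"

section \<open>Periodicity\<close>

text \<open>\<open>(m, n)\<close> acts by the translation of vector \<open>m * fst (periods G) + n * snd (periods G)\<close>;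
  \<open>shift G (m, n)\<close> is the induced (and determined) map on edges.\<close>

record 'e periodic_graph = "'e plane_graph" +
  periods :: "complex \<times> complex"
  shift :: "int \<times> int \<Rightarrow> 'e \<Rightarrow> 'e"

definition lattice_vec :: "'e periodic_graph \<Rightarrow> int \<times> int \<Rightarrow> complex" where
  "lattice_vec G z = of_int (fst z) * fst (periods G) + of_int (snd z) * snd (periods G)"

definition periodic_bipartite_plane_graph :: "'e periodic_graph \<Rightarrow> bool" where
  "periodic_bipartite_plane_graph G \<longleftrightarrow>
     bipartite_plane_graph G \<and>
     Im (cnj (fst (periods G)) * snd (periods G)) > 0 \<and>
     (\<forall>z e. path_image (curve G (shift G z e)) =
              (\<lambda>x. x + lattice_vec G z) ` path_image (curve G e) \<and>
            white G (shift G z e) = white G e + lattice_vec G z \<and>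
            black G (shift G z e) = black G e + lattice_vec G z \<and>
            rotB G (shift G z e) = shift G z (rotB G e) \<and>
            rotW G (shift G z e) = shift G z (rotW G e))"

definition shift_corner :: "'e periodic_graph \<Rightarrow> int \<times> int \<Rightarrow> 'e corner \<Rightarrow> 'e corner" where
  "shift_corner G z = map_corner (shift G z)"

text \<open>The train-tracks of the quotient graph on the torus are the orbits of train-tracks.\<close>

definition torus_track :: "'e periodic_graph \<Rightarrow> 'e corner set \<Rightarrow> 'e corner set set" where
  "torus_track G T = range (\<lambda>z. shift_corner G z ` T)"

definition torus_tracks :: "'e periodic_graph \<Rightarrow> 'e corner set set set" where
  "torus_tracks G = torus_track G ` tracks G"

text \<open>
  The homology class of a train-track of the torus: the closed curve starting at (the projection
  of) an edge \<open>c\<close> of the quad-graph comes back there for the first time when its lift reaches a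
  translate \<open>c + z\<close>. A closed curve on the torus is homologous to
  \<open>h [\<gamma>\<^sub>x] + v [\<gamma>\<^sub>y]\<close> iff its lifts to the plane are displaced by \<open>(h, v)\<close>, since the
  lifts of the two basis loops join a face to its translates by \<open>(1, 0)\<close> and \<open>(0, 1)\<close>.\<close>

definition first_return :: "'e periodic_graph \<Rightarrow> 'e corner \<Rightarrow> int \<times> int \<Rightarrow> bool" where
  "first_return G c z \<longleftrightarrow>
     (\<exists>n>0. (c, shift_corner G z c) \<in> track_step G ^^ n \<and>
            (\<forall>k z'. 0 < k \<and> k < n \<longrightarrow> (c, shift_corner G z' c) \<notin> track_step G ^^ k))"

definition track_class :: "'e periodic_graph \<Rightarrow> 'e corner set set \<Rightarrow> int \<times> int" where
  "track_class G T = (THE z. \<exists>c. torus_track G (track_of G c) = T \<and> first_return G c z)"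

definition cyc_track ::
    "'e periodic_graph \<Rightarrow> 'e corner set set \<Rightarrow> 'e corner set set \<Rightarrow> 'e corner set set \<Rightarrow> bool" where
  "cyc_track G T T' T'' \<longleftrightarrow>
     cyc_direction (track_class G T) (track_class G T') (track_class G T'')"

section \<open>The geometric Newton polygon\<close>

definition plane_point :: "int \<times> int \<Rightarrow> real \<times> real" where
  "plane_point p = (of_int (fst p), of_int (snd p))"

definition enumerates_tracks :: "'e periodic_graph \<Rightarrow> (nat \<Rightarrow> 'e corner set set) \<Rightarrow> bool" where
  "enumerates_tracks G T \<longleftrightarrow>
     bij_betw T {..<card (torus_tracks G)} (torus_tracks G) \<and>
     cyc_sorted (cyc_track G) (card (torus_tracks G)) T"

definition side_by_side ::
    "'e periodic_graph \<Rightarrow> (nat \<Rightarrow> 'e corner set set) \<Rightarrow> (nat \<Rightarrow> int \<times> int) \<Rightarrow> bool" where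
  "side_by_side G T P \<longleftrightarrow>
     (\<forall>j<card (torus_tracks G). P (Suc j) = P j + track_class G (T j))"

text \<open>\<open>N\<close> is one of the integer translates of the geometric Newton polygon.\<close>

definition newton_polygon :: "'e periodic_graph \<Rightarrow> (real \<times> real) set \<Rightarrow> bool" where
  "newton_polygon G N \<longleftrightarrow>
     (\<exists>T P. enumerates_tracks G T \<and> side_by_side G T P \<and>
            N = convex hull ((plane_point \<circ> P) ` {..<card (torus_tracks G)}))"

section \<open>Periodic half-angle maps and the map phi\<close>

definition X_per :: "'e periodic_graph \<Rightarrow> ('e corner set set \<Rightarrow> halfangle) set" where
  "X_per G = {\<alpha>.
     (\<forall>T\<in>torus_tracks G. \<forall>T'\<in>torus_tracks G. \<forall>T''\<in>torus_tracks G.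
        cyc_track G T T' T'' \<longrightarrow> \<not> cyc_angle (\<alpha> T) (\<alpha> T'') (\<alpha> T')) \<and>
     (\<forall>T\<in>torus_tracks G. \<forall>T'\<in>torus_tracks G.
        track_class G T \<noteq> track_class G T' \<longrightarrow> \<alpha> T \<noteq> \<alpha> T')}"

text \<open>The value of \<open>phi\<close> does not depend on the choice of the enumeration \<open>T\<close>, and the points
  \<open>P j\<close> are determined by \<open>T\<close> and by the condition that they lie on the boundary of \<open>N\<close>.\<close>

definition admissible_enumeration ::
    "'e periodic_graph \<Rightarrow> (real \<times> real) set \<Rightarrow> ('e corner set set \<Rightarrow> halfangle) \<Rightarrow>
     (nat \<Rightarrow> 'e corner set set) \<Rightarrow> (nat \<Rightarrow> int \<times> int) \<Rightarrow> bool" where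
  "admissible_enumeration G N \<alpha> T P \<longleftrightarrow>
     enumerates_tracks G T \<and>
     cyc_sorted cyc_angle (card (torus_tracks G)) (\<alpha> \<circ> T) \<and>
     side_by_side G T P \<and>
     (\<forall>j<card (torus_tracks G). plane_point (P j) \<in> frontier N)"

definition phi ::
    "'e periodic_graph \<Rightarrow> (real \<times> real) set \<Rightarrow> ('e corner set set \<Rightarrow> halfangle) \<Rightarrow> real \<times> real" where
  "phi G N \<alpha> =
     (let r = card (torus_tracks G);
          (T, P) = (SOME (T, P). admissible_enumeration G N \<alpha> T P)
      in \<Sum>j<r. (lift_angle (\<alpha> (T j) - \<alpha> (T ((j + r - 1) mod r))) / pi) *\<^sub>R plane_point (P j))"

section \<open>Fock's elliptic Kasteleyn operator\<close>

definition theta :: "complex \<Rightarrow> complex \<Rightarrow> complex" where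
  "theta \<tau> z = 2 * (\<Sum>n. (-1) ^ n * exp (\<i> * of_real pi * \<tau> * (of_nat n + 1 / 2)\<^sup>2)
                        * sin ((2 * of_nat n + 1) * z))"

definition half_angle_at ::
    "'e periodic_graph \<Rightarrow> ('e corner set set \<Rightarrow> halfangle) \<Rightarrow> 'e corner \<Rightarrow> halfangle" where
  "half_angle_at G \<alpha> c = \<alpha> (torus_track G (track_of G c))"

text \<open>A train-track crosses an edge \<open>f b\<close> of the quad-graph with \<open>b\<close> on its right, hence from
  right to left when the edge is traversed from \<open>f\<close> to \<open>b\<close>; it crosses an edge \<open>f w\<close> with \<open>w\<close>
  on its left, hence from left to right when the edge is traversed from \<open>f\<close> to \<open>w\<close>. These
  conditions determine the values on the vertices of the quad-graph, which is connected.\<close>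

definition is_abel_map ::
    "'e periodic_graph \<Rightarrow> ('e corner set set \<Rightarrow> halfangle) \<Rightarrow> quad_vertex \<Rightarrow>
     (quad_vertex \<Rightarrow> halfangle) \<Rightarrow> bool" where
  "is_abel_map G \<alpha> v0 \<eta> \<longleftrightarrow>
     \<eta> v0 = 0 \<and>
     (\<forall>e. \<eta> (Vertex (black G e)) = \<eta> (Face (right_face G e)) + half_angle_at G \<alpha> (CornerB e)) \<and>
     (\<forall>e. \<eta> (Vertex (white G e)) = \<eta> (Face (left_face G e)) - half_angle_at G \<alpha> (CornerW e))"

definition abel_map ::
    "'e periodic_graph \<Rightarrow> ('e corner set set \<Rightarrow> halfangle) \<Rightarrow> quad_vertex \<Rightarrow> quad_vertex \<Rightarrow> halfangle" where
  "abel_map G \<alpha> v0 = (SOME \<eta>. is_abel_map G \<alpha> v0 \<eta>)"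

text \<open>Since \<open>theta \<tau> (z + pi) = - theta \<tau> z\<close>, the following expression does not depend on the
  choice of the lifts of the half-angles \<open>\<alpha>\<close> (written \<open>a\<close>), \<open>\<beta>\<close> (written \<open>b\<close>) and
  \<open>\<eta>(b)\<close> (written \<open>x\<close>).\<close>

definition edge_coefficient ::
    "'e periodic_graph \<Rightarrow> ('e corner set set \<Rightarrow> halfangle) \<Rightarrow> quad_vertex \<Rightarrow> complex \<Rightarrow> complex \<Rightarrow>
     'e \<Rightarrow> complex" where
  "edge_coefficient G \<alpha> v0 \<tau> t e =
     (let a = of_real (lift_angle (half_angle_at G \<alpha> (side_wr G e)));
          b = of_real (lift_angle (half_angle_at G \<alpha> (side_br G e)));
          x = of_real (lift_angle (abel_map G \<alpha> v0 (Vertex (black G e))))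
      in theta \<tau> (b - a) / (theta \<tau> (t + x - b) * theta \<tau> (t + x - a)))"

text \<open>The sum is empty if \<open>w\<close> and \<open>b\<close> are not adjacent, and has a single term if there is only
  one edge between them.\<close>

definition fock_operator ::
    "'e periodic_graph \<Rightarrow> ('e corner set set \<Rightarrow> halfangle) \<Rightarrow> quad_vertex \<Rightarrow> complex \<Rightarrow> complex \<Rightarrow>
     complex \<Rightarrow> complex \<Rightarrow> complex" where
  "fock_operator G \<alpha> v0 \<tau> t w b =
     (\<Sum>e | white G e = w \<and> black G e = b. edge_coefficient G \<alpha> v0 \<tau> t e)"

definition periodic_operator :: "'e periodic_graph \<Rightarrow> (complex \<Rightarrow> complex \<Rightarrow> complex) \<Rightarrow> bool" where
  "periodic_operator G K \<longleftrightarrow>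
     (\<forall>w\<in>white_vertices G. \<forall>b\<in>black_vertices G. \<forall>z.
        K (w + lattice_vec G z) (b + lattice_vec G z) = K w b)"

end

theory Submission
  imports Defs "HOL-Library.Groups_Big_Fun"
begin

text \<open>
  Choose real lifts \<open>a T\<close> of the half-angles. Summation by parts turns the barycentre
  \<open>phi \<alpha>\<close> of the points \<open>P j\<close> into an integer point minus \<open>(1 / pi) \<Sum> a T [T]\<close>
  (\<open>gap_sum_lifts\<close>). Hence \<open>phi \<alpha>\<close> is an integer point iff \<open>\<Sum> a T [T]\<close> lies in
  \<open>pi \<int>\<^sup>2\<close>, and everything rests on the meaning of this vector for the Abel map.

  The Abel map of the lifts exists as a real function: every cycle of edges is the boundary of a
  finitely supported function on the faces, made of its winding numbers (\<open>cycle_bounds\<close>), so that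
  closed forms are exact. A translation \<open>z\<close> changes the Abel map by a constant \<open>\<delta> z\<close>, and
  \<open>\<Sum> a T [T] = (- \<delta> (0, 1), \<delta> (1, 0))\<close>. This is a bilinear relation in the manner of Riemann
  (\<open>periods_of_abel_map\<close>): the commutator of two walks that generate the fundamental group of the
  torus bounds a fundamental domain, and a sum over the edges of the torus is computed on its
  boundary. So \<open>phi \<alpha>\<close> is an integer point iff the Abel map is invariant under the translations
  modulo \<open>pi\<close>.

  Invariance of the Abel map clearly makes the operator periodic. Conversely, \<open>\<tau>\<close> is imaginary and
  \<open>t\<close> lies on the line shifted by a half-period, where \<open>theta\<close> is a positive function times a phase;
  the argument of the coefficient of an edge \<open>w b\<close> is therefore \<open>2 \<eta>(b)\<close> plus a term that does not
  depend on \<open>\<eta>(b)\<close>, and the coefficient determines \<open>\<eta>(b)\<close> modulo \<open>pi\<close>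
  (\<open>fock_weight_phase\<close>). This requires an edge without parallel edges, since parallel edges are summed
  up in the operator, and a nonzero coefficient. Both come from minimality: if all edges had
  parallel ones, an innermost digon would be a face, and two strands would cross in the
  quadrilaterals of both of its sides in the same direction (\<open>exists_single_edge\<close>), and
  two crossing train-tracks have different classes, hence different half-angles, since
  otherwise they would cross again in the translated quadrilateral
  (\<open>crossing_tracks_class\<close>; that a class does not vanish is
  \<open>minimal_tracks_not_closed\<close>).

  The image of \<open>phi\<close> is a matter of convexity. A linear form that is maximal on the polygon at
  \<open>phi \<alpha>\<close> is maximal at all points of nonzero weight; a weight vanishes only where the polygon is
  straight, so the form would be maximal everywhere (\<open>gap_sum_interior\<close>). Conversely a point of the
  interior is a barycentre of all the \<open>P j\<close> with positive weights, which are the gaps of a strictly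
  monotone map (\<open>gap_sum_surjective\<close>). The value of \<open>phi\<close> does not depend on the enumeration
  (\<open>gap_sum_unique\<close>).\<close>

section \<open>Finitely supported chains of edges\<close>

text \<open>The value of a complex 1-cochain on an integral 1-chain.\<close>

definition pairing :: "('e \<Rightarrow> int) \<Rightarrow> ('e \<Rightarrow> complex) \<Rightarrow> complex" where
  "pairing c h = Sum_any (\<lambda>e. of_int (c e) * h e)"

lemma pairing_superset:
  assumes "finite A" "{e. c e \<noteq> 0} \<subseteq> A"
  shows "pairing c h = (\<Sum>e\<in>A. of_int (c e) * h e)"
  unfolding pairing_def using assms by (intro Sum_any.expand_superset) auto

lemma pairing_support:
  assumes "finite {e. c e \<noteq> 0}"
  shows "pairing c h = (\<Sum>e | c e \<noteq> 0. of_int (c e) * h e)"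
  using pairing_superset[OF assms order_refl] .

lemma finite_support_combine:
  assumes "finite {e. c e \<noteq> (0::int)}" "finite {e. d e \<noteq> 0}"
  shows "finite {e. c e + k * d e \<noteq> 0}"
  by (rule finite_subset[OF _ finite_UnI[OF assms]]) auto

lemma pairing_combine:
  assumes "finite {e. c e \<noteq> 0}" "finite {e. d e \<noteq> 0}"
  shows "pairing (\<lambda>e. c e + k * d e) h = pairing c h + of_int k * pairing d h"
proof -
  let ?A = "{e. c e \<noteq> 0} \<union> {e. d e \<noteq> 0}"
  have A: "finite ?A" using assms by auto
  show ?thesis
    by (subst (1 2 3) pairing_superset[OF A])
       (auto simp: sum.distrib sum_distrib_left algebra_simps)
qed

lemma pairing_zero [simp]: "pairing (\<lambda>e. 0) h = 0"
  by (simp add: pairing_def)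

lemma pairing_single [simp]: "pairing (\<lambda>e. of_bool (e = e0)) h = h e0"
  by (subst pairing_superset[of "{e0}"]) auto

lemma pairing_sum:
  assumes "finite S" "\<And>s. s \<in> S \<Longrightarrow> finite {e. d s e \<noteq> 0}"
  shows "finite {e. (\<Sum>s\<in>S. k s * d s e) \<noteq> 0} \<and>
         pairing (\<lambda>e. \<Sum>s\<in>S. k s * d s e) h = (\<Sum>s\<in>S. of_int (k s) * pairing (d s) h)"
  using assms
proof (induction S rule: finite_induct)
  case empty
  then show ?case by simp
next
  case (insert s S)
  then have IH: "finite {e. (\<Sum>s\<in>S. k s * d s e) \<noteq> 0}"
    "pairing (\<lambda>e. \<Sum>s\<in>S. k s * d s e) h = (\<Sum>s\<in>S. of_int (k s) * pairing (d s) h)" by auto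
  have fin: "finite {e. d s e \<noteq> 0}" using insert by auto
  have eq: "(\<lambda>e. \<Sum>s\<in>insert s S. k s * d s e) = (\<lambda>e. (\<Sum>s\<in>S. k s * d s e) + k s * d s e)"
    using insert.hyps by (simp add: add.commute)
  have "finite {e. (\<Sum>s\<in>insert s S. k s * d s e) \<noteq> 0}"
    using finite_support_combine[OF IH(1) fin, of "k s"] unfolding eq[symmetric] by (simp add: eq fun_cong[OF eq])
  moreover have "pairing (\<lambda>e. \<Sum>s\<in>insert s S. k s * d s e) h = (\<Sum>s\<in>insert s S. of_int (k s) * pairing (d s) h)"
    unfolding eq by (subst pairing_combine[OF IH(1) fin]) (use insert.hyps in \<open>simp add: IH(2) add.commute\<close>)
  ultimately show ?case by blast
qed

section \<open>Bipartite plane graphs\<close>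

locale bipartite_plane =
  fixes G :: "('e, 'm) plane_graph_scheme"
  assumes G: "bipartite_plane_graph G"
begin

abbreviation "lf \<equiv> left_face G"
abbreviation "rf \<equiv> right_face G"
abbreviation "nx \<equiv> next_left G"
abbreviation "rB \<equiv> rotB G"
abbreviation "rW \<equiv> rotW G"
abbreviation "edge e \<equiv> path_image (curve G e)"

lemmas G_conj1 = G[unfolded bipartite_plane_graph_def]
lemmas G_conj2 = G_conj1[THEN conjunct2]
lemmas G_conj3 = G_conj2[THEN conjunct2]
lemmas G_conj4 = G_conj3[THEN conjunct2]
lemmas G_conj5 = G_conj4[THEN conjunct2]
lemmas G_conj6 = G_conj5[THEN conjunct2]
lemmas G_conj7 = G_conj6[THEN conjunct2]
lemmas G_conj8 = G_conj7[THEN conjunct2]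
lemmas G_conj9 = G_conj8[THEN conjunct2]
lemmas G_conj10 = G_conj9[THEN conjunct2]
lemmas G_conj11 = G_conj10[THEN conjunct2]
lemmas G_conj12 = G_conj11[THEN conjunct2]
lemmas G_conj13 = G_conj12[THEN conjunct2]
lemmas G_conj14 = G_conj13[THEN conjunct2]

lemma infinite_edges: "infinite (UNIV :: 'e set)"
  using G_conj1 by (rule conjunct1)

lemma arc_curve: "arc (curve G e)"
  using G_conj2[THEN conjunct1] by (rule spec)

lemma path_curve: "path (curve G e)"
  by (rule arc_imp_path[OF arc_curve])

lemma pathstart_curve: "pathstart (curve G e) = white G e"
  and pathfinish_curve: "pathfinish (curve G e) = black G e"
  by (simp_all add: white_def black_def)

lemma black_white_disjoint: "black G e \<noteq> white G e'"
  using G_conj3[THEN conjunct1] unfolding black_vertices_def white_vertices_def by blast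

lemma edge_vertices: "edge e \<inter> vertices G = {white G e, black G e}"
  using G_conj4[THEN conjunct1] by (rule spec)

lemma edge_inter: "e \<noteq> e' \<Longrightarrow> edge e \<inter> edge e' \<subseteq> vertices G"
  using G_conj5[THEN conjunct1] by simp

lemma locally_finite: "compact S \<Longrightarrow> finite {e. edge e \<inter> S \<noteq> {}}"
  using G_conj6[THEN conjunct1] by simp

lemma bij_rotB: "bij rB" and bij_rotW: "bij rW"
  using G_conj7[THEN conjunct1] G_conj9[THEN conjunct1] by auto

lemma black_eq_iff: "black G e = black G e' \<longleftrightarrow> (\<exists>n. e' = (rB ^^ n) e)"
  using G_conj8[THEN conjunct1] by (elim allE)

lemma white_eq_iff: "white G e = white G e' \<longleftrightarrow> (\<exists>n. e' = (rW ^^ n) e)"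
  using G_conj10[THEN conjunct1] by (elim allE)

lemma face_bounded: "F \<in> faces G \<Longrightarrow> bounded F"
  and face_disc: "F \<in> faces G \<Longrightarrow> F homeomorphic (ball 0 1 :: complex set)"
  using G_conj11[THEN conjunct1] by auto

lemma left_period: "\<exists>n>0. (nx ^^ n) e = e"
  using G_conj12[THEN conjunct1] by (rule spec)

lemma left_boundary_winding: "z \<notin> support G \<Longrightarrow> winding_number (left_boundary G e) z \<in> {0, 1}"
  using G_conj13[THEN conjunct1] by blast

lemma range_lf: "range lf = faces G"
  using G_conj14 by (rule conjunct1)

lemma lf_eq_iff: "lf e = lf e' \<longleftrightarrow> (\<exists>n. e' = (nx ^^ n) e)"
  using G_conj14[THEN conjunct2] by (elim allE)

lemma rotB_inv [simp]: "rB (inv rB e) = e" "inv rB (rB e) = e"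
  using bij_rotB by (simp_all add: bij_is_surj surj_f_inv_f bij_is_inj)

lemma rotW_inv [simp]: "rW (inv rW e) = e" "inv rW (rW e) = e"
  using bij_rotW by (simp_all add: bij_is_surj surj_f_inv_f bij_is_inj)

lemma black_rotB [simp]: "black G (rB e) = black G e"
  using black_eq_iff[of e "rB e"] by (metis funpow_0 funpow_simps_right(2) o_apply)
lemma black_inv_rotB [simp]: "black G (inv rB e) = black G e"
  using black_rotB[of "inv rB e"] by simp
lemma white_rotW [simp]: "white G (rW e) = white G e"
  using white_eq_iff[of e "rW e"] by (metis funpow_0 funpow_simps_right(2) o_apply)
lemma white_inv_rotW [simp]: "white G (inv rW e) = white G e"
  using white_rotW[of "inv rW e"] by simp

lemma nx_eq: "nx e = inv rW (inv rB e)"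
  by (simp add: next_left_def)

lemma bij_nx: "bij nx"
proof -
  have "nx = inv rW \<circ> inv rB" by (auto simp: nx_eq)
  then show ?thesis by (metis bij_comp bij_imp_bij_inv bij_rotB bij_rotW)
qed

lemma lf_nx [simp]: "lf (nx e) = lf e"
  using lf_eq_iff[of e "nx e"] by (metis funpow_0 funpow_simps_right(2) o_apply)

lemma rf_eq: "rf e = lf (rB e)"
  by (simp add: right_face_def)

lemma rf_inv_rotB [simp]: "rf (inv rB e) = lf e"
  by (simp add: rf_eq)

lemma rf_rotW: "rf (rW e) = lf e"
proof -
  have "nx (rB (rW e)) = e" by (simp add: nx_eq)
  then show ?thesis by (metis lf_nx rf_eq)
qed

lemma white_nx: "white G (nx e) = white G (inv rB e)"
  by (simp add: nx_eq)

lemma left_orbit: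
  assumes "n > 0" "(nx ^^ n) e = e"
  shows "(\<lambda>i. (nx ^^ i) e) ` {..<n} = {e'. lf e' = lf e}"
proof (intro equalityI subsetI)
  fix e' assume "e' \<in> {e'. lf e' = lf e}"
  then obtain k where k: "e' = (nx ^^ k) e" using lf_eq_iff[of e e'] by auto
  also have "\<dots> = (nx ^^ (k mod n)) e" using assms(2) by (simp add: funpow_mod_eq)
  finally show "e' \<in> (\<lambda>i. (nx ^^ i) e) ` {..<n}"
    using assms(1) by (intro image_eqI[of _ _ "k mod n"]) auto
next
  fix e' assume "e' \<in> (\<lambda>i. (nx ^^ i) e) ` {..<n}"
  then obtain i where "e' = (nx ^^ i) e" by blast
  then have "lf e = lf e'" using lf_eq_iff by blast
  then show "e' \<in> {e'. lf e' = lf e}" by simp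
qed

lemma finite_lf_fiber: "finite {e. lf e = F}"
proof (cases "\<exists>e0. lf e0 = F")
  case True
  then obtain e0 where e0: "lf e0 = F" by blast
  obtain n where n: "n > 0" "(nx ^^ n) e0 = e0" using left_period by blast
  have "finite ((\<lambda>i. (nx ^^ i) e0) ` {..<n})" by simp
  then show ?thesis unfolding left_orbit[OF n] e0 .
qed auto

lemma finite_rf_fiber: "finite {e. rf e = F}"
proof -
  have "{e. rf e = F} = rB -` {e. lf e = F}" by (auto simp: rf_eq)
  moreover have "finite (rB -` {e. lf e = F})"
    using finite_lf_fiber[of F] bij_is_inj[OF bij_rotB] by (rule finite_vimageI)
  ultimately show ?thesis by simp
qed

text \<open>By local finiteness, only finitely many of these compact arcs come close to a given point.\<close>

lemma closed_edges: "closed (\<Union>e\<in>E. edge e)"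
proof -
  have "open (- (\<Union>e\<in>E. edge e))"
    unfolding open_contains_ball
  proof
    fix x assume x: "x \<in> - (\<Union>e\<in>E. edge e)"
    let ?E = "{e. edge e \<inter> cball x 1 \<noteq> {}} \<inter> E"
    have "finite ?E" using locally_finite[of "cball x 1"] by auto
    then have "closed (\<Union>e\<in>?E. edge e)"
      by (intro closed_UN) (auto simp: closed_path_image path_curve)
    then have "open (- (\<Union>e\<in>?E. edge e))" by (rule open_Compl)
    moreover have "x \<in> - (\<Union>e\<in>?E. edge e)" using x by blast
    ultimately obtain r where r: "r > 0" "ball x r \<subseteq> - (\<Union>e\<in>?E. edge e)"
      unfolding open_contains_ball by metis
    have "ball x (min r 1) \<subseteq> - (\<Union>e\<in>E. edge e)"
    proof
      fix y assume y: "y \<in> ball x (min r 1)"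
      then have "y \<in> ball x r" "y \<in> cball x 1" by auto
      then show "y \<in> - (\<Union>e\<in>E. edge e)" using r by blast
    qed
    then show "\<exists>r>0. ball x r \<subseteq> - (\<Union>e\<in>E. edge e)"
      using r by (intro exI[of _ "min r 1"]) auto
  qed
  then show ?thesis by (simp add: closed_def)
qed

lemma closed_support: "closed (support G)"
  using closed_edges[of UNIV] by (simp add: support_def)

lemma edge_support: "edge e \<subseteq> support G"
  by (auto simp: support_def)

text \<open>The union of the other edges is closed and avoids \<open>m\<close>.\<close>

lemma local_star:
  assumes "m \<in> edge e0" "m \<notin> vertices G" "open U" "m \<in> U"
  obtains \<epsilon> where "\<epsilon> > 0" "ball m \<epsilon> \<subseteq> U" "\<And>e. e \<noteq> e0 \<Longrightarrow> ball m \<epsilon> \<inter> edge e = {}"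
proof -
  have "open (U \<inter> - (\<Union>e\<in>-{e0}. edge e))"
    by (intro open_Int assms open_Compl closed_edges)
  moreover have "m \<in> U \<inter> - (\<Union>e\<in>-{e0}. edge e)"
    using assms edge_inter by blast
  ultimately obtain \<epsilon> where "\<epsilon> > 0" "ball m \<epsilon> \<subseteq> U \<inter> - (\<Union>e\<in>-{e0}. edge e)"
    using open_contains_ball by metis
  then show ?thesis by (intro that[of \<epsilon>]) auto
qed

lemma edge_interior_point: obtains m where "m \<in> edge e" "m \<notin> vertices G"
proof
  show m: "curve G e (1/2) \<in> edge e" by (auto simp: path_image_def)
  have "inj_on (curve G e) {0..1}" using arc_curve arc_def by blast
  then have "curve G e (1/2) \<noteq> curve G e 0" "curve G e (1/2) \<noteq> curve G e 1"
    by (auto dest: inj_onD)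
  then show "curve G e (1/2) \<notin> vertices G"
    using m edge_vertices[of e] by (auto simp: white_def black_def pathstart_def pathfinish_def)
qed

lemma edge_inj: "edge e = edge e' \<Longrightarrow> e = e'"
  using edge_interior_point[of e] edge_inter[of e e'] by (metis IntI subsetD)

section \<open>Winding numbers of cycles\<close>

definition wind :: "('e \<Rightarrow> int) \<Rightarrow> complex \<Rightarrow> complex" where
  "wind c p = pairing c (\<lambda>e. winding_number (curve G e) p)"

text \<open>The boundary is tested on the functions of the vertices; this avoids sums over the edges
  around a vertex.\<close>

definition boundary_is :: "('e \<Rightarrow> int) \<Rightarrow> complex \<Rightarrow> complex \<Rightarrow> bool" where
  "boundary_is c u v \<longleftrightarrow> finite {e. c e \<noteq> 0} \<and>
     (\<forall>f. pairing c (\<lambda>e. f (black G e) - f (white G e)) = f v - f u)"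

definition cycle :: "('e \<Rightarrow> int) \<Rightarrow> bool" where
  "cycle c \<longleftrightarrow> finite {e. c e \<noteq> 0} \<and>
     (\<forall>f. pairing c (\<lambda>e. f (black G e) - f (white G e)) = 0)"

lemma cycle_finite: "cycle c \<Longrightarrow> finite {e. c e \<noteq> 0}"
  by (simp add: cycle_def)

lemma cycle_combine: "cycle c \<Longrightarrow> cycle d \<Longrightarrow> cycle (\<lambda>e. c e + k * d e)"
  unfolding cycle_def using finite_support_combine[of c d k] by (auto simp: pairing_combine)

lemma cycle_sum:
  assumes "finite S" "\<And>s. s \<in> S \<Longrightarrow> cycle (d s)"
  shows "cycle (\<lambda>e. \<Sum>s\<in>S. k s * d s e)"
proof -
  have "finite {e. (\<Sum>s\<in>S. k s * d s e) \<noteq> 0} \<and>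
        pairing (\<lambda>e. \<Sum>s\<in>S. k s * d s e) h = (\<Sum>s\<in>S. of_int (k s) * pairing (d s) h)" for h
    using assms by (intro pairing_sum) (auto simp: cycle_def)
  then show ?thesis using assms by (auto simp: cycle_def)
qed

lemma wind_combine:
  "finite {e. c e \<noteq> 0} \<Longrightarrow> finite {e. d e \<noteq> 0} \<Longrightarrow>
    wind (\<lambda>e. c e + k * d e) p = wind c p + of_int k * wind d p"
  by (simp add: wind_def pairing_combine)

text \<open>Up to an integer, the winding number of an edge is the difference of a function of its end
  points, so that the winding numbers along a cycle sum up to an integer.\<close>

lemma edge_winding_Ln:
  assumes "p \<notin> edge e"
  obtains k :: int where
    "winding_number (curve G e) p =
       (Ln (black G e - p) - Ln (white G e - p)) / (2 * pi * \<i>) + of_int k"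
proof -
  have "white G e \<in> edge e" "black G e \<in> edge e"
    using edge_vertices by blast+
  with assms have ne: "white G e - p \<noteq> 0" "black G e - p \<noteq> 0" by auto
  have "black G e - p = exp (2 * pi * \<i> * winding_number (curve G e) p) * (white G e - p)"
    using winding_number_exp_2pi[OF path_curve assms] by (simp add: pathstart_curve pathfinish_curve)
  then have "exp (Ln (black G e - p)) = exp (2 * pi * \<i> * winding_number (curve G e) p + Ln (white G e - p))"
    using ne by (simp add: exp_add)
  then obtain n :: int where
    "2 * pi * \<i> * winding_number (curve G e) p + Ln (white G e - p) = Ln (black G e - p) + of_int (2 * n) * pi * \<i>"
    using exp_eq[of "2 * pi * \<i> * winding_number (curve G e) p + Ln (white G e - p)" "Ln (black G e - p)"]
    by auto
  then have "winding_number (curve G e) p =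
       (Ln (black G e - p) - Ln (white G e - p)) / (2 * pi * \<i>) + of_int n"
    by (simp add: field_simps)
  then show ?thesis using that by blast
qed

lemma wind_Ints:
  assumes "cycle c" "\<And>e. c e \<noteq> 0 \<Longrightarrow> p \<notin> edge e"
  shows "wind c p \<in> \<int>"
proof -
  define f where "f v = Ln (v - p) / (2 * pi * \<i>)" for v
  define k where "k e = (SOME k :: int. winding_number (curve G e) p = f (black G e) - f (white G e) + of_int k)" for e
  have k: "winding_number (curve G e) p = f (black G e) - f (white G e) + of_int (k e)" if "c e \<noteq> 0" for e
    unfolding k_def
  proof (rule someI_ex)
    show "\<exists>k::int. winding_number (curve G e) p = f (black G e) - f (white G e) + of_int k"
      using edge_winding_Ln[OF assms(2)[OF that]] unfolding f_def by (metis diff_divide_distrib)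
  qed
  have fin: "finite {e. c e \<noteq> 0}" using assms cycle_finite by blast
  have "wind c p = (\<Sum>e | c e \<noteq> 0. of_int (c e) * (f (black G e) - f (white G e))) + (\<Sum>e | c e \<noteq> 0. of_int (c e * k e))"
    unfolding wind_def pairing_support[OF fin] sum.distrib[symmetric]
    by (intro sum.cong) (auto simp: k algebra_simps)
  also have "(\<Sum>e | c e \<noteq> 0. of_int (c e) * (f (black G e) - f (white G e))) = 0"
    using assms(1) unfolding pairing_support[OF fin, symmetric] cycle_def by simp
  finally have "wind c p = of_int (\<Sum>e | c e \<noteq> 0. c e * k e)" by simp
  then show ?thesis by (simp only: Ints_of_int)
qed

lemma wind_continuous:
  assumes "finite {e. c e \<noteq> 0}" "\<And>e p. c e \<noteq> 0 \<Longrightarrow> p \<in> S \<Longrightarrow> p \<notin> edge e"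
  shows "continuous_on S (wind c)"
proof -
  have "wind c = (\<lambda>p. \<Sum>e | c e \<noteq> 0. of_int (c e) * winding_number (curve G e) p)"
    by (rule ext) (simp add: wind_def pairing_support[OF assms(1)])
  moreover have "continuous_on S (winding_number (curve G e))" if "c e \<noteq> 0" for e
    using assms(2)[OF that] continuous_at_winding_number[OF path_curve]
    by (simp add: continuous_at_imp_continuous_on)
  ultimately show ?thesis by (auto intro!: continuous_intros)
qed

text \<open>The winding number of a cycle is an integer and depends continuously on the point.\<close>

lemma wind_constant:
  assumes "cycle c" "\<And>e p. c e \<noteq> 0 \<Longrightarrow> p \<in> S \<Longrightarrow> p \<notin> edge e" "connected S" "p \<in> S" "q \<in> S"
  shows "wind c p = wind c q"
proof -
  have "wind c constant_on S"
  proof (rule continuous_discrete_range_constant[OF assms(3)])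
    show "continuous_on S (wind c)"
      using assms cycle_finite by (intro wind_continuous) auto
    fix x assume x: "x \<in> S"
    show "\<exists>e>0. \<forall>y. y \<in> S \<and> wind c y \<noteq> wind c x \<longrightarrow> e \<le> norm (wind c y - wind c x)"
    proof (intro exI[of _ 1] conjI allI impI)
      fix y assume y: "y \<in> S \<and> wind c y \<noteq> wind c x"
      have "wind c y \<in> \<int>" "wind c x \<in> \<int>"
        using x y assms by (auto intro!: wind_Ints)
      then obtain a b where ab: "wind c y = of_int a" "wind c x = of_int b"
        by (auto elim!: Ints_cases)
      with y have "a \<noteq> b" by auto
      then have "1 \<le> \<bar>real_of_int (a - b)\<bar>" by linarith
      then show "1 \<le> norm (wind c y - wind c x)"
        unfolding ab by (metis norm_of_int of_int_diff)
    qed auto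
  qed
  then show ?thesis using assms unfolding constant_on_def by metis
qed

section \<open>Walks\<close>

definition adjacent :: "'e set \<Rightarrow> complex \<Rightarrow> complex \<Rightarrow> bool" where
  "adjacent E u v \<longleftrightarrow> (\<exists>e\<in>E. (white G e = u \<and> black G e = v) \<or> (black G e = u \<and> white G e = v))"

text \<open>The sign \<open>s\<close> is that of the direction in which the edge is traversed.\<close>

lemma adjacent_dart:
  assumes "adjacent E u v"
  obtains e \<delta> and s :: int where "e \<in> E" "arc \<delta>" "pathstart \<delta> = u" "pathfinish \<delta> = v"
    "path_image \<delta> = edge e" "s \<noteq> 0"
    "\<And>p. p \<notin> edge e \<Longrightarrow> winding_number \<delta> p = of_int s * winding_number (curve G e) p"
    "\<And>f :: complex \<Rightarrow> complex. of_int s * (f (black G e) - f (white G e)) = f v - f u"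
    "edge e \<inter> vertices G = {u, v}"
proof -
  obtain e where e: "e \<in> E" "(white G e = u \<and> black G e = v) \<or> (black G e = u \<and> white G e = v)"
    using assms adjacent_def by auto
  from e(2) show ?thesis
  proof
    assume *: "white G e = u \<and> black G e = v"
    show ?thesis
      by (rule that[of e "curve G e" 1])
         (use e * in \<open>auto simp: arc_curve pathstart_curve pathfinish_curve edge_vertices\<close>)
  next
    assume *: "black G e = u \<and> white G e = v"
    show ?thesis
      by (rule that[of e "reversepath (curve G e)" "-1"])
         (use e * in \<open>auto simp: arc_reversepath arc_curve path_curve pathstart_curve pathfinish_curve
            winding_number_reversepath edge_vertices\<close>)
  qed
qed

text \<open>The path of a shortest walk is an arc: its remaining part only visits vertices that are
  strictly closer to the end than the starting point.\<close>

lemma shortest_walk_arc: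
  assumes "(adjacent E ^^ n) u v" "n > 0" "\<And>m. m < n \<Longrightarrow> \<not> (adjacent E ^^ m) u v"
  shows "\<exists>\<gamma> c. arc \<gamma> \<and> pathstart \<gamma> = u \<and> pathfinish \<gamma> = v \<and> finite {e. c e \<noteq> 0} \<and>
           {e. c e \<noteq> 0} \<subseteq> E \<and> path_image \<gamma> = (\<Union>e\<in>{e. c e \<noteq> 0}. edge e) \<and> boundary_is c u v \<and>
           (\<forall>p. p \<notin> path_image \<gamma> \<longrightarrow> wind c p = winding_number \<gamma> p) \<and>
           (\<forall>x\<in>path_image \<gamma> \<inter> vertices G. \<exists>m\<le>n. (adjacent E ^^ m) x v)"
  using assms
proof (induction n arbitrary: u)
  case 0
  then show ?case by simp
next
  case (Suc n)
  obtain u' where u': "adjacent E u u'" "(adjacent E ^^ n) u' v"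
    using Suc.prems(1) by (metis relpowp_Suc_D2)
  obtain e \<delta> s where d: "e \<in> E" "arc \<delta>" "pathstart \<delta> = u" "pathfinish \<delta> = u'"
    "path_image \<delta> = edge e" "s \<noteq> (0::int)"
    "\<And>p. p \<notin> edge e \<Longrightarrow> winding_number \<delta> p = of_int s * winding_number (curve G e) p"
    "\<And>f :: complex \<Rightarrow> complex. of_int s * (f (black G e) - f (white G e)) = f u' - f u"
    "edge e \<inter> vertices G = {u, u'}"
    using adjacent_dart[OF u'(1)] by metis
  define c1 where "c1 = (\<lambda>x. s * of_bool (x = e))"
  have c1: "{e. c1 e \<noteq> 0} = {e}" using d(6) by (auto simp: c1_def)
  have pc1: "pairing c1 h = of_int s * h e" for h
    using pairing_superset[of "{e}" c1 h] c1 by (simp add: c1_def)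
  show ?case
  proof (cases "n = 0")
    case True
    then have v: "v = u'" using u' by simp
    have "\<exists>m\<le>Suc n. (adjacent E ^^ m) x v" if "x \<in> {u, u'}" for x
    proof (cases "x = u")
      case True then show ?thesis using Suc.prems by blast
    next
      case False then show ?thesis using that v by (intro exI[of _ 0]) auto
    qed
    then show ?thesis
      using d c1 v by (intro exI[of _ \<delta>] exI[of _ c1]) (auto simp: boundary_is_def pc1 wind_def)
  next
    case False
    have "\<not> (adjacent E ^^ m) u' v" if "m < n" for m
      using Suc.prems(3)[of "Suc m"] that u'(1) relpowp_Suc_I2 by (metis Suc_less_eq)
    then obtain \<gamma> c where g: "arc \<gamma>" "pathstart \<gamma> = u'" "pathfinish \<gamma> = v" "finite {e. c e \<noteq> 0}"
       "{e. c e \<noteq> 0} \<subseteq> E" "path_image \<gamma> = (\<Union>e\<in>{e. c e \<noteq> 0}. edge e)" "boundary_is c u' v"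
       "\<And>p. p \<notin> path_image \<gamma> \<Longrightarrow> wind c p = winding_number \<gamma> p"
       "\<And>x. x \<in> path_image \<gamma> \<inter> vertices G \<Longrightarrow> \<exists>m\<le>n. (adjacent E ^^ m) x v"
      using Suc.IH[OF u'(2)] False by blast
    have u: "u \<notin> path_image \<gamma>"
    proof
      assume "u \<in> path_image \<gamma>"
      moreover have "u \<in> vertices G" using d(9) by blast
      ultimately obtain m where "m \<le> n" "(adjacent E ^^ m) u v" using g(9) by blast
      then show False using Suc.prems(3)[of m] by simp
    qed
    have ce: "c e = 0"
    proof (rule ccontr)
      assume "c e \<noteq> 0"
      then have "u \<in> path_image \<gamma>" using g(6) d(9) by blast
      then show False using u by simp
    qed
    define c' where "c' = (\<lambda>x. c x + 1 * c1 x)"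
    have supp: "{x. c' x \<noteq> 0} = insert e {x. c x \<noteq> 0}"
      using ce d(6) by (auto simp: c'_def c1_def split: if_splits)
    have fin1: "finite {x. c1 x \<noteq> 0}" by (simp add: c1)
    have int: "path_image \<delta> \<inter> path_image \<gamma> \<subseteq> {u'}"
    proof
      fix x assume x: "x \<in> path_image \<delta> \<inter> path_image \<gamma>"
      then obtain e' where e': "c e' \<noteq> 0" "x \<in> edge e'" using g(6) by blast
      then have "e' \<noteq> e" using ce by auto
      then have "x \<in> vertices G" using edge_inter x e' d(5) by blast
      then have "x \<in> {u, u'}" using d(5,9) x by blast
      then show "x \<in> {u'}" using u x by auto
    qed
    have "arc (\<delta> +++ \<gamma>)"
      using d g int by (intro arc_join) auto
    moreover have "boundary_is c' u v"
      unfolding boundary_is_def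
    proof (intro conjI allI)
      show "finite {e. c' e \<noteq> 0}" using g(4) by (simp add: supp)
      fix f :: "complex \<Rightarrow> complex"
      have "pairing c (\<lambda>e. f (black G e) - f (white G e)) = f v - f u'"
        using g(7) by (simp add: boundary_is_def)
      then show "pairing c' (\<lambda>e. f (black G e) - f (white G e)) = f v - f u"
        unfolding c'_def pairing_combine[OF g(4) fin1] pc1 by (simp add: d(8))
    qed
    moreover have pim: "path_image (\<delta> +++ \<gamma>) = edge e \<union> path_image \<gamma>"
      using d g by (simp add: path_image_join)
    moreover have "wind c' p = winding_number (\<delta> +++ \<gamma>) p" if "p \<notin> path_image (\<delta> +++ \<gamma>)" for p
    proof -
      have p: "p \<notin> edge e" "p \<notin> path_image \<gamma>" using that pim by auto
      have "winding_number (\<delta> +++ \<gamma>) p = winding_number \<delta> p + winding_number \<gamma> p"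
        using p d g by (intro winding_number_join) (auto simp: arc_imp_path)
      then show ?thesis
        using p g(8) d(7) unfolding c'_def by (simp add: wind_combine[OF g(4) fin1, of 1, simplified] wind_def pc1)
    qed
    moreover have "\<exists>m\<le>Suc n. (adjacent E ^^ m) x v" if x: "x \<in> path_image (\<delta> +++ \<gamma>) \<inter> vertices G" for x
    proof (cases "x \<in> path_image \<gamma>")
      case True then show ?thesis using g(9) x le_Suc_eq by blast
    next
      case False
      then have "x \<in> {u, u'}" using x pim d(9) by blast
      moreover have "u' \<in> path_image \<gamma>" using g(2) by (metis pathstart_in_path_image)
      ultimately have "x = u" using False by auto
      then show ?thesis using Suc.prems by blast
    qed
    moreover have "path_image (\<delta> +++ \<gamma>) = (\<Union>e\<in>{e. c' e \<noteq> 0}. edge e)"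
      unfolding pim supp g(6) by auto
    ultimately show ?thesis
      using d g supp by (intro exI[of _ "\<delta> +++ \<gamma>"] exI[of _ c']) auto
  qed
qed

lemma walk_arc:
  assumes "(adjacent E)\<^sup>*\<^sup>* u v" "u \<noteq> v"
  obtains \<gamma> c where "arc \<gamma>" "pathstart \<gamma> = u" "pathfinish \<gamma> = v"
    "{e. c e \<noteq> 0} \<subseteq> E" "path_image \<gamma> = (\<Union>e\<in>{e. c e \<noteq> 0}. edge e)" "boundary_is c u v"
    "\<And>p. p \<notin> path_image \<gamma> \<Longrightarrow> wind c p = winding_number \<gamma> p"
proof -
  define n where "n = (LEAST n. (adjacent E ^^ n) u v)"
  have ex: "\<exists>n. (adjacent E ^^ n) u v" using assms(1) by (simp add: rtranclp_power)
  then have n: "(adjacent E ^^ n) u v" unfolding n_def by (rule LeastI_ex)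
  have "n > 0" using n assms(2) by (cases n) auto
  moreover have "\<not> (adjacent E ^^ m) u v" if "m < n" for m
    using that not_less_Least unfolding n_def by blast
  ultimately show ?thesis using shortest_walk_arc[OF n] that by meson
qed

section \<open>A cycle is determined by its winding numbers\<close>

text \<open>If the other edges of \<open>c\<close> did not connect the ends of \<open>e0\<close>, the
  indicator function of the component of one end would change along \<open>e0\<close> only,
  and testing the boundary of \<open>c\<close> on it would give \<open>c e0 = 0\<close>. A
  shortest walk along these edges closes \<open>e0\<close> up to a Jordan curve.\<close>

lemma edge_on_loop:
  assumes c: "cycle c" and ce: "c e0 \<noteq> 0"
  obtains \<gamma> d where "simple_path \<gamma>" "pathfinish \<gamma> = pathstart \<gamma>" "edge e0 \<subseteq> path_image \<gamma>"
    "cycle d" "d e0 = 1" "path_image \<gamma> \<subseteq> support G"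
    "\<And>p. p \<notin> support G \<Longrightarrow> wind d p = winding_number \<gamma> p"
proof -
  define E where "E = {e. c e \<noteq> 0} - {e0}"
  have fin: "finite {e. c e \<noteq> 0}" using c cycle_finite by blast
  have reach: "(adjacent E)\<^sup>*\<^sup>* (black G e0) (white G e0)"
  proof (rule ccontr)
    assume no: "\<not> ?thesis"
    define f :: "complex \<Rightarrow> complex" where "f v = of_bool ((adjacent E)\<^sup>*\<^sup>* (black G e0) v)" for v
    have f0: "f (black G e) - f (white G e) = 0" if "e \<in> E" for e
    proof -
      have "adjacent E (black G e) (white G e)" "adjacent E (white G e) (black G e)"
        using that by (auto simp: adjacent_def)
      then show ?thesis unfolding f_def by (simp, meson rtranclp.rtrancl_into_rtrancl)
    qed
    have "0 = pairing c (\<lambda>e. f (black G e) - f (white G e))"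
      using c by (simp add: cycle_def)
    also have "\<dots> = (\<Sum>e | c e \<noteq> 0. of_int (c e) * (f (black G e) - f (white G e)))"
      using pairing_support[OF fin] by simp
    also have "\<dots> = (\<Sum>e\<in>{e0}. of_int (c e) * (f (black G e) - f (white G e)))"
      using fin ce f0 by (intro sum.mono_neutral_right) (auto simp: E_def)
    also have "\<dots> = of_int (c e0)" using no by (simp add: f_def)
    finally show False using ce by simp
  qed
  obtain \<gamma> d where g: "arc \<gamma>" "pathstart \<gamma> = black G e0" "pathfinish \<gamma> = white G e0"
    "{e. d e \<noteq> 0} \<subseteq> E" "path_image \<gamma> = (\<Union>e\<in>{e. d e \<noteq> 0}. edge e)"
    "boundary_is d (black G e0) (white G e0)"
    "\<And>p. p \<notin> path_image \<gamma> \<Longrightarrow> wind d p = winding_number \<gamma> p"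
    using walk_arc[OF reach black_white_disjoint] by metis
  have fd: "finite {e. d e \<noteq> 0}" using g(6) boundary_is_def by blast
  define d' where "d' = (\<lambda>e. d e + 1 * of_bool (e = e0))"
  have f1: "finite {e. (of_bool (e = e0) :: int) \<noteq> 0}" by simp
  have de0: "d e0 = 0" using g(4) by (auto simp: E_def)
  have "edge e0 \<inter> path_image \<gamma> \<subseteq> {white G e0, black G e0}"
  proof
    fix x assume x: "x \<in> edge e0 \<inter> path_image \<gamma>"
    then obtain e where e: "d e \<noteq> 0" "x \<in> edge e" using g(5) by blast
    then have "e \<noteq> e0" using de0 by auto
    then show "x \<in> {white G e0, black G e0}" using x e edge_inter edge_vertices by blast
  qed
  then have sp: "simple_path (curve G e0 +++ \<gamma>)"
    using g by (intro simple_path_join_loop) (auto simp: arc_curve pathstart_curve pathfinish_curve)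
  have pim: "path_image (curve G e0 +++ \<gamma>) = edge e0 \<union> path_image \<gamma>"
    using g by (simp add: path_image_join pathfinish_curve)
  show ?thesis
  proof (rule that[of "curve G e0 +++ \<gamma>" d'])
    show "cycle d'"
      using g(6) unfolding cycle_def boundary_is_def d'_def
      by (auto simp: pairing_combine[OF fd f1, of 1, simplified] finite_support_combine[OF fd f1, of 1, simplified])
    show "d' e0 = 1" by (simp add: d'_def de0)
    show "path_image (curve G e0 +++ \<gamma>) \<subseteq> support G"
      unfolding pim g(5) using edge_support by blast
    show "wind d' p = winding_number (curve G e0 +++ \<gamma>) p" if "p \<notin> support G" for p
    proof -
      have p: "p \<notin> edge e0" "p \<notin> path_image \<gamma>" using that edge_support g(5) by blast+
      have "winding_number (curve G e0 +++ \<gamma>) p = winding_number (curve G e0) p + winding_number \<gamma> p"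
        using p g by (intro winding_number_join) (auto simp: arc_imp_path path_curve pathfinish_curve)
      then show ?thesis
        using p g(7) unfolding d'_def by (simp add: wind_combine[OF fd f1, of 1, simplified] wind_def)
    qed
  qed (use sp g pim in \<open>auto simp: pathstart_curve pathfinish_curve\<close>)
qed

text \<open>Near \<open>m\<close>, the winding number of a Jordan curve through \<open>e0\<close> is zero
  on one side of \<open>e0\<close> and nonzero on the other. Subtracting a multiple of this
  curve from \<open>c\<close> yields a cycle that does not use \<open>e0\<close>, and whose
  winding numbers on the two sides agree.\<close>

lemma wind_jump:
  assumes c: "cycle c" and ce: "c e0 \<noteq> 0" and m: "m \<in> edge e0" "m \<notin> vertices G"
    and U: "open U" "m \<in> U"
  obtains p q where "p \<in> U" "p \<notin> support G" "q \<in> U" "q \<notin> support G" "wind c p \<noteq> wind c q"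
proof -
  obtain \<gamma> d where g: "simple_path \<gamma>" "pathfinish \<gamma> = pathstart \<gamma>" "edge e0 \<subseteq> path_image \<gamma>"
    "cycle d" "d e0 = 1" "path_image \<gamma> \<subseteq> support G"
    "\<And>p. p \<notin> support G \<Longrightarrow> wind d p = winding_number \<gamma> p"
    using edge_on_loop[OF c ce] by metis
  obtain \<epsilon> where eps: "\<epsilon> > 0" "ball m \<epsilon> \<subseteq> U" "\<And>e. e \<noteq> e0 \<Longrightarrow> ball m \<epsilon> \<inter> edge e = {}"
    using local_star[OF m U] by metis
  define c' where "c' = (\<lambda>e. c e + (- c e0) * d e)"
  have c': "cycle c'" unfolding c'_def using c g(4) by (rule cycle_combine)
  have c'0: "c' e0 = 0" by (simp add: c'_def g(5))
  have supp: "support G \<inter> ball m \<epsilon> \<subseteq> path_image \<gamma>"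
  proof
    fix x assume x: "x \<in> support G \<inter> ball m \<epsilon>"
    then obtain e where e: "x \<in> edge e" by (auto simp: support_def)
    then have "e = e0" using eps(3)[of e] x by blast
    then show "x \<in> path_image \<gamma>" using e g(3) by blast
  qed
  note J = Jordan_inside_outside[OF g(1,2)]
  have "m \<in> frontier (inside (path_image \<gamma>))" "m \<in> frontier (outside (path_image \<gamma>))"
    using J m(1) g(3) by auto
  then have "m \<in> closure (inside (path_image \<gamma>))" "m \<in> closure (outside (path_image \<gamma>))"
    by (auto simp: frontier_def)
  then obtain p q where p: "p \<in> inside (path_image \<gamma>)" "p \<in> ball m \<epsilon>" and q: "q \<in> outside (path_image \<gamma>)" "q \<in> ball m \<epsilon>"
    using eps(1) unfolding closure_approachable by (metis dist_commute mem_ball)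
  have pn: "p \<notin> path_image \<gamma>" and qn: "q \<notin> path_image \<gamma>"
    using p q inside_no_overlap outside_no_overlap by blast+
  have ps: "p \<notin> support G" "q \<notin> support G" using supp p q pn qn by blast+
  have "winding_number \<gamma> p \<noteq> 0"
    using simple_closed_path_winding_number_inside[OF g(1)] p(1) by (metis zero_neq_neg_one zero_neq_one)
  moreover have "winding_number \<gamma> q = 0"
    using winding_number_zero_in_outside[OF _ g(2) q(1)] g(1) simple_path_imp_path by blast
  ultimately have dne: "wind d p \<noteq> wind d q" using g(7) ps by auto
  have "wind c' p = wind c' q"
  proof (rule wind_constant[OF c'])
    show "x \<notin> edge e" if "c' e \<noteq> 0" "x \<in> ball m \<epsilon>" for e x
      using that eps(3)[of e] c'0 by (cases "e = e0") auto
  qed (use p q in auto)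
  moreover have "wind c' x = wind c x - of_int (c e0) * wind d x" for x
    unfolding c'_def using wind_combine[of c d "- c e0"] c g(4) cycle_finite by simp
  ultimately have "wind c p - of_int (c e0) * wind d p = wind c q - of_int (c e0) * wind d q" by simp
  then have "wind c p \<noteq> wind c q" using dne ce by auto
  then show ?thesis using that[of p q] p q ps eps(2) by blast
qed

lemma wind_constant_imp_zero:
  assumes "cycle c" "\<And>p q. p \<notin> support G \<Longrightarrow> q \<notin> support G \<Longrightarrow> wind c p = wind c q"
  shows "c e = 0"
proof (rule ccontr)
  assume ce: "c e \<noteq> 0"
  obtain m where m: "m \<in> edge e" "m \<notin> vertices G" using edge_interior_point by blast
  obtain p q where "p \<notin> support G" "q \<notin> support G" "wind c p \<noteq> wind c q"
    using wind_jump[OF assms(1) ce m open_UNIV UNIV_I] by metis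
  then show False using assms(2) by blast
qed

section \<open>Faces\<close>

lemma face_of_point: "p \<notin> support G \<Longrightarrow> \<exists>F\<in>faces G. p \<in> F"
  unfolding faces_def by (metis ComplI UnionE Union_components)

lemma face_subset: "F \<in> faces G \<Longrightarrow> F \<inter> support G = {}"
  unfolding faces_def using in_components_subset by blast

lemma face_connected: "F \<in> faces G \<Longrightarrow> connected F"
  and face_nonempty: "F \<in> faces G \<Longrightarrow> F \<noteq> {}"
  unfolding faces_def using in_components_connected in_components_nonempty by blast+

lemma face_open: "F \<in> faces G \<Longrightarrow> open F"
  unfolding faces_def using closed_support open_components by blast

lemma faces_disjoint: "F \<in> faces G \<Longrightarrow> F' \<in> faces G \<Longrightarrow> p \<in> F \<Longrightarrow> p \<in> F' \<Longrightarrow> F = F'"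
  unfolding faces_def using components_eq by blast

lemma lf_face: "lf e \<in> faces G" and rf_face: "rf e \<in> faces G"
  using range_lf by (auto simp: rf_eq)

lemma cycle_const_on_face:
  assumes "cycle c" "F \<in> faces G" "p \<in> F" "q \<in> F"
  shows "wind c p = wind c q"
  by (rule wind_constant[OF assms(1) _ face_connected[OF assms(2)] assms(3,4)])
     (use face_subset[OF assms(2)] edge_support in blast)

text \<open>The boundary of the face, as a chain.\<close>

definition face_chain :: "complex set \<Rightarrow> 'e \<Rightarrow> int" where
  "face_chain F e = of_bool (lf e = F) - of_bool (rf e = F)"

lemma pairing_face_chain:
  "pairing (face_chain F) h = (\<Sum>e | lf e = F. h e - h (inv rB e))"
  "finite {e. face_chain F e \<noteq> 0}"
proof -
  let ?A = "{e. lf e = F} \<union> {e. rf e = F}"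
  have A: "finite ?A" using finite_lf_fiber finite_rf_fiber by auto
  then show "finite {e. face_chain F e \<noteq> 0}"
    by (rule rev_finite_subset) (auto simp: face_chain_def)
  have "pairing (face_chain F) h = (\<Sum>e\<in>?A. of_int (face_chain F e) * h e)"
    using A by (intro pairing_superset) (auto simp: face_chain_def)
  also have "\<dots> = (\<Sum>e\<in>?A. of_bool (lf e = F) * h e) - (\<Sum>e\<in>?A. of_bool (rf e = F) * h e)"
    unfolding sum_subtractf[symmetric] by (intro sum.cong) (auto simp: face_chain_def)
  also have "(\<Sum>e\<in>?A. of_bool (lf e = F) * h e) = (\<Sum>e | lf e = F. h e)"
    using A by (intro sum.mono_neutral_cong_right) auto
  also have "(\<Sum>e\<in>?A. of_bool (rf e = F) * h e) = (\<Sum>e | rf e = F. h e)"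
    using A by (intro sum.mono_neutral_cong_right) auto
  also have "\<dots> = (\<Sum>e | lf e = F. h (inv rB e))"
    by (rule sum.reindex_bij_witness[of _ "inv rB" rB]) (auto simp: rf_eq)
  finally show "pairing (face_chain F) h = (\<Sum>e | lf e = F. h e - h (inv rB e))"
    by (simp add: sum_subtractf)
qed

lemma sum_lf_nx: "(\<Sum>e | lf e = F. h (nx e)) = (\<Sum>e | lf e = F. h e)"
proof (rule sum.reindex_bij_witness[of _ "inv nx" nx])
  have inv: "nx (inv nx e) = e" "inv nx (nx e) = e" for e
    using bij_nx by (simp_all add: bij_is_surj surj_f_inv_f bij_is_inj)
  show "inv nx b \<in> {e. lf e = F}" if "b \<in> {e. lf e = F}" for b
    using that lf_nx[of "inv nx b"] inv by simp
qed (use bij_nx in \<open>auto simp: bij_is_surj surj_f_inv_f bij_is_inj\<close>)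

lemma cycle_face_chain: "cycle (face_chain F)"
  unfolding cycle_def
proof (intro conjI allI pairing_face_chain(2))
  fix f :: "complex \<Rightarrow> complex"
  have "pairing (face_chain F) (\<lambda>e. f (black G e) - f (white G e)) =
        (\<Sum>e | lf e = F. f (white G (nx e)) - f (white G e))"
    unfolding pairing_face_chain by (intro sum.cong) (auto simp: white_nx)
  also have "\<dots> = 0" by (simp add: sum_subtractf sum_lf_nx[of "\<lambda>e. f (white G e)"])
  finally show "pairing (face_chain F) (\<lambda>e. f (black G e) - f (white G e)) = 0" .
qed

lemma left_walk_path:
  "path (left_walk G n e) \<and> pathstart (left_walk G n e) = white G e \<and>
   path_image (left_walk G n e) \<subseteq> support G \<and>
   (\<forall>p. p \<notin> support G \<longrightarrow> winding_number (left_walk G n e) p =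
     (\<Sum>i<n. winding_number (curve G ((nx ^^ i) e)) p - winding_number (curve G (inv rB ((nx ^^ i) e))) p))"
proof (induction n arbitrary: e)
  case 0
  have "white G e \<in> support G" using edge_vertices edge_support by blast
  moreover have "winding_number (left_walk G 0 e) p = 0" if "p \<notin> support G" for p
    unfolding left_walk.simps using that calculation by (intro winding_number_trivial) auto
  moreover have "path (left_walk G 0 e)" unfolding left_walk.simps by (rule path_linepath)
  moreover have "pathstart (left_walk G 0 e) = white G e"
    unfolding left_walk.simps by (rule pathstart_linepath)
  moreover have "path_image (left_walk G 0 e) = {white G e}"
    unfolding left_walk.simps by (simp only: path_image_linepath closed_segment_idem)
  ultimately show ?case by (simp del: left_walk.simps)
next
  case (Suc n)
  define \<delta> where "\<delta> = reversepath (curve G (inv rB e))"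
  define \<gamma> where "\<gamma> = left_walk G n (nx e)"
  have g: "path \<gamma>" "pathstart \<gamma> = white G (nx e)" "path_image \<gamma> \<subseteq> support G"
     "\<And>p. p \<notin> support G \<Longrightarrow> winding_number \<gamma> p =
     (\<Sum>i<n. winding_number (curve G ((nx ^^ i) (nx e))) p - winding_number (curve G (inv rB ((nx ^^ i) (nx e)))) p)"
    using Suc[of "nx e"] by (auto simp: \<gamma>_def)
  have d: "path \<delta>" "pathstart \<delta> = black G e" "pathfinish \<delta> = white G (nx e)" "path_image \<delta> = edge (inv rB e)"
    by (auto simp: \<delta>_def path_curve pathfinish_curve pathstart_curve white_nx)
  have pdg: "path (\<delta> +++ \<gamma>)" "path_image (\<delta> +++ \<gamma>) \<subseteq> support G"
    using g d edge_support by (auto simp: path_image_join)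
  have W: "left_walk G (Suc n) e = curve G e +++ (\<delta> +++ \<gamma>)" by (simp add: \<delta>_def \<gamma>_def)
  have "winding_number (left_walk G (Suc n) e) p =
     (\<Sum>i<Suc n. winding_number (curve G ((nx ^^ i) e)) p - winding_number (curve G (inv rB ((nx ^^ i) e))) p)"
    if p: "p \<notin> support G" for p
  proof -
    have pp: "p \<notin> edge e'" for e' using p edge_support by blast
    have "winding_number (left_walk G (Suc n) e) p = winding_number (curve G e) p + winding_number (\<delta> +++ \<gamma>) p"
      unfolding W using pdg p pp d g
      by (intro winding_number_join) (auto simp: path_curve pathfinish_curve)
    also have "winding_number (\<delta> +++ \<gamma>) p = winding_number \<delta> p + winding_number \<gamma> p"
      using p pp d g by (intro winding_number_join) auto
    also have "winding_number \<delta> p = - winding_number (curve G (inv rB e)) p"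
      unfolding \<delta>_def by (simp add: winding_number_reversepath path_curve pp)
    finally show ?thesis
      unfolding sum.lessThan_Suc_shift using g(4)[OF p]
      by (simp add: funpow_swap1 del: funpow.simps(2) add: funpow_Suc_right)
  qed
  then show ?case
    unfolding W using pdg d g edge_support[of e]
    by (auto simp: path_curve pathfinish_curve pathstart_curve path_image_join)
qed

lemma sum_orbit:
  assumes "n = (LEAST n. n > 0 \<and> (nx ^^ n) e = e)"
  shows "(\<Sum>i<n. h ((nx ^^ i) e)) = (\<Sum>e' | lf e' = lf e. h e')"
proof -
  have n: "n > 0" "(nx ^^ n) e = e"
    using LeastI_ex[of "\<lambda>n. n > 0 \<and> (nx ^^ n) e = e"] left_period[of e] assms by auto
  have min: "(nx ^^ k) e \<noteq> e" if "0 < k" "k < n" for k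
    using not_less_Least[of k "\<lambda>n. n > 0 \<and> (nx ^^ n) e = e"] that assms by auto
  have inj: "inj_on (\<lambda>i. (nx ^^ i) e) {..<n}"
  proof (rule linorder_inj_onI)
    fix i j assume ij: "i < j" "i \<in> {..<n}" "j \<in> {..<n}"
    show "(nx ^^ i) e \<noteq> (nx ^^ j) e"
    proof
      assume eq: "(nx ^^ i) e = (nx ^^ j) e"
      have "(nx ^^ j) e = (nx ^^ i) ((nx ^^ (j - i)) e)"
        using ij by (metis add_diff_inverse_nat funpow_add less_imp_not_less o_apply)
      then have "(nx ^^ (j - i)) e = e"
        using eq bij_nx by (metis bij_fn bij_is_inj injD)
      moreover have "0 < j - i" "j - i < n" using ij by auto
      ultimately show False using min by blast
    qed
  qed auto
  show ?thesis using sum.reindex[OF inj, of h] left_orbit[OF n] by (simp add: o_def)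
qed

text \<open>The boundary walk of the face consists of the edges of its chain.\<close>

lemma wind_face_chain:
  assumes F: "F \<in> faces G" and p: "p \<notin> support G"
  shows "wind (face_chain F) p = of_bool (p \<in> F)"
proof -
  obtain e where e: "F = lf e" using F range_lf by auto
  define n where "n = (LEAST n. n > 0 \<and> (nx ^^ n) e = e)"
  have "winding_number (left_boundary G e) p =
    (\<Sum>i<n. winding_number (curve G ((nx ^^ i) e)) p - winding_number (curve G (inv rB ((nx ^^ i) e))) p)"
    using left_walk_path[of n e] p unfolding left_boundary_def n_def by blast
  also have "\<dots> = wind (face_chain F) p"
    using sum_orbit[OF n_def, of "\<lambda>e. winding_number (curve G e) p - winding_number (curve G (inv rB e)) p"]
    by (simp add: wind_def pairing_face_chain e)
  finally have *: "wind (face_chain F) p = winding_number (left_boundary G e) p" ..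
  moreover have "p \<in> F \<longleftrightarrow> winding_number (left_boundary G e) p = 1"
    unfolding e left_face_def using p by auto
  ultimately show ?thesis
    using left_boundary_winding[OF p, of e] by auto
qed

text \<open>The winding numbers of \<open>c\<close>, minus their value \<open>k\<close> at infinity, form
  a function \<open>g\<close> on the faces. The boundary of \<open>g\<close> has the winding
  numbers of \<open>c\<close> up to the constant \<open>k\<close>, so that the difference of
  these two cycles vanishes by \<open>wind_jump\<close>. The support of \<open>g\<close> is
  finite because a face with \<open>g F \<noteq> 0\<close> lies in a disc containing the edges
  of \<open>c\<close>, hence an edge of its own boundary meets this disc, and the graph is
  locally finite.\<close>

theorem cycle_bounds:
  assumes c: "cycle c"
  obtains g :: "complex set \<Rightarrow> int" and k :: complex where
    "finite {F. g F \<noteq> 0}" "\<And>e. c e = g (lf e) - g (rf e)"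
    "\<And>F p. F \<in> faces G \<Longrightarrow> p \<in> F \<Longrightarrow> wind c p = of_int (g F) + k"
    "\<exists>R. \<forall>p. norm p > R \<longrightarrow> wind c p = k" "{F. g F \<noteq> 0} \<subseteq> faces G"
proof -
  have fin: "finite {e. c e \<noteq> 0}" using c cycle_finite by blast
  have "bounded (\<Union>e\<in>{e. c e \<noteq> 0}. edge e)"
    using fin by (intro bounded_UN) (auto simp: bounded_path_image path_curve)
  then obtain R where R: "\<And>e x. c e \<noteq> 0 \<Longrightarrow> x \<in> edge e \<Longrightarrow> norm x \<le> R"
    unfolding bounded_iff by blast
  have conn: "connected (- cball (0::complex) R)"
    by (simp add: connected_complement_bounded_convex)
  obtain p0 :: complex where p0: "norm p0 > R"
    using that[of "of_real (\<bar>R\<bar> + 1)"] by (auto simp del: of_real_add)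
  define k where "k = wind c p0"
  have k: "wind c p = k" if "norm p > R" for p
    unfolding k_def
    by (rule wind_constant[OF c _ conn]) (use that p0 R in \<open>auto simp: not_le\<close>, fastforce)
  have kI: "k \<in> \<int>" unfolding k_def using p0 R by (intro wind_Ints[OF c]) fastforce
  define pt where "pt F = (SOME p. p \<in> F)" for F :: "complex set"
  have pt: "pt F \<in> F" if "F \<in> faces G" for F
    unfolding pt_def using face_nonempty[OF that] by (simp add: some_in_eq)
  have int: "wind c p \<in> \<int>" if "p \<notin> support G" for p
    using that edge_support by (intro wind_Ints[OF c]) blast
  define g where "g F = (if F \<in> faces G then \<lfloor>Re (wind c (pt F) - k)\<rfloor> else 0)" for F
  have g: "wind c p = of_int (g F) + k" if "F \<in> faces G" "p \<in> F" for F p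
  proof -
    have ps: "pt F \<notin> support G" using pt[OF that(1)] face_subset[OF that(1)] by blast
    have "wind c (pt F) - k \<in> \<int>" using int[OF ps] kI by simp
    then have "of_int \<lfloor>Re (wind c (pt F) - k)\<rfloor> = wind c (pt F) - k"
      by (elim Ints_cases) (simp only: complex_Re_of_int floor_of_int)
    then show ?thesis
      using that cycle_const_on_face[OF c that(1) that(2) pt[OF that(1)]] unfolding g_def by simp
  qed
  have "{F. g F \<noteq> 0} \<subseteq> lf ` {e. edge e \<inter> cball 0 R \<noteq> {}} \<union> rf ` {e. edge e \<inter> cball 0 R \<noteq> {}}"
  proof
    fix F assume "F \<in> {F. g F \<noteq> 0}"
    then have gF: "g F \<noteq> 0" and F: "F \<in> faces G" by (auto simp: g_def split: if_splits)
    have sub: "F \<subseteq> cball 0 R"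
    proof
      fix p assume p: "p \<in> F"
      then have "wind c p \<noteq> k" using g[OF F] gF by simp
      then show "p \<in> cball 0 R" using k[of p] by fastforce
    qed
    have "\<exists>e. face_chain F e \<noteq> 0"
    proof (rule ccontr)
      assume "\<not> ?thesis"
      then have "face_chain F = (\<lambda>_. 0)" by auto
      then have "wind (face_chain F) (pt F) = 0" by (simp add: wind_def)
      moreover have "pt F \<notin> support G" using pt[OF F] face_subset[OF F] by blast
      ultimately show False using wind_face_chain[OF F, of "pt F"] pt[OF F] by simp
    qed
    then obtain e where e: "face_chain F e \<noteq> 0" by blast
    obtain m where m: "m \<in> edge e" "m \<notin> vertices G" using edge_interior_point by blast
    (* The winding number of the boundary of F jumps at m, hence F comes arbitrarily close to
       m. *)
    have "m \<in> closure F"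
      unfolding closure_iff_nhds_not_empty
    proof (intro allI impI)
      fix A V assume V: "V \<subseteq> A" "open V" "m \<in> V"
      obtain p q where pq: "p \<in> V" "p \<notin> support G" "q \<in> V" "q \<notin> support G"
        "wind (face_chain F) p \<noteq> wind (face_chain F) q"
        using wind_jump[OF cycle_face_chain e m V(2,3)] by metis
      then have "p \<in> F \<or> q \<in> F" using wind_face_chain[OF F] by auto
      then show "F \<inter> A \<noteq> {}" using pq V by blast
    qed
    then have "m \<in> cball 0 R" using sub closed_cball by (metis closure_minimal subsetD)
    then have "edge e \<inter> cball 0 R \<noteq> {}" using m by blast
    moreover have "F = lf e \<or> F = rf e"
    proof (rule ccontr)
      assume "\<not> ?thesis"
      then have "lf e \<noteq> F" "rf e \<noteq> F" by auto
      then show False using e unfolding face_chain_def by simp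
    qed
    ultimately show "F \<in> lf ` {e. edge e \<inter> cball 0 R \<noteq> {}} \<union> rf ` {e. edge e \<inter> cball 0 R \<noteq> {}}"
      by blast
  qed
  then have fing: "finite {F. g F \<noteq> 0}"
    by (rule finite_subset) (use locally_finite[of "cball 0 R"] in auto)
  (* b is the boundary of the 2-chain g. *)
  define b where "b = (\<lambda>e. \<Sum>F | g F \<noteq> 0. g F * face_chain F e)"
  have gface: "F \<in> faces G" if "g F \<noteq> 0" for F using that by (auto simp: g_def split: if_splits)
  have b: "cycle b" unfolding b_def using fing by (intro cycle_sum cycle_face_chain) auto
  have bw: "wind b p = (\<Sum>F | g F \<noteq> 0. of_int (g F) * wind (face_chain F) p)" for p
    unfolding wind_def b_def using fing by (intro pairing_sum[THEN conjunct2] pairing_face_chain(2))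
  have be: "b e = g (lf e) - g (rf e)" for e
  proof -
    have "b e = (\<Sum>F | g F \<noteq> 0. g F * of_bool (lf e = F)) - (\<Sum>F | g F \<noteq> 0. g F * of_bool (rf e = F))"
      by (simp add: b_def face_chain_def algebra_simps sum_subtractf)
    also have "(\<Sum>F | g F \<noteq> 0. g F * of_bool (lf e = F)) = g (lf e)"
      using fing by (simp add: sum.delta of_bool_def if_distrib cong: if_cong)
    also have "(\<Sum>F | g F \<noteq> 0. g F * of_bool (rf e = F)) = g (rf e)"
      using fing by (simp add: sum.delta of_bool_def if_distrib cong: if_cong)
    finally show ?thesis .
  qed
  have "wind b p = wind c p - k" if p: "p \<notin> support G" for p
  proof -
    obtain F where F: "F \<in> faces G" "p \<in> F" using face_of_point[OF p] by blast
    have "wind b p = (\<Sum>F' | g F' \<noteq> 0. of_int (g F') * of_bool (F' = F))"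
      unfolding bw
    proof (intro sum.cong refl)
      fix F' assume "F' \<in> {F. g F \<noteq> 0}"
      then have F': "F' \<in> faces G" using gface by simp
      have "p \<in> F' \<longleftrightarrow> F' = F" using faces_disjoint[OF F' F(1)] F(2) by blast
      then show "of_int (g F') * wind (face_chain F') p = of_int (g F') * of_bool (F' = F)"
        using wind_face_chain[OF F' p] by simp
    qed
    also have "\<dots> = of_int (g F)"
      using fing by (simp add: sum.delta of_bool_def if_distrib cong: if_cong)
    finally show ?thesis using g[OF F] by simp
  qed
  moreover have "wind (\<lambda>e. c e + (-1) * b e) p = wind c p - wind b p" for p
    using wind_combine[OF cycle_finite[OF c] cycle_finite[OF b], of "-1"] by simp
  ultimately have "wind (\<lambda>e. c e + (-1) * b e) p = k" if "p \<notin> support G" for p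
    using that by simp
  then have "c e + (-1) * b e = 0" for e
    by (intro wind_constant_imp_zero[OF cycle_combine[OF c b]]) simp
  then have "c e - b e = 0" for e by (metis mult_minus1 uminus_add_conv_diff add.commute)
  then have "c e = b e" for e by (metis eq_iff_diff_eq_0)
  then have "c e = g (lf e) - g (rf e)" for e using be[of e] by simp
  then show ?thesis using that fing g k gface by blast
qed

section \<open>Connectedness\<close>

text \<open>A bounded disc in the plane has a connected frontier.\<close>

lemma frontier_face:
  assumes "F \<in> faces G"
  shows "connected (frontier F)" "frontier F \<subseteq> support G"
proof -
  have "simply_connected F"
    using face_disc[OF assms] homeomorphic_simply_connected_eq convex_imp_simply_connected convex_ball by blast
  then have "connected (- F) \<or> connected (frontier F)"
    using simply_connected_eq_frontier_properties[OF face_open[OF assms]] face_bounded[OF assms] by auto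
  then show "connected (frontier F)"
    using simply_connected_eq_frontier_properties[OF face_open[OF assms]] face_bounded[OF assms]
      \<open>simply_connected F\<close> by auto
  show "frontier F \<subseteq> support G"
    using assms frontier_of_components_closed_complement[OF closed_support] unfolding faces_def by blast
qed

text \<open>Otherwise the graph splits into two nonempty closed parts without common point. The frontier
  of a face is connected, so it lies in one of them. Each part, together with the faces whose
  frontier it contains, is open, and the plane would be disconnected.\<close>

lemma vertices_connected:
  assumes "u \<in> vertices G" "v \<in> vertices G"
  shows "(adjacent UNIV)\<^sup>*\<^sup>* u v"
proof -
  define X where "X = {v. (adjacent UNIV)\<^sup>*\<^sup>* u v}"
  define A where "A = (\<Union>e\<in>{e. white G e \<in> X}. edge e)"
  define B where "B = (\<Union>e\<in>{e. white G e \<notin> X}. edge e)"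
  have iff: "white G e \<in> X \<longleftrightarrow> black G e \<in> X" for e
  proof -
    have "adjacent UNIV (black G e) (white G e)" "adjacent UNIV (white G e) (black G e)"
      by (auto simp: adjacent_def)
    then show ?thesis unfolding X_def by (auto intro: rtranclp.rtrancl_into_rtrancl)
  qed
  have clA: "closed A" "closed B" unfolding A_def B_def by (rule closed_edges)+
  have AB: "A \<union> B = support G" by (auto simp: A_def B_def support_def)
  have disj: "A \<inter> B = {}"
  proof (rule ccontr)
    assume "A \<inter> B \<noteq> {}"
    then obtain x e e' where x: "x \<in> edge e" "x \<in> edge e'" "white G e \<in> X" "white G e' \<notin> X"
      by (auto simp: A_def B_def)
    then have "e \<noteq> e'" by auto
    then have "x \<in> vertices G" using x edge_inter by blast
    then have "x \<in> {white G e, black G e}" "x \<in> {white G e', black G e'}"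
      using x(1,2) edge_vertices[of e] edge_vertices[of e'] by auto
    then have "x \<in> X" "x \<notin> X" using x(3,4) iff[of e] iff[of e'] by auto
    then show False by simp
  qed
  (* The parts of the plane covered by A and by B. *)
  define UA where "UA = A \<union> \<Union>{F\<in>faces G. frontier F \<subseteq> A}"
  define UB where "UB = B \<union> \<Union>{F\<in>faces G. frontier F \<subseteq> B}"
  have dich: "frontier F \<subseteq> A \<or> frontier F \<subseteq> B" if "F \<in> faces G" for F
  proof -
    have "A \<inter> frontier F = {} \<or> B \<inter> frontier F = {}"
      using frontier_face[OF that] clA AB disj
      by (intro connected_closedD) auto
    then show ?thesis using frontier_face(2)[OF that] AB by blast
  qed
  have ne: "frontier F \<noteq> {}" if "F \<in> faces G" for F
    using face_nonempty[OF that] face_bounded[OF that] by (metis frontier_eq_empty not_bounded_UNIV)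
  have openU: "open (C \<union> \<Union>{F\<in>faces G. frontier F \<subseteq> C})"
    if C: "C \<union> D = support G" "C \<inter> D = {}" "closed C" "closed D"
      "\<And>F. F \<in> faces G \<Longrightarrow> frontier F \<subseteq> C \<or> frontier F \<subseteq> D" for C D
    unfolding open_contains_ball
  proof
    fix x assume x: "x \<in> C \<union> \<Union>{F\<in>faces G. frontier F \<subseteq> C}"
    show "\<exists>e>0. ball x e \<subseteq> C \<union> \<Union>{F\<in>faces G. frontier F \<subseteq> C}"
    proof (cases "x \<in> C")
      case False
      then obtain F where F: "F \<in> faces G" "frontier F \<subseteq> C" "x \<in> F" using x by blast
      then show ?thesis using face_open[OF F(1)] unfolding open_contains_ball by blast
    next
      case True
      then have "x \<in> - D" using C by blast
      then obtain r where r: "r > 0" "ball x r \<subseteq> - D" using C(4) open_contains_ball by (metis open_Compl)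
      have "ball x r \<subseteq> C \<union> \<Union>{F\<in>faces G. frontier F \<subseteq> C}"
      proof
        fix y assume y: "y \<in> ball x r"
        show "y \<in> C \<union> \<Union>{F\<in>faces G. frontier F \<subseteq> C}"
        proof (cases "y \<in> support G")
          case True then show ?thesis using y r C(1) by blast
        next
          case False
          then obtain F where F: "F \<in> faces G" "y \<in> F" using face_of_point by blast
          have "x \<notin> F" using True C(1) face_subset[OF F(1)] by blast
          then have "ball x r \<inter> frontier F \<noteq> {}"
          proof (intro connected_Int_frontier)
            have "x \<in> ball x r" using r by simp
            then show "ball x r - F \<noteq> {}" using \<open>x \<notin> F\<close> by blast
          qed (use y F in auto)
          then have "frontier F \<subseteq> C" using C(5)[OF F(1)] r by blast
          then show ?thesis using F by blast
        qed
      qed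
      then show ?thesis using r by blast
    qed
  qed
  have oA: "open UA" unfolding UA_def using openU[OF AB disj clA dich] by simp
  have oB: "open UB" unfolding UB_def
    by (rule openU[of B A]) (use AB disj clA dich in auto)
  have "UA \<union> UB = UNIV"
  proof -
    have "x \<in> UA \<union> UB" for x
    proof (cases "x \<in> support G")
      case True then show ?thesis using AB by (auto simp: UA_def UB_def)
    next
      case False
      then obtain F where F: "F \<in> faces G" "x \<in> F" using face_of_point by blast
      then show ?thesis using dich[OF F(1)] by (auto simp: UA_def UB_def)
    qed
    then show ?thesis by auto
  qed
  moreover have "UA \<inter> UB = {}"
  proof -
    have "False" if x: "x \<in> UA" "x \<in> UB" for x
    proof (cases "x \<in> support G")
      case True
      have "x \<notin> F" if "F \<in> faces G" for F using True face_subset[OF that] by blast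
      then have "x \<in> A" "x \<in> B" using x by (auto simp: UA_def UB_def)
      then show False using disj by blast
    next
      case False
      then have "x \<notin> A" "x \<notin> B" using AB by blast+
      then obtain F F' where F: "F \<in> faces G" "F' \<in> faces G" "x \<in> F" "x \<in> F'" "frontier F \<subseteq> A" "frontier F' \<subseteq> B"
        using x by (auto simp: UA_def UB_def)
      then have "F = F'" using faces_disjoint by blast
      then show False using F ne[OF F(1)] disj by blast
    qed
    then show ?thesis by blast
  qed
  ultimately have "UA = {} \<or> UB = {}"
    using connectedD[OF connected_UNIV oA oB] by auto
  moreover have "u \<in> UA"
  proof -
    obtain e where e: "u = white G e \<or> u = black G e"
      using assms(1) by (auto simp: vertices_def white_vertices_def black_vertices_def)
    have "u \<in> X" by (simp add: X_def)
    then have "white G e \<in> X" using e iff by blast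
    moreover have "u \<in> edge e" using e edge_vertices by blast
    ultimately show ?thesis by (auto simp: UA_def A_def)
  qed
  ultimately have "B = {}" by (auto simp: UB_def)
  then have all: "white G e \<in> X" for e
    unfolding B_def using edge_vertices[of e] by blast
  obtain e where "v = white G e \<or> v = black G e"
    using assms(2) by (auto simp: vertices_def white_vertices_def black_vertices_def)
  then have "v \<in> X" using all iff by blast
  then show ?thesis by (simp add: X_def)
qed

section \<open>Exactness of closed forms\<close>

lemma finite_support_lf:
  assumes "finite {F. g F \<noteq> 0}"
  shows "finite {e. g (lf e) \<noteq> 0}"
proof -
  have "{e. g (lf e) \<noteq> 0} = (\<Union>F\<in>{F. g F \<noteq> 0}. {e. lf e = F})" by auto
  then show ?thesis using assms finite_lf_fiber by auto
qed

lemma finite_support_rf: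
  assumes "finite {F. g F \<noteq> 0}"
  shows "finite {e. g (rf e) \<noteq> 0}"
proof -
  have "{e. g (rf e) \<noteq> 0} = (\<Union>F\<in>{F. g F \<noteq> 0}. {e. rf e = F})" by auto
  then show ?thesis using assms finite_rf_fiber by auto
qed

lemma Sum_any_rf: "Sum_any (\<lambda>e. g (rf e) * h e) = Sum_any (\<lambda>e. g (lf e) * h (inv rB e))"
  by (rule Sum_any.reindex_cong[of "inv rB"]) (auto simp: bij_rotB bij_imp_bij_inv)

lemma Sum_any_nx: "Sum_any (\<lambda>e. g (lf e) * h (nx e)) = Sum_any (\<lambda>e. g (lf e) * h e)"
  by (rule Sum_any.reindex_cong[of nx, symmetric]) (auto simp: bij_nx)

text \<open>The right face of \<open>inv rB e\<close> is the left face of \<open>e\<close>: a sum of jumps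
  over the edges is a sum over the boundary walks of the faces.\<close>

lemma Sum_any_jump:
  fixes g :: "complex set \<Rightarrow> complex"
  assumes "finite {F. g F \<noteq> 0}"
  shows "Sum_any (\<lambda>e. (g (lf e) - g (rf e)) * h e) = Sum_any (\<lambda>e. g (lf e) * (h e - h (inv rB e)))"
proof -
  let ?A = "{e. g (lf e) \<noteq> 0} \<union> {e. g (rf e) \<noteq> 0}"
  have A: "finite ?A" using finite_support_lf[OF assms] finite_support_rf[OF assms] by auto
  have "Sum_any (\<lambda>e. (g (lf e) - g (rf e)) * h e) = (\<Sum>e\<in>?A. g (lf e) * h e - g (rf e) * h e)"
    by (subst Sum_any.expand_superset[OF A]) (auto simp: algebra_simps)
  also have "\<dots> = Sum_any (\<lambda>e. g (lf e) * h e) - Sum_any (\<lambda>e. g (rf e) * h e)"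
    unfolding sum_subtractf
    by (subst (1 2) Sum_any.expand_superset[OF A]) auto
  also have "\<dots> = Sum_any (\<lambda>e. g (lf e) * h e) - Sum_any (\<lambda>e. g (lf e) * h (inv rB e))"
    by (simp add: Sum_any_rf)
  also have "\<dots> = (\<Sum>e\<in>?A. g (lf e) * h e - g (lf e) * h (inv rB e))"
    unfolding sum_subtractf
    by (subst (1 2) Sum_any.expand_superset[OF A]) auto
  also have "\<dots> = Sum_any (\<lambda>e. g (lf e) * (h e - h (inv rB e)))"
    by (subst Sum_any.expand_superset[OF A]) (auto simp: algebra_simps)
  finally show ?thesis .
qed

text \<open>\<open>nx\<close> permutes the edges of the boundary walk of each face.\<close>

lemma Sum_any_telescope:
  fixes g :: "complex set \<Rightarrow> complex"
  assumes "finite {F. g F \<noteq> 0}"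
  shows "Sum_any (\<lambda>e. g (lf e) * (h e - h (nx e))) = 0"
proof -
  have A: "finite {e. g (lf e) \<noteq> 0}" using finite_support_lf[OF assms] .
  have "Sum_any (\<lambda>e. g (lf e) * (h e - h (nx e))) =
      (\<Sum>e | g (lf e) \<noteq> 0. g (lf e) * h e - g (lf e) * h (nx e))"
    by (subst Sum_any.expand_superset[OF A]) (auto simp: algebra_simps)
  also have "\<dots> = Sum_any (\<lambda>e. g (lf e) * h e) - Sum_any (\<lambda>e. g (lf e) * h (nx e))"
    unfolding sum_subtractf by (subst (1 2) Sum_any.expand_superset[OF A]) auto
  finally show ?thesis by (simp add: Sum_any_nx)
qed

text \<open>Discrete Stokes formula: \<open>c\<close> is a boundary by \<open>cycle_bounds\<close>, and
  the hypothesis makes the integral of \<open>om\<close> along the boundary walk of a face a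
  telescoping sum.\<close>

lemma closed_form_cycle:
  assumes "\<And>e. om e - om (inv rB e) = ps e - ps (nx e)" "cycle c"
  shows "pairing c om = 0"
proof -
  obtain g :: "complex set \<Rightarrow> int" where g: "finite {F. g F \<noteq> 0}" "\<And>e. c e = g (lf e) - g (rf e)"
    using cycle_bounds[OF assms(2)] by metis
  have g': "finite {F. (of_int (g F) :: complex) \<noteq> 0}" using g(1) by simp
  have "pairing c om = Sum_any (\<lambda>e. (of_int (g (lf e)) - of_int (g (rf e))) * om e)"
    by (simp add: pairing_def g(2))
  also have "\<dots> = 0"
    using Sum_any_jump[OF g', of om] Sum_any_telescope[OF g', of ps] by (simp add: assms(1))
  finally show ?thesis .
qed

text \<open>The boundary of a boundary vanishes.\<close>

lemma jump_cycle:
  fixes g :: "complex set \<Rightarrow> int"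
  assumes "finite {F. g F \<noteq> 0}"
  shows "cycle (\<lambda>e. g (lf e) - g (rf e))"
  unfolding cycle_def
proof (intro conjI allI)
  show "finite {e. g (lf e) - g (rf e) \<noteq> 0}"
    by (rule finite_subset[OF _ finite_UnI[OF finite_support_lf[OF assms] finite_support_rf[OF assms]]]) auto
  fix f :: "complex \<Rightarrow> complex"
  have g': "finite {F. (of_int (g F) :: complex) \<noteq> 0}" using assms by simp
  have "pairing (\<lambda>e. g (lf e) - g (rf e)) (\<lambda>e. f (black G e) - f (white G e)) =
     Sum_any (\<lambda>e. of_int (g (lf e)) * (f (white G (nx e)) - f (white G e)))"
    using Sum_any_jump[OF g', of "\<lambda>e. f (black G e) - f (white G e)"] by (simp add: pairing_def white_nx)
  also have "\<dots> = - Sum_any (\<lambda>e. of_int (g (lf e)) * (f (white G e) - f (white G (nx e))))"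
    by (simp add: Sum_any.expand_superset[OF finite_support_lf[OF g']] sum_negf[symmetric] algebra_simps subset_iff)
  also have "\<dots> = 0"
    using Sum_any_telescope[OF g', of "\<lambda>e. f (white G e)"] by simp
  finally show "pairing (\<lambda>e. g (lf e) - g (rf e)) (\<lambda>e. f (black G e) - f (white G e)) = 0" .
qed

lemma white_vertex: "white G e \<in> vertices G" and black_vertex: "black G e \<in> vertices G"
  by (auto simp: vertices_def white_vertices_def black_vertices_def)

lemma vertex_cases:
  assumes "v \<in> vertices G"
  obtains e where "v = white G e" | e where "v = black G e"
  using assms by (auto simp: vertices_def white_vertices_def black_vertices_def)

lemma vertex_chain:
  assumes "u \<in> vertices G" "v \<in> vertices G"
  shows "\<exists>c. boundary_is c u v"
proof (cases "u = v")
  case True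
  then show ?thesis by (intro exI[of _ "\<lambda>_. 0"]) (simp add: boundary_is_def)
next
  case False
  then show ?thesis using walk_arc[OF vertices_connected[OF assms]] by metis
qed

text \<open>The potential \<open>h\<close> integrates \<open>om\<close> along an arbitrary chain from a
  fixed vertex, and the choice of the chain does not matter by
  \<open>closed_form_cycle\<close>.\<close>

lemma closed_form_exact:
  fixes om ps :: "'e \<Rightarrow> real"
  assumes "\<And>e. om e - om (inv rB e) = ps e - ps (nx e)"
  shows "\<exists>h. \<forall>e. om e = h (black G e) - h (white G e)"
proof -
  define v0 where "v0 = white G (undefined :: 'e)"
  define ch where "ch v = (SOME c. boundary_is c v0 v)" for v
  have ch: "boundary_is (ch v) v0 v" if "v \<in> vertices G" for v
    unfolding ch_def v0_def by (rule someI_ex[OF vertex_chain[OF white_vertex that]])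
  let ?om = "\<lambda>e. complex_of_real (om e)"
  define h where "h v = Re (pairing (ch v) ?om)" for v
  have "om e = h (black G e) - h (white G e)" for e
  proof -
    note cw = ch[OF white_vertex[of e]] and cb = ch[OF black_vertex[of e]]
    have fw: "finite {x. ch (white G e) x \<noteq> 0}" and fb: "finite {x. ch (black G e) x \<noteq> 0}"
      using cw cb by (auto simp: boundary_is_def)
    define c1 where "c1 = (\<lambda>x. ch (white G e) x + 1 * of_bool (x = e))"
    have f1: "finite {x. c1 x \<noteq> 0}"
      unfolding c1_def by (rule finite_support_combine[OF fw]) simp
    define c where "c = (\<lambda>x. c1 x + (-1) * ch (black G e) x)"
    have pc: "pairing c k = pairing (ch (white G e)) k + k e - pairing (ch (black G e)) k" for k
      unfolding c_def pairing_combine[OF f1 fb] unfolding c1_def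
      by (subst pairing_combine[OF fw]) auto
    have "cycle c"
      unfolding cycle_def pc using cw cb finite_support_combine[OF f1 fb, of "-1"]
      by (auto simp: boundary_is_def c_def)
    moreover have "?om e - ?om (inv rB e) = of_real (ps e) - of_real (ps (nx e))" for e
      using assms[of e] by (metis of_real_diff)
    ultimately have "pairing c ?om = 0" by (intro closed_form_cycle[of ?om "\<lambda>e. of_real (ps e)"])
    then have "Re (pairing (ch (white G e)) ?om + ?om e - pairing (ch (black G e)) ?om) = 0"
      unfolding pc by simp
    then show ?thesis by (simp add: h_def)
  qed
  then show ?thesis by blast
qed

text \<open>The rotations act transitively on the edges since the graph is connected.\<close>

lemma edge_function_constant:
  assumes "\<And>e. k (rB e) = k e" "\<And>e. k (rW e) = k e"
  shows "k e = k e'"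
proof -
  have kb: "k x = k y" if "black G x = black G y" for x y
  proof -
    obtain n where n: "y = (rB ^^ n) x" using \<open>black G x = black G y\<close> black_eq_iff by blast
    have "k ((rB ^^ n) x) = k x" by (induction n) (auto simp: assms)
    then show ?thesis using n by simp
  qed
  have kw: "k x = k y" if "white G x = white G y" for x y
  proof -
    obtain n where n: "y = (rW ^^ n) x" using \<open>white G x = white G y\<close> white_eq_iff by blast
    have "k ((rW ^^ n) x) = k x" by (induction n) (auto simp: assms)
    then show ?thesis using n by simp
  qed
  define P where "P v \<longleftrightarrow> (\<forall>x. white G x = v \<or> black G x = v \<longrightarrow> k x = k e)" for v
  have "(adjacent UNIV)\<^sup>*\<^sup>* (white G e) (white G e')"
    using vertices_connected white_vertex by blast
  moreover have "P (white G e)"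
    unfolding P_def using kw black_white_disjoint by metis
  moreover have "P v" if "adjacent UNIV u v" "P u" for u v
  proof -
    obtain x where x: "(white G x = u \<and> black G x = v) \<or> (black G x = u \<and> white G x = v)"
      using \<open>adjacent UNIV u v\<close> by (auto simp: adjacent_def)
    then have kx: "k x = k e" using \<open>P u\<close> unfolding P_def by blast
    have "k y = k e" if "white G y = v \<or> black G y = v" for y
      using that x kx kb[of x y] kw[of x y] black_white_disjoint by metis
    then show ?thesis unfolding P_def by blast
  qed
  ultimately have "P (white G e')"
    by (induction rule: rtranclp_induct) auto
  then show ?thesis unfolding P_def by metis
qed

lemma face_function_constant:
  assumes "\<And>e. g (lf e) = g (rf e)"
  shows "g (lf e) = g (lf e')"
proof (rule edge_function_constant[of "\<lambda>e. g (lf e)"])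
  show "g (lf (rB e)) = g (lf e)" for e by (metis assms rf_eq)
  show "g (lf (rW e)) = g (lf e)" for e by (metis assms rf_rotW)
qed

lemma infinite_faces: "infinite (faces G)"
proof
  assume "finite (faces G)"
  then have "finite (\<Union>F\<in>faces G. {e. lf e = F})" using finite_lf_fiber by auto
  moreover have "(\<Union>F\<in>faces G. {e. lf e = F}) = UNIV" using lf_face by auto
  ultimately show False using infinite_edges by simp
qed

text \<open>There are infinitely many faces, hence one on which both functions vanish; from it they
  propagate by their jumps.\<close>

lemma face_function_unique:
  fixes g g' :: "complex set \<Rightarrow> int"
  assumes "finite {F. g F \<noteq> 0}" "finite {F. g' F \<noteq> 0}"
    "\<And>e. g (lf e) - g (rf e) = g' (lf e) - g' (rf e)" "F \<in> faces G"
  shows "g F = g' F"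
proof -
  obtain F0 where F0: "F0 \<in> faces G" "g F0 = 0" "g' F0 = 0"
  proof -
    have "\<exists>F0 \<in> faces G. F0 \<notin> {F. g F \<noteq> 0} \<union> {F. g' F \<noteq> 0}"
      using infinite_faces finite_UnI[OF assms(1,2)] by (meson finite_subset subsetI)
    then show ?thesis using that by auto
  qed
  obtain e e0 where e: "F = lf e" "F0 = lf e0" using range_lf assms(4) F0(1) by (metis imageE)
  have "g (lf e) - g' (lf e) = g (lf e0) - g' (lf e0)"
    by (rule face_function_constant) (use assms(3) in \<open>smt (verit)\<close>)
  then show ?thesis using e F0 by simp
qed

section \<open>The discrete Abel map\<close>

text \<open>The equations of the Abel map without its normalisation. The group is arbitrary because they
  are solved first for real lifts of the half-angles.\<close>

definition abel_eqs :: "('e corner \<Rightarrow> 'a :: ab_group_add) \<Rightarrow> (quad_vertex \<Rightarrow> 'a) \<Rightarrow> bool" where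
  "abel_eqs a \<eta> \<longleftrightarrow>
     (\<forall>e. \<eta> (Vertex (black G e)) = \<eta> (Face (rf e)) + a (CornerB e)) \<and>
     (\<forall>e. \<eta> (Vertex (white G e)) = \<eta> (Face (lf e)) - a (CornerW e))"

definition track_invariant :: "('e corner \<Rightarrow> 'a) \<Rightarrow> bool" where
  "track_invariant a \<longleftrightarrow> (\<forall>e. a (side_wr G e) = a (side_bl G e) \<and> a (side_br G e) = a (side_wl G e))"

lemma track_invariantD:
  assumes "track_invariant a"
  shows "a (CornerB e) = a (CornerW e)" "a (CornerW (inv rW e)) = a (CornerB (inv rB e))"
  using assms unfolding track_invariant_def side_wr_def side_bl_def side_br_def side_wl_def by auto

text \<open>The Abel map has to change by \<open>om e\<close> from the white to the black end of
  \<open>e\<close>. This form is closed because \<open>a\<close> takes the same value on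
  opposite sides of a quadrilateral, and the values on the faces follow from those on the
  vertices.\<close>

lemma abel_exists:
  fixes a :: "'e corner \<Rightarrow> real"
  assumes "track_invariant a"
  shows "\<exists>\<eta>. abel_eqs a \<eta>"
proof -
  note inv = track_invariantD[OF assms]
  define om where "om e = a (CornerW e) + a (CornerB (inv rB e))" for e
  have closed: "om e - om (inv rB e) = a (CornerW e) - a (CornerW (nx e))" for e
    unfolding om_def nx_eq using inv(1)[of "inv rB e"] inv(2)[of "inv rB e"] by simp
  obtain h where h: "\<And>e. om e = h (black G e) - h (white G e)"
    using closed_form_exact[OF closed] by blast
  (* The value imposed by e on its left face. *)
  define \<phi> where "\<phi> e = h (white G e) + a (CornerW e)" for e
  have nx: "\<phi> (nx e) = \<phi> e" for e
    using closed[of e] h[of e] h[of "inv rB e"] unfolding \<phi>_def white_nx by simp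
  have \<phi>: "\<phi> e = \<phi> e'" if "lf e = lf e'" for e e'
  proof -
    obtain n where n: "e' = (nx ^^ n) e" using \<open>lf e = lf e'\<close> lf_eq_iff by blast
    have "\<phi> ((nx ^^ n) e) = \<phi> e" by (induction n) (auto simp: nx)
    then show ?thesis using n by simp
  qed
  define \<eta> where "\<eta> x = (case x of Vertex v \<Rightarrow> h v | Face F \<Rightarrow> \<phi> (SOME e. lf e = F))" for x
  have \<eta>F: "\<eta> (Face (lf e)) = \<phi> e" for e
    unfolding \<eta>_def using \<phi>[of "SOME e'. lf e' = lf e" e] by (simp add: someI[of "\<lambda>e'. lf e' = lf e" e])
  have \<eta>V: "\<eta> (Vertex v) = h v" for v by (simp add: \<eta>_def)
  have "abel_eqs a \<eta>"
    unfolding abel_eqs_def \<eta>V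
  proof (intro conjI allI)
    fix e
    show "h (white G e) = \<eta> (Face (lf e)) - a (CornerW e)" unfolding \<eta>F \<phi>_def by simp
    show "h (black G e) = \<eta> (Face (rf e)) + a (CornerB e)"
      unfolding rf_eq \<eta>F \<phi>_def using h[of "rB e"] by (simp add: om_def)
  qed
  then show ?thesis by blast
qed

text \<open>The difference of two solutions does not change along the edges of the quad-graph.\<close>

lemma abel_difference:
  assumes "abel_eqs a \<eta>" "abel_eqs a \<eta>'" "x \<in> quad_vertices G" "y \<in> quad_vertices G"
  shows "\<eta> x - \<eta>' x = \<eta> y - \<eta>' y"
proof -
  define d where "d x = \<eta> x - \<eta>' x" for x
  have db: "d (Vertex (black G e)) = d (Face (rf e))" and dw: "d (Vertex (white G e)) = d (Face (lf e))" for e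
    using assms(1,2) unfolding abel_eqs_def d_def by simp_all
  have dl: "d (Face (lf e)) = d (Vertex (black G e))" for e
    using db[of "inv rB e"] by simp
  have const: "d (Face (lf e)) = d (Face (lf e'))" for e e'
  proof (rule edge_function_constant[of "\<lambda>e. d (Face (lf e))"])
    show "d (Face (lf (rB e))) = d (Face (lf e))" for e using dl[of e] dl[of "rB e"] by simp
    show "d (Face (lf (rW e))) = d (Face (lf e))" for e using dw[of e] dw[of "rW e"] by simp
  qed
  have "\<exists>e. d x = d (Face (lf e))" if xq: "x \<in> quad_vertices G" for x
  proof -
    consider v where "x = Vertex v" "v \<in> vertices G" | F where "x = Face F" "F \<in> faces G"
      using xq unfolding quad_vertices_def by blast
    then show ?thesis
    proof cases
      case 1
      then show ?thesis using dw dl by (metis vertex_cases)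
    next
      case 2
      then show ?thesis using range_lf by (metis imageE)
    qed
  qed
  then show ?thesis using assms(3,4) const unfolding d_def by metis
qed

section \<open>Train-tracks\<close>

fun step :: "'e corner \<Rightarrow> 'e corner" where
  "step (CornerB e) = CornerW e"
| "step (CornerW e) = CornerB (inv rB (rW e))"

lemma track_step_iff: "(c, d) \<in> track_step G \<longleftrightarrow> d = step c"
proof
  assume "(c, d) \<in> track_step G"
  then show "d = step c"
    by (auto simp: track_step_def side_wr_def side_bl_def side_br_def side_wl_def)
next
  assume d: "d = step c"
  show "(c, d) \<in> track_step G"
  proof (cases c)
    case (CornerB e)
    then show ?thesis using d by (auto simp: track_step_def side_br_def side_wl_def)
  next
    case (CornerW e)
    then have "(c, d) = (side_wr G (rW e), side_bl G (rW e))"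
      using d by (simp add: side_wr_def side_bl_def)
    then show ?thesis unfolding track_step_def by blast
  qed
qed

lemma bij_step: "bij step"
proof (rule bijI)
  show "inj step"
  proof (rule injI)
    fix c d assume "step c = step d"
    then show "c = d"
      by (cases c; cases d) (auto, metis rotB_inv(1) rotW_inv(2))
  qed
  show "surj step"
  proof (rule surjI)
    show "step (case d of CornerW e \<Rightarrow> CornerB e | CornerB e \<Rightarrow> CornerW (inv rW (rB e))) = d" for d
      by (cases d) auto
  qed
qed

lemma track_step_power: "(c, d) \<in> track_step G ^^ n \<longleftrightarrow> d = (step ^^ n) c"
  by (induction n arbitrary: d) (auto simp: track_step_iff relcomp_unfold)

lemma track_step_rtrancl: "(c, d) \<in> (track_step G)\<^sup>* \<longleftrightarrow> (\<exists>n. d = (step ^^ n) c)"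
  by (simp add: rtrancl_power track_step_power)

lemma track_invariantI:
  assumes "\<And>c. a (step c) = a c"
  shows "track_invariant a"
  unfolding track_invariant_def side_wr_def side_bl_def side_br_def side_wl_def
proof
  fix e
  show "a (CornerW (inv rW e)) = a (CornerB (inv rB e)) \<and> a (CornerB e) = a (CornerW e)"
    using assms[of "CornerW (inv rW e)"] assms[of "CornerB e"] by simp
qed

definition same_track :: "'e corner rel" where
  "same_track = (track_step G \<union> (track_step G)\<inverse>)\<^sup>*"

lemma track_of_iff: "d \<in> track_of G c \<longleftrightarrow> (c, d) \<in> same_track"
  by (simp add: track_of_def same_track_def)

lemma equiv_same_track: "equiv UNIV same_track"
proof (rule equivI)
  show "sym same_track" unfolding same_track_def
    by (intro sym_rtrancl) (auto simp: sym_def)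
qed (auto simp: same_track_def refl_on_def trans_rtrancl)

lemma track_of_class: "track_of G c = same_track `` {c}"
  by (auto simp: track_of_iff)

lemma track_of_eq_iff: "track_of G c = track_of G d \<longleftrightarrow> (c, d) \<in> same_track"
  unfolding track_of_class using eq_equiv_class_iff[OF equiv_same_track] by simp

lemma mem_track_of: "d \<in> track_of G c \<longleftrightarrow> track_of G d = track_of G c"
  using track_of_eq_iff[of c d] by (auto simp: track_of_iff)

lemma track_of_step [simp]: "track_of G (step c) = track_of G c"
proof -
  have "(c, step c) \<in> track_step G" by (simp add: track_step_iff)
  then have "(c, step c) \<in> same_track" unfolding same_track_def by blast
  then show ?thesis using track_of_eq_iff by blast
qed

lemma track_of_step_power [simp]: "track_of G ((step ^^ n) c) = track_of G c"
  by (induction n) auto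

lemma same_track_iff: "(c, d) \<in> same_track \<longleftrightarrow> (\<exists>n. d = (step ^^ n) c \<or> c = (step ^^ n) d)"
proof
  assume "\<exists>n. d = (step ^^ n) c \<or> c = (step ^^ n) d"
  then have "track_of G c = track_of G d" by auto
  then show "(c, d) \<in> same_track" using track_of_eq_iff by blast
next
  assume "(c, d) \<in> same_track"
  then show "\<exists>n. d = (step ^^ n) c \<or> c = (step ^^ n) d"
    unfolding same_track_def
  proof (induction rule: rtrancl_induct)
    case base
    then show ?case by (intro exI[of _ 0]) simp
  next
    case (step y z)
    obtain n where n: "y = (local.step ^^ n) c \<or> c = (local.step ^^ n) y" using step.IH by blast
    from step.hyps(2) have "z = local.step y \<or> y = local.step z" by (auto simp: track_step_iff)
    then show ?case
    proof
      assume z: "z = local.step y"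
      from n show ?thesis
      proof
        assume "y = (local.step ^^ n) c"
        then show ?thesis using z by (intro exI[of _ "Suc n"]) simp
      next
        assume c: "c = (local.step ^^ n) y"
        show ?thesis
        proof (cases n)
          case 0
          then show ?thesis using c z by (intro exI[of _ 1]) simp
        next
          case (Suc m)
          then have "c = (local.step ^^ m) z" using c z by (simp add: funpow_swap1)
          then show ?thesis by blast
        qed
      qed
    next
      assume y: "y = local.step z"
      from n show ?thesis
      proof
        assume c: "c = (local.step ^^ n) y"
        then have "c = (local.step ^^ Suc n) z" using y by (simp add: funpow_swap1)
        then show ?thesis by blast
      next
        assume yc: "y = (local.step ^^ n) c"
        show ?thesis
        proof (cases n)
          case 0
          then show ?thesis using yc y by (intro exI[of _ 1]) simp
        next
          case (Suc m)
          then have "local.step z = local.step ((local.step ^^ m) c)" using yc y by simp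
          then have "z = (local.step ^^ m) c" using bij_step by (metis bij_is_inj injD)
          then show ?thesis by blast
        qed
      qed
    qed
  qed
qed

text \<open>Two strands cross in the quadrilateral that a strand enters through \<open>c\<close>; this is
  the entry of the second one.\<close>

fun opposite_entry :: "'e corner \<Rightarrow> 'e corner" where
  "opposite_entry (CornerB e) = side_wr G e"
| "opposite_entry (CornerW e) = side_br G (rW e)"

fun quad_entered :: "'e corner \<Rightarrow> 'e" where
  "quad_entered (CornerB e) = e"
| "quad_entered (CornerW e) = rW e"

lemma entries: "{opposite_entry c, c} = {side_wr G (quad_entered c), side_br G (quad_entered c)}"
  by (cases c) (auto simp: side_wr_def side_br_def)

text \<open>The form in which minimality is used: the strands that cross at the entry \<open>d\<close>
  cannot cross again at a later entry \<open>d'\<close> of both.\<close>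

lemma minimal_no_parallel_crossing:
  assumes "minimal_graph G" "d \<noteq> d'" "d \<noteq> opposite_entry d'"
    "d' = (step ^^ n) d" "opposite_entry d' = (step ^^ m) (opposite_entry d)"
  shows False
proof -
  have "quad_entered d \<noteq> quad_entered d'"
  proof
    assume "quad_entered d = quad_entered d'"
    then have "{opposite_entry d, d} = {opposite_entry d', d'}"
      unfolding entries by simp
    then have "d \<in> {opposite_entry d', d'}" by blast
    then show False using assms(2,3) by simp
  qed
  moreover have "(d, d') \<in> (track_step G)\<^sup>*" "(opposite_entry d, opposite_entry d') \<in> (track_step G)\<^sup>*"
    using assms(4,5) unfolding track_step_rtrancl by blast+
  ultimately have "\<exists>e e' c d c' d'. e \<noteq> e' \<and>
          {c, d} = {side_wr G e, side_br G e} \<and> {c', d'} = {side_wr G e', side_br G e'} \<and>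
          (c, c') \<in> (track_step G)\<^sup>* \<and> (d, d') \<in> (track_step G)\<^sup>*"
    using entries[of d] entries[of d'] by blast
  then show False using assms(1) unfolding minimal_graph_def by blast
qed

lemma minimal_opposite_track:
  assumes "minimal_graph G"
  shows "track_of G (opposite_entry c) \<noteq> track_of G c"
proof -
  have "track_of G (side_wr G e) \<noteq> track_of G (side_br G e)" for e
    using assms unfolding minimal_graph_def by blast
  then show ?thesis using entries[of c] by (metis doubleton_eq_iff)
qed

lemma opposite_entry_involution: "opposite_entry (opposite_entry c) = c"
  by (cases c) (auto simp: side_wr_def side_br_def)

subsection \<open>Closed train-tracks\<close>

text \<open>The end on the right of the train-track of the edge of the quad-graph that it crosses.\<close>

fun right_of :: "'e corner \<Rightarrow> quad_vertex" where
  "right_of (CornerB e) = Vertex (black G e)"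
| "right_of (CornerW e) = Face (lf e)"

fun crossing_sign :: "'e corner \<Rightarrow> real" where
  "crossing_sign (CornerB e) = -1"
| "crossing_sign (CornerW e) = 1"

text \<open>Between two successive edges crossed by a train-track, the vertex on its right moves across
  one other strand.\<close>

lemma right_of_step:
  assumes "abel_eqs a \<eta>" "track_invariant a"
  shows "\<eta> (right_of (step c)) = \<eta> (right_of c) + crossing_sign c * a (opposite_entry c)"
proof (cases c)
  case (CornerB e)
  have "\<eta> (Vertex (black G e)) = \<eta> (Face (lf e)) + a (CornerB (inv rB e))"
    using assms(1) unfolding abel_eqs_def by (metis black_inv_rotB rf_inv_rotB)
  moreover have "a (CornerB (inv rB e)) = a (side_wr G e)"
    using track_invariantD(2)[OF assms(2), of e] by (simp add: side_wr_def)
  ultimately show ?thesis using CornerB by simp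
next
  case (CornerW e)
  have "\<eta> (Vertex (black G (rW e))) = \<eta> (Face (rf (rW e))) + a (CornerB (rW e))"
    using assms(1) unfolding abel_eqs_def by blast
  then show ?thesis using CornerW by (simp add: side_br_def rf_rotW)
qed

text \<open>For the indicator function of a closed train-track, the Abel map counts how often the track is
  crossed. Its jumps across the edges of the graph form a finite cycle, which bounds by
  \<open>cycle_bounds\<close>; therefore it is constant outside a finite set of faces.\<close>

lemma closed_track_potential:
  assumes "n > 0" "(step ^^ n) c = c"
  obtains \<eta> :: "quad_vertex \<Rightarrow> real" and C where
    "abel_eqs (\<lambda>d. of_bool (d \<in> track_of G c)) \<eta>"
    "finite {e. \<eta> (Face (lf e)) \<noteq> C}"
proof -
  define T where "T = track_of G c"
  define a :: "'e corner \<Rightarrow> real" where "a d = of_bool (d \<in> T)" for d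
  have inv: "track_invariant a"
    by (rule track_invariantI) (simp add: a_def T_def mem_track_of)
  obtain \<eta> where \<eta>: "abel_eqs a \<eta>" using abel_exists[OF inv] by blast
  have finT: "finite T"
  proof -
    have power: "(step ^^ k) c \<in> (\<lambda>i. (step ^^ i) c) ` {..<n}" for k
    proof -
      have "(step ^^ k) c = (step ^^ (k mod n)) c" using assms(2) by (simp add: funpow_mod_eq)
      then show ?thesis using assms(1) by (intro image_eqI[of _ _ "k mod n"]) auto
    qed
    have "T \<subseteq> (\<lambda>i. (step ^^ i) c) ` {..<n}"
    proof
      fix d assume "d \<in> T"
      then obtain k where "d = (step ^^ k) c \<or> c = (step ^^ k) d"
        unfolding T_def track_of_iff same_track_iff by blast
      then show "d \<in> (\<lambda>i. (step ^^ i) c) ` {..<n}"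
      proof
        assume "d = (step ^^ k) c" then show ?thesis using power by simp
      next
        assume k: "c = (step ^^ k) d"
        have "(step ^^ (n * k)) c = c" using assms(2) by (induction k) (auto simp: funpow_add)
        also have "n * k = k + (n * k - k)" using assms(1) by (cases n) auto
        finally have "(step ^^ k) ((step ^^ (n * k - k)) c) = (step ^^ k) d"
          using k by (simp add: funpow_add)
        then have "(step ^^ (n * k - k)) c = d"
          using bij_step by (metis bij_fn bij_is_inj injD)
        then show ?thesis using power by metis
      qed
    qed
    then show ?thesis using finite_surj by blast
  qed
  (* The jump of the Abel map from the right to the left of an edge. *)
  define J :: "'e \<Rightarrow> int" where "J e = of_bool (CornerB e \<in> T) - of_bool (CornerB (inv rB e) \<in> T)" for e
  have jump: "\<eta> (Face (lf e)) - \<eta> (Face (rf e)) = of_int (J e)" for e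
  proof -
    have "\<eta> (Vertex (black G e)) = \<eta> (Face (lf e)) + a (CornerB (inv rB e))"
      using \<eta> unfolding abel_eqs_def by (metis black_inv_rotB rf_inv_rotB)
    moreover have "\<eta> (Vertex (black G e)) = \<eta> (Face (rf e)) + a (CornerB e)"
      using \<eta> unfolding abel_eqs_def by blast
    ultimately show ?thesis by (simp add: J_def a_def)
  qed
  have JW: "J e = of_bool (CornerW e \<in> T) - of_bool (CornerW (inv rW e) \<in> T)" for e
  proof -
    have "CornerB e \<in> T \<longleftrightarrow> CornerW e \<in> T" "CornerB (inv rB e) \<in> T \<longleftrightarrow> CornerW (inv rW e) \<in> T"
      using track_invariantD[OF inv, of e] by (auto simp: a_def)
    then show ?thesis by (simp add: J_def)
  qed
  have fB: "finite {e. CornerB e \<in> T}" and fW: "finite {e. CornerW e \<in> T}"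
    using finite_vimageI[OF finT, of CornerB] finite_vimageI[OF finT, of CornerW]
    by (auto simp: vimage_def inj_def)
  have fB': "finite {e. CornerB (inv rB e) \<in> T}" and fW': "finite {e. CornerW (inv rW e) \<in> T}"
    using finite_vimageI[OF fB, of "inv rB"] finite_vimageI[OF fW, of "inv rW"] bij_rotB bij_rotW
    by (auto simp: vimage_def bij_is_inj bij_imp_bij_inv)
  have J: "cycle J"
    unfolding cycle_def
  proof (intro conjI allI)
    show finJ: "finite {e. J e \<noteq> 0}"
      by (rule finite_subset[OF _ finite_UnI[OF fB fB']]) (auto simp: J_def)
    fix f :: "complex \<Rightarrow> complex"
    have sumB: "pairing J (\<lambda>e. f (black G e)) = 0"
    proof -
      have "pairing J (\<lambda>e. f (black G e)) =
        (\<Sum>e\<in>{e. CornerB e \<in> T} \<union> {e. CornerB (inv rB e) \<in> T}. of_bool (CornerB e \<in> T) * f (black G e))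
        - (\<Sum>e\<in>{e. CornerB e \<in> T} \<union> {e. CornerB (inv rB e) \<in> T}. of_bool (CornerB (inv rB e) \<in> T) * f (black G e))"
        unfolding sum_subtractf[symmetric]
        by (subst pairing_superset[OF finite_UnI[OF fB fB']]) (auto simp: J_def algebra_simps intro!: sum.cong)
      also have "(\<Sum>e\<in>{e. CornerB e \<in> T} \<union> {e. CornerB (inv rB e) \<in> T}. of_bool (CornerB e \<in> T) * f (black G e))
         = (\<Sum>e | CornerB e \<in> T. f (black G e))"
        using fB fB' by (intro sum.mono_neutral_cong_right) auto
      also have "(\<Sum>e\<in>{e. CornerB e \<in> T} \<union> {e. CornerB (inv rB e) \<in> T}. of_bool (CornerB (inv rB e) \<in> T) * f (black G e))
         = (\<Sum>e | CornerB (inv rB e) \<in> T. f (black G e))"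
        using fB fB' by (intro sum.mono_neutral_cong_right) auto
      also have "\<dots> = (\<Sum>e | CornerB e \<in> T. f (black G e))"
        by (rule sum.reindex_bij_witness[of _ rB "inv rB"]) auto
      finally show ?thesis by simp
    qed
    have sumW: "pairing J (\<lambda>e. f (white G e)) = 0"
    proof -
      have "pairing J (\<lambda>e. f (white G e)) =
        (\<Sum>e\<in>{e. CornerW e \<in> T} \<union> {e. CornerW (inv rW e) \<in> T}. of_bool (CornerW e \<in> T) * f (white G e))
        - (\<Sum>e\<in>{e. CornerW e \<in> T} \<union> {e. CornerW (inv rW e) \<in> T}. of_bool (CornerW (inv rW e) \<in> T) * f (white G e))"
        unfolding sum_subtractf[symmetric]
        by (subst pairing_superset[OF finite_UnI[OF fW fW']]) (auto simp: JW algebra_simps intro!: sum.cong)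
      also have "(\<Sum>e\<in>{e. CornerW e \<in> T} \<union> {e. CornerW (inv rW e) \<in> T}. of_bool (CornerW e \<in> T) * f (white G e))
         = (\<Sum>e | CornerW e \<in> T. f (white G e))"
        using fW fW' by (intro sum.mono_neutral_cong_right) auto
      also have "(\<Sum>e\<in>{e. CornerW e \<in> T} \<union> {e. CornerW (inv rW e) \<in> T}. of_bool (CornerW (inv rW e) \<in> T) * f (white G e))
         = (\<Sum>e | CornerW (inv rW e) \<in> T. f (white G e))"
        using fW fW' by (intro sum.mono_neutral_cong_right) auto
      also have "\<dots> = (\<Sum>e | CornerW e \<in> T. f (white G e))"
        by (rule sum.reindex_bij_witness[of _ rW "inv rW"]) auto
      finally show ?thesis by simp
    qed
    show "pairing J (\<lambda>e. f (black G e) - f (white G e)) = 0"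
      using sumB sumW by (simp add: pairing_support[OF finJ] right_diff_distrib sum_subtractf)
  qed
  obtain g :: "complex set \<Rightarrow> int" where g: "finite {F. g F \<noteq> 0}" "\<And>e. J e = g (lf e) - g (rf e)"
    using cycle_bounds[OF J] by metis
  define e0 :: 'e where "e0 = undefined"
  define C where "C = \<eta> (Face (lf e0)) - of_int (g (lf e0))"
  have "\<eta> (Face (lf e)) - of_int (g (lf e)) = C" for e
    unfolding C_def
  proof (rule face_function_constant[of "\<lambda>F. \<eta> (Face F) - of_int (g F)"])
    show "\<eta> (Face (lf e)) - of_int (g (lf e)) = \<eta> (Face (rf e)) - of_int (g (rf e))" for e
      using jump[of e] g(2)[of e] by simp
  qed
  then have "{e. \<eta> (Face (lf e)) \<noteq> C} \<subseteq> {e. g (lf e) \<noteq> 0}" by (auto simp: algebra_simps)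
  then have "finite {e. \<eta> (Face (lf e)) \<noteq> C}"
    using finite_support_lf[OF g(1)] finite_subset by blast
  then show ?thesis using that \<eta> unfolding a_def T_def by blast
qed

text \<open>A closed train-track runs from each of its corners to every other one in its own direction. If
  a strand met it again, both would run from the first crossing to the second one in their own
  directions, which minimality excludes.\<close>

lemma crossing_ahead:
  assumes c: "n > 0" "(step ^^ n) c = c"
    and min: "minimal_graph G" and d: "opposite_entry d \<in> track_of G c"
    and k: "k > 0" "(step ^^ k) d \<noteq> d"
  shows "opposite_entry ((step ^^ k) d) \<notin> track_of G c"
proof
  assume k': "opposite_entry ((step ^^ k) d) \<in> track_of G c"
  define x where "x = opposite_entry d"
  define y where "y = opposite_entry ((step ^^ k) d)"
  have xy: "(x, y) \<in> same_track"
    using d k' unfolding x_def y_def mem_track_of by (metis track_of_eq_iff)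
  have px: "\<exists>N>0. (step ^^ N) x = x"
  proof -
    have "(c, x) \<in> same_track" using d unfolding x_def track_of_iff .
    then obtain i where "x = (step ^^ i) c \<or> c = (step ^^ i) x" unfolding same_track_iff by blast
    then show ?thesis
    proof
      assume "x = (step ^^ i) c"
      then have "(step ^^ n) x = (step ^^ i) ((step ^^ n) c)"
        by (simp only: funpow_add[symmetric, THEN fun_cong, unfolded comp_apply] add.commute)
      then have "(step ^^ n) x = x" using c(2) \<open>x = (step ^^ i) c\<close> by simp
      then show ?thesis using c(1) by blast
    next
      assume i: "c = (step ^^ i) x"
      have "(step ^^ i) ((step ^^ n) x) = (step ^^ n) ((step ^^ i) x)"
        by (simp only: funpow_add[symmetric, THEN fun_cong, unfolded comp_apply] add.commute)
      then have "(step ^^ i) ((step ^^ n) x) = (step ^^ i) x"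
        using c(2) i by simp
      then have "(step ^^ n) x = x" using bij_step by (metis bij_fn bij_is_inj injD)
      then show ?thesis using c(1) by blast
    qed
  qed
  then obtain N where N: "N > 0" "(step ^^ N) x = x" by blast
  have "\<exists>m. y = (step ^^ m) x"
  proof -
    obtain i where "y = (step ^^ i) x \<or> x = (step ^^ i) y" using xy unfolding same_track_iff by blast
    then show ?thesis
    proof
      assume i: "x = (step ^^ i) y"
      have "(step ^^ (N * i)) x = x" using N(2) by (induction i) (auto simp: funpow_add)
      moreover have "N * i = i + (N * i - i)" using N(1) by (cases N) auto
      ultimately have "(step ^^ i) ((step ^^ (N * i - i)) x) = (step ^^ i) y"
        using i by (metis funpow_add comp_apply)
      then have "(step ^^ (N * i - i)) x = y"
        using bij_step by (metis bij_fn bij_is_inj injD)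
      then show ?thesis by metis
    qed blast
  qed
  then obtain m where m: "y = (step ^^ m) x" by blast
  have "d \<noteq> opposite_entry ((step ^^ k) d)"
  proof
    assume eq: "d = opposite_entry ((step ^^ k) d)"
    then have "track_of G d = track_of G c" using k' unfolding mem_track_of by simp
    moreover have "track_of G (opposite_entry d) = track_of G c" using d unfolding mem_track_of .
    ultimately show False using minimal_opposite_track[OF min, of d] by simp
  qed
  then show False
    using minimal_no_parallel_crossing[OF min _ _ refl, of d k m] k(2) m by (simp add: x_def y_def)
qed

text \<open>Consider a strand that crosses the closed track. By minimality it crosses it only once, so
  that the potential of \<open>closed_track_potential\<close> on its right takes one value
  before the crossing and another one after it. A closed strand comes back to the first value;
  a strand that is not closed leaves every finite set in both directions, where the potential
  takes the same value \<open>C\<close>. Both are impossible.\<close>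

theorem minimal_tracks_not_closed:
  assumes min: "minimal_graph G" and n: "n > 0"
  shows "(step ^^ n) c \<noteq> c"
proof
  assume c: "(step ^^ n) c = c"
  obtain \<eta> :: "quad_vertex \<Rightarrow> real" and C where
    \<eta>: "abel_eqs (\<lambda>d. of_bool (d \<in> track_of G c)) \<eta>" and finC: "finite {e. \<eta> (Face (lf e)) \<noteq> C}"
    using closed_track_potential[OF n c] by metis
  have inv: "track_invariant (\<lambda>d. of_bool (d \<in> track_of G c) :: real)"
    by (rule track_invariantI) (simp add: mem_track_of)
  note st = right_of_step[OF \<eta> inv]
  define d where "d = opposite_entry c"
  have d0: "opposite_entry d \<in> track_of G c" by (simp add: d_def opposite_entry_involution mem_track_of)
  have change: "\<eta> (right_of (step d)) \<noteq> \<eta> (right_of d)"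
    using st[of d] d0 by (cases d) auto
  (* The corners of the crossing strand, numbered by the integers; it crosses the closed
     track at 0. *)
  define D where "D i = (if i \<ge> 0 then (step ^^ nat i) d else (inv step ^^ nat (- i)) d)" for i :: int
  have stepinv: "step (inv step x) = x" "inv step (step x) = x" for x
    using bij_step by (simp_all add: bij_is_surj surj_f_inv_f bij_is_inj)
  have DS: "D (i + 1) = step (D i)" for i
  proof (cases "i \<ge> 0")
    case True
    then have "nat (i + 1) = Suc (nat i)" by simp
    then show ?thesis using True by (simp add: D_def)
  next
    case False
    then have *: "nat (- i) = Suc (nat (- i - 1))" by simp
    show ?thesis
    proof (cases "i = -1")
      case True then show ?thesis by (simp add: D_def stepinv)
    next
      case False
      then have "\<not> i + 1 \<ge> 0" using \<open>\<not> i \<ge> 0\<close> by simp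
      moreover have "nat (- (i + 1)) = nat (- i - 1)" by simp
      ultimately show ?thesis using \<open>\<not> i \<ge> 0\<close> unfolding D_def * by (simp add: stepinv)
    qed
  qed
  have Dplus: "D (i + int k) = (step ^^ k) (D i)" for i k
  proof (induction k)
    case (Suc k)
    then show ?case using DS[of "i + int k"] by (simp add: algebra_simps)
  qed simp
  have D0: "D 0 = d" by (simp add: D_def)
  define \<psi> where "\<psi> i = \<eta> (right_of (D i))" for i
  have \<psi>1: "\<psi> 1 \<noteq> \<psi> 0" using change DS[of 0] by (simp add: \<psi>_def D0)
  have \<psi>S: "\<psi> (i + 1) = \<psi> i" if "opposite_entry (D i) \<notin> track_of G c" for i
    unfolding \<psi>_def DS using st[of "D i"] that by simp
  show False
  proof (cases "\<exists>k>0. (step ^^ k) d = d")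
    case True
    define p where "p = (LEAST k. k > 0 \<and> (step ^^ k) d = d)"
    have p: "p > 0" "(step ^^ p) d = d"
      using LeastI_ex[OF True] unfolding p_def by auto
    have least: "(step ^^ k) d \<noteq> d" if "0 < k" "k < p" for k
      using not_less_Least[of k "\<lambda>k. k > 0 \<and> (step ^^ k) d = d"] that unfolding p_def by blast
    have "\<psi> (int (Suc k)) = \<psi> 1" if "k < p" for k
      using that
    proof (induction k)
      case (Suc k)
      have "opposite_entry (D (int (Suc k))) \<notin> track_of G c"
        using crossing_ahead[OF n c min d0, of "Suc k"] least[of "Suc k"] Suc.prems Dplus[of 0 "Suc k"]
        by (simp add: D0)
      then show ?case using \<psi>S[of "int (Suc k)"] Suc by (simp add: algebra_simps)
    qed simp
    then have "\<psi> (int p) = \<psi> 1" using p(1) by (metis Suc_pred' diff_less zero_less_one)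
    moreover have "\<psi> (int p) = \<psi> 0" using p(2) Dplus[of 0 p] by (simp add: \<psi>_def D0)
    ultimately show False using \<psi>1 by simp
  next
    case False
    have inj: "D i \<noteq> D j" if "i < j" for i j
    proof
      assume eq: "D i = D j"
      define k where "k = nat (j - i)"
      have k: "k > 0" "j = i + int k" using that by (auto simp: k_def)
      have per: "(step ^^ k) (D i) = D i" using eq k Dplus by metis
      have "(step ^^ k) (D (i + int l)) = D (i + int l)" for l
        using per by (metis Dplus add.commute funpow_add comp_apply)
      moreover have "(step ^^ k) (D (i - int l)) = D (i - int l)" for l
      proof -
        have "(step ^^ l) ((step ^^ k) (D (i - int l))) = (step ^^ l) (D (i - int l))"
          using per Dplus[of "i - int l" l] by (metis add.commute funpow_add comp_apply diff_add_cancel)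
        then show ?thesis using bij_step by (metis bij_fn bij_is_inj injD)
      qed
      ultimately have "(step ^^ k) (D 0) = D 0"
      proof (cases "i \<ge> 0")
        case True
        then show ?thesis using \<open>\<And>l. (step ^^ k) (D (i - int l)) = D (i - int l)\<close>[of "nat i"] by simp
      next
        case False
        then show ?thesis using \<open>\<And>l. (step ^^ k) (D (i + int l)) = D (i + int l)\<close>[of "nat (- i)"] by simp
      qed
      then show False using False k D0 by metis
    qed
    have Dinj: "inj D" by (rule linorder_injI) (use inj in auto)
    have far: "finite {i. \<psi> i \<noteq> C \<and> (\<exists>e. D i = CornerW e)}"
    proof -
      have "{i. \<psi> i \<noteq> C \<and> (\<exists>e. D i = CornerW e)} \<subseteq> D -` (CornerW ` {e. \<eta> (Face (lf e)) \<noteq> C})"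
        by (auto simp: \<psi>_def)
      moreover have "finite (D -` (CornerW ` {e. \<eta> (Face (lf e)) \<noteq> C}))"
        using finC Dinj by (intro finite_vimageI) auto
      ultimately show ?thesis by (rule finite_subset)
    qed
    then obtain M :: int where M: "\<And>i. \<bar>i\<bar> > M \<Longrightarrow> (\<exists>e. D i = CornerW e) \<Longrightarrow> \<psi> i = C"
    proof -
      obtain M where "\<forall>i\<in>{i. \<psi> i \<noteq> C \<and> (\<exists>e. D i = CornerW e)}. \<bar>i\<bar> \<le> M"
        using far finite_imageI[OF far, of abs] by (metis (no_types, lifting) Max_ge imageI)
      then show ?thesis using that by (metis (mono_tags, lifting) mem_Collect_eq not_le)
    qed
    have alt: "(\<exists>e. D i = CornerW e) \<or> (\<exists>e. D (i + 1) = CornerW e)" for i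
      unfolding DS by (cases "D i") auto
    have pos: "\<psi> (1 + int k) = \<psi> 1" for k
    proof (induction k)
      case (Suc k)
      have "(step ^^ Suc k) d \<noteq> d" using False by blast
      then have "opposite_entry (D (1 + int k)) \<notin> track_of G c"
        using crossing_ahead[OF n c min d0, of "Suc k"] Dplus[of 0 "Suc k"] by (simp add: D0 algebra_simps)
      then show ?case using \<psi>S[of "1 + int k"] Suc by (simp add: algebra_simps)
    qed simp
    have neg: "\<psi> (- int k) = \<psi> 0" for k
    proof (induction k)
      case (Suc k)
      have eq: "(step ^^ Suc k) (D (- int (Suc k))) = d"
        using Dplus[of "- int (Suc k)" "Suc k"] by (simp add: D0)
      have "opposite_entry (D (- int (Suc k))) \<notin> track_of G c"
      proof
        assume *: "opposite_entry (D (- int (Suc k))) \<in> track_of G c"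
        have "(step ^^ Suc k) (D (- int (Suc k))) \<noteq> D (- int (Suc k))"
          using inj[of "- int (Suc k)" 0] eq D0 by auto
        then show False
          using crossing_ahead[OF n c min *, of "Suc k"] eq d0 by simp
      qed
      then show ?case using \<psi>S[of "- int (Suc k)"] Suc by simp
    qed simp
    have "\<psi> 1 = C"
    proof -
      define k where "k = nat (\<bar>M\<bar> + 1)"
      have "(\<exists>e. D (1 + int k) = CornerW e) \<or> (\<exists>e. D (1 + int (Suc k)) = CornerW e)"
        using alt[of "1 + int k"] by (simp add: algebra_simps)
      then show ?thesis
        using M[of "1 + int k"] M[of "1 + int (Suc k)"] pos[of k] pos[of "Suc k"] unfolding k_def by auto
    qed
    moreover have "\<psi> 0 = C"
    proof -
      define k where "k = nat (\<bar>M\<bar> + 1)"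
      have "(\<exists>e. D (- int (Suc k)) = CornerW e) \<or> (\<exists>e. D (- int k) = CornerW e)"
        using alt[of "- int (Suc k)"] by simp
      then show ?thesis
        using M[of "- int k"] M[of "- int (Suc k)"] neg[of k] neg[of "Suc k"] unfolding k_def by auto
    qed
    ultimately show False using \<psi>1 by simp
  qed
qed

section \<open>Digons\<close>

text \<open>\<open>S\<close> is the set of the faces enclosed by the two edges: its boundary is the cycle
  that goes along \<open>e\<close> and back along \<open>e'\<close>.\<close>

definition digon :: "'e \<Rightarrow> 'e \<Rightarrow> complex set set \<Rightarrow> bool" where
  "digon e e' S \<longleftrightarrow> e \<noteq> e' \<and> white G e = white G e' \<and> black G e = black G e' \<and>
     finite S \<and> S \<subseteq> faces G \<and>
     (\<forall>x. (of_bool (x = e) - of_bool (x = e') :: int) = of_bool (lf x \<in> S) - of_bool (rf x \<in> S))"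

lemma digonD:
  assumes "digon e e' S"
  shows "lf e \<in> S" "rf e \<notin> S" "lf e' \<notin> S" "rf e' \<in> S"
    "x \<noteq> e \<Longrightarrow> x \<noteq> e' \<Longrightarrow> lf x \<in> S \<longleftrightarrow> rf x \<in> S"
proof -
  have ne: "e \<noteq> e'" and
    d: "(of_bool (x = e) - of_bool (x = e') :: int) = of_bool (lf x \<in> S) - of_bool (rf x \<in> S)" for x
    using assms by (auto simp: digon_def)
  show "lf e \<in> S" "rf e \<notin> S" using d[of e] ne by (auto simp: of_bool_def split: if_splits)
  show "lf e' \<notin> S" "rf e' \<in> S" using d[of e'] ne by (auto simp: of_bool_def split: if_splits)
  show "x \<noteq> e \<Longrightarrow> x \<noteq> e' \<Longrightarrow> lf x \<in> S \<longleftrightarrow> rf x \<in> S"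
    using d[of x] by (auto simp: of_bool_def split: if_splits)
qed

text \<open>The two edges form a Jordan curve, whose winding number is constant inside, equal to 1 or -1,
  and vanishes outside.\<close>

lemma parallel_edges_digon:
  assumes "e \<noteq> e'" "white G e = white G e'" "black G e = black G e'"
  shows "\<exists>S. digon e e' S \<or> digon e' e S"
proof -
  define c :: "'e \<Rightarrow> int" where "c = (\<lambda>x. of_bool (x = e) + (-1) * of_bool (x = e'))"
  have f: "finite {x. (of_bool (x = e) :: int) \<noteq> 0}" "finite {x. (of_bool (x = e') :: int) \<noteq> 0}" by auto
  have pc: "pairing c h = h e - h e'" for h
    unfolding c_def pairing_combine[OF f] by simp
  have cyc: "cycle c"
    unfolding cycle_def pc using finite_support_combine[OF f, of "-1"] assms by (auto simp: c_def)
  define \<gamma> where "\<gamma> = curve G e +++ reversepath (curve G e')"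
  have sp: "simple_path \<gamma>"
    unfolding \<gamma>_def
  proof (rule simple_path_join_loop)
    show "path_image (curve G e) \<inter> path_image (reversepath (curve G e')) \<subseteq>
      {pathstart (curve G e), pathstart (reversepath (curve G e'))}"
      using edge_inter[OF assms(1)] edge_vertices[of e] assms by (auto simp: pathstart_curve pathfinish_curve)
  qed (use assms in \<open>auto simp: arc_curve arc_reversepath pathstart_curve pathfinish_curve\<close>)
  have loop: "pathfinish \<gamma> = pathstart \<gamma>"
    using assms by (simp add: \<gamma>_def pathstart_curve)
  have w\<gamma>: "wind c p = winding_number \<gamma> p" if "p \<notin> edge e" "p \<notin> edge e'" for p
    unfolding wind_def pc \<gamma>_def using that assms
    by (subst winding_number_join)
       (auto simp: path_curve pathstart_curve pathfinish_curve winding_number_reversepath)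
  obtain \<sigma> :: int where \<sigma>: "\<sigma> = 1 \<or> \<sigma> = -1"
    "\<And>z. z \<in> inside (path_image \<gamma>) \<Longrightarrow> winding_number \<gamma> z = of_int \<sigma>"
    using simple_closed_path_winding_number_inside[OF sp] by (metis of_int_1 of_int_minus)
  have val: "winding_number \<gamma> z = 0 \<or> winding_number \<gamma> z = of_int \<sigma>" if "z \<notin> path_image \<gamma>" for z
  proof (cases "z \<in> inside (path_image \<gamma>)")
    case False
    then have "z \<in> outside (path_image \<gamma>)" using that inside_Un_outside by blast
    then show ?thesis
      using winding_number_zero_in_outside[OF simple_path_imp_path[OF sp] loop] by simp
  qed (use \<sigma>(2) in auto)
  obtain g k where g: "finite {F. g F \<noteq> 0}" "\<And>x. c x = g (lf x) - g (rf x)"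
    "\<And>F p. F \<in> faces G \<Longrightarrow> p \<in> F \<Longrightarrow> wind c p = of_int (g F) + k"
    "\<exists>R. \<forall>p. norm p > R \<longrightarrow> wind c p = k" "{F. g F \<noteq> 0} \<subseteq> faces G"
    by (rule cycle_bounds[OF cyc]) (rule that)
  have pim: "path_image \<gamma> = edge e \<union> edge e'"
    unfolding \<gamma>_def using assms by (simp add: path_image_join pathfinish_curve)
  have k0: "k = 0"
  proof -
    obtain R where R: "\<And>p. norm p > R \<Longrightarrow> wind c p = k" using g(4) by blast
    obtain B where B: "\<And>z. B \<le> norm z \<Longrightarrow> winding_number \<gamma> z = 0"
      using winding_number_zero_at_infinity[OF simple_path_imp_path[OF sp] loop] by blast
    obtain D where D: "\<And>z. z \<in> path_image \<gamma> \<Longrightarrow> norm z \<le> D"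
      using bounded_path_image[OF simple_path_imp_path[OF sp]] unfolding bounded_iff by blast
    define p :: complex where "p = of_real (\<bar>R\<bar> + \<bar>B\<bar> + \<bar>D\<bar> + 1)"
    have np: "norm p = \<bar>R\<bar> + \<bar>B\<bar> + \<bar>D\<bar> + 1" unfolding p_def by (simp only: norm_of_real)
    have "p \<notin> path_image \<gamma>" using D[of p] np by auto
    then show ?thesis using R[of p] B[of p] w\<gamma>[of p] np pim by auto
  qed
  have gval: "g F = 0 \<or> g F = \<sigma>" for F
  proof (cases "g F = 0")
    case False
    then have F: "F \<in> faces G" using g(5) by blast
    obtain p where p: "p \<in> F" using face_nonempty[OF F] by blast
    then have "p \<notin> support G" using face_subset[OF F] by blast
    then have pe: "p \<notin> edge e" "p \<notin> edge e'" using edge_support by blast+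
    then have "(of_int (g F) :: complex) = 0 \<or> (of_int (g F) :: complex) = of_int \<sigma>"
      using val[of p] pim w\<gamma>[of p] g(3)[OF F p] k0 by auto
    then show ?thesis by (simp only: of_int_eq_iff of_int_eq_0_iff)
  qed simp
  define S where "S = {F. g F \<noteq> 0}"
  have gS: "g F = \<sigma> * of_bool (F \<in> S)" for F using gval[of F] by (auto simp: S_def)
  have jump: "of_bool (x = e) - of_bool (x = e') = \<sigma> * (of_bool (lf x \<in> S) - of_bool (rf x \<in> S))" for x
    using g(2)[of x] unfolding gS c_def by (simp add: algebra_simps)
  from \<sigma>(1) show ?thesis
  proof
    assume "\<sigma> = 1"
    then have "digon e e' S" using jump assms g(1,5) by (auto simp: digon_def S_def)
    then show ?thesis by blast
  next
    assume \<sigma>: "\<sigma> = -1"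
    have "of_bool (x = e') - of_bool (x = e) = (of_bool (lf x \<in> S) - of_bool (rf x \<in> S) :: int)" for x
      using jump[of x] unfolding \<sigma> by (simp add: algebra_simps)
    then have "digon e' e S" using assms g(1,5) by (auto simp: digon_def S_def)
    then show ?thesis by blast
  qed
qed

lemma face_set_unique:
  fixes \<alpha> \<beta> :: int
  assumes "finite A" "finite B" "finite C"
    "\<And>x. of_bool (lf x \<in> A) - of_bool (rf x \<in> A) =
      \<alpha> * (of_bool (lf x \<in> B) - of_bool (rf x \<in> B)) + \<beta> * (of_bool (lf x \<in> C) - of_bool (rf x \<in> C))"
    "F \<in> faces G"
  shows "of_bool (F \<in> A) = \<alpha> * of_bool (F \<in> B) + \<beta> * of_bool (F \<in> C)"
proof (rule face_function_unique[of "\<lambda>F. of_bool (F \<in> A)" "\<lambda>F. \<alpha> * of_bool (F \<in> B) + \<beta> * of_bool (F \<in> C)"])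
  show "finite {F. (of_bool (F \<in> A) :: int) \<noteq> 0}" using assms(1) by simp
  show "finite {F. \<alpha> * of_bool (F \<in> B) + \<beta> * of_bool (F \<in> C) \<noteq> 0}"
    by (rule finite_subset[OF _ finite_UnI[OF assms(2,3)]]) auto
qed (use assms(4,5) in \<open>auto simp: algebra_simps\<close>)

text \<open>A digon without inner edge is a face with two edges, and each of the two strands that cross in
  the quadrilateral of \<open>e\<close> passes in one step to that of \<open>e'\<close>.\<close>

lemma minimal_no_digon_face:
  assumes min: "minimal_graph G" and dg: "digon e e' S"
    and no: "\<And>x. \<not> (lf x \<in> S \<and> rf x \<in> S)"
  shows False
proof -
  note D = digonD[OF dg]
  have l: "x = e" if "lf x \<in> S" for x using that no[of x] D(3) D(5)[of x] by metis
  have r: "x = e'" if "rf x \<in> S" for x using that no[of x] D(2) D(5)[of x] by metis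
  have "nx e = e" using l[of "nx e"] D(1) by simp
  moreover have inv: "inv rB e = e'" using r[of "inv rB e"] D(1) by simp
  ultimately have w: "rW e = e'" unfolding nx_eq by (metis rotW_inv(1))
  define d where "d = side_br G e"
  define d' where "d' = side_wr G e'"
  have d': "d' = step d" unfolding d_def d'_def side_br_def side_wr_def using w by auto
  have "opposite_entry d' = step (opposite_entry d)"
    unfolding d_def d'_def side_br_def side_wr_def using w inv by (auto simp: side_wr_def side_br_def)
  moreover have "d \<noteq> opposite_entry d'"
    using w dg unfolding d_def d'_def side_br_def side_wr_def by (auto simp: side_br_def digon_def)
  moreover have "d \<noteq> d'" unfolding d_def d'_def side_br_def side_wr_def by simp
  ultimately show False
    using minimal_no_parallel_crossing[OF min, of d d' 1 1] d' by simp
qed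

text \<open>Otherwise consider a digon with the least number of faces. It has an inner edge
  \<open>e1\<close>, and \<open>e1\<close> has a parallel edge. If \<open>e1\<close> has the
  same ends as the digon, it cuts the digon into two smaller ones. If not, one end of
  \<open>e1\<close> is an inner vertex of the digon, so that the parallel edge is inside as
  well; the digon formed by these two edges is contained in the first one, hence equal to it,
  but its sides are inner edges.\<close>

theorem exists_single_edge:
  assumes min: "minimal_graph G"
  shows "\<exists>e. \<forall>e'. white G e' = white G e \<and> black G e' = black G e \<longrightarrow> e' = e"
proof (rule ccontr)
  assume "\<not> ?thesis"
  then have par: "\<exists>e'. white G e' = white G e \<and> black G e' = black G e \<and> e' \<noteq> e" for e by blast
  define P where "P n \<longleftrightarrow> (\<exists>e e' S. digon e e' S \<and> card S = n)" for n
  have "\<exists>n. P n"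
  proof -
    obtain e' where "white G e' = white G undefined" "black G e' = black G undefined" "e' \<noteq> undefined"
      using par by blast
    then show ?thesis using parallel_edges_digon[of e' undefined] unfolding P_def by blast
  qed
  then have LE: "P (LEAST n. P n)" by (rule LeastI_ex)
  then obtain e e' S where dg: "digon e e' S" and cS: "card S = (LEAST n. P n)" unfolding P_def by blast
  have least: "card S \<le> card S'" if "digon x x' S'" for x x' S'
    unfolding cS using that by (intro Least_le) (auto simp: P_def)
  note D = digonD[OF dg]
  have finS: "finite S" and SF: "S \<subseteq> faces G" and ne: "e \<noteq> e'"
    and wb: "white G e = white G e'" "black G e = black G e'"
    and jS: "\<And>x. (of_bool (x = e) - of_bool (x = e') :: int) = of_bool (lf x \<in> S) - of_bool (rf x \<in> S)"
    using dg by (auto simp: digon_def)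
  obtain e1 where e1: "lf e1 \<in> S" "rf e1 \<in> S"
    using minimal_no_digon_face[OF min dg] by blast
  then have e1n: "e1 \<noteq> e" "e1 \<noteq> e'" using D by auto
  show False
  proof (cases "white G e1 = white G e \<and> black G e1 = black G e")
    case True
    obtain A \<alpha> where A: "finite A" "A \<subseteq> faces G" "\<alpha> = (1::int) \<or> \<alpha> = -1" "card S \<le> card A"
      "\<And>x. of_bool (x = e) - of_bool (x = e1) = \<alpha> * (of_bool (lf x \<in> A) - of_bool (rf x \<in> A))"
    proof -
      obtain A where "digon e e1 A \<or> digon e1 e A"
        using parallel_edges_digon[of e e1] True e1n by auto
      then show ?thesis
      proof
        assume d: "digon e e1 A"
        then show ?thesis using that[of A 1] least[OF d] by (auto simp: digon_def)
      next
        assume d: "digon e1 e A"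
        then have "of_bool (x = e) - of_bool (x = e1) = (-1::int) * (of_bool (lf x \<in> A) - of_bool (rf x \<in> A))" for x
          unfolding digon_def by (smt (verit))
        then show ?thesis using that[of A "-1"] least[OF d] d by (auto simp: digon_def)
      qed
    qed
    obtain B \<beta> where B: "finite B" "B \<subseteq> faces G" "\<beta> = (1::int) \<or> \<beta> = -1" "B \<noteq> {}"
      "\<And>x. of_bool (x = e1) - of_bool (x = e') = \<beta> * (of_bool (lf x \<in> B) - of_bool (rf x \<in> B))"
    proof -
      obtain B where "digon e1 e' B \<or> digon e' e1 B"
        using parallel_edges_digon[of e1 e'] True e1n wb by auto
      then show ?thesis
      proof
        assume d: "digon e1 e' B"
        then show ?thesis using that[of B 1] digonD(1)[OF d] by (auto simp: digon_def)
      next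
        assume d: "digon e' e1 B"
        then have "of_bool (x = e1) - of_bool (x = e') = (-1::int) * (of_bool (lf x \<in> B) - of_bool (rf x \<in> B))" for x
          unfolding digon_def by (smt (verit))
        then show ?thesis using that[of B "-1"] digonD(1)[OF d] d by (auto simp: digon_def)
      qed
    qed
    have sum: "(of_bool (F \<in> S) :: int) = \<alpha> * of_bool (F \<in> A) + \<beta> * of_bool (F \<in> B)" if "F \<in> faces G" for F
    proof (rule face_set_unique[OF finS A(1) B(1) _ that])
      show "(of_bool (lf x \<in> S) - of_bool (rf x \<in> S) :: int) =
          \<alpha> * (of_bool (lf x \<in> A) - of_bool (rf x \<in> A)) + \<beta> * (of_bool (lf x \<in> B) - of_bool (rf x \<in> B))" for x
        using jS[of x] A(5)[of x] B(5)[of x] by linarith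
    qed
    have jA: "(-1::int) = \<alpha> * (of_bool (lf e1 \<in> A) - of_bool (rf e1 \<in> A))" using A(5)[of e1] e1n by simp
    have jB: "(1::int) = \<beta> * (of_bool (lf e1 \<in> B) - of_bool (rf e1 \<in> B))" using B(5)[of e1] e1n by simp
    have s1: "(1::int) = \<alpha> * of_bool (lf e1 \<in> A) + \<beta> * of_bool (lf e1 \<in> B)"
      "(1::int) = \<alpha> * of_bool (rf e1 \<in> A) + \<beta> * of_bool (rf e1 \<in> B)"
      using sum[OF lf_face, of e1] sum[OF rf_face, of e1] e1 by simp_all
    have "\<alpha> = 1 \<and> \<beta> = 1"
      using A(3) B(3) s1 jA jB by (auto simp: of_bool_def split: if_splits)
    then have sum1: "(of_bool (F \<in> S) :: int) = of_bool (F \<in> A) + of_bool (F \<in> B)" if "F \<in> faces G" for F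
      using sum[OF that] by simp
    have "(F \<in> S \<longleftrightarrow> F \<in> A \<or> F \<in> B) \<and> \<not> (F \<in> A \<and> F \<in> B)" if "F \<in> faces G" for F
      using sum1[OF that] by (auto simp: of_bool_def split: if_splits)
    then have "S = A \<union> B" "A \<inter> B = {}" using SF A(2) B(2) by blast+
    then have "card S = card A + card B" using A(1) B(1) by (simp add: card_Un_disjoint)
    then show False using A(4) B(1,4) by (simp add: card_gt_0_iff)
  next
    case False
    obtain e1' where e1': "white G e1' = white G e1" "black G e1' = black G e1" "e1' \<noteq> e1"
      using par by blast
    then have e1'n: "e1' \<noteq> e" "e1' \<noteq> e'" using False wb by auto
    (* Around a vertex that is not an end of the digon, no edge leaves the digon. *)
    have inner: "lf e1' \<in> S"
    proof (cases "black G e1 = black G e")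
      case False
      have "lf ((rB ^^ n) e1) \<in> S" for n
      proof (induction n)
        case (Suc n)
        have "black G ((rB ^^ n) e1) = black G e1" by (induction n) auto
        then have "(rB ^^ n) e1 \<noteq> e" "(rB ^^ n) e1 \<noteq> e'" using False wb by auto
        then show ?case using Suc D(5) by (simp add: rf_eq)
      qed (use e1 in auto)
      then show ?thesis using e1'(2) black_eq_iff by metis
    next
      case True
      then have Fw: "white G e1 \<noteq> white G e" using False by simp
      have "rf ((rW ^^ n) e1) \<in> S" for n
      proof (induction n)
        case (Suc n)
        have "white G ((rW ^^ n) e1) = white G e1" by (induction n) auto
        then have "(rW ^^ n) e1 \<noteq> e" "(rW ^^ n) e1 \<noteq> e'" using Fw wb by auto
        then show ?case using Suc D(5) by (simp add: rf_rotW)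
      qed (use e1 in auto)
      then have "rf e1' \<in> S" using e1'(1) white_eq_iff by metis
      then show ?thesis using D(5) e1'n by simp
    qed
    then have inner': "rf e1' \<in> S" using D(5) e1'n by simp
    obtain a b S1 where S1: "digon a b S1" "{a, b} = {e1, e1'}"
      using parallel_edges_digon[of e1 e1'] e1' by (metis insert_commute)
    then have ab: "lf a \<in> S" "rf a \<in> S" "lf b \<in> S" "rf b \<in> S" "a \<noteq> e" "a \<noteq> e'" "b \<noteq> e" "b \<noteq> e'"
      using e1 inner inner' e1n e1'n by (auto simp: doubleton_eq_iff)
    have finS1: "finite S1" and S1F: "S1 \<subseteq> faces G" using S1(1) by (auto simp: digon_def)
    (* The jumps of U are carried by e and e', so they are a multiple of those of S. *)
    define U where "U = S1 - S"
    have finU: "finite U" using finS1 by (simp add: U_def)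
    define J where "J x = (of_bool (lf x \<in> U) - of_bool (rf x \<in> U) :: int)" for x
    have J0: "J x = 0" if "x \<noteq> e" "x \<noteq> e'" for x
    proof (cases "lf x \<in> S")
      case True
      then show ?thesis using D(5)[OF that] by (simp add: J_def U_def)
    next
      case False
      then have "rf x \<notin> S" "x \<noteq> a" "x \<noteq> b" using D(5)[OF that] ab by auto
      then show ?thesis using False digonD(5)[OF S1(1), of x] by (simp add: J_def U_def)
    qed
    have "cycle J" unfolding J_def using finU by (intro jump_cycle[of "\<lambda>F. of_bool (F \<in> U)"]) simp
    then have "pairing J (\<lambda>x. of_bool (black G x = black G e) - of_bool (white G x = black G e)) = 0"
      unfolding cycle_def by (elim conjE allE[of _ "\<lambda>v. of_bool (v = black G e)"])
    moreover have "pairing J h = of_int (J e) * h e + of_int (J e') * h e'" for h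
      using ne J0 by (subst pairing_superset[of "{e, e'}"]) auto
    moreover have "white G x \<noteq> black G y" for x y using black_white_disjoint[of y x] by metis
    ultimately have "complex_of_int (J e + J e') = 0"
      using wb(2) by simp
    then have "J e + J e' = 0" by (simp only: of_int_eq_0_iff)
    then have JJ: "J e' = - J e" by simp
    have Jeq: "J x = J e * (of_bool (lf x \<in> S) - of_bool (rf x \<in> S)) + 0 * (of_bool (lf x \<in> S) - of_bool (rf x \<in> S))" for x
    proof -
      consider "x = e" | "x = e'" | "x \<noteq> e" "x \<noteq> e'" by blast
      then show ?thesis
      proof cases
        case 1
        then show ?thesis unfolding jS[of x, symmetric] using ne by simp
      next
        case 2
        then show ?thesis unfolding jS[of x, symmetric] using ne JJ by simp
      next
        case 3
        then show ?thesis unfolding jS[of x, symmetric] using J0[of x] by simp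
      qed
    qed
    have "U = {}"
    proof (rule ccontr)
      assume "U \<noteq> {}"
      then obtain F where F: "F \<in> U" by blast
      then have "F \<in> faces G" "F \<notin> S" using S1F by (auto simp: U_def)
      then show False
        using face_set_unique[OF finU finS finS Jeq[unfolded J_def[of x for x]], of F] F by simp
    qed
    then have "S1 \<subseteq> S" by (auto simp: U_def)
    then have "S1 = S" using least[OF S1(1)] finS by (simp add: card_seteq)
    then have "lf a \<in> S \<and> rf a \<notin> S" using digonD(1,2)[OF S1(1)] by simp
    then show False using ab by simp
  qed
qed

end

section \<open>Periodic graphs\<close>

locale periodic_plane =
  fixes G :: "'e periodic_graph"
  assumes periodic: "periodic_bipartite_plane_graph G"

sublocale periodic_plane \<subseteq> bipartite_plane G
  using periodic unfolding bipartite_plane_def periodic_bipartite_plane_graph_def by (rule conjunct1)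

context periodic_plane
begin

abbreviation "lat \<equiv> lattice_vec G"
abbreviation "sh \<equiv> shift G"
abbreviation "px \<equiv> fst (periods G)"
abbreviation "py \<equiv> snd (periods G)"

lemma lat_add: "lat (z + z') = lat z + lat z'"
  and lat_0 [simp]: "lat 0 = 0"
  by (auto simp: lattice_vec_def algebra_simps)

lemma lat_uminus: "lat (- z) = - lat z"
  by (auto simp: lattice_vec_def algebra_simps)

lemma orientation: "Im (cnj px * py) > 0"
  using periodic unfolding periodic_bipartite_plane_graph_def by blast

lemma periods_independent:
  assumes "of_real a * px + of_real b * py = 0"
  shows "a = 0 \<and> b = 0"
proof -
  have "Im (cnj px * (of_real a * px + of_real b * py)) = b * Im (cnj px * py)"
    by (simp add: algebra_simps)
  then have b: "b = 0" using assms orientation by simp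
  have "px \<noteq> 0" using orientation by auto
  then show ?thesis using assms b by simp
qed

lemma lat_real: "lat z = of_real (of_int (fst z)) * px + of_real (of_int (snd z)) * py"
  by (simp add: lattice_vec_def)

lemma lat_eq_0_iff: "lat z = 0 \<longleftrightarrow> z = 0"
proof
  assume "lat z = 0"
  then show "z = 0" using periods_independent unfolding lat_real by (metis of_int_eq_0_iff prod_eqI zero_prod_def fst_conv snd_conv)
qed simp

lemma lat_inj: "lat z = lat z' \<Longrightarrow> z = z'"
  using lat_eq_0_iff[of "z - z'"] lat_add[of "z - z'" z'] by simp

lemma edge_shift: "edge (sh z e) = (\<lambda>x. x + lat z) ` edge e"
  and white_shift: "white G (sh z e) = white G e + lat z"
  and black_shift: "black G (sh z e) = black G e + lat z"
  and rotB_shift: "rB (sh z e) = sh z (rB e)"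
  and rotW_shift: "rW (sh z e) = sh z (rW e)"
  using periodic unfolding periodic_bipartite_plane_graph_def by metis+

lemma shift_add: "sh (z + z') e = sh z (sh z' e)"
  by (rule edge_inj) (simp add: edge_shift lat_add image_image algebra_simps)

lemma shift_0 [simp]: "sh 0 e = e"
  by (rule edge_inj) (simp add: edge_shift)

lemma shift_inverse [simp]: "sh z (sh (- z) e) = e" "sh (- z) (sh z e) = e"
  by (simp_all flip: shift_add)

lemma bij_shift: "bij (sh z)"
  by (rule o_bij[of "sh (- z)"]) auto

lemma shift_free: "sh z e = sh z' e \<longleftrightarrow> z = z'"
  by (metis add_left_cancel lat_inj white_shift)

lemma inv_rotB_shift: "inv rB (sh z e) = sh z (inv rB e)"
  and inv_rotW_shift: "inv rW (sh z e) = sh z (inv rW e)"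
  by (metis rotB_inv rotB_shift, metis rotW_inv rotW_shift)

lemma nx_shift: "nx (sh z e) = sh z (nx e)"
  by (simp add: nx_eq inv_rotB_shift inv_rotW_shift)

subsection \<open>Representatives of the edges modulo translations\<close>

definition orbit_rep :: "'e \<Rightarrow> 'e" where
  "orbit_rep e = (SOME e'. \<exists>z. e' = sh z e)"

abbreviation "reps \<equiv> range orbit_rep"

lemma orbit_rep_shift_ex: "\<exists>z. e = sh z (orbit_rep e)"
proof -
  have "\<exists>z. orbit_rep e = sh z e"
    unfolding orbit_rep_def by (rule someI[of "\<lambda>e'. \<exists>z. e' = sh z e" e]) (metis shift_0)
  then show ?thesis by (metis shift_inverse(2))
qed

lemma orbit_rep_shift [simp]: "orbit_rep (sh z e) = orbit_rep e"
proof -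
  have "(\<exists>z'. e' = sh z' (sh z e)) \<longleftrightarrow> (\<exists>z'. e' = sh z' e)" for e'
  proof
    assume "\<exists>z'. e' = sh z' (sh z e)"
    then show "\<exists>z'. e' = sh z' e" unfolding shift_add[symmetric] by blast
  next
    assume "\<exists>z'. e' = sh z' e"
    then obtain z' where "e' = sh z' e" by blast
    then have "e' = sh (z' - z) (sh z e)" unfolding shift_add[symmetric] by simp
    then show "\<exists>z'. e' = sh z' (sh z e)" by blast
  qed
  then show ?thesis unfolding orbit_rep_def by simp
qed

lemma orbit_rep_idem [simp]: "orbit_rep (orbit_rep e) = orbit_rep e"
  using orbit_rep_shift_ex[of e] by (metis orbit_rep_shift)

lemma reps_iff: "r \<in> reps \<longleftrightarrow> orbit_rep r = r"
proof
  assume "r \<in> reps"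
  then obtain e where "r = orbit_rep e" by blast
  then show "orbit_rep r = r" by simp
next
  assume "orbit_rep r = r"
  then show "r \<in> reps" by (rule range_eqI[OF sym])
qed

lemma orbit_rep_eq_iff: "orbit_rep e = orbit_rep e' \<longleftrightarrow> (\<exists>z. e' = sh z e)"
proof
  assume eq: "orbit_rep e = orbit_rep e'"
  obtain z z' where z: "e = sh z (orbit_rep e)" "e' = sh z' (orbit_rep e')"
    using orbit_rep_shift_ex by blast
  have "orbit_rep e' = sh (- z) e" using z(1) eq by (metis shift_inverse(2))
  then have "e' = sh (z' + - z) e" using z(2) by (metis shift_add)
  then show "\<exists>z. e' = sh z e" by blast
qed auto

text \<open>Take the fractional parts of the coordinates with respect to the periods.\<close>

lemma lattice_reduction: "\<exists>z a b. 0 \<le> a \<and> a \<le> 1 \<and> 0 \<le> b \<and> b \<le> 1 \<and>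
    p + lat z = of_real a * px + of_real b * py"
proof -
  define b where "b = Im (cnj px * p) / Im (cnj px * py)"
  define a where "a = Im (cnj py * p) / Im (cnj py * px)"
  have o: "Im (cnj py * px) = - Im (cnj px * py)" by (simp add: algebra_simps)
  have D: "Im (cnj px * py) \<noteq> 0" "Im (cnj py * px) \<noteq> 0" using orientation unfolding o by auto
  have p: "p = of_real a * px + of_real b * py"
  proof -
    define d where "d = p - (of_real a * px + of_real b * py)"
    have "Im (cnj px * d) = Im (cnj px * p) - b * Im (cnj px * py)" by (simp add: d_def algebra_simps)
    then have d1: "Im (cnj px * d) = 0" using D by (simp add: b_def)
    have "Im (cnj py * d) = Im (cnj py * p) - a * Im (cnj py * px)" by (simp add: d_def algebra_simps)
    then have d2: "Im (cnj py * d) = 0" using D by (simp add: a_def)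
    have "Re d * Im (cnj px * py) = Re py * Im (cnj px * d) - Re px * Im (cnj py * d)"
      "Im d * Im (cnj px * py) = Im py * Im (cnj px * d) - Im px * Im (cnj py * d)"
      by (simp_all add: algebra_simps)
    then have "d = 0" using d1 d2 D(1) by (simp add: complex_eq_iff)
    then show ?thesis by (simp add: d_def)
  qed
  have "p + lat (- \<lfloor>a\<rfloor>, - \<lfloor>b\<rfloor>) = of_real (frac a) * px + of_real (frac b) * py"
    by (subst p) (simp add: lattice_vec_def frac_def algebra_simps)
  then show ?thesis
    using frac_ge_0 frac_lt_1 less_imp_le by metis
qed

text \<open>Every edge has a translate that starts in the compact fundamental parallelogram.\<close>

lemma finite_reps: "finite reps"
proof -
  define P where "P = (\<lambda>(a, b). of_real a * px + of_real b * py) ` ({0..1::real} \<times> {0..1::real})"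
  have "compact P"
    unfolding P_def case_prod_beta
    by (intro compact_continuous_image continuous_intros compact_Times compact_Icc)
  then have fin: "finite {e. edge e \<inter> P \<noteq> {}}" by (rule locally_finite)
  have "reps \<subseteq> orbit_rep ` {e. edge e \<inter> P \<noteq> {}}"
  proof
    fix r assume "r \<in> reps"
    then obtain e where e: "r = orbit_rep e" by blast
    obtain z a b where z: "0 \<le> a" "a \<le> 1" "0 \<le> b" "b \<le> 1"
      "white G e + lat z = of_real a * px + of_real b * py"
      using lattice_reduction by blast
    have "white G (sh z e) \<in> P" unfolding P_def white_shift z(5) using z by force
    moreover have "white G (sh z e) \<in> edge (sh z e)" using edge_vertices by blast
    ultimately have "sh z e \<in> {e. edge e \<inter> P \<noteq> {}}" by blast
    then show "r \<in> orbit_rep ` {e. edge e \<inter> P \<noteq> {}}" using e orbit_rep_shift by (metis imageI)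
  qed
  then show ?thesis using fin finite_surj by blast
qed

text \<open>A sum over the edges of the plane, carried out orbit by orbit.\<close>

lemma Sum_any_unfold:
  fixes u f :: "'e \<Rightarrow> complex"
  assumes u: "finite {e. u e \<noteq> 0}" and f: "\<And>z e. f (sh z e) = f e"
  shows "Sum_any (\<lambda>e. u e * f e) = (\<Sum>r\<in>reps. Sum_any (\<lambda>z. u (sh z r)) * f r)"
proof -
  define B where "B r = {z. u (sh z r) \<noteq> 0}" for r
  have finB: "finite (B r)" for r
  proof -
    have "B r = (\<lambda>z. sh z r) -` {e. u e \<noteq> 0}" by (auto simp: B_def)
    moreover have "inj (\<lambda>z. sh z r)" by (auto simp: inj_def shift_free)
    moreover have "finite ((\<lambda>z. sh z r) -` {e. u e \<noteq> 0})"
      using u calculation(2) by (rule finite_vimageI)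
    ultimately show ?thesis by simp
  qed
  have "(\<Sum>r\<in>reps. Sum_any (\<lambda>z. u (sh z r)) * f r) = (\<Sum>r\<in>reps. \<Sum>z\<in>B r. u (sh z r) * f (sh z r))"
    by (simp add: Sum_any.expand_set B_def sum_distrib_right f)
  also have "\<dots> = (\<Sum>(r, z)\<in>Sigma reps B. u (sh z r) * f (sh z r))"
    using finB finite_reps by (intro sum.Sigma) auto
  also have "\<dots> = (\<Sum>e | u e \<noteq> 0. u e * f e)"
  proof -
    have bij: "bij_betw (\<lambda>(r, z). sh z r) (Sigma reps B) {e. u e \<noteq> 0}"
      unfolding bij_betw_def
    proof
      show "inj_on (\<lambda>(r, z). sh z r) (Sigma reps B)"
      proof (rule inj_onI)
        fix p q assume p: "p \<in> Sigma reps B" "q \<in> Sigma reps B" "(\<lambda>(r, z). sh z r) p = (\<lambda>(r, z). sh z r) q"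
        then have eq: "sh (snd p) (fst p) = sh (snd q) (fst q)" by (simp add: case_prod_beta)
        have "orbit_rep (fst p) = fst p" "orbit_rep (fst q) = fst q" using p(1,2) reps_iff by auto
        then have "fst p = fst q" using arg_cong[OF eq, of orbit_rep] by simp
        then show "p = q" using eq by (simp add: shift_free prod_eq_iff)
      qed
      show "(\<lambda>(r, z). sh z r) ` Sigma reps B = {e. u e \<noteq> 0}"
      proof (intro equalityI subsetI)
        fix e assume e: "e \<in> {e. u e \<noteq> 0}"
        obtain z where z: "e = sh z (orbit_rep e)" using orbit_rep_shift_ex by blast
        then have "(orbit_rep e, z) \<in> Sigma reps B" using e by (auto simp: B_def)
        then show "e \<in> (\<lambda>(r, z). sh z r) ` Sigma reps B" using z by force
      qed (auto simp: B_def)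
    qed
    show ?thesis
      using sum.reindex_bij_betw[OF bij, of "\<lambda>e. u e * f e"] by (simp add: case_prod_beta)
  qed
  also have "\<dots> = Sum_any (\<lambda>e. u e * f e)"
    by (rule Sum_any.expand_superset[symmetric, OF u]) auto
  finally show ?thesis ..
qed

lemma sum_reps_permute:
  assumes \<sigma>: "bij \<sigma>" "\<And>z e. \<sigma> (sh z e) = sh z (\<sigma> e)" and f: "\<And>z e. f (sh z e) = f e"
  shows "(\<Sum>r\<in>reps. f (\<sigma> r)) = (\<Sum>r\<in>reps. f r)"
proof -
  have fr: "f (orbit_rep e) = f e" for e
    using orbit_rep_shift_ex[of e] f by metis
  have inj: "inj_on (\<lambda>r. orbit_rep (\<sigma> r)) reps"
  proof (rule inj_onI)
    fix r r' assume r: "r \<in> reps" "r' \<in> reps" "orbit_rep (\<sigma> r) = orbit_rep (\<sigma> r')"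
    then obtain z where "\<sigma> r' = sh z (\<sigma> r)" using orbit_rep_eq_iff by blast
    then have "r' = sh z r" using \<sigma> by (metis bij_is_inj injD)
    then have "orbit_rep r = orbit_rep r'" by simp
    then show "r = r'" using r reps_iff by metis
  qed
  have "(\<lambda>r. orbit_rep (\<sigma> r)) ` reps = reps"
    using inj finite_reps by (intro endo_inj_surj) auto
  then have "(\<Sum>r\<in>reps. f r) = (\<Sum>r\<in>reps. f (orbit_rep (\<sigma> r)))"
    using sum.reindex[OF inj, of f] by (simp add: o_def)
  then show ?thesis by (simp add: fr)
qed

subsection \<open>Homology classes of the train-tracks of the torus\<close>

abbreviation "shc \<equiv> shift_corner G"

lemma shift_corner_simps [simp]:
  "shc z (CornerB e) = CornerB (sh z e)" "shc z (CornerW e) = CornerW (sh z e)"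
  by (simp_all add: shift_corner_def)

lemma shc_add: "shc (z + z') c = shc z (shc z' c)" and shc_0 [simp]: "shc 0 c = c"
  by (cases c; simp add: shift_add)+

lemma shc_inverse [simp]: "shc z (shc (- z) c) = c" "shc (- z) (shc z c) = c"
  by (cases c; simp)+

lemma shc_free: "shc z c = shc z' c \<longleftrightarrow> z = z'"
  by (cases c) (auto simp: shift_free)

lemma shc_inj: "shc z c = shc z d \<longleftrightarrow> c = d"
  by (metis shc_inverse(2))

lemma step_shift: "step (shc z c) = shc z (step c)"
  by (cases c) (auto simp: inv_rotB_shift rotW_shift)

lemma step_power_shift: "(step ^^ n) (shc z c) = shc z ((step ^^ n) c)"
  by (induction n) (auto simp: step_shift)

lemma step_power_inj: "(step ^^ n) c = (step ^^ n) d \<longleftrightarrow> c = d"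
  using bij_step by (metis bij_fn bij_is_inj injD)

lemma track_of_shift: "track_of G (shc z c) = shc z ` track_of G c"
proof -
  have sub: "shc z ` track_of G c \<subseteq> track_of G (shc z c)" for z c
    by (auto simp: track_of_iff same_track_iff step_power_shift)
  have "track_of G (shc z c) \<subseteq> shc z ` track_of G c"
  proof
    fix d assume "d \<in> track_of G (shc z c)"
    then have "shc (- z) d \<in> track_of G (shc (- z) (shc z c))" using sub[of "- z" "shc z c"] by blast
    then show "d \<in> shc z ` track_of G c" by (metis image_eqI shc_inverse)
  qed
  then show ?thesis using sub[of z c] by blast
qed

definition ttrack :: "'e corner \<Rightarrow> 'e corner set set" where
  "ttrack c = torus_track G (track_of G c)"

lemma ttrack_alt: "ttrack c = range (\<lambda>z. track_of G (shc z c))"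
  by (simp add: ttrack_def torus_track_def track_of_shift)

lemma ttrack_step [simp]: "ttrack (step c) = ttrack c"
  by (simp add: ttrack_def)

lemma ttrack_step_power [simp]: "ttrack ((step ^^ n) c) = ttrack c"
  by (simp add: ttrack_def)

lemma ttrack_shift [simp]: "ttrack (shc z c) = ttrack c"
proof -
  have "range (\<lambda>z'. track_of G (shc z' (shc z c))) = range (\<lambda>z'. track_of G (shc z' c))"
  proof (intro equalityI subsetI)
    fix T assume "T \<in> range (\<lambda>z'. track_of G (shc z' c))"
    then obtain z' where "T = track_of G (shc z' c)" by blast
    also have "shc z' c = shc (z' - z) (shc z c)" by (simp flip: shc_add)
    finally show "T \<in> range (\<lambda>z'. track_of G (shc z' (shc z c)))" by blast
  qed (auto simp flip: shc_add)
  then show ?thesis by (simp add: ttrack_alt)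
qed

lemma ttrack_eqD:
  assumes "ttrack c = ttrack d"
  obtains z n where "d = shc z ((step ^^ n) c) \<or> c = shc z ((step ^^ n) d)"
proof -
  have "track_of G d \<in> ttrack d" unfolding ttrack_alt by (metis rangeI shc_0)
  then obtain z where "track_of G d = track_of G (shc z c)"
    using assms unfolding ttrack_alt by blast
  then have "(shc z c, d) \<in> same_track" using track_of_eq_iff by metis
  then obtain n where "d = (step ^^ n) (shc z c) \<or> shc z c = (step ^^ n) d"
    unfolding same_track_iff by blast
  then show ?thesis
  proof
    assume "d = (step ^^ n) (shc z c)"
    then have "d = shc z ((step ^^ n) c)" by (simp add: step_power_shift)
    then show ?thesis using that by blast
  next
    assume "shc z c = (step ^^ n) d"
    then have "c = shc (- z) ((step ^^ n) d)" by (metis shc_inverse(2))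
    then show ?thesis using that by blast
  qed
qed

lemma torus_tracks_range: "torus_tracks G = range ttrack"
  by (auto simp: torus_tracks_def tracks_def ttrack_def)

fun corner_rep :: "'e corner \<Rightarrow> 'e corner" where
  "corner_rep (CornerB e) = CornerB (orbit_rep e)"
| "corner_rep (CornerW e) = CornerW (orbit_rep e)"

abbreviation "creps \<equiv> range corner_rep"

lemma creps_eq: "creps = CornerB ` reps \<union> CornerW ` reps"
proof (intro equalityI subsetI)
  fix c assume "c \<in> creps"
  then obtain d where "c = corner_rep d" by blast
  then show "c \<in> CornerB ` reps \<union> CornerW ` reps" by (cases d) auto
next
  fix c assume "c \<in> CornerB ` reps \<union> CornerW ` reps"
  then show "c \<in> creps" by (auto intro: range_eqI[of _ _ "CornerB _"] range_eqI[of _ _ "CornerW _"])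
qed

lemma finite_creps: "finite creps"
  unfolding creps_eq using finite_reps by auto

lemma corner_rep_ex: "\<exists>z. c = shc z (corner_rep c)"
  using orbit_rep_shift_ex by (cases c) auto

lemma corner_rep_eqD: "corner_rep c = corner_rep d \<Longrightarrow> \<exists>z. d = shc z c"
  using orbit_rep_eq_iff by (cases c; cases d) auto

lemma corner_rep_shift [simp]: "corner_rep (shc z c) = corner_rep c"
  by (cases c) auto

lemma ttrack_corner_rep [simp]: "ttrack (corner_rep c) = ttrack c"
  using corner_rep_ex[of c] by (metis ttrack_shift)

lemma torus_tracks_creps: "torus_tracks G = ttrack ` creps"
  unfolding torus_tracks_range by (auto simp: image_image)

lemma finite_torus_tracks: "finite (torus_tracks G)"
  unfolding torus_tracks_creps using finite_creps by simp

text \<open>There are finitely many corners modulo translations.\<close>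

lemma track_returns: "\<exists>n>0. \<exists>z. (step ^^ n) c = shc z c"
proof -
  have "\<not> inj (\<lambda>k. corner_rep ((step ^^ k) c))"
  proof
    assume "inj (\<lambda>k. corner_rep ((step ^^ k) c))"
    then have "finite (UNIV :: nat set)"
      using finite_creps by (metis (no_types, lifting) finite_imageD finite_subset image_subsetI rangeI)
    then show False by simp
  qed
  then obtain i j where ij: "i \<noteq> j" "corner_rep ((step ^^ i) c) = corner_rep ((step ^^ j) c)"
    by (auto simp: inj_def)
  have "\<exists>n>0. \<exists>z. (step ^^ n) c = shc z c" if less: "i < j" and rep: "corner_rep ((step ^^ i) c) = corner_rep ((step ^^ j) c)" for i j
  proof -
    obtain z where "(step ^^ j) c = shc z ((step ^^ i) c)" using corner_rep_eqD[OF rep] by blast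
    moreover have "(step ^^ j) c = (step ^^ i) ((step ^^ (j - i)) c)"
      using less by (simp flip: funpow_add[THEN fun_cong, unfolded comp_apply])
    ultimately have "(step ^^ i) ((step ^^ (j - i)) c) = (step ^^ i) (shc z c)" by (simp add: step_power_shift)
    then have "(step ^^ (j - i)) c = shc z c" by (simp only: step_power_inj)
    moreover have "0 < j - i" using less by simp
    ultimately show ?thesis by blast
  qed
  then show ?thesis using ij by (metis nat_neq_iff)
qed

definition return_time :: "'e corner \<Rightarrow> nat" where
  "return_time c = (LEAST n. n > 0 \<and> (\<exists>z. (step ^^ n) c = shc z c))"

lemma return_time_pos: "return_time c > 0"
  and return_time_returns: "\<exists>z. (step ^^ return_time c) c = shc z c"
  using LeastI_ex[OF track_returns[of c, unfolded Bex_def]] track_returns[of c]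
    LeastI_ex[of "\<lambda>n. n > 0 \<and> (\<exists>z. (step ^^ n) c = shc z c)"]
  unfolding return_time_def by auto

lemma return_time_min: "0 < k \<Longrightarrow> k < return_time c \<Longrightarrow> (step ^^ k) c \<noteq> shc z c"
  using not_less_Least[of k "\<lambda>n. n > 0 \<and> (\<exists>z. (step ^^ n) c = shc z c)"] unfolding return_time_def by blast

lemma first_return_iff: "first_return G c z \<longleftrightarrow> (step ^^ return_time c) c = shc z c"
proof
  assume "first_return G c z"
  then obtain n where n: "n > 0" "(step ^^ n) c = shc z c"
    "\<And>k z'. 0 < k \<Longrightarrow> k < n \<Longrightarrow> (step ^^ k) c \<noteq> shc z' c"
    unfolding first_return_def track_step_power by metis
  have "return_time c = n"
    using n return_time_pos[of c] return_time_returns[of c] return_time_min[of n c z] by (metis nat_neq_iff)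
  then show "(step ^^ return_time c) c = shc z c" using n by simp
next
  assume *: "(step ^^ return_time c) c = shc z c"
  show "first_return G c z"
    unfolding first_return_def track_step_power
    using * return_time_pos[of c] return_time_min[of _ c] by metis
qed

lemma return_step_iff: "shc z (step c) = (step ^^ n) (step c) \<longleftrightarrow> shc z c = (step ^^ n) c"
  using step_power_inj[of 1 "shc z c" "(step ^^ n) c"] by (simp add: funpow_swap1 step_shift)

lemma return_shift_iff: "shc z (shc z' c) = (step ^^ n) (shc z' c) \<longleftrightarrow> shc z c = (step ^^ n) c"
  unfolding step_power_shift by (metis add.commute shc_add shc_inj)

lemma first_return_step: "first_return G (step c) z \<longleftrightarrow> first_return G c z"
  by (simp only: first_return_def track_step_power return_step_iff)

lemma first_return_shift: "first_return G (shc z' c) z \<longleftrightarrow> first_return G c z"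
  by (simp only: first_return_def track_step_power return_shift_iff)

lemma first_return_ttrack:
  assumes "ttrack c = ttrack d"
  shows "first_return G c z \<longleftrightarrow> first_return G d z"
proof -
  have pow: "first_return G ((step ^^ n) c) z \<longleftrightarrow> first_return G c z" for n c
    by (induction n) (auto simp: first_return_step)
  obtain z' n where "d = shc z' ((step ^^ n) c) \<or> c = shc z' ((step ^^ n) d)"
    using ttrack_eqD[OF assms] by blast
  then show ?thesis using pow first_return_shift by metis
qed

lemma track_class_iff: "track_class G (ttrack c) = z \<longleftrightarrow> (step ^^ return_time c) c = shc z c"
proof -
  obtain z0 where z0: "(step ^^ return_time c) c = shc z0 c" using return_time_returns by blast
  have "track_class G (ttrack c) = z0"
    unfolding track_class_def
  proof (rule the_equality)
    show "\<exists>c'. torus_track G (track_of G c') = ttrack c \<and> first_return G c' z0"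
      using z0 first_return_iff by (intro exI[of _ c]) (simp add: ttrack_def)
  next
    fix z assume "\<exists>c'. torus_track G (track_of G c') = ttrack c \<and> first_return G c' z"
    then obtain c' where c': "ttrack c' = ttrack c" "first_return G c' z" by (auto simp: ttrack_def)
    then have "first_return G c z" using first_return_ttrack by blast
    then show "z = z0" using z0 unfolding first_return_iff by (simp add: shc_free)
  qed
  then show ?thesis using z0 by (auto simp: shc_free)
qed

lemma return_class: "(step ^^ return_time c) c = shc (track_class G (ttrack c)) c"
  using track_class_iff by blast

theorem track_class_nonzero:
  assumes "minimal_graph G" "T \<in> torus_tracks G"
  shows "track_class G T \<noteq> 0"
proof
  assume "track_class G T = 0"
  moreover obtain c where "T = ttrack c" using assms(2) torus_tracks_range by blast
  ultimately have "(step ^^ return_time c) c = c" using return_class[of c] by simp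
  then show False using minimal_tracks_not_closed[OF assms(1) return_time_pos] by blast
qed

lemma opposite_entry_shift: "opposite_entry (shc z c) = shc z (opposite_entry c)"
  by (cases c) (auto simp: side_wr_def side_br_def inv_rotW_shift rotW_shift)

text \<open>If both classes were equal to \<open>z\<close>, both strands would pass in their own
  directions from their crossing to its translate by \<open>z\<close>. This translate is
  another crossing as \<open>z \<noteq> 0\<close>.\<close>

theorem crossing_tracks_class:
  assumes "minimal_graph G"
  shows "track_class G (ttrack (opposite_entry c)) \<noteq> track_class G (ttrack c)"
proof
  define z where "z = track_class G (ttrack c)"
  assume "track_class G (ttrack (opposite_entry c)) = track_class G (ttrack c)"
  then have opp: "(step ^^ return_time (opposite_entry c)) (opposite_entry c) = opposite_entry (shc z c)"
    using return_class[of "opposite_entry c"] by (simp add: z_def opposite_entry_shift)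
  have c: "(step ^^ return_time c) c = shc z c" using return_class by (simp add: z_def)
  have "z \<noteq> 0"
    unfolding z_def by (rule track_class_nonzero[OF assms]) (simp add: torus_tracks_range)
  then have "c \<noteq> shc z c" using shc_free[of z c 0] by simp
  moreover have "c \<noteq> opposite_entry (shc z c)"
    using opp minimal_opposite_track[OF assms, of c] track_of_step_power by metis
  ultimately show False
    using minimal_no_parallel_crossing[OF assms, of c "shc z c"] c opp by metis
qed

subsection \<open>The class of a train-track as a sum over its corners\<close>

text \<open>A track is followed by the vertices of the graph next to it, alternately on its right and on
  its left. Any choice of points that commutes with the translations has the same total
  displacement over a period.\<close>

fun corner_pos :: "'e corner \<Rightarrow> complex" where
  "corner_pos (CornerB e) = black G e"
| "corner_pos (CornerW e) = white G e"

lemma corner_pos_shift: "corner_pos (shc z c) = corner_pos c + lat z"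
  by (cases c) (auto simp: black_shift white_shift)

text \<open>The displacements telescope over a period of the track, which meets each of its corners once
  modulo translations.\<close>

lemma lat_track_class:
  assumes T: "T \<in> torus_tracks G"
  shows "lat (track_class G T) = (\<Sum>d | d \<in> creps \<and> ttrack d = T. corner_pos (step d) - corner_pos d)"
proof -
  obtain c where c: "T = ttrack c" using T torus_tracks_range by blast
  define n where "n = return_time c"
  define z where "z = track_class G T"
  have n: "n > 0" "(step ^^ n) c = shc z c" using return_time_pos return_class by (auto simp: n_def z_def c)
  define D where "D d = corner_pos (step d) - corner_pos d" for d
  have Dsh: "D (shc z d) = D d" for z d by (simp add: D_def step_shift corner_pos_shift)
  have Drep: "D (corner_rep d) = D d" for d using corner_rep_ex[of d] Dsh by metis
  have inj: "inj_on (\<lambda>k. corner_rep ((step ^^ k) c)) {..<n}"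
  proof (rule linorder_inj_onI)
    fix i j assume ij: "i < j" "i \<in> {..<n}" "j \<in> {..<n}"
    show "corner_rep ((step ^^ i) c) \<noteq> corner_rep ((step ^^ j) c)"
    proof
      assume "corner_rep ((step ^^ i) c) = corner_rep ((step ^^ j) c)"
      then obtain z' where "(step ^^ j) c = shc z' ((step ^^ i) c)" using corner_rep_eqD by blast
      moreover have "(step ^^ j) c = (step ^^ i) ((step ^^ (j - i)) c)"
        using ij(1) by (simp flip: funpow_add[THEN fun_cong, unfolded comp_apply])
      ultimately have "(step ^^ i) ((step ^^ (j - i)) c) = (step ^^ i) (shc z' c)" by (simp add: step_power_shift)
      then have "(step ^^ (j - i)) c = shc z' c" by (simp add: step_power_inj)
      moreover have "0 < j - i" "j - i < n" using ij by auto
      ultimately show False using return_time_min[of "j - i" c z'] by (simp add: n_def)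
    qed
  qed auto
  have mult: "\<exists>z'. (step ^^ (n * k)) c = shc z' c" for k
  proof (induction k)
    case (Suc k)
    then obtain z' where "(step ^^ (n * k)) c = shc z' c" by blast
    then have "(step ^^ (n * Suc k)) c = shc (z' + z) c"
      using n(2) by (simp add: funpow_add step_power_shift shc_add)
    then show ?case by blast
  next
    case 0
    show ?case by (rule exI[of _ 0]) simp
  qed
  (* Beyond the first return, the track repeats itself up to translations. *)
  have red: "corner_rep ((step ^^ k) c) \<in> (\<lambda>k. corner_rep ((step ^^ k) c)) ` {..<n}" for k
  proof -
    obtain z' where "(step ^^ (n * (k div n))) c = shc z' c" using mult by blast
    then have "(step ^^ (k mod n + n * (k div n))) c = shc z' ((step ^^ (k mod n)) c)"
      unfolding funpow_add comp_apply by (simp add: step_power_shift)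
    then have "corner_rep ((step ^^ k) c) = corner_rep ((step ^^ (k mod n)) c)" by simp
    then show ?thesis using n(1) by (intro image_eqI[of _ _ "k mod n"]) auto
  qed
  have img: "(\<lambda>k. corner_rep ((step ^^ k) c)) ` {..<n} = {d. d \<in> creps \<and> ttrack d = T}"
  proof (intro equalityI subsetI)
    fix d assume "d \<in> {d. d \<in> creps \<and> ttrack d = T}"
    then obtain d' where d': "d = corner_rep d'" "ttrack c = ttrack d'" using c by auto
    obtain z' k where "d' = shc z' ((step ^^ k) c) \<or> c = shc z' ((step ^^ k) d')"
      using ttrack_eqD[OF d'(2)] by blast
    then show "d \<in> (\<lambda>k. corner_rep ((step ^^ k) c)) ` {..<n}"
    proof
      assume "d' = shc z' ((step ^^ k) c)"
      then show ?thesis using red d' by simp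
    next
      assume k: "c = shc z' ((step ^^ k) d')"
      obtain z2 where z2: "(step ^^ (n * k)) c = shc z2 c" using mult by blast
      have "n * k = k + (n * k - k)" using n(1) by (cases n) auto
      then have "(step ^^ k) ((step ^^ (n * k - k)) c) = shc z2 (shc z' ((step ^^ k) d'))"
        using z2 k by (metis funpow_add comp_apply)
      also have "\<dots> = (step ^^ k) (shc (z2 + z') d')" by (simp add: step_power_shift shc_add)
      finally have "(step ^^ (n * k - k)) c = shc (z2 + z') d'" by (simp add: step_power_inj)
      then have "corner_rep d' = corner_rep ((step ^^ (n * k - k)) c)" by simp
      then show ?thesis using red d' by simp
    qed
  qed (auto simp: c)
  have "(\<Sum>k<n. D ((step ^^ k) c)) = corner_pos ((step ^^ n) c) - corner_pos c"
    by (simp add: D_def sum_lessThan_telescope[of "\<lambda>k. corner_pos ((step ^^ k) c)", simplified])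
  also have "\<dots> = lat z" by (simp add: n(2) corner_pos_shift)
  finally have "lat z = (\<Sum>k<n. D (corner_rep ((step ^^ k) c)))" by (simp add: Drep)
  also have "\<dots> = (\<Sum>d | d \<in> creps \<and> ttrack d = T. D d)"
    unfolding img[symmetric] sum.reindex[OF inj] by simp
  finally show ?thesis by (simp add: z_def D_def)
qed

text \<open>In the quadrilateral of an edge, the strand that enters through \<open>side_wr\<close> goes
  from the white to the black end and the one that enters through \<open>side_br\<close> goes
  back.\<close>

lemma weighted_sum_of_classes:
  fixes \<alpha> :: "'e corner set set \<Rightarrow> complex"
  shows "(\<Sum>T\<in>torus_tracks G. \<alpha> T * lat (track_class G T)) =
    (\<Sum>r\<in>reps. (\<alpha> (ttrack (side_wr G r)) - \<alpha> (ttrack (side_br G r))) * (black G r - white G r))"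
proof -
  have "(\<Sum>T\<in>torus_tracks G. \<alpha> T * lat (track_class G T)) =
    (\<Sum>T\<in>ttrack ` creps. \<Sum>d | d \<in> creps \<and> ttrack d = T. \<alpha> (ttrack d) * (corner_pos (step d) - corner_pos d))"
    unfolding torus_tracks_creps[symmetric]
    by (intro sum.cong refl) (simp add: lat_track_class sum_distrib_left)
  also have "\<dots> = (\<Sum>d\<in>creps. \<alpha> (ttrack d) * (corner_pos (step d) - corner_pos d))"
    using sum.image_gen[OF finite_creps, of "\<lambda>d. \<alpha> (ttrack d) * (corner_pos (step d) - corner_pos d)" ttrack] by simp
  also have "\<dots> = (\<Sum>r\<in>reps. \<alpha> (ttrack (CornerB r)) * (white G r - black G r))
     + (\<Sum>r\<in>reps. \<alpha> (ttrack (CornerW r)) * (black G (rW r) - white G r))"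
    unfolding creps_eq using finite_reps
    by (subst sum.union_disjoint) (auto simp: sum.reindex inj_on_def)
  also have "(\<Sum>r\<in>reps. \<alpha> (ttrack (CornerW r)) * (black G (rW r) - white G r)) =
     (\<Sum>r\<in>reps. \<alpha> (ttrack (CornerW (inv rW r))) * (black G r - white G r))"
  proof -
    define f where "f e = \<alpha> (ttrack (CornerW (inv rW e))) * (black G e - white G e)" for e
    have "f (sh z e) = f e" for z e
      unfolding f_def inv_rotW_shift black_shift white_shift using ttrack_shift[of z "CornerW (inv rW e)"] by simp
    then have "(\<Sum>r\<in>reps. f (rW r)) = (\<Sum>r\<in>reps. f r)"
      by (intro sum_reps_permute bij_rotW rotW_shift)
    then show ?thesis by (simp add: f_def)
  qed
  finally show ?thesis
    by (simp add: side_wr_def side_br_def sum.distrib[symmetric] algebra_simps)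
qed

text \<open>For constant weights the contributions of the two strands of each quadrilateral cancel.\<close>

lemma sum_of_classes: "(\<Sum>T\<in>torus_tracks G. track_class G T) = 0"
proof -
  have "lat (\<Sum>T\<in>torus_tracks G. track_class G T) = (\<Sum>T\<in>torus_tracks G. lat (track_class G T))"
    by (induction rule: infinite_finite_induct) (auto simp: lat_add)
  also have "\<dots> = 0" using weighted_sum_of_classes[of "\<lambda>_. 1"] by simp
  finally show ?thesis using lat_eq_0_iff by blast
qed

subsection \<open>Periods of the Abel map\<close>

text \<open>As \<open>a\<close> is invariant, the change of \<open>\<eta>\<close> under a translation is
  the same at both ends of every edge of the quad-graph.\<close>

lemma abel_period:
  fixes \<eta> :: "quad_vertex \<Rightarrow> 'a :: ab_group_add"
  assumes \<eta>: "abel_eqs a \<eta>" and a: "\<And>z c. a (shc z c) = a c"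
  obtains \<delta> where
    "\<And>z e. \<eta> (Vertex (white G (sh z e))) = \<eta> (Vertex (white G e)) + \<delta> z"
    "\<And>z e. \<eta> (Vertex (black G (sh z e))) = \<eta> (Vertex (black G e)) + \<delta> z"
    "\<And>z e. \<eta> (Face (lf (sh z e))) = \<eta> (Face (lf e)) + \<delta> z"
    "\<And>z e. \<eta> (Face (rf (sh z e))) = \<eta> (Face (rf e)) + \<delta> z"
    "\<And>z z'. \<delta> (z + z') = \<delta> z + \<delta> z'"
proof -
  define k where "k z e = \<eta> (Face (lf (sh z e))) - \<eta> (Face (lf e))" for z e
  have w: "\<eta> (Vertex (white G (sh z e))) - \<eta> (Vertex (white G e)) = k z e" for z e
    using \<eta> a[of z "CornerW e"] unfolding abel_eqs_def k_def by simp
  have b': "\<eta> (Vertex (black G (sh z e))) - \<eta> (Vertex (black G e)) = \<eta> (Face (rf (sh z e))) - \<eta> (Face (rf e))" for z e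
    using \<eta> a[of z "CornerB e"] unfolding abel_eqs_def by simp
  have b: "\<eta> (Vertex (black G (sh z e))) - \<eta> (Vertex (black G e)) = k z e" for z e
    using b'[of z "inv rB e"] unfolding k_def by (simp add: black_shift inv_rotB_shift[symmetric])
  have const: "k z e = k z e'" for z e e'
  proof (rule edge_function_constant[of "k z"])
    show "k z (rB e) = k z e" for e
      using b[of z e] b[of z "rB e"] by (simp add: black_shift)
    show "k z (rW e) = k z e" for e
      using w[of z e] w[of z "rW e"] by (simp add: white_shift)
  qed
  define \<delta> where "\<delta> z = k z undefined" for z
  have kd: "k z e = \<delta> z" for z e unfolding \<delta>_def by (rule const)
  show ?thesis
  proof (rule that[of \<delta>])
    fix z z' and e
    show "\<eta> (Vertex (white G (sh z e))) = \<eta> (Vertex (white G e)) + \<delta> z"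
      using w[of z e] unfolding kd by (metis add.commute diff_add_cancel)
    show "\<eta> (Vertex (black G (sh z e))) = \<eta> (Vertex (black G e)) + \<delta> z"
      using b[of z e] unfolding kd by (metis add.commute diff_add_cancel)
    show "\<eta> (Face (lf (sh z e))) = \<eta> (Face (lf e)) + \<delta> z"
      using kd[of z e] unfolding k_def by (metis add.commute diff_add_cancel)
    show "\<eta> (Face (rf (sh z e))) = \<eta> (Face (rf e)) + \<delta> z"
      using b[of z e] b'[of z e] unfolding kd by (metis add.commute diff_add_cancel)
    have "k (z + z') undefined = k z (sh z' undefined) + k z' undefined"
      unfolding k_def shift_add by simp
    then show "\<delta> (z + z') = \<delta> z + \<delta> z'" unfolding kd .
  qed
qed

end

section \<open>Duality between train-tracks and periods\<close>

text \<open>Closed up by the segment, the path stays in a convex set that avoids \<open>p\<close>.\<close>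

lemma winding_number_far:
  assumes "path \<gamma>" "path_image \<gamma> \<subseteq> S" "convex S" "p \<notin> S"
  shows "winding_number \<gamma> p = winding_number (linepath (pathstart \<gamma>) (pathfinish \<gamma>)) p"
proof -
  define l where "l = linepath (pathstart \<gamma>) (pathfinish \<gamma>)"
  have ends: "pathstart \<gamma> \<in> S" "pathfinish \<gamma> \<in> S"
    using assms(2) pathstart_in_path_image pathfinish_in_path_image by blast+
  have l: "path l" "path_image l \<subseteq> S" "pathstart l = pathstart \<gamma>" "pathfinish l = pathfinish \<gamma>"
    using assms(3) ends by (auto simp: l_def closed_segment_subset)
  have pl: "p \<notin> path_image l" using l(2) assms(4) by blast
  have "winding_number (\<gamma> +++ reversepath l) p = 0"
    using assms l by (intro winding_number_zero_outside[of _ S]) (auto simp: path_image_join)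
  moreover have "winding_number (\<gamma> +++ reversepath l) p = winding_number \<gamma> p - winding_number l p"
    using assms l pl by (subst winding_number_join) (auto simp: winding_number_reversepath)
  ultimately show ?thesis by (simp add: l_def)
qed

lemma winding_number_linepath_multiple:
  assumes "\<And>m. m \<le> n \<Longrightarrow> p \<notin> closed_segment a (a + of_nat m * w)"
    "\<And>m. m < n \<Longrightarrow> p \<notin> closed_segment (a + of_nat m * w) (a + of_nat (Suc m) * w)"
  shows "(\<Sum>i<n. winding_number (linepath (a + of_nat i * w) (a + of_nat (Suc i) * w)) p) =
    winding_number (linepath a (a + of_nat n * w)) p"
  using assms
proof (induction n)
  case 0
  have "p \<noteq> a" using 0(1)[of 0] by simp
  then have "winding_number (linepath a a) p = 0" by (intro winding_number_trivial) auto
  then have "winding_number (linepath a (a + of_nat 0 * w)) p = 0" by (simp only: of_nat_0 mult_zero_left add_0_right)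
  then show ?case by (simp only: lessThan_0 sum.empty)
next
  case (Suc n)
  have seg: "a + of_nat n * w \<in> closed_segment a (a + of_nat (Suc n) * w)"
  proof -
    have "a + of_nat n * w = (1 - real n / real (Suc n)) *\<^sub>R a + (real n / real (Suc n)) *\<^sub>R (a + of_nat (Suc n) * w)"
    proof -
      have "(real n / real (Suc n)) *\<^sub>R (of_nat (Suc n) * w) = of_nat n * w"
        by (simp add: scaleR_conv_of_real del: of_nat_Suc)
      then show ?thesis by (simp add: algebra_simps del: of_nat_Suc)
    qed
    then show ?thesis unfolding in_segment by (intro exI[of _ "real n / real (Suc n)"]) auto
  qed
  have "winding_number (linepath a (a + of_nat (Suc n) * w)) p =
     winding_number (linepath a (a + of_nat n * w)) p + winding_number (linepath (a + of_nat n * w) (a + of_nat (Suc n) * w)) p"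
    using seg Suc.prems(1)[of "Suc n"] by (intro winding_number_split_linepath) auto
  then show ?case using Suc by simp
qed

lemma abs_Im_cnj_mult_le: "\<bar>Im (cnj u * w)\<bar> \<le> cmod u * cmod w"
  by (metis abs_Im_le_cmod complex_mod_cnj norm_mult)

text \<open>The winding number of a segment is the angle under which the segment is seen, divided by
  \<open>2 * pi\<close>. From its left this angle is between 0 and \<open>pi\<close>, and the
  angles of consecutive segments of a line add up.\<close>

lemma winding_number_left_of_line:
  assumes left: "Im (cnj w * (p - a)) > 0" and n: "n > 0"
  shows "(\<Sum>i<n. winding_number (linepath (a + of_nat i * w) (a + of_nat (Suc i) * w)) p) =
      winding_number (linepath a (a + of_nat n * w)) p"
    "Re (winding_number (linepath a (a + of_nat n * w)) p) \<in> {0<..<1/2}"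
proof -
  have off: "p \<notin> closed_segment (a + of_nat i * w) (a + of_nat j * w)" for i j
  proof
    assume "p \<in> closed_segment (a + of_nat i * w) (a + of_nat j * w)"
    then obtain u where "p = (1 - u) *\<^sub>R (a + of_nat i * w) + u *\<^sub>R (a + of_nat j * w)"
      unfolding in_segment by blast
    then have "p - a = of_real ((1 - u) * real i + u * real j) * w"
      by (simp add: scaleR_conv_of_real algebra_simps)
    then have "Im (cnj w * (p - a)) = Im (cnj w * (of_real ((1 - u) * real i + u * real j) * w))"
      by (simp only:)
    also have "\<dots> = 0" by (simp add: algebra_simps)
    finally show False using left by simp
  qed
  show "(\<Sum>i<n. winding_number (linepath (a + of_nat i * w) (a + of_nat (Suc i) * w)) p) =
      winding_number (linepath a (a + of_nat n * w)) p"
    using off[of 0] off by (intro winding_number_linepath_multiple) (auto simp del: of_nat_Suc)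
  have "Re (winding_number (linepath a (a + of_nat n * w)) p) > 0"
  proof (rule winding_number_linepath_pos_lt)
    have "Im ((a + of_nat n * w - a) * cnj (a + of_nat n * w - p)) = real n * Im (cnj w * (p - a))"
      by (simp add: algebra_simps)
    then show "0 < Im ((a + of_nat n * w - a) * cnj (a + of_nat n * w - p))" using left n by simp
  qed
  moreover have "\<bar>Re (winding_number (linepath a (a + of_nat n * w)) p)\<bar> < 1/2"
    using off[of 0 n] by (intro winding_number_lt_half_linepath) simp
  ultimately show "Re (winding_number (linepath a (a + of_nat n * w)) p) \<in> {0<..<1/2}" by auto
qed

context periodic_plane
begin

subsection \<open>Translated chains\<close>

lemma winding_number_curve_shift:
  assumes "p + lat z \<notin> edge (sh z e)"
  shows "winding_number (curve G (sh z e)) (p + lat z) = winding_number (curve G e) p"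
proof -
  define \<gamma> where "\<gamma> = (\<lambda>t. curve G e t + lat z)"
  have im: "path_image \<gamma> = edge (sh z e)"
    unfolding edge_shift \<gamma>_def by (auto simp: path_image_def)
  have p\<gamma>: "path \<gamma>"
    using path_curve[of e] unfolding \<gamma>_def path_def by (intro continuous_intros)
  have "simply_connected (edge (sh z e))"
  proof -
    have "edge (sh z e) homeomorphic {0..1::real}"
      using arc_curve by (intro homeomorphic_arc_image_interval) auto
    then show ?thesis
      using homeomorphic_simply_connected_eq convex_imp_simply_connected[of "{0..1::real}"] by blast
  qed
  then have "homotopic_paths (edge (sh z e)) (curve G (sh z e)) \<gamma>"
    unfolding simply_connected_eq_homotopic_paths
    using p\<gamma> im path_curve[of "sh z e"] pathstart_curve pathfinish_curve white_shift[of z e] black_shift[of z e]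
    by (auto simp: \<gamma>_def pathstart_def pathfinish_def white_def black_def)
  then have "homotopic_paths (- {p + lat z}) (curve G (sh z e)) \<gamma>"
    using assms by (elim homotopic_paths_subset) auto
  then have "winding_number (curve G (sh z e)) (p + lat z) = winding_number \<gamma> (p + lat z)"
    by (rule winding_number_homotopic_paths)
  also have "\<dots> = winding_number (curve G e) p"
    unfolding \<gamma>_def winding_number_offset[of _ "p + lat z"] winding_number_offset[of _ p] by simp
  finally show ?thesis .
qed

lemma support_shift: "p + lat z \<in> support G \<longleftrightarrow> p \<in> support G"
proof -
  have *: "p + lat z \<in> support G" if p: "p \<in> support G" for p z
  proof -
    obtain e where "p \<in> edge e" using p by (auto simp: support_def)
    then have "p + lat z \<in> edge (sh z e)" unfolding edge_shift by blast
    then show ?thesis using edge_support by blast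
  qed
  show ?thesis using *[of p z] *[of "p + lat z" "- z"] by (auto simp: lat_uminus)
qed

definition translate :: "int \<times> int \<Rightarrow> ('e \<Rightarrow> int) \<Rightarrow> 'e \<Rightarrow> int" where
  "translate z c e = c (sh (- z) e)"

lemma pairing_translate: "pairing (translate z c) h = pairing c (\<lambda>e. h (sh z e))"
  unfolding pairing_def
  by (rule Sum_any.reindex_cong[of "sh z"]) (auto simp: bij_shift translate_def)

lemma finite_translate:
  assumes "finite {e. c e \<noteq> 0}"
  shows "finite {e. translate z c e \<noteq> 0}"
proof -
  have "{e. translate z c e \<noteq> 0} = sh (- z) -` {e. c e \<noteq> 0}" by (auto simp: translate_def)
  then show ?thesis using finite_vimageI[OF assms bij_is_inj[OF bij_shift], of "- z"] by simp
qed

lemma wind_translate: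
  assumes "p \<notin> support G"
  shows "wind (translate z c) (p + lat z) = wind c p"
  unfolding wind_def pairing_translate
proof (rule arg_cong[where f = "pairing c"], rule ext)
  fix e
  have "p + lat z \<notin> edge (sh z e)"
    using assms support_shift edge_support by blast
  then show "winding_number (curve G (sh z e)) (p + lat z) = winding_number (curve G e) p"
    by (rule winding_number_curve_shift)
qed

lemma lf_shift_eq: "lf e' = lf (sh z e) \<longleftrightarrow> lf (sh (- z) e') = lf e"
proof -
  have pow: "(nx ^^ n) (sh z e) = sh z ((nx ^^ n) e)" for n z e
    by (induction n) (auto simp: nx_shift)
  have "lf (sh z e) = lf e' \<longleftrightarrow> (\<exists>n. e' = sh z ((nx ^^ n) e))"
    unfolding lf_eq_iff pow ..
  also have "\<dots> \<longleftrightarrow> (\<exists>n. sh (- z) e' = (nx ^^ n) e)"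
    by (metis shift_inverse)
  also have "\<dots> \<longleftrightarrow> lf e = lf (sh (- z) e')" unfolding lf_eq_iff ..
  finally show ?thesis by auto
qed

lemma lf_shift_point:
  assumes "p \<in> lf e"
  shows "p + lat z \<in> lf (sh z e)"
proof -
  have p: "p \<notin> support G" using assms face_subset[OF lf_face] by blast
  then have p': "p + lat z \<notin> support G" by (simp add: support_shift)
  have "face_chain (lf (sh z e)) = translate z (face_chain (lf e))"
  proof
    fix e'
    have "rf e' = lf (sh z e) \<longleftrightarrow> rf (sh (- z) e') = lf e"
      unfolding rf_eq rotB_shift lf_shift_eq ..
    then show "face_chain (lf (sh z e)) e' = translate z (face_chain (lf e)) e'"
      by (simp add: face_chain_def translate_def lf_shift_eq)
  qed
  then have "wind (face_chain (lf (sh z e))) (p + lat z) = wind (face_chain (lf e)) p"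
    using wind_translate[OF p] by simp
  then show ?thesis
    using wind_face_chain[OF lf_face p', of "sh z e"] wind_face_chain[OF lf_face p, of e] assms
    by (auto simp: of_bool_def split: if_splits)
qed

lemma finite_lattice_ball: "finite {z. norm (p - lat z) \<le> R}"
proof -
  define e :: 'e where "e = undefined"
  define K where "K = cball (white G e - p) R"
  have "finite {e'. edge e' \<inter> K \<noteq> {}}" by (intro locally_finite) (simp add: K_def)
  moreover have "inj (\<lambda>z. sh z e)" by (auto simp: inj_def shift_free)
  ultimately have "finite ((\<lambda>z. sh z e) -` {e'. edge e' \<inter> K \<noteq> {}})" by (rule finite_vimageI)
  moreover have "uminus ` {z. norm (p - lat z) \<le> R} \<subseteq> (\<lambda>z. sh z e) -` {e'. edge e' \<inter> K \<noteq> {}}"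
  proof
    fix z assume "z \<in> uminus ` {z. norm (p - lat z) \<le> R}"
    then obtain z' where z': "z = - z'" "norm (p - lat z') \<le> R" by blast
    then have "norm (p + lat z) \<le> R" by (simp only: lat_uminus add_uminus_conv_diff)
    moreover have "(white G e - p) - (white G e + lat z) = - (p + lat z)" by simp
    ultimately have "white G (sh z e) \<in> K"
      unfolding K_def white_shift mem_cball dist_norm by (simp only: norm_minus_cancel)
    moreover have "white G (sh z e) \<in> edge (sh z e)" using edge_vertices by blast
    ultimately show "z \<in> (\<lambda>z. sh z e) -` {e'. edge e' \<inter> K \<noteq> {}}" by blast
  qed
  ultimately have "finite (uminus ` {z. norm (p - lat z) \<le> R})" by (rule rev_finite_subset)
  then show ?thesis by (rule finite_imageD) simp
qed

subsection \<open>The fundamental cycle of the torus\<close>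

abbreviation "ex \<equiv> (1, 0) :: int \<times> int"
abbreviation "ey \<equiv> (0, 1) :: int \<times> int"

lemma lat_ex: "lat ex = px" and lat_ey: "lat ey = py"
  by (simp_all add: lattice_vec_def)

text \<open>\<open>C\<close> goes along \<open>A\<close>, then along a translate of \<open>B\<close>, and
  back along a translate of \<open>A\<close> and along \<open>B\<close>. In the sum over a
  large box of translates, the contributions of the inner translates of \<open>A\<close> and
  \<open>B\<close> telescope. What remains is the boundary of the box, whose four sides are
  seen from \<open>p\<close> like straight lines: each contributes a real part in the interval
  from 0 to 1/2. As the sum is an integer, it is 1.\<close>

lemma box_winding:
  fixes A B :: "'e \<Rightarrow> int"
  assumes A: "boundary_is A v (v + px)" "path \<gamma>\<^sub>A" "pathstart \<gamma>\<^sub>A = v" "pathfinish \<gamma>\<^sub>A = v + px"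
      "\<And>p. p \<notin> support G \<Longrightarrow> wind A p = winding_number \<gamma>\<^sub>A p"
    and B: "boundary_is B v (v + py)" "path \<gamma>\<^sub>B" "pathstart \<gamma>\<^sub>B = v" "pathfinish \<gamma>\<^sub>B = v + py"
      "\<And>p. p \<notin> support G \<Longrightarrow> wind B p = winding_number \<gamma>\<^sub>B p"
    and C: "C = (\<lambda>e. A e + translate ex B e - translate ey A e - B e)" and p: "p \<notin> support G"
  shows "cycle C \<and> (\<exists>N0. \<forall>N>N0. (\<Sum>i\<in>{-int N..<int N}. \<Sum>j\<in>{-int N..<int N}. wind C (p - lat (i, j))) = 1)"
proof
  have fA: "finite {e. A e \<noteq> 0}" and fB: "finite {e. B e \<noteq> 0}" using A(1) B(1) boundary_is_def by blast+
  note ftA = finite_translate[OF fA, of ey] and ftB = finite_translate[OF fB, of ex]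
  have pC: "pairing C h = pairing A h + pairing (translate ex B) h - pairing (translate ey A) h - pairing B h"
    and fC: "finite {e. C e \<noteq> 0}" for h
  proof -
    define c1 where "c1 = (\<lambda>e. A e + 1 * translate ex B e)"
    have c1: "pairing c1 h = pairing A h + pairing (translate ex B) h" "finite {e. c1 e \<noteq> 0}"
      unfolding c1_def using pairing_combine[OF fA ftB, of 1] finite_support_combine[OF fA ftB, of 1] by simp_all
    define c2 where "c2 = (\<lambda>e. c1 e + (-1) * translate ey A e)"
    have c2: "pairing c2 h = pairing c1 h - pairing (translate ey A) h" "finite {e. c2 e \<noteq> 0}"
      unfolding c2_def using pairing_combine[OF c1(2) ftA, of "-1"] finite_support_combine[OF c1(2) ftA, of "-1"] by simp_all
    have c3: "C = (\<lambda>e. c2 e + (-1) * B e)" unfolding C c2_def c1_def by auto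
    show "pairing C h = pairing A h + pairing (translate ex B) h - pairing (translate ey A) h - pairing B h"
      unfolding c3 pairing_combine[OF c2(2) fB] c2 c1 by simp
    show "finite {e. C e \<noteq> 0}"
      unfolding c3 by (rule finite_support_combine[OF c2(2) fB])
  qed
  show cyc: "cycle C"
    unfolding cycle_def
  proof (intro conjI allI fC)
    fix f :: "complex \<Rightarrow> complex"
    have bA: "pairing A (\<lambda>e. g (black G e) - g (white G e)) = g (v + px) - g v" for g
      using A(1) by (simp add: boundary_is_def)
    have bB: "pairing B (\<lambda>e. g (black G e) - g (white G e)) = g (v + py) - g v" for g
      using B(1) by (simp add: boundary_is_def)
    show "pairing C (\<lambda>e. f (black G e) - f (white G e)) = 0"
      unfolding pC pairing_translate black_shift white_shift lat_ex lat_ey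
        bA[of f] bB[of f] bA[of "\<lambda>x. f (x + py)"] bB[of "\<lambda>x. f (x + px)"]
      by (simp add: algebra_simps)
  qed
  define \<alpha> where "\<alpha> i j = wind A (p - lat (i, j))" for i j
  define \<beta> where "\<beta> i j = wind B (p - lat (i, j))" for i j
  have psup: "p - lat z \<notin> support G" for z
    using support_shift[of "p - lat z" z] p by simp
  have wC: "wind C (p - lat (i, j)) = \<alpha> i j + \<beta> (i + 1) j - \<alpha> i (j + 1) - \<beta> i j" for i j
  proof -
    have "wind (translate ex B) (p - lat (i, j)) = \<beta> (i + 1) j"
      using wind_translate[OF psup[of "(i + 1, j)"], of ex B] lat_add[of "(i, j)" ex] by (simp add: \<beta>_def)
    moreover have "wind (translate ey A) (p - lat (i, j)) = \<alpha> i (j + 1)"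
      using wind_translate[OF psup[of "(i, j + 1)"], of ey A] lat_add[of "(i, j)" ey] by (simp add: \<alpha>_def)
    ultimately show ?thesis by (simp add: wind_def pC \<alpha>_def \<beta>_def)
  qed
  have tele: "(\<Sum>j\<in>{-int N..<int N}. f (j + 1) - f j) = f (int N) - f (- int N)" for f :: "int \<Rightarrow> complex" and N
  proof (induction N)
    case (Suc N)
    have "{-int (Suc N)..<int (Suc N)} = insert (-int (Suc N)) (insert (int N) {-int N..<int N})" by auto
    then show ?case using Suc by (simp add: algebra_simps)
  qed simp
  obtain R where R: "path_image \<gamma>\<^sub>A \<subseteq> cball v R" "path_image \<gamma>\<^sub>B \<subseteq> cball v R"
  proof -
    have "bounded (path_image \<gamma>\<^sub>A \<union> path_image \<gamma>\<^sub>B)"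
      using bounded_path_image[OF A(2)] bounded_path_image[OF B(2)] by simp
    then obtain R where "path_image \<gamma>\<^sub>A \<union> path_image \<gamma>\<^sub>B \<subseteq> ball v R"
      using bounded_subset_ballD by blast
    then have "path_image \<gamma>\<^sub>A \<subseteq> cball v R" "path_image \<gamma>\<^sub>B \<subseteq> cball v R" by auto
    then show ?thesis using that by blast
  qed
  define d where "d = p - v"
  define a where "a = Im (cnj px * py)"
  have apos: "a > 0" using orientation by (simp add: a_def)
  have ac: "Im (cnj py * px) = - a" by (simp add: a_def algebra_simps)
  define dx where "dx = Im (cnj px * d)"
  define dy where "dy = Im (cnj py * d)"
  define L where "L = \<bar>dx\<bar> + \<bar>dy\<bar> + cmod px * \<bar>R\<bar> + cmod py * \<bar>R\<bar> + 1"
  (* L bounds the distances to the axes through v of p and of the discs that contain the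
     paths, scaled by the lengths of the periods; the sides of a box of size N are at the
     scaled distance N * a. *)
  obtain N0 :: nat where N0: "L < real N0 * a"
    using reals_Archimedean3[OF apos] by blast
  show "\<exists>N0. \<forall>N>N0. (\<Sum>i\<in>{-int N..<int N}. \<Sum>j\<in>{-int N..<int N}. wind C (p - lat (i, j))) = 1"
  proof (intro exI allI impI)
    fix N assume N: "N0 < N"
    have big: "L < real N * a"
      using N0 N apos by (smt (verit) mult_strict_right_mono of_nat_less_iff)
    have Npos: "2 * N > 0" using N by simp
    have nn: "cmod px * \<bar>R\<bar> \<ge> 0" "cmod py * \<bar>R\<bar> \<ge> 0" by auto
    have bx: "\<bar>dx\<bar> + cmod px * \<bar>R\<bar> < real N * a" "\<bar>dx\<bar> < real N * a"
      and b_y: "\<bar>dy\<bar> + cmod py * \<bar>R\<bar> < real N * a" "\<bar>dy\<bar> < real N * a"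
      using big nn unfolding L_def by linarith+
    have Jx: "Im (cnj px * (d - lat (i, j))) = dx - of_int j * a" for i j
      by (simp add: lattice_vec_def a_def dx_def algebra_simps)
    have Jy: "Im (cnj py * (d - lat (i, j))) = dy + of_int i * a" for i j
      by (simp add: lattice_vec_def a_def dy_def algebra_simps)
    have dl: "p - (v + lat (i, j)) = d - lat (i, j)" for i j by (simp add: d_def)
    have farx: "p - lat (i, j) \<notin> cball v R" if j: "j = int N \<or> j = - int N" for i j
    proof
      assume "p - lat (i, j) \<in> cball v R"
      then have "cmod (d - lat (i, j)) \<le> \<bar>R\<bar>" by (simp add: d_def dist_norm norm_minus_commute algebra_simps)
      then have "\<bar>Im (cnj px * (d - lat (i, j)))\<bar> \<le> cmod px * \<bar>R\<bar>"
        using abs_Im_cnj_mult_le[of px "d - lat (i, j)"] by (meson mult_left_mono norm_ge_zero order_trans)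
      then have "\<bar>dx - of_int j * a\<bar> \<le> cmod px * \<bar>R\<bar>" by (simp only: Jx)
      then show False using j bx b_y by auto
    qed
    have fary: "p - lat (i, j) \<notin> cball v R" if i: "i = int N \<or> i = - int N" for i j
    proof
      assume "p - lat (i, j) \<in> cball v R"
      then have "cmod (d - lat (i, j)) \<le> \<bar>R\<bar>" by (simp add: d_def dist_norm norm_minus_commute algebra_simps)
      then have "\<bar>Im (cnj py * (d - lat (i, j)))\<bar> \<le> cmod py * \<bar>R\<bar>"
        using abs_Im_cnj_mult_le[of py "d - lat (i, j)"] by (meson mult_left_mono norm_ge_zero order_trans)
      then have "\<bar>dy + of_int i * a\<bar> \<le> cmod py * \<bar>R\<bar>" by (simp only: Jy)
      then show False using i bx b_y by auto
    qed
    have off: "winding_number (linepath s t) (p - q) = winding_number (linepath (s + q) (t + q)) p" for s t q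
      unfolding winding_number_offset[of _ "p - q"] winding_number_offset[of _ p]
      by (rule arg_cong2[of _ _ _ _ winding_number]) (auto simp: linepath_def algebra_simps scaleR_conv_of_real)
    have \<alpha>l: "\<alpha> i j = winding_number (linepath (v + lat (i, j)) (v + lat (i + 1, j))) p"
      if "j = int N \<or> j = - int N" for i j
      unfolding \<alpha>_def A(5)[OF psup] winding_number_far[OF A(2) R(1) convex_cball farx[OF that]] A(3,4) off
      using lat_add[of "(i, j)" ex] by (simp add: lat_ex algebra_simps)
    have \<beta>l: "\<beta> i j = winding_number (linepath (v + lat (i, j)) (v + lat (i, j + 1))) p"
      if "i = int N \<or> i = - int N" for i j
      unfolding \<beta>_def B(5)[OF psup] winding_number_far[OF B(2) R(2) convex_cball fary[OF that]] B(3,4) off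
      using lat_add[of "(i, j)" ey] by (simp add: lat_ey algebra_simps)
    have reidx: "(\<Sum>i\<in>{-int N..<int N}. f i) = (\<Sum>k<2 * N. f (int k - int N))" for f :: "int \<Rightarrow> complex"
      by (rule sum.reindex_bij_witness[of _ "\<lambda>k. int k - int N" "\<lambda>i. nat (i + int N)"]) auto
    have reidx': "(\<Sum>i\<in>{-int N..<int N}. f i) = (\<Sum>k<2 * N. f (int N - 1 - int k))" for f :: "int \<Rightarrow> complex"
      by (rule sum.reindex_bij_witness[of _ "\<lambda>k. int N - 1 - int k" "\<lambda>i. nat (int N - 1 - i)"]) auto
    have rev: "- winding_number (linepath s t) p = winding_number (linepath t s) p"
      if "p \<notin> closed_segment s t" for s t
      using that winding_number_reversepath[of "linepath s t" p] by simp
    have lx: "v + lat (i, j) = v + lat (- int N, j) + of_nat k * px" if "i = int k - int N" for i j k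
      unfolding that by (simp add: lattice_vec_def algebra_simps)
    have ly: "v + lat (i, j) = v + lat (i, - int N) + of_nat k * py" if "j = int k - int N" for i j k
      unfolding that by (simp add: lattice_vec_def algebra_simps)
    have lx': "v + lat (i, j) = v + lat (int N, j) + of_nat k * (- px)" if "i = int N - int k" for i j k
      unfolding that by (simp add: lattice_vec_def algebra_simps)
    have ly': "v + lat (i, j) = v + lat (i, int N) + of_nat k * (- py)" if "j = int N - int k" for i j k
      unfolding that by (simp add: lattice_vec_def algebra_simps)
    have bottom: "Re (\<Sum>i\<in>{-int N..<int N}. \<alpha> i (- int N)) \<in> {0<..<1/2}"
    proof -
      let ?a = "v + lat (- int N, - int N)"
      have "Im (cnj px * (p - ?a)) > 0"
        unfolding dl Jx using bx b_y by simp
      note S = winding_number_left_of_line[OF this Npos]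
      have "(\<Sum>i\<in>{-int N..<int N}. \<alpha> i (- int N)) =
        (\<Sum>k<2 * N. winding_number (linepath (?a + of_nat k * px) (?a + of_nat (Suc k) * px)) p)"
        unfolding reidx
      proof (intro sum.cong refl)
        fix k
        show "\<alpha> (int k - int N) (- int N) = winding_number (linepath (?a + of_nat k * px) (?a + of_nat (Suc k) * px)) p"
          using \<alpha>l[of "- int N" "int k - int N"] lx[of "int k - int N" k "- int N"] lx[of "int k - int N + 1" "Suc k" "- int N"]
          by (simp del: of_nat_Suc)
      qed
      then show ?thesis using S by simp
    qed
    have right: "Re (\<Sum>j\<in>{-int N..<int N}. \<beta> (int N) j) \<in> {0<..<1/2}"
    proof -
      let ?a = "v + lat (int N, - int N)"
      have "Im (cnj py * (p - ?a)) > 0"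
        unfolding dl Jy using bx b_y by simp
      note S = winding_number_left_of_line[OF this Npos]
      have "(\<Sum>j\<in>{-int N..<int N}. \<beta> (int N) j) =
        (\<Sum>k<2 * N. winding_number (linepath (?a + of_nat k * py) (?a + of_nat (Suc k) * py)) p)"
        unfolding reidx
      proof (intro sum.cong refl)
        fix k
        show "\<beta> (int N) (int k - int N) = winding_number (linepath (?a + of_nat k * py) (?a + of_nat (Suc k) * py)) p"
          using \<beta>l[of "int N" "int k - int N"] ly[of "int k - int N" k "int N"] ly[of "int k - int N + 1" "Suc k" "int N"]
          by (simp del: of_nat_Suc)
      qed
      then show ?thesis using S by simp
    qed
    have notseg: "p \<notin> closed_segment s t" if "p \<notin> closed_segment t s" for s t
      using that by (simp add: closed_segment_commute)
    have left_off: "p \<notin> closed_segment a (a + w)" if "Im (cnj w * (p - a)) \<noteq> 0" for a w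
    proof
      assume "p \<in> closed_segment a (a + w)"
      then obtain u where "p = (1 - u) *\<^sub>R a + u *\<^sub>R (a + w)" unfolding in_segment by blast
      then have "p - a = of_real u * w" by (simp add: scaleR_conv_of_real algebra_simps)
      then have "Im (cnj w * (p - a)) = Im (cnj w * (of_real u * w))" by (simp only:)
      also have "\<dots> = 0" by (simp add: algebra_simps)
      finally show False using that by simp
    qed
    have top: "Re (\<Sum>i\<in>{-int N..<int N}. - \<alpha> i (int N)) \<in> {0<..<1/2}"
    proof -
      let ?a = "v + lat (int N, int N)"
      have pos: "Im (cnj (- px) * (p - (v + lat (i, int N)))) > 0" for i
      proof -
        have "Im (cnj (- px) * (d - lat (i, int N))) = - (dx - of_int (int N) * a)"
          unfolding Jx[symmetric, of _ i] by simp
        then show ?thesis unfolding dl using bx b_y by simp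
      qed
      note S = winding_number_left_of_line[OF pos Npos]
      have "(\<Sum>i\<in>{-int N..<int N}. - \<alpha> i (int N)) =
        (\<Sum>k<2 * N. winding_number (linepath (?a + of_nat k * (- px)) (?a + of_nat (Suc k) * (- px))) p)"
        unfolding reidx'
      proof (intro sum.cong refl)
        fix k
        have "p \<notin> closed_segment (v + lat (int N - int k, int N)) (v + lat (int N - int k, int N) + (- px))"
          using pos by (intro left_off) (metis less_irrefl)
        moreover have "v + lat (int N - int k, int N) + (- px) = v + lat (int N - 1 - int k, int N)"
          by (simp add: lattice_vec_def algebra_simps)
        ultimately have "p \<notin> closed_segment (v + lat (int N - 1 - int k, int N)) (v + lat (int N - int k, int N))"
          using notseg by metis
        then show "- \<alpha> (int N - 1 - int k) (int N) = winding_number (linepath (?a + of_nat k * (- px)) (?a + of_nat (Suc k) * (- px))) p"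
          using \<alpha>l[of "int N" "int N - 1 - int k"] rev lx'[of "int N - int k" k "int N"]
            lx'[of "int N - 1 - int k" "Suc k" "int N"]
          by (simp del: of_nat_Suc)
      qed
      then show ?thesis using S[of "int N"] by simp
    qed
    have lef: "Re (\<Sum>j\<in>{-int N..<int N}. - \<beta> (- int N) j) \<in> {0<..<1/2}"
    proof -
      let ?a = "v + lat (- int N, int N)"
      have pos: "Im (cnj (- py) * (p - (v + lat (- int N, j)))) > 0" for j
      proof -
        have "Im (cnj (- py) * (d - lat (- int N, j))) = - (dy + of_int (- int N) * a)"
          unfolding Jy[symmetric, of _ j] by simp
        then show ?thesis unfolding dl using bx b_y by simp
      qed
      note S = winding_number_left_of_line[OF pos Npos]
      have "(\<Sum>j\<in>{-int N..<int N}. - \<beta> (- int N) j) =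
        (\<Sum>k<2 * N. winding_number (linepath (?a + of_nat k * (- py)) (?a + of_nat (Suc k) * (- py))) p)"
        unfolding reidx'
      proof (intro sum.cong refl)
        fix k
        have "p \<notin> closed_segment (v + lat (- int N, int N - int k)) (v + lat (- int N, int N - int k) + (- py))"
          using pos by (intro left_off) (metis less_irrefl)
        moreover have "v + lat (- int N, int N - int k) + (- py) = v + lat (- int N, int N - 1 - int k)"
          by (simp add: lattice_vec_def algebra_simps)
        ultimately have "p \<notin> closed_segment (v + lat (- int N, int N - 1 - int k)) (v + lat (- int N, int N - int k))"
          using notseg by metis
        then show "- \<beta> (- int N) (int N - 1 - int k) = winding_number (linepath (?a + of_nat k * (- py)) (?a + of_nat (Suc k) * (- py))) p"
          using \<beta>l[of "- int N" "int N - 1 - int k"] rev ly'[of "int N - int k" k "- int N"]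
            ly'[of "int N - 1 - int k" "Suc k" "- int N"]
          by (simp del: of_nat_Suc)
      qed
      then show ?thesis using S[of "int N"] by simp
    qed
    let ?I = "{-int N..<int N}"
    let ?S = "\<Sum>i\<in>?I. \<Sum>j\<in>?I. wind C (p - lat (i, j))"
    have "?S = (\<Sum>i\<in>?I. \<Sum>j\<in>?I. (\<alpha> i j - \<alpha> i (j + 1))) + (\<Sum>i\<in>?I. \<Sum>j\<in>?I. (\<beta> (i + 1) j - \<beta> i j))"
      unfolding wC sum.distrib[symmetric] by (intro sum.cong refl) (simp add: algebra_simps)
    also have "(\<Sum>i\<in>?I. \<Sum>j\<in>?I. (\<alpha> i j - \<alpha> i (j + 1))) = (\<Sum>i\<in>?I. \<alpha> i (- int N) - \<alpha> i (int N))"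
    proof (intro sum.cong refl)
      fix i
      show "(\<Sum>j\<in>?I. \<alpha> i j - \<alpha> i (j + 1)) = \<alpha> i (- int N) - \<alpha> i (int N)"
        using tele[of "\<lambda>j. - \<alpha> i j" N] by (simp add: algebra_simps)
    qed
    also have "(\<Sum>i\<in>?I. \<Sum>j\<in>?I. (\<beta> (i + 1) j - \<beta> i j)) = (\<Sum>j\<in>?I. \<beta> (int N) j - \<beta> (- int N) j)"
      by (subst sum.swap) (intro sum.cong refl tele)
    finally have S: "?S = (\<Sum>i\<in>?I. \<alpha> i (- int N)) + (\<Sum>i\<in>?I. - \<alpha> i (int N))
        + (\<Sum>j\<in>?I. \<beta> (int N) j) + (\<Sum>j\<in>?I. - \<beta> (- int N) j)"
      by (simp add: sum_subtractf sum_negf)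
    (* Each summand is the winding number of a cycle. *)
    have "?S \<in> \<int>"
    proof (intro Ints_sum)
      fix i j
      show "wind C (p - lat (i, j)) \<in> \<int>"
        using psup edge_support by (intro wind_Ints[OF cyc]) blast
    qed
    then obtain m where m: "?S = of_int m" by (elim Ints_cases)
    have "Re ?S \<in> {0<..<2}" unfolding S plus_complex.sel using bottom top right lef by auto
    then have "m = 1" unfolding m by simp
    then show "?S = 1" using m by simp
  qed
qed

text \<open>On the torus, two loops that generate the fundamental group cut out a fundamental domain, and
  their commutator is its boundary. In the plane, the domain becomes the function
  \<open>g\<close> of winding numbers of the commutator cycle, which may take values other
  than 0 and 1, but whose translates still sum up to one: by \<open>box_winding\<close> at the
  translates of one point, and then at all faces because the translates of the commutator
  cancel.\<close>

lemma fundamental_cycle: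
  obtains A B :: "'e \<Rightarrow> int" and g :: "complex set \<Rightarrow> int" and v where
    "boundary_is A v (v + px)" "boundary_is B v (v + py)"
    "finite {F. g F \<noteq> 0}"
    "\<And>e. A e + translate ex B e - translate ey A e - B e = g (lf e) - g (rf e)"
    "\<And>e. Sum_any (\<lambda>z. g (lf (sh z e))) = 1" "\<And>e. Sum_any (\<lambda>z. g (rf (sh z e))) = 1"
proof -
  define e0 :: 'e where "e0 = undefined"
  define v where "v = white G e0"
  have vx: "v + px \<in> vertices G" "v + py \<in> vertices G" "v \<in> vertices G"
    using white_vertex[of "sh ex e0"] white_vertex[of "sh ey e0"] white_vertex[of e0]
    by (simp_all add: v_def white_shift lat_ex lat_ey)
  have ne: "v \<noteq> v + px" "v \<noteq> v + py" using orientation by auto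
  obtain \<gamma>\<^sub>A A where A: "arc \<gamma>\<^sub>A" "pathstart \<gamma>\<^sub>A = v" "pathfinish \<gamma>\<^sub>A = v + px"
    "path_image \<gamma>\<^sub>A = (\<Union>e\<in>{e. A e \<noteq> 0}. edge e)" "boundary_is A v (v + px)"
    "\<And>p. p \<notin> path_image \<gamma>\<^sub>A \<Longrightarrow> wind A p = winding_number \<gamma>\<^sub>A p"
    using walk_arc[OF vertices_connected[OF vx(3,1)] ne(1)] by metis
  obtain \<gamma>\<^sub>B B where B: "arc \<gamma>\<^sub>B" "pathstart \<gamma>\<^sub>B = v" "pathfinish \<gamma>\<^sub>B = v + py"
    "path_image \<gamma>\<^sub>B = (\<Union>e\<in>{e. B e \<noteq> 0}. edge e)" "boundary_is B v (v + py)"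
    "\<And>p. p \<notin> path_image \<gamma>\<^sub>B \<Longrightarrow> wind B p = winding_number \<gamma>\<^sub>B p"
    using walk_arc[OF vertices_connected[OF vx(3,2)] ne(2)] by metis
  define C where "C = (\<lambda>e. A e + translate ex B e - translate ey A e - B e)"
  obtain p where pl: "p \<in> lf e0" using face_nonempty[OF lf_face] by blast
  then have p: "p \<notin> support G" using face_subset[OF lf_face] by blast
  have wA: "wind A q = winding_number \<gamma>\<^sub>A q" and wB: "wind B q = winding_number \<gamma>\<^sub>B q" if "q \<notin> support G" for q
    using that edge_support A(4,6) B(4,6) by blast+
  note box = box_winding[OF A(5) arc_imp_path[OF A(1)] A(2,3) wA B(5) arc_imp_path[OF B(1)] B(2,3) wB C_def p]
  then have C: "cycle C" by blast
  obtain N0 where N0: "\<And>N. N > N0 \<Longrightarrow> (\<Sum>i\<in>{-int N..<int N}. \<Sum>j\<in>{-int N..<int N}. wind C (p - lat (i, j))) = 1"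
    using box by blast
  obtain g k where g: "finite {F. g F \<noteq> 0}" "\<And>e. C e = g (lf e) - g (rf e)"
    "\<And>F p. F \<in> faces G \<Longrightarrow> p \<in> F \<Longrightarrow> wind C p = of_int (g F) + k"
    "\<exists>R. \<forall>p. norm p > R \<longrightarrow> wind C p = k" "{F. g F \<noteq> 0} \<subseteq> faces G"
    by (rule cycle_bounds[OF C]) (rule that)
  obtain R where R: "\<And>p. norm p > R \<Longrightarrow> wind C p = k" using g(4) by blast
  define u where "u z = g (lf (sh (- z) e0))" for z
  have wu: "wind C (p - lat z) = of_int (u z) + k" for z
  proof -
    have "p - lat z \<in> lf (sh (- z) e0)" using lf_shift_point[OF pl, of "- z"] by (simp add: lat_uminus)
    then show ?thesis unfolding u_def by (rule g(3)[OF lf_face])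
  qed
  have u0: "u z = 0" if "norm (p - lat z) > R" for z
    using wu[of z] R[OF that] by simp
  have finu: "finite {z. u z \<noteq> 0}"
    by (rule finite_subset[OF _ finite_lattice_ball[of p R]]) (use u0 in force)
  define box where "box N = {-int N..<int N} \<times> {-int N..<int N}" for N
  have boxsum: "(\<Sum>i\<in>{-int N..<int N}. \<Sum>j\<in>{-int N..<int N}. wind C (p - lat (i, j))) =
     of_int (\<Sum>z\<in>box N. u z) + of_nat ((2 * N)\<^sup>2) * k" for N
    unfolding sum.cartesian_product box_def
    by (simp add: case_prod_beta wu sum.distrib card_cartesian_product power2_eq_square nat_mult_distrib)
  obtain N1 where N1: "\<And>N. N \<ge> N1 \<Longrightarrow> {z. u z \<noteq> 0} \<subseteq> box N"
  proof -
    define N1 where "N1 = Suc (nat (Max ((\<lambda>z. \<bar>fst z\<bar> + \<bar>snd z\<bar>) ` insert 0 {z. u z \<noteq> 0})))"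
    have "{z. u z \<noteq> 0} \<subseteq> box N" if N: "N \<ge> N1" for N
    proof
      fix z assume z: "z \<in> {z. u z \<noteq> 0}"
      have "\<bar>fst z\<bar> + \<bar>snd z\<bar> \<le> Max ((\<lambda>z. \<bar>fst z\<bar> + \<bar>snd z\<bar>) ` insert 0 {z. u z \<noteq> 0})"
        using finu z by (intro Max_ge) auto
      then have "\<bar>fst z\<bar> + \<bar>snd z\<bar> < int N" using N unfolding N1_def by linarith
      then show "z \<in> box N" unfolding box_def by (cases z) auto
    qed
    then show ?thesis using that by blast
  qed
  have finbox: "finite (box N)" for N by (simp add: box_def)
  have total: "of_int (Sum_any u) + of_nat ((2 * N)\<^sup>2) * k = 1" if "N > N0" "N \<ge> N1" for N
    using N0[OF that(1)] boxsum[of N] Sum_any.expand_superset[OF finbox N1[OF that(2)]] by simp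
  (* The value k at infinity is counted once for every translate in the box, and the sum does
     not depend on the size of the box; so k = 0. *)
  define N where "N = Suc (N0 + N1)"
  have "of_nat ((2 * N)\<^sup>2) * k = of_nat ((2 * Suc N)\<^sup>2) * k"
    using total[of N] total[of "Suc N"] unfolding N_def by (metis add_left_cancel le_add2 le_SucI less_Suc_eq le_add1 le_imp_less_Suc)
  moreover have "(2 * N)\<^sup>2 < (2 * Suc N)\<^sup>2" by (intro power_strict_mono) auto
  ultimately have k0: "k = 0" by (metis mult_cancel_right of_nat_eq_iff less_irrefl)
  have "of_int (Sum_any u) = (1 :: complex)"
    using total[of N] k0 unfolding N_def by (simp add: le_imp_less_Suc)
  then have Su: "Sum_any u = 1" by (metis of_int_eq_1_iff)
  define M where "M e = Sum_any (\<lambda>z. g (lf (sh z e)))" for e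
  define M' where "M' e = Sum_any (\<lambda>z. g (rf (sh z e)))" for e
  have inj_sh: "inj (\<lambda>z. sh z e)" for e by (auto simp: inj_def shift_free)
  have MM: "M e = M' e" for e
  proof -
    define K where "K = {z. g (lf (sh z e)) \<noteq> 0} \<union> {z. g (rf (sh z e)) \<noteq> 0} \<union> {z. A (sh z e) \<noteq> 0} \<union>
       {z. B (sh z e) \<noteq> 0} \<union> {z. translate ex B (sh z e) \<noteq> 0} \<union> {z. translate ey A (sh z e) \<noteq> 0}"
    have fv: "finite {z. h (sh z e) \<noteq> (0::int)}" if "finite {e. h e \<noteq> 0}" for h
      using finite_vimageI[OF that inj_sh] by (simp add: vimage_def)
    have fA: "finite {e. A e \<noteq> 0}" and fB: "finite {e. B e \<noteq> 0}" using A(5) B(5) boundary_is_def by blast+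
    have K: "finite K"
      unfolding K_def using fA fB g(1)
      by (auto intro!: fv finite_support_lf finite_support_rf finite_translate)
    have sumK: "Sum_any h = sum h K" if "{z. h z \<noteq> 0} \<subseteq> K" for h :: "int \<times> int \<Rightarrow> int"
      using K that by (rule Sum_any.expand_superset)
    have tB: "Sum_any (\<lambda>z. translate ex B (sh z e)) = Sum_any (\<lambda>z. B (sh z e))"
      by (rule Sum_any.reindex_cong[of "\<lambda>z. z + ex"])
         (auto intro!: o_bij[of "\<lambda>z. z - ex"] simp: translate_def comp_def simp flip: shift_add)
    have tA: "Sum_any (\<lambda>z. translate ey A (sh z e)) = Sum_any (\<lambda>z. A (sh z e))"
      by (rule Sum_any.reindex_cong[of "\<lambda>z. z + ey"])
         (auto intro!: o_bij[of "\<lambda>z. z - ey"] simp: translate_def comp_def simp flip: shift_add)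
    have "M e - M' e = (\<Sum>z\<in>K. C (sh z e))"
      unfolding M_def M'_def g(2) sum_subtractf by (subst (1 2) sumK) (auto simp: K_def)
    also have "\<dots> = sum (\<lambda>z. A (sh z e)) K + sum (\<lambda>z. translate ex B (sh z e)) K
        - sum (\<lambda>z. translate ey A (sh z e)) K - sum (\<lambda>z. B (sh z e)) K"
      by (simp add: C_def sum_subtractf sum.distrib)
    also have "\<dots> = Sum_any (\<lambda>z. A (sh z e)) + Sum_any (\<lambda>z. translate ex B (sh z e))
        - Sum_any (\<lambda>z. translate ey A (sh z e)) - Sum_any (\<lambda>z. B (sh z e))"
      by (subst (1 2 3 4) sumK) (auto simp: K_def)
    finally show ?thesis unfolding tA tB by simp
  qed
  have const: "M e = M e'" for e e'
  proof (rule edge_function_constant[of M])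
    show "M (rB e) = M e" for e
      using MM[of e] by (simp add: M_def M'_def rf_eq flip: rotB_shift)
    show "M (rW e) = M e" for e
      using MM[of "rW e"] by (simp add: M_def M'_def rf_rotW flip: rotW_shift)
  qed
  have "M e0 = Sum_any u"
    unfolding M_def u_def by (rule Sum_any.reindex_cong[of uminus]) (auto intro!: o_bij[of uminus])
  then have M1: "M e = 1" for e using const[of e e0] Su by simp
  show ?thesis
  proof (rule that[of A v B g])
    show "A e + translate ex B e - translate ey A e - B e = g (lf e) - g (rf e)" for e
      using g(2)[of e] by (simp add: C_def)
    show "Sum_any (\<lambda>z. g (lf (sh z e))) = 1" "Sum_any (\<lambda>z. g (rf (sh z e))) = 1" for e
      using M1[of e] MM[of e] by (simp_all add: M_def M'_def)
  qed (use A B g in auto)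
qed

text \<open>Bilinear relation. A sum over the edges modulo translations of an invariant function becomes a
  sum over all edges against the function \<open>g\<close> of
  \<open>fundamental_cycle\<close>. The terms with the values of \<open>\<eta>\<close> on the
  faces then vanish around each face, and the others involve only the jumps of
  \<open>g\<close>, that is \<open>A\<close> and \<open>B\<close> and their translates, which
  are evaluated by quasi-periodicity.\<close>

theorem periods_of_abel_map:
  fixes \<eta> :: "quad_vertex \<Rightarrow> real" and a :: "'e corner \<Rightarrow> real"
  assumes \<eta>: "abel_eqs a \<eta>" and inv: "track_invariant a" and per: "\<And>z c. a (shc z c) = a c"
    and \<delta>: "\<And>z e. \<eta> (Vertex (white G (sh z e))) = \<eta> (Vertex (white G e)) + \<delta> z"
    "\<And>z e. \<eta> (Vertex (black G (sh z e))) = \<eta> (Vertex (black G e)) + \<delta> z"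
    "\<And>z e. \<eta> (Face (lf (sh z e))) = \<eta> (Face (lf e)) + \<delta> z"
    "\<And>z e. \<eta> (Face (rf (sh z e))) = \<eta> (Face (rf e)) + \<delta> z"
  shows "(\<Sum>r\<in>reps. of_real (a (side_wr G r) - a (side_br G r)) * (black G r - white G r)) =
    of_real (\<delta> ex) * py - of_real (\<delta> ey) * px"
proof -
  obtain A B :: "'e \<Rightarrow> int" and g :: "complex set \<Rightarrow> int" and v where
    A: "boundary_is A v (v + px)" and B: "boundary_is B v (v + py)" and
    g: "finite {F. g F \<noteq> 0}" and
    C: "\<And>e. A e + translate ex B e - translate ey A e - B e = g (lf e) - g (rf e)" and
    M: "\<And>e. Sum_any (\<lambda>z. g (lf (sh z e))) = 1" "\<And>e. Sum_any (\<lambda>z. g (rf (sh z e))) = 1"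
    by (rule fundamental_cycle) (rule that)
  define gc where "gc F = (of_int (g F) :: complex)" for F
  have fg: "finite {F. gc F \<noteq> 0}" using g by (simp add: gc_def)
  have of_int_Sum: "Sum_any (\<lambda>z. of_int (h z)) = (of_int (Sum_any h) :: complex)" for h :: "int \<times> int \<Rightarrow> int"
    unfolding Sum_any.expand_set by simp
  have Mc: "Sum_any (\<lambda>z. gc (lf (sh z e))) = 1" "Sum_any (\<lambda>z. gc (rf (sh z e))) = 1" for e
    unfolding gc_def of_int_Sum by (simp_all add: M)
  (* Only differences of values of the Abel map are invariant under translations, so the mean
     over the ends of the edge is subtracted from the values on the faces. *)
  define mid where "mid e = complex_of_real ((\<eta> (Vertex (black G e)) + \<eta> (Vertex (white G e))) / 2)" for e
  define bw where "bw e = black G e - white G e" for e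
  have bw_sh: "bw (sh z e) = bw e" for z e by (simp add: bw_def black_shift white_shift)
  have mid_sh: "mid (sh z e) = mid e + of_real (\<delta> z)" for z e by (simp add: mid_def \<delta> add_divide_distrib)
  define \<eta>l where "\<eta>l e = complex_of_real (\<eta> (Face (lf e)))" for e
  define \<eta>r where "\<eta>r e = complex_of_real (\<eta> (Face (rf e)))" for e
  have ar: "a (side_wr G e) - a (side_br G e) = \<eta> (Face (rf e)) - \<eta> (Face (lf e))" for e
  proof -
    have "\<eta> (Vertex (black G e)) = \<eta> (Face (lf e)) + a (CornerB (inv rB e))"
      using \<eta> unfolding abel_eqs_def by (metis black_inv_rotB rf_inv_rotB)
    moreover have "\<eta> (Vertex (black G e)) = \<eta> (Face (rf e)) + a (CornerB e)"
      using \<eta> unfolding abel_eqs_def by blast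
    moreover have "a (CornerB (inv rB e)) = a (side_wr G e)"
      using track_invariantD(2)[OF inv, of e] by (simp add: side_wr_def)
    ultimately show ?thesis by (simp add: side_br_def)
  qed
  have supl: "finite {e. gc (lf e) \<noteq> 0}" and supr: "finite {e. gc (rf e) \<noteq> 0}"
    using finite_support_lf[OF fg] finite_support_rf[OF fg] by auto
  define K where "K = {e. gc (lf e) \<noteq> 0} \<union> {e. gc (rf e) \<noteq> 0}"
  have K: "finite K" using supl supr by (simp add: K_def)
  have sumK: "Sum_any h = sum h K" if "{e. h e \<noteq> 0} \<subseteq> K" for h :: "'e \<Rightarrow> complex"
    using K that by (rule Sum_any.expand_superset)
  have L: "(\<Sum>r\<in>reps. (\<eta>l r - mid r) * bw r) = Sum_any (\<lambda>e. gc (lf e) * ((\<eta>l e - mid e) * bw e))"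
    using Sum_any_unfold[OF supl, of "\<lambda>e. (\<eta>l e - mid e) * bw e"]
    by (simp add: Mc mid_sh bw_sh \<eta>l_def \<delta>(3))
  have Rr: "(\<Sum>r\<in>reps. (\<eta>r r - mid r) * bw r) = Sum_any (\<lambda>e. gc (rf e) * ((\<eta>r e - mid e) * bw e))"
    using Sum_any_unfold[OF supr, of "\<lambda>e. (\<eta>r e - mid e) * bw e"]
    by (simp add: Mc mid_sh bw_sh \<eta>r_def \<delta>(4))
  have "(\<Sum>r\<in>reps. of_real (a (side_wr G r) - a (side_br G r)) * (black G r - white G r)) =
      (\<Sum>r\<in>reps. (\<eta>r r - mid r) * bw r) - (\<Sum>r\<in>reps. (\<eta>l r - mid r) * bw r)"
    unfolding sum_subtractf[symmetric]
    by (intro sum.cong refl) (simp add: ar \<eta>r_def \<eta>l_def bw_def algebra_simps)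
  also have "\<dots> = (\<Sum>e\<in>K. (gc (rf e) * \<eta>r e - gc (lf e) * \<eta>l e) * bw e) + (\<Sum>e\<in>K. (gc (lf e) - gc (rf e)) * (mid e * bw e))"
    unfolding L Rr sum.distrib[symmetric]
    by (subst (1 2) sumK) (auto simp: K_def sum_subtractf[symmetric] algebra_simps intro!: sum.cong)
  also have "(\<Sum>e\<in>K. (gc (rf e) * \<eta>r e - gc (lf e) * \<eta>l e) * bw e) = 0"
  proof -
    define H where "H F = gc F * complex_of_real (\<eta> (Face F))" for F
    have fH: "finite {F. H F \<noteq> 0}"
      by (rule finite_subset[OF _ fg]) (auto simp: H_def)
    have "(\<Sum>e\<in>K. (gc (rf e) * \<eta>r e - gc (lf e) * \<eta>l e) * bw e) = - (\<Sum>e\<in>K. (H (lf e) - H (rf e)) * bw e)"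
      unfolding sum_negf[symmetric] by (intro sum.cong refl) (simp add: H_def \<eta>r_def \<eta>l_def algebra_simps)
    also have "(\<Sum>e\<in>K. (H (lf e) - H (rf e)) * bw e) = Sum_any (\<lambda>e. (H (lf e) - H (rf e)) * bw e)"
      by (subst sumK) (auto simp: K_def H_def)
    also have "\<dots> = Sum_any (\<lambda>e. H (lf e) * (bw e - bw (inv rB e)))" by (rule Sum_any_jump[OF fH])
    also have "\<dots> = Sum_any (\<lambda>e. H (lf e) * ((- white G e) - (- white G (nx e))))"
      by (rule arg_cong[of _ _ Sum_any]) (simp add: bw_def white_nx)
    also have "\<dots> = 0" by (rule Sum_any_telescope[OF fH])
    finally show ?thesis by simp
  qed
  also have "(\<Sum>e\<in>K. (gc (lf e) - gc (rf e)) * (mid e * bw e)) = of_real (\<delta> ex) * py - of_real (\<delta> ey) * px"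
  proof -
    define \<psi> where "\<psi> e = mid e * bw e" for e
    have affine: "pairing c (\<lambda>e. (mid e + d) * bw e) = pairing c \<psi> + d * pairing c bw"
      if "finite {e. c e \<noteq> 0}" for c d
      unfolding pairing_support[OF that] \<psi>_def
      by (simp add: algebra_simps sum.distrib sum_distrib_left)
    have bw: "bw = (\<lambda>e. black G e - white G e)" by (simp add: bw_def fun_eq_iff)
    have fA: "finite {e. A e \<noteq> 0}" and fB: "finite {e. B e \<noteq> 0}" using A B boundary_is_def by blast+
    note ftA = finite_translate[OF fA, of ey] and ftB = finite_translate[OF fB, of ex]
    define Q where "Q = K \<union> {e. A e \<noteq> 0} \<union> {e. B e \<noteq> 0} \<union> {e. translate ex B e \<noteq> 0} \<union> {e. translate ey A e \<noteq> 0}"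
    have Q: "finite Q" using K fA fB ftA ftB by (simp add: Q_def)
    have pQ: "pairing c h = (\<Sum>e\<in>Q. of_int (c e) * h e)" if "{e. c e \<noteq> 0} \<subseteq> Q" for c h
      by (rule pairing_superset[OF Q that])
    have "(\<Sum>e\<in>K. (gc (lf e) - gc (rf e)) * (mid e * bw e)) = (\<Sum>e\<in>Q. (gc (lf e) - gc (rf e)) * \<psi> e)"
      unfolding \<psi>_def[symmetric] using Q by (intro sum.mono_neutral_left) (auto simp: Q_def K_def)
    also have "\<dots> = (\<Sum>e\<in>Q. of_int (A e + translate ex B e - translate ey A e - B e) * \<psi> e)"
      unfolding C by (simp add: gc_def)
    also have "\<dots> = (\<Sum>e\<in>Q. of_int (A e) * \<psi> e) + (\<Sum>e\<in>Q. of_int (translate ex B e) * \<psi> e)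
        - (\<Sum>e\<in>Q. of_int (translate ey A e) * \<psi> e) - (\<Sum>e\<in>Q. of_int (B e) * \<psi> e)"
      by (simp add: sum.distrib sum_subtractf algebra_simps)
    also have "\<dots> = pairing A \<psi> + pairing (translate ex B) \<psi> - pairing (translate ey A) \<psi> - pairing B \<psi>"
      by (subst (1 2 3 4) pQ) (auto simp: Q_def)
    also have "pairing (translate ex B) \<psi> = pairing B \<psi> + of_real (\<delta> ex) * py"
    proof -
      have "pairing B bw = py"
        using B[unfolded boundary_is_def, THEN conjunct2, THEN spec, of "\<lambda>x. x"] by (simp add: bw)
      then show ?thesis
        unfolding pairing_translate using affine[OF fB] by (simp add: \<psi>_def bw_sh mid_sh)
    qed
    also have "pairing (translate ey A) \<psi> = pairing A \<psi> + of_real (\<delta> ey) * px"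
    proof -
      have "pairing A bw = px"
        using A[unfolded boundary_is_def, THEN conjunct2, THEN spec, of "\<lambda>x. x"] by (simp add: bw)
      then show ?thesis
        unfolding pairing_translate using affine[OF fA] by (simp add: \<psi>_def bw_sh mid_sh)
    qed
    finally show ?thesis by simp
  qed
  finally show ?thesis by simp
qed

corollary weighted_classes_periods:
  fixes \<alpha> :: "'e corner set set \<Rightarrow> real"
  assumes "abel_eqs (\<lambda>c. \<alpha> (ttrack c)) \<eta>"
    "\<And>z e. \<eta> (Vertex (white G (sh z e))) = \<eta> (Vertex (white G e)) + \<delta> z"
    "\<And>z e. \<eta> (Vertex (black G (sh z e))) = \<eta> (Vertex (black G e)) + \<delta> z"
    "\<And>z e. \<eta> (Face (lf (sh z e))) = \<eta> (Face (lf e)) + \<delta> z"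
    "\<And>z e. \<eta> (Face (rf (sh z e))) = \<eta> (Face (rf e)) + \<delta> z"
  shows "(\<Sum>T\<in>torus_tracks G. \<alpha> T * of_int (fst (track_class G T))) = - \<delta> ey"
    "(\<Sum>T\<in>torus_tracks G. \<alpha> T * of_int (snd (track_class G T))) = \<delta> ex"
proof -
  define X where "X = (\<Sum>T\<in>torus_tracks G. \<alpha> T * of_int (fst (track_class G T)))"
  define Y where "Y = (\<Sum>T\<in>torus_tracks G. \<alpha> T * of_int (snd (track_class G T)))"
  have "(\<Sum>T\<in>torus_tracks G. complex_of_real (\<alpha> T) * lat (track_class G T)) = of_real (\<delta> ex) * py - of_real (\<delta> ey) * px"
    using weighted_sum_of_classes[of "\<lambda>T. complex_of_real (\<alpha> T)"]
      periods_of_abel_map[OF assms(1) _ _ assms(2-5)]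
    by (simp add: track_invariantI)
  moreover have "(\<Sum>T\<in>torus_tracks G. complex_of_real (\<alpha> T) * lat (track_class G T)) = of_real X * px + of_real Y * py"
    unfolding lat_real X_def Y_def of_real_sum sum_distrib_right sum.distrib[symmetric]
    by (intro sum.cong refl) (simp add: algebra_simps)
  ultimately have "of_real (X + \<delta> ey) * px + of_real (Y - \<delta> ex) * py = 0"
    by (simp add: algebra_simps)
  then have "X + \<delta> ey = 0 \<and> Y - \<delta> ex = 0" by (rule periods_independent)
  then show "X = - \<delta> ey" "Y = \<delta> ex" by auto
qed

end

section \<open>Theta series\<close>

definition Theta_term :: "real \<Rightarrow> complex \<Rightarrow> int \<Rightarrow> complex" where
  "Theta_term c z n = exp (- of_real c * of_int n ^ 2 + of_int n * z)"

text \<open>The Jacobi theta series with nome \<open>exp (- c)\<close>. Up to an exponential factor,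
  \<open>theta\<close> is this series at a shifted argument (\<open>Theta_pairing\<close>);
  positivity is easier to see in the bilateral series.\<close>

definition Theta :: "real \<Rightarrow> complex \<Rightarrow> complex" where
  "Theta c z = infsum (Theta_term c z) UNIV"

lemma norm_Theta_term: "norm (Theta_term c z n) = exp (- c * of_int n ^ 2 + of_int n * Re z)"
  by (simp add: Theta_term_def norm_exp_eq_Re power2_eq_square)

lemma summable_gauss:
  assumes "c > 0"
  shows "summable (\<lambda>n. exp (- c * real n ^ 2 + real n * y))"
proof -
  obtain N :: nat where N: "(\<bar>y\<bar> + 1) / c < real N" using reals_Archimedean2 by blast
  show ?thesis
  proof (rule summable_comparison_test)
    show "\<exists>N. \<forall>n\<ge>N. norm (exp (- c * real n ^ 2 + real n * y)) \<le> exp (- 1) ^ n"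
    proof (intro exI allI impI)
      fix n assume "N \<le> n"
      then have "(\<bar>y\<bar> + 1) / c < real n" using N by linarith
      then have "\<bar>y\<bar> + 1 < c * real n" using assms by (simp add: field_simps)
      then have "- c * real n + y \<le> - 1" by linarith
      then have "real n * (- c * real n + y) \<le> real n * (- 1)" by (intro mult_left_mono) auto
      then have "- c * real n ^ 2 + real n * y \<le> - real n" by (simp add: power2_eq_square algebra_simps)
      moreover have "exp (- 1 :: real) ^ n = exp (- real n)" by (simp flip: exp_of_nat_mult)
      ultimately show "norm (exp (- c * real n ^ 2 + real n * y)) \<le> exp (- 1) ^ n" by simp
    qed
    show "summable (\<lambda>n. exp (- 1 :: real) ^ n)" by (intro summable_geometric) simp
  qed
qed

lemma int_nat_split: "(UNIV :: int set) = range int \<union> range (\<lambda>k. - 1 - int k)"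
proof -
  have "n \<in> range int \<union> range (\<lambda>k. - 1 - int k)" for n :: int
  proof (cases "n \<ge> 0")
    case True then show ?thesis by (metis UnI1 nonneg_int_cases rangeI)
  next
    case False
    then have "n = - 1 - int (nat (- 1 - n))" by simp
    then show ?thesis by blast
  qed
  then show ?thesis by auto
qed

lemma inj_int_neg: "inj (\<lambda>k. - 1 - int k)"
  by (auto simp: inj_def)

lemma Theta_summable:
  assumes "c > 0"
  shows "Theta_term c z summable_on UNIV"
proof -
  have n1: "summable (\<lambda>n. norm (Theta_term c z (int n)))"
    using summable_gauss[OF assms, of "Re z"] by (simp add: norm_Theta_term)
  have "norm (Theta_term c z (- 1 - int k)) = exp (- c * real (Suc k) ^ 2 + real (Suc k) * (- Re z))" for k
    unfolding norm_Theta_term by (simp add: power2_eq_square algebra_simps)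
  then have n2: "summable (\<lambda>k. norm (Theta_term c z (- 1 - int k)))"
    using summable_Suc_iff[of "\<lambda>n. exp (- c * real n ^ 2 + real n * (- Re z))"]
      summable_gauss[OF assms, of "- Re z"] by simp
  have "Theta_term c z summable_on range int"
    using norm_summable_imp_summable_on[OF n1] by (subst summable_on_reindex) (auto simp: o_def)
  moreover have "Theta_term c z summable_on range (\<lambda>k. - 1 - int k)"
    using norm_summable_imp_summable_on[OF n2] inj_int_neg by (subst summable_on_reindex) (auto simp: o_def)
  ultimately show ?thesis
    unfolding int_nat_split by (rule summable_on_Un_disjoint) auto
qed

lemma infsum_int_split:
  fixes f :: "int \<Rightarrow> complex"
  assumes f: "f summable_on UNIV"
  shows "summable (\<lambda>k. f (int k) + f (- 1 - int k))"
    "infsum f UNIV = suminf (\<lambda>k. f (int k) + f (- 1 - int k))"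
proof -
  have s1: "f summable_on range int" and s2: "f summable_on range (\<lambda>k. - 1 - int k)"
    using f summable_on_subset_banach by blast+
  have t1: "(\<lambda>k. f (int k)) summable_on UNIV"
    using s1 by (subst (asm) summable_on_reindex) (auto simp: o_def)
  have t2: "(\<lambda>k. f (- 1 - int k)) summable_on UNIV"
    using s2 inj_int_neg by (subst (asm) summable_on_reindex) (auto simp: o_def)
  have "infsum f UNIV = infsum f (range int) + infsum f (range (\<lambda>k. - 1 - int k))"
    by (subst int_nat_split, rule infsum_Un_disjoint[OF s1 s2]) auto
  also have "infsum f (range int) = infsum (\<lambda>k. f (int k)) UNIV"
    by (subst infsum_reindex) (auto simp: o_def)
  also have "infsum f (range (\<lambda>k. - 1 - int k)) = infsum (\<lambda>k. f (- 1 - int k)) UNIV"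
    using inj_int_neg by (subst infsum_reindex) (auto simp: o_def)
  also have "infsum (\<lambda>k. f (int k)) UNIV + infsum (\<lambda>k. f (- 1 - int k)) UNIV =
     infsum (\<lambda>k. f (int k) + f (- 1 - int k)) UNIV"
    by (rule infsum_add[OF t1 t2, symmetric])
  finally have *: "infsum f UNIV = infsum (\<lambda>k. f (int k) + f (- 1 - int k)) UNIV" .
  have "((\<lambda>k. f (int k) + f (- 1 - int k)) has_sum infsum (\<lambda>k. f (int k) + f (- 1 - int k)) UNIV) UNIV"
    using summable_on_add[OF t1 t2] by (rule has_sum_infsum)
  then have "(\<lambda>k. f (int k) + f (- 1 - int k)) sums infsum f UNIV"
    unfolding * by (rule has_sum_imp_sums)
  then show "summable (\<lambda>k. f (int k) + f (- 1 - int k))"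
    "infsum f UNIV = suminf (\<lambda>k. f (int k) + f (- 1 - int k))"
    by (auto simp: sums_iff)
qed

lemma infsum_int_product:
  fixes f g :: "int \<Rightarrow> complex"
  assumes f: "f summable_on UNIV" and g: "g summable_on UNIV"
  shows "(\<lambda>(m, n). f m * g n) summable_on UNIV"
    "infsum (\<lambda>(m, n). f m * g n) UNIV = infsum f UNIV * infsum g UNIV"
proof -
  have af: "(\<lambda>x. norm (f x)) summable_on UNIV" and ag: "(\<lambda>x. norm (g x)) summable_on UNIV"
    using f g summable_on_iff_abs_summable_on_complex by blast+
  have "(\<lambda>p. norm (case p of (m, n) \<Rightarrow> f m * g n)) summable_on (SIGMA m:UNIV. UNIV)"
    unfolding Infinite_Sum.abs_summable_on_Sigma_iff
  proof (intro conjI ballI)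
    show "(\<lambda>y. norm (case (x, y) of (m, n) \<Rightarrow> f m * g n)) summable_on UNIV" for x
      using summable_on_cmult_right[OF ag, of "norm (f x)"] by (simp add: norm_mult)
    have "(\<lambda>x. norm (f x) * infsum (\<lambda>y. norm (g y)) UNIV) summable_on UNIV"
      using af by (rule summable_on_cmult_left)
    then show "(\<lambda>x. norm (\<Sum>\<^sub>\<infinity>y\<in>UNIV. norm (case (x, y) of (m, n) \<Rightarrow> f m * g n))) summable_on UNIV"
      by (simp add: norm_mult infsum_cmult_right' infsum_nonneg)
  qed
  then have s: "(\<lambda>(m, n). f m * g n) summable_on (SIGMA m:UNIV. UNIV)"
    by (rule abs_summable_summable)
  then show "(\<lambda>(m, n). f m * g n) summable_on UNIV" by simp
  show "infsum (\<lambda>(m, n). f m * g n) UNIV = infsum f UNIV * infsum g UNIV"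
    using infsum_Sigma_banach[OF s] by (simp add: infsum_cmult_right' infsum_cmult_left')
qed

lemma exp_i_pi_int: "exp (of_int n * (\<i> * of_real pi)) = (if even n then 1 else - 1)"
proof -
  have "exp (of_int n * (\<i> * of_real pi)) = cis (pi * of_int n)"
    by (simp add: cis_conv_exp algebra_simps)
  also have "\<dots> = (if even n then 1 else - 1)"
  proof (cases "even n")
    case True
    then obtain k where "n = 2 * k" by blast
    then have "cis (pi * of_int n) = cis (2 * pi * of_int k)" by (simp add: algebra_simps)
    also have "\<dots> = 1" by (simp add: complex_eq_iff cos_int_2pin sin_int_2pin)
    finally show ?thesis using True by simp
  next
    case False
    then obtain k where k: "n = 2 * k + 1" by (elim oddE)
    have "cis (pi * of_int n) = cis (2 * pi * of_int k) * cis pi"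
      unfolding cis_mult k by (simp add: algebra_simps)
    also have "cis (2 * pi * of_int k) = 1"
      by (simp add: complex_eq_iff cos_int_2pin sin_int_2pin)
    finally show ?thesis using False by simp
  qed
  finally show ?thesis .
qed

text \<open>Landen's transformation: in the double series of the product on the left, exchanging \<open>m\<close>
  and \<open>n\<close> cancels the terms with \<open>m + n\<close> odd.\<close>

lemma Theta_duplication:
  assumes c: "c > 0"
  shows "Theta c z * Theta c (z + \<i> * of_real pi) =
    Theta (2 * c) (- \<i> * of_real pi) * Theta (2 * c) (2 * z + \<i> * of_real pi)"
proof -
  define F where "F = (\<lambda>(m, n). Theta_term c z m * Theta_term c (z + \<i> * of_real pi) n)"
  have sF: "F summable_on UNIV" and iF: "infsum F UNIV = Theta c z * Theta c (z + \<i> * of_real pi)"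
    unfolding F_def Theta_def using infsum_int_product Theta_summable[OF c] by blast+
  define E where "E = {p :: int \<times> int. even (fst p + snd p)}"
  have Fsgn: "F (m, n) = exp (- of_real c * (of_int m ^ 2 + of_int n ^ 2) + (of_int m + of_int n) * z) * (if even n then 1 else - 1)" for m n
  proof -
    have "F (m, n) = exp (- of_real c * (of_int m ^ 2 + of_int n ^ 2) + (of_int m + of_int n) * z) * exp (of_int n * (\<i> * of_real pi))"
      unfolding F_def Theta_term_def by (simp add: algebra_simps flip: exp_add)
    then show ?thesis by (simp only: exp_i_pi_int)
  qed
  have sE: "F summable_on E" and sO: "F summable_on - E"
    using sF summable_on_subset_banach by blast+
  have split: "infsum F UNIV = infsum F E + infsum F (- E)"
    using infsum_Un_disjoint[OF sE sO] by simp
  have "infsum F (- E) = infsum (\<lambda>p. F (prod.swap p)) (- E)"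
    by (rule infsum_reindex_bij_betw[symmetric]) (rule bij_betwI[of _ _ _ prod.swap], auto simp: E_def)
  also have "\<dots> = infsum (\<lambda>p. - F p) (- E)"
  proof (rule infsum_cong)
    fix p assume "p \<in> - E"
    then have "odd (fst p + snd p)" by (simp add: E_def)
    then show "F (prod.swap p) = - F p"
      by (cases p) (auto simp: Fsgn add.commute)
  qed
  finally have "infsum F (- E) = - infsum F (- E)" by (simp add: infsum_uminus)
  then have O0: "infsum F (- E) = 0" by simp
  define h where "h = (\<lambda>(r :: int, s :: int). (s + r, s - r))"
  have bij: "bij_betw h UNIV E"
    by (rule bij_betwI[of _ _ _ "\<lambda>(m, n). ((m - n) div 2, (m + n) div 2)"])
       (auto simp: h_def E_def elim!: evenE, presburger+)
  have "infsum F E = infsum (\<lambda>p. F (h p)) UNIV"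
    by (rule infsum_reindex_bij_betw[OF bij, symmetric])
  also have "(\<lambda>p. F (h p)) = (\<lambda>(r, s). Theta_term (2 * c) (- \<i> * of_real pi) r * Theta_term (2 * c) (2 * z + \<i> * of_real pi) s)"
  proof (rule ext, clarify)
    fix r s :: int
    show "F (h (r, s)) = Theta_term (2 * c) (- \<i> * of_real pi) r * Theta_term (2 * c) (2 * z + \<i> * of_real pi) s"
      unfolding F_def h_def Theta_term_def
      by (simp flip: exp_add) (simp add: algebra_simps power2_eq_square)
  qed
  also have "infsum \<dots> UNIV = Theta (2 * c) (- \<i> * of_real pi) * Theta (2 * c) (2 * z + \<i> * of_real pi)"
    unfolding Theta_def using c by (intro infsum_int_product Theta_summable) auto
  finally show ?thesis using split O0 iF by simp
qed

text \<open>The terms with odd index cancel.\<close>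

lemma Theta_even_part:
  assumes c: "c > 0"
  shows "Theta c z + Theta c (z + \<i> * of_real pi) = 2 * Theta (4 * c) (2 * z)"
proof -
  have "Theta c z + Theta c (z + \<i> * of_real pi) =
      infsum (\<lambda>n. Theta_term c z n + Theta_term c (z + \<i> * of_real pi) n) UNIV"
    unfolding Theta_def by (rule infsum_add[symmetric]) (rule Theta_summable[OF c])+
  also have "\<dots> = infsum (\<lambda>n. 2 * Theta_term c z n) (range (\<lambda>n. 2 * n))"
  proof (rule infsum_cong_neutral)
    have t: "Theta_term c (z + \<i> * of_real pi) n = Theta_term c z n * (if even n then 1 else - 1)" for n
    proof -
      have "Theta_term c (z + \<i> * of_real pi) n = Theta_term c z n * exp (of_int n * (\<i> * of_real pi))"
        unfolding Theta_term_def by (simp add: algebra_simps flip: exp_add)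
      then show ?thesis by (simp only: exp_i_pi_int)
    qed
    fix n :: int
    show "n \<in> UNIV - range (\<lambda>n. 2 * n) \<Longrightarrow> Theta_term c z n + Theta_term c (z + \<i> * of_real pi) n = 0"
      unfolding t by (auto elim!: evenE)
    show "n \<in> UNIV \<inter> range (\<lambda>n. 2 * n) \<Longrightarrow> Theta_term c z n + Theta_term c (z + \<i> * of_real pi) n = 2 * Theta_term c z n"
      unfolding t by auto
  qed auto
  also have "\<dots> = infsum (\<lambda>n. 2 * Theta_term (4 * c) (2 * z) n) UNIV"
  proof (subst infsum_reindex)
    show "inj (\<lambda>n :: int. 2 * n)" by (auto simp: inj_def)
    show "infsum ((\<lambda>n. 2 * Theta_term c z n) \<circ> (\<lambda>n. 2 * n)) UNIV = infsum (\<lambda>n. 2 * Theta_term (4 * c) (2 * z) n) UNIV"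
      by (rule infsum_cong) (simp add: Theta_term_def algebra_simps power2_eq_square)
  qed
  finally show ?thesis by (simp add: Theta_def infsum_cmult_right')
qed

lemma Theta_shift:
  "Theta c (z - 2 * of_real c) = exp (of_real c - z) * Theta c z"
proof -
  have "Theta c (z - 2 * of_real c) = infsum (\<lambda>n. exp (of_real c - z) * Theta_term c z (n + 1)) UNIV"
    unfolding Theta_def
    by (rule infsum_cong) (simp add: Theta_term_def algebra_simps power2_eq_square flip: exp_add)
  also have "\<dots> = exp (of_real c - z) * infsum (\<lambda>n. Theta_term c z (n + 1)) UNIV"
    by (rule infsum_cmult_right')
  also have "infsum (\<lambda>n. Theta_term c z (n + 1)) UNIV = infsum (Theta_term c z) UNIV"
    by (rule infsum_reindex_bij_betw) (rule bij_betwI[of _ _ _ "\<lambda>n. n - 1"], auto)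
  finally show ?thesis by (simp add: Theta_def)
qed

text \<open>The terms of index \<open>k\<close> and \<open>- 1 - k\<close> of the bilateral series combine
  into a sine.\<close>

lemma Theta_pairing:
  assumes c: "c > 0"
  shows "summable (\<lambda>k. (-1) ^ k * exp (- of_real c * (of_nat k ^ 2 + of_nat k)) * sin ((2 * of_nat k + 1) * u))"
    "Theta c (2 * \<i> * u - of_real c + \<i> * of_real pi) = exp (- \<i> * u) * (2 * \<i>) *
      suminf (\<lambda>k. (-1) ^ k * exp (- of_real c * (of_nat k ^ 2 + of_nat k)) * sin ((2 * of_nat k + 1) * u))"
proof -
  define z where "z = 2 * \<i> * u - of_real c + \<i> * of_real pi"
  define s where "s k = (-1) ^ k * exp (- of_real c * (of_nat k ^ 2 + of_nat k)) * sin ((2 * of_nat k + 1) * u)" for k :: nat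
  define d where "d = exp (- \<i> * u) * (2 * \<i>)"
  have T: "Theta_term c z n = (if even n then 1 else - 1) * (exp (- of_real c * (of_int n ^ 2 + of_int n)) * exp (2 * of_int n * \<i> * u))" for n
  proof -
    have "Theta_term c z n = exp (of_int n * (\<i> * of_real pi)) * (exp (- of_real c * (of_int n ^ 2 + of_int n)) * exp (2 * of_int n * \<i> * u))"
      unfolding Theta_term_def z_def by (simp add: algebra_simps flip: exp_add)
    then show ?thesis by (simp only: exp_i_pi_int)
  qed
  have pair: "Theta_term c z (int k) + Theta_term c z (- 1 - int k) = d * s k" for k
  proof -
    have sq: "(of_int (- 1 - int k) ^ 2 + of_int (- 1 - int k) :: complex) = of_nat k ^ 2 + of_nat k"
      by (simp add: power2_eq_square algebra_simps)
    have par: "even (- 1 - int k) \<longleftrightarrow> odd k" by simp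
    have "Theta_term c z (int k) + Theta_term c z (- 1 - int k) =
       (-1) ^ k * exp (- of_real c * (of_nat k ^ 2 + of_nat k)) *
         (exp (2 * of_nat k * \<i> * u) - exp (2 * of_int (- 1 - int k) * \<i> * u))"
      unfolding T sq par by (auto simp: algebra_simps)
    also have "exp (2 * of_nat k * \<i> * u) - exp (2 * of_int (- 1 - int k) * \<i> * u) =
       exp (- \<i> * u) * (exp (\<i> * ((2 * of_nat k + 1) * u)) - exp (- (\<i> * ((2 * of_nat k + 1) * u))))"
      by (simp add: algebra_simps flip: exp_add)
    also have "exp (\<i> * ((2 * of_nat k + 1) * u)) - exp (- (\<i> * ((2 * of_nat k + 1) * u))) = 2 * \<i> * sin ((2 * of_nat k + 1) * u)"
      by (simp add: sin_exp_eq)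
    finally show ?thesis unfolding d_def s_def by (simp only: ac_simps)
  qed
  have d0: "d \<noteq> 0" by (simp add: d_def)
  note split = infsum_int_split[OF Theta_summable[OF c, of z], unfolded pair]
  show "summable (\<lambda>k. (-1) ^ k * exp (- of_real c * (of_nat k ^ 2 + of_nat k)) * sin ((2 * of_nat k + 1) * u))"
    using split(1) d0 unfolding s_def[symmetric] by (simp add: summable_cmult_iff)
  then have "summable s" unfolding s_def .
  then have "suminf (\<lambda>k. d * s k) = d * suminf s" by (rule suminf_mult)
  then show "Theta c (2 * \<i> * u - of_real c + \<i> * of_real pi) = exp (- \<i> * u) * (2 * \<i>) *
      suminf (\<lambda>k. (-1) ^ k * exp (- of_real c * (of_nat k ^ 2 + of_nat k)) * sin ((2 * of_nat k + 1) * u))"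
    using split(2) unfolding s_def[symmetric] d_def[symmetric] Theta_def[symmetric] z_def[symmetric] by simp
qed

lemma geometric_tail_lt_half:
  assumes "q \<ge> 0" "q < 1 / (3 :: real)"
  shows "summable (\<lambda>k. q ^ Suc k)" "suminf (\<lambda>k. q ^ Suc k) < 1 / 2"
proof -
  have s: "(\<lambda>k. q ^ Suc k) sums (q * (1 / (1 - q)))"
    using sums_mult[OF geometric_sums[of q], of q] assms by simp
  then show "summable (\<lambda>k. q ^ Suc k)" by (rule sums_summable)
  have "q * (1 / (1 - q)) < 1 / 2" using assms by (simp add: field_simps)
  then show "suminf (\<lambda>k. q ^ Suc k) < 1 / 2" using s sums_unique by metis
qed

subsection \<open>Positivity and non-vanishing\<close>

lemma Theta_imaginary_real: "Im (Theta c (\<i> * of_real y)) = 0"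
proof -
  have "cnj (Theta c (\<i> * of_real y)) = infsum (\<lambda>n. cnj (Theta_term c (\<i> * of_real y) n)) UNIV"
    unfolding Theta_def by (rule infsum_cnj[symmetric])
  also have "\<dots> = infsum (\<lambda>n. Theta_term c (\<i> * of_real y) (- n)) UNIV"
    by (rule infsum_cong) (simp add: Theta_term_def exp_cnj algebra_simps)
  also have "\<dots> = Theta c (\<i> * of_real y)"
    unfolding Theta_def by (rule infsum_reindex_bij_betw) (rule bij_betwI[of _ _ _ uminus], auto)
  finally show ?thesis by (metis Im_complex_of_real complex_cnj_cancel_iff cnj.sel(2) complex_eq_iff neg_equal_zero)
qed

text \<open>The term of index 0 is larger than all others together.\<close>

lemma Theta_imaginary_pos_large:
  assumes "c > ln 3"
  shows "Re (Theta c (\<i> * of_real y)) > 0"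
proof -
  have c: "c > 0" using assms by (meson less_trans ln_gt_zero one_less_numeral_iff semiring_norm(77))
  define f where "f = Theta_term c (\<i> * of_real y)"
  define q where "q = exp (- c)"
  have q: "q \<ge> 0" "q < 1 / 3"
  proof -
    have "exp (- c) < exp (- ln 3)" using assms by simp
    then show "q < 1 / 3" by (simp add: q_def exp_minus inverse_eq_divide)
  qed (simp add: q_def)
  have nf: "norm (f n) = exp (- c * of_int n ^ 2)" for n by (simp add: f_def norm_Theta_term)
  have s: "f summable_on UNIV" unfolding f_def by (rule Theta_summable[OF c])
  have s1: "summable (\<lambda>k. norm (f (int k)))"
    using summable_gauss[OF c, of 0] by (simp add: nf)
  have bound: "norm (f (int (Suc k))) \<le> q ^ Suc k" "norm (f (- 1 - int k)) \<le> q ^ Suc k" for k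
  proof -
    have le: "real (Suc k) \<le> real (Suc k) ^ 2" by (simp add: power2_eq_square)
    have "exp (- c * real (Suc k) ^ 2) \<le> exp (- c * real (Suc k))" using c le by simp
    also have "\<dots> = q ^ Suc k" unfolding q_def by (simp add: exp_of_nat_mult[symmetric] algebra_simps del: power_Suc)
    finally have *: "exp (- c * real (Suc k) ^ 2) \<le> q ^ Suc k" .
    show "norm (f (int (Suc k))) \<le> q ^ Suc k" using * by (simp add: nf)
    have "(of_int (- 1 - int k) :: real) ^ 2 = real (Suc k) ^ 2" by (simp add: power2_eq_square algebra_simps)
    then show "norm (f (- 1 - int k)) \<le> q ^ Suc k" using * unfolding nf by simp
  qed
  note geo = geometric_tail_lt_half[OF q]
  have sA: "summable (\<lambda>k. norm (f (int (Suc k))))" and sB: "summable (\<lambda>k. norm (f (- 1 - int k)))"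
    by (rule summable_comparison_test[OF _ geo(1)], use bound in auto)+
  have sA0: "summable (\<lambda>k. f (int k))" using s1 by (rule summable_norm_cancel)
  have "infsum f UNIV = suminf (\<lambda>k. f (int k)) + suminf (\<lambda>k. f (- 1 - int k))"
    unfolding infsum_int_split(2)[OF s] by (rule suminf_add[symmetric, OF sA0 summable_norm_cancel[OF sB]])
  also have "suminf (\<lambda>k. f (int k)) = f 0 + suminf (\<lambda>k. f (int (Suc k)))"
    using suminf_split_head[OF sA0] by simp
  finally have infsum_f: "infsum f UNIV = f 0 + suminf (\<lambda>k. f (int (Suc k))) + suminf (\<lambda>k. f (- 1 - int k))" .
  have eq: "Theta c (\<i> * of_real y) = 1 + suminf (\<lambda>k. f (int (Suc k))) + suminf (\<lambda>k. f (- 1 - int k))"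
  proof -
    have "f 0 = 1" by (simp add: f_def Theta_term_def)
    moreover have "Theta c (\<i> * of_real y) = infsum f UNIV" by (simp only: Theta_def f_def)
    ultimately show ?thesis using infsum_f by (simp only:)
  qed
  have "norm (suminf (\<lambda>k. f (int (Suc k)))) \<le> suminf (\<lambda>k. norm (f (int (Suc k))))" by (rule summable_norm[OF sA])
  also have "\<dots> \<le> suminf (\<lambda>k. q ^ Suc k)" by (rule suminf_le[OF bound(1) sA geo(1)])
  finally have 1: "norm (suminf (\<lambda>k. f (int (Suc k)))) < 1 / 2" using geo(2) by simp
  have "norm (suminf (\<lambda>k. f (- 1 - int k))) \<le> suminf (\<lambda>k. norm (f (- 1 - int k)))" by (rule summable_norm[OF sB])
  also have "\<dots> \<le> suminf (\<lambda>k. q ^ Suc k)" by (rule suminf_le[OF bound(2) sB geo(1)])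
  finally have 2: "norm (suminf (\<lambda>k. f (- 1 - int k))) < 1 / 2" using geo(2) by simp
  have "\<bar>Re (suminf (\<lambda>k. f (int (Suc k))))\<bar> < 1 / 2" "\<bar>Re (suminf (\<lambda>k. f (- 1 - int k)))\<bar> < 1 / 2"
    using 1 2 abs_Re_le_cmod by (meson le_less_trans)+
  then show ?thesis unfolding eq by simp
qed

text \<open>By \<open>Theta_duplication\<close> and \<open>Theta_even_part\<close>, two values of
  \<open>Theta c\<close> have a product and a sum that are positive if \<open>Theta (2 *
  c)\<close> and \<open>Theta (4 * c)\<close> are positive on the imaginary axis; so they are
  positive themselves. Starting from large parameters, repeated halving reaches every
  \<open>c\<close>.\<close>

lemma Theta_imaginary_pos:
  assumes "c > 0"
  shows "Re (Theta c (\<i> * of_real y)) > 0"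
proof -
  have "Re (Theta c (\<i> * of_real y)) > 0" if "c > 0" "2 ^ k * c > ln 3" for k y c
    using that
  proof (induction k arbitrary: c y)
    case 0
    then show ?case using Theta_imaginary_pos_large by simp
  next
    case (Suc k)
    have IH2: "Re (Theta (2 * c) (\<i> * of_real y)) > 0" for y
      using Suc.IH[of "2 * c"] Suc.prems by (simp add: algebra_simps)
    have IH4: "Re (Theta (4 * c) (\<i> * of_real y)) > 0" for y
    proof (rule Suc.IH)
      have "2 ^ Suc k * c \<le> 2 ^ k * (4 * c)" using Suc.prems(1) by simp
      then show "2 ^ k * (4 * c) > ln 3" using Suc.prems(2) by linarith
    qed (use Suc.prems in simp)
    define A where "A = Theta c (\<i> * of_real y)"
    define B where "B = Theta c (\<i> * of_real (y + pi))"
    have AI: "Im A = 0" and BI: "Im B = 0" unfolding A_def B_def by (rule Theta_imaginary_real)+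
    have zpi: "\<i> * of_real y + \<i> * of_real pi = \<i> * of_real (y + pi)" by (simp add: algebra_simps)
    have "A * B = Theta (2 * c) (\<i> * of_real (- pi)) * Theta (2 * c) (\<i> * of_real (2 * y + pi))"
      using Theta_duplication[OF Suc.prems(1), of "\<i> * of_real y"]
      unfolding A_def B_def zpi by (simp add: algebra_simps)
    moreover have "Re (P * Q) = Re P * Re Q" if "Im P = 0" for P Q using that by simp
    ultimately have "Re A * Re B = Re (Theta (2 * c) (\<i> * of_real (- pi))) * Re (Theta (2 * c) (\<i> * of_real (2 * y + pi)))"
      using AI Theta_imaginary_real[of "2 * c" "- pi"] by metis
    moreover have "\<dots> > 0" using IH2[of "- pi"] IH2[of "2 * y + pi"] by (rule mult_pos_pos)
    ultimately have AB: "Re A * Re B > 0" by (simp only:)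
    define W where "W = Theta (4 * c) (\<i> * of_real (2 * y))"
    have "A + B = 2 * W"
      using Theta_even_part[OF Suc.prems(1), of "\<i> * of_real y"]
      unfolding A_def B_def W_def zpi by (simp add: algebra_simps)
    then have "Re (A + B) = Re (2 * W)" by (simp only:)
    then have "Re A + Re B = 2 * Re W" by simp
    moreover have "Re W > 0" unfolding W_def by (rule IH4)
    ultimately have "Re A + Re B > 0" by simp
    then show "Re (Theta c (\<i> * of_real y)) > 0" using AB unfolding A_def[symmetric]
      by (smt (verit) mult_nonneg_nonpos2 mult_nonpos_nonneg mult_less_0_iff zero_less_mult_iff)
  qed
  moreover obtain k where "2 ^ k * c > ln 3"
  proof -
    obtain k where "ln 3 / c < 2 ^ k" using real_arch_pow[of 2 "ln 3 / c"] by auto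
    then show ?thesis using that assms by (simp add: field_simps)
  qed
  ultimately show ?thesis using assms by blast
qed

lemma abs_sin_multiple_le: "\<bar>sin (of_nat n * x)\<bar> \<le> real n * \<bar>sin (x :: real)\<bar>"
proof (induction n)
  case (Suc n)
  have "sin (of_nat (Suc n) * x) = sin (of_nat n * x) * cos x + cos (of_nat n * x) * sin x"
    by (simp add: sin_add algebra_simps)
  then have "\<bar>sin (of_nat (Suc n) * x)\<bar> \<le> \<bar>sin (of_nat n * x)\<bar> * \<bar>cos x\<bar> + \<bar>cos (of_nat n * x)\<bar> * \<bar>sin x\<bar>"
    by (metis abs_mult abs_triangle_ineq)
  also have "\<dots> \<le> \<bar>sin (of_nat n * x)\<bar> * 1 + 1 * \<bar>sin x\<bar>"
    by (intro add_mono mult_left_mono mult_right_mono) auto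
  also have "\<dots> \<le> real (Suc n) * \<bar>sin x\<bar>" using Suc by (simp add: algebra_simps)
  finally show ?case .
qed simp

definition theta_sine :: "real \<Rightarrow> real \<Rightarrow> nat \<Rightarrow> real" where
  "theta_sine c u k = (-1) ^ k * exp (- c * (real k ^ 2 + real k)) * sin ((2 * real k + 1) * u)"

lemma theta_sine_complex:
  "(-1) ^ k * exp (- of_real c * (of_nat k ^ 2 + of_nat k)) * sin ((2 * of_nat k + 1) * of_real u) = complex_of_real (theta_sine c u k)"
proof -
  have "complex_of_real (theta_sine c u k) = of_real ((-1) ^ k) * of_real (exp (- c * (real k ^ 2 + real k))) * of_real (sin ((2 * real k + 1) * u))"
    unfolding theta_sine_def of_real_mult ..
  also have "\<dots> = (-1) ^ k * exp (- of_real c * (of_nat k ^ 2 + of_nat k)) * sin ((2 * of_nat k + 1) * of_real u)"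
    unfolding exp_of_real[symmetric] sin_of_real[symmetric] by simp
  finally show ?thesis ..
qed

lemma theta_sine_summable:
  assumes "c > 0"
  shows "summable (theta_sine c u)"
  using Theta_pairing(1)[OF assms, of "of_real u"] unfolding theta_sine_complex by (simp add: summable_of_real_iff)

lemma Theta_theta_sine:
  assumes "c > 0"
  shows "Theta c (2 * \<i> * of_real u - of_real c + \<i> * of_real pi) =
    exp (- \<i> * of_real u) * (2 * \<i>) * of_real (suminf (theta_sine c u))"
  unfolding Theta_pairing(2)[OF assms] theta_sine_complex
  by (simp only: suminf_of_real[OF theta_sine_summable[OF assms, of u]])

text \<open>The first term \<open>sin u\<close> dominates the series, because the other sines are bounded
  by multiples of \<open>sin u\<close>.\<close>

lemma theta_sine_nonzero_large:
  assumes "c > ln 3" "sin u \<noteq> 0"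
  shows "suminf (theta_sine c u) \<noteq> 0"
proof -
  have c: "c > 0" using assms(1) by (meson less_trans ln_gt_zero one_less_numeral_iff semiring_norm(77))
  define q where "q = exp (- c)"
  have q: "q \<ge> 0" "q < 1 / 3"
  proof -
    have "exp (- c) < exp (- ln 3)" using assms by simp
    then show "q < 1 / 3" by (simp add: q_def exp_minus inverse_eq_divide)
  qed (simp add: q_def)
  note geo = geometric_tail_lt_half[OF q]
  have bound: "\<bar>theta_sine c u (Suc k)\<bar> \<le> \<bar>sin u\<bar> * q ^ Suc k" for k
  proof -
    have "\<bar>theta_sine c u (Suc k)\<bar> = exp (- c * (real (Suc k) ^ 2 + real (Suc k))) * \<bar>sin (of_nat (2 * Suc k + 1) * u)\<bar>"
      unfolding theta_sine_def by (simp add: abs_mult)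
    also have "\<dots> \<le> exp (- c * (real (Suc k) ^ 2 + real (Suc k))) * (real (2 * Suc k + 1) * \<bar>sin u\<bar>)"
      by (intro mult_left_mono abs_sin_multiple_le) auto
    also have "exp (- c * (real (Suc k) ^ 2 + real (Suc k))) \<le> q ^ (Suc k) * q ^ (Suc k)"
    proof -
      have le: "real (Suc k) \<le> real (Suc k) ^ 2" by (simp add: power2_eq_square)
      have "exp (- c * (real (Suc k) ^ 2 + real (Suc k))) \<le> exp (- c * (real (Suc k) + real (Suc k)))" using c le by simp
      also have "\<dots> = q ^ Suc k * q ^ Suc k"
        unfolding q_def by (simp add: exp_of_nat_mult[symmetric] algebra_simps flip: exp_add del: power_Suc)
      finally show ?thesis .
    qed
    also have "q ^ Suc k * q ^ Suc k * (real (2 * Suc k + 1) * \<bar>sin u\<bar>) \<le> q ^ Suc k * (1 / 3) ^ Suc k * (3 ^ Suc k * \<bar>sin u\<bar>)"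
    proof -
      have "real (2 * Suc k + 1) \<le> 3 ^ Suc k" by (induction k) auto
      moreover have "q ^ Suc k \<le> (1 / 3) ^ Suc k" using q by (intro power_mono) auto
      ultimately show ?thesis using q by (intro mult_mono) auto
    qed
    also have "\<dots> = \<bar>sin u\<bar> * q ^ Suc k" by (simp add: power_divide)
    finally show ?thesis by (simp add: mult_right_mono)
  qed
  have s: "summable (theta_sine c u)" by (rule theta_sine_summable[OF c])
  have sb: "summable (\<lambda>k. \<bar>sin u\<bar> * q ^ Suc k)" using geo(1) by (rule summable_mult)
  have sn: "summable (\<lambda>k. \<bar>theta_sine c u (Suc k)\<bar>)"
    by (rule summable_comparison_test[OF _ sb]) (use bound in auto)
  have "suminf (theta_sine c u) = sin u + suminf (\<lambda>k. theta_sine c u (Suc k))"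
    using suminf_split_head[OF s] by (simp add: theta_sine_def)
  moreover have "\<bar>suminf (\<lambda>k. theta_sine c u (Suc k))\<bar> < \<bar>sin u\<bar>"
  proof -
    have "\<bar>suminf (\<lambda>k. theta_sine c u (Suc k))\<bar> \<le> suminf (\<lambda>k. \<bar>theta_sine c u (Suc k)\<bar>)"
      using summable_rabs[OF sn] .
    also have "\<dots> \<le> suminf (\<lambda>k. \<bar>sin u\<bar> * q ^ Suc k)" by (rule suminf_le[OF bound sn sb])
    also have "\<dots> = \<bar>sin u\<bar> * suminf (\<lambda>k. q ^ Suc k)" by (rule suminf_mult[OF geo(1)])
    also have "\<dots> < \<bar>sin u\<bar> * 1" using geo(2) assms(2) by (intro mult_strict_left_mono) auto
    finally show ?thesis by simp
  qed
  ultimately show ?thesis by linarith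
qed

text \<open>All terms of the series have the sign of \<open>sin u\<close>.\<close>

lemma theta_sine_half_pi:
  assumes c: "c > 0" and u: "cos u = 0"
  shows "suminf (theta_sine c u) \<noteq> 0"
proof -
  have su: "sin u \<noteq> 0" using u sin_cos_squared_add[of u] by auto
  have s: "sin ((2 * real k + 1) * u) = (-1) ^ k * sin u" for k
  proof (induction k)
    case (Suc k)
    have "sin ((2 * real (Suc k) + 1) * u) = sin ((2 * real k + 1) * u + 2 * u)" by (simp add: algebra_simps)
    also have "\<dots> = sin ((2 * real k + 1) * u) * cos (2 * u) + cos ((2 * real k + 1) * u) * sin (2 * u)" by (rule sin_add)
    also have "cos (2 * u) = - 1" using u sin_cos_squared_add[of u] by (simp add: cos_double)
    also have "sin (2 * u) = 0" using u by (simp add: sin_double)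
    finally show ?case using Suc by simp
  qed simp
  define p where "p k = exp (- c * (real k ^ 2 + real k))" for k
  have ts: "theta_sine c u = (\<lambda>k. sin u * p k)"
    by (rule ext) (simp add: theta_sine_def s p_def power_mult_distrib[symmetric] flip: power_add)
  have sp: "summable p"
    using theta_sine_summable[OF c, of u] su unfolding ts by (simp add: summable_cmult_iff)
  have "suminf p > 0" using sp by (intro suminf_pos) (auto simp: p_def)
  then show ?thesis unfolding ts using suminf_mult[OF sp, of "sin u"] su by simp
qed

text \<open>By \<open>Theta_duplication\<close>, a zero at \<open>u\<close> for the parameter
  \<open>c\<close> implies one at \<open>2 * u\<close> for \<open>2 * c\<close>, unless
  \<open>cos u = 0\<close>.\<close>

lemma theta_sine_nonzero:
  assumes "c > 0" "sin u \<noteq> 0"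
  shows "suminf (theta_sine c u) \<noteq> 0"
proof -
  have "suminf (theta_sine c u) \<noteq> 0" if "c > 0" "2 ^ k * c > ln 3" "sin u \<noteq> 0" for k c u
    using that
  proof (induction k arbitrary: c u)
    case 0
    then show ?case using theta_sine_nonzero_large by simp
  next
    case (Suc k)
    show ?case
    proof (cases "cos u = 0")
      case True
      then show ?thesis using theta_sine_half_pi Suc.prems by blast
    next
      case False
      then have "sin (2 * u) \<noteq> 0" using Suc.prems by (simp add: sin_double)
      then have ne: "suminf (theta_sine (2 * c) (2 * u)) \<noteq> 0"
        using Suc.IH[of "2 * c" "2 * u"] Suc.prems by (simp add: algebra_simps)
      define z where "z = 2 * \<i> * of_real u - of_real c"
      have "Theta (2 * c) (2 * z + \<i> * of_real pi) \<noteq> 0"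
        using Theta_theta_sine[of "2 * c" "2 * u"] ne Suc.prems(1) by (simp add: z_def algebra_simps)
      moreover have "Theta (2 * c) (- \<i> * of_real pi) \<noteq> 0"
        using Theta_imaginary_pos[of "2 * c" "- pi"] Suc.prems(1) by auto
      ultimately have "Theta c (z + \<i> * of_real pi) \<noteq> 0"
        using Theta_duplication[OF Suc.prems(1), of z] by auto
      then show ?thesis using Theta_theta_sine[OF Suc.prems(1), of u] unfolding z_def by auto
    qed
  qed
  moreover obtain k where "2 ^ k * c > ln 3"
  proof -
    obtain k where "ln 3 / c < 2 ^ k" using real_arch_pow[of 2 "ln 3 / c"] by auto
    then show ?thesis using that assms by (simp add: field_simps)
  qed
  ultimately show ?thesis using assms by blast
qed

subsection \<open>The theta function of Fock's operator\<close>

lemma theta_eq: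
  assumes "Re \<tau> = 0" "Im \<tau> > 0"
  shows "theta \<tau> u = 2 * exp (- of_real (pi * Im \<tau> / 4)) *
     suminf (\<lambda>k. (-1) ^ k * exp (- of_real (pi * Im \<tau>) * (of_nat k ^ 2 + of_nat k)) * sin ((2 * of_nat k + 1) * u))"
proof -
  define c where "c = pi * Im \<tau>"
  have c: "c > 0" using assms by (simp add: c_def)
  have \<tau>: "\<tau> = \<i> * of_real (Im \<tau>)" using assms by (simp add: complex_eq_iff)
  have it: "\<i> * of_real pi * \<tau> = - of_real c"
    by (subst \<tau>) (simp add: c_def algebra_simps)
  have "exp (\<i> * of_real pi * \<tau> * (of_nat k + 1 / 2)\<^sup>2) = exp (- of_real (c / 4)) * exp (- of_real c * (of_nat k ^ 2 + of_nat k))" for k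
  proof -
    have "- of_real c * (of_nat k + 1 / 2)\<^sup>2 = - of_real (c / 4) + (- of_real c * (of_nat k ^ 2 + of_nat k) :: complex)"
      by (simp add: power2_eq_square field_simps)
    then show ?thesis unfolding it by (simp only: exp_add)
  qed
  then have eq: "(-1) ^ k * exp (\<i> * of_real pi * \<tau> * (of_nat k + 1 / 2)\<^sup>2) * sin ((2 * of_nat k + 1) * u) =
     exp (- of_real (c / 4)) * ((-1) ^ k * exp (- of_real c * (of_nat k ^ 2 + of_nat k)) * sin ((2 * of_nat k + 1) * u))" for k
    by (simp only: ac_simps)
  show ?thesis
    unfolding theta_def eq suminf_mult[OF Theta_pairing(1)[OF c]] unfolding c_def by (simp add: mult.assoc)
qed

lemma theta_real:
  assumes "Re \<tau> = 0" "Im \<tau> > 0"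
  obtains r :: real where "theta \<tau> (of_real u) = of_real r" "sin u \<noteq> 0 \<Longrightarrow> r \<noteq> 0"
proof -
  define c where "c = pi * Im \<tau>"
  have c: "c > 0" using assms by (simp add: c_def)
  have "theta \<tau> (of_real u) = 2 * exp (- of_real (c / 4)) * of_real (suminf (theta_sine c u))"
    unfolding theta_eq[OF assms] c_def[symmetric] theta_sine_complex
    by (simp only: suminf_of_real[OF theta_sine_summable[OF c, of u]])
  also have "\<dots> = of_real (2 * exp (- (c / 4)) * suminf (theta_sine c u))"
    by (simp flip: exp_of_real)
  finally have eq: "theta \<tau> (of_real u) = of_real (2 * exp (- (c / 4)) * suminf (theta_sine c u))" .
  show ?thesis by (rule that[OF eq]) (use theta_sine_nonzero[OF c, of u] in simp)
qed

text \<open>A shift by a half-period moves the real line to the axis where \<open>Theta\<close> is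
  positive; the phase is the factor of quasi-periodicity.\<close>

lemma theta_half_period:
  assumes "Re \<tau> = 0" "Im \<tau> > 0"
  obtains \<rho> :: real where "\<rho> > 0" "theta \<tau> (of_real s + of_real (pi / 2) * \<tau>) = of_real \<rho> * \<i> * cis (- s)"
proof -
  define c where "c = pi * Im \<tau>"
  have c: "c > 0" using assms by (simp add: c_def)
  have \<tau>: "\<tau> = \<i> * of_real (Im \<tau>)" using assms by (simp add: complex_eq_iff)
  define u where "u = of_real s + of_real (pi / 2) * \<tau>"
  have iu: "\<i> * u = \<i> * of_real s - of_real (c / 2)"
    unfolding u_def by (subst \<tau>) (simp add: c_def algebra_simps)
  define S where "S = suminf (\<lambda>k. (-1) ^ k * exp (- of_real c * (of_nat k ^ 2 + of_nat k)) * sin ((2 * of_nat k + 1) * u))"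
  have th: "theta \<tau> u = 2 * exp (- of_real (c / 4)) * S"
    unfolding theta_eq[OF assms] c_def[symmetric] S_def ..
  define \<zeta> where "\<zeta> = \<i> * of_real (2 * s + pi)"
  have "2 * \<i> * u - of_real c + \<i> * of_real pi = 2 * (\<i> * u) - of_real c + \<i> * of_real pi" by simp
  also have "\<dots> = \<zeta> - 2 * of_real c" unfolding iu by (simp add: \<zeta>_def algebra_simps)
  finally have z_eq: "2 * \<i> * u - of_real c + \<i> * of_real pi = \<zeta> - 2 * of_real c" .
  have "Theta c (\<zeta> - 2 * of_real c) = exp (- \<i> * u) * (2 * \<i>) * S"
    using Theta_pairing(2)[OF c, of u] unfolding z_eq S_def .
  then have "exp (of_real c - \<zeta>) * Theta c \<zeta> = exp (- \<i> * u) * (2 * \<i>) * S"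
    unfolding Theta_shift .
  then have "exp (\<i> * u) * (exp (of_real c - \<zeta>) * Theta c \<zeta>) = exp (\<i> * u) * (exp (- \<i> * u) * (2 * \<i>) * S)" by simp
  also have "\<dots> = 2 * \<i> * S" by (simp add: mult.assoc[symmetric] flip: exp_add)
  finally have X: "exp (\<i> * u) * (exp (of_real c - \<zeta>) * Theta c \<zeta>) = 2 * \<i> * S" .
  have "2 * S = - \<i> * (2 * \<i> * S)" by simp
  also have "\<dots> = - \<i> * (exp (\<i> * u) * exp (of_real c - \<zeta>)) * Theta c \<zeta>"
    unfolding X[symmetric] by (simp only: mult.assoc)
  also have "exp (\<i> * u) * exp (of_real c - \<zeta>) = - (of_real (exp (c / 2)) * cis (- s))"
  proof -
    have "\<i> * u + (of_real c - \<zeta>) = of_real (c / 2) + \<i> * of_real (- s) + of_int (-1) * (\<i> * of_real pi)"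
      unfolding iu \<zeta>_def by (simp add: algebra_simps)
    then have "exp (\<i> * u) * exp (of_real c - \<zeta>) = exp (of_real (c / 2)) * exp (\<i> * of_real (- s)) * exp (of_int (-1) * (\<i> * of_real pi))"
      by (simp only: exp_add[symmetric])
    also have "\<dots> = - (of_real (exp (c / 2)) * cis (- s))"
      unfolding exp_i_pi_int exp_of_real cis_conv_exp[symmetric] by simp
    finally show ?thesis .
  qed
  finally have S: "2 * S = \<i> * (of_real (exp (c / 2)) * cis (- s)) * Theta c \<zeta>" by simp
  have T: "Theta c \<zeta> = of_real (Re (Theta c \<zeta>))"
    using Theta_imaginary_real[of c "2 * s + pi"] unfolding \<zeta>_def by (simp add: complex_eq_iff)
  define \<rho> where "\<rho> = exp (- (c / 4)) * exp (c / 2) * Re (Theta c \<zeta>)"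
  have "\<rho> > 0" using Theta_imaginary_pos[OF c, of "2 * s + pi"] by (simp add: \<rho>_def \<zeta>_def)
  moreover have "theta \<tau> u = of_real \<rho> * \<i> * cis (- s)"
  proof -
    have "theta \<tau> u = exp (- of_real (c / 4)) * (2 * S)" using th by simp
    also have "\<dots> = of_real \<rho> * \<i> * cis (- s)"
      unfolding S \<rho>_def by (subst T) (simp add: exp_of_real[symmetric] ac_simps)
    finally show ?thesis .
  qed
  ultimately show ?thesis using that by (simp add: u_def)
qed

text \<open>Up to a positive factor, the weight is the real number \<open>theta (b - a)\<close> times a
  phase whose argument depends on \<open>x\<close> by \<open>2 * x\<close>.\<close>

lemma fock_weight_phase:
  assumes \<tau>: "Re \<tau> = 0" "Im \<tau> > 0" and t: "t - of_real (pi / 2) * \<tau> \<in> \<real>"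
    and ab: "sin (b - a) \<noteq> 0" and xy: "0 \<le> x" "x < pi" "0 \<le> y" "y < pi"
    and eq: "theta \<tau> (of_real b - of_real a) / (theta \<tau> (t + of_real x - of_real b) * theta \<tau> (t + of_real x - of_real a)) =
      theta \<tau> (of_real b - of_real a) / (theta \<tau> (t + of_real y - of_real b) * theta \<tau> (t + of_real y - of_real a))"
  shows "x = y"
proof -
  obtain t0 where t0: "t - of_real (pi / 2) * \<tau> = of_real t0" using t by (elim Reals_cases)
  obtain r where r: "theta \<tau> (of_real (b - a)) = of_real r" "r \<noteq> 0"
    using theta_real[OF \<tau>] ab by metis
  have den: "\<exists>\<rho>>0. theta \<tau> (t + of_real x - of_real b) * theta \<tau> (t + of_real x - of_real a) = - of_real \<rho> * cis (a + b - 2 * t0 - 2 * x)" for x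
  proof -
    have arg: "t + of_real x - of_real b = of_real (t0 + x - b) + of_real (pi / 2) * \<tau>" for b
      using t0 by (simp add: algebra_simps)
    obtain \<rho>1 where 1: "\<rho>1 > 0" "theta \<tau> (t + of_real x - of_real b) = of_real \<rho>1 * \<i> * cis (- (t0 + x - b))"
      using theta_half_period[OF \<tau>, of "t0 + x - b"] unfolding arg by metis
    obtain \<rho>2 where 2: "\<rho>2 > 0" "theta \<tau> (t + of_real x - of_real a) = of_real \<rho>2 * \<i> * cis (- (t0 + x - a))"
      using theta_half_period[OF \<tau>, of "t0 + x - a"] unfolding arg by metis
    have "theta \<tau> (t + of_real x - of_real b) * theta \<tau> (t + of_real x - of_real a) =
       (\<i> * \<i>) * of_real (\<rho>1 * \<rho>2) * (cis (- (t0 + x - b)) * cis (- (t0 + x - a)))"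
      unfolding 1 2 by (simp only: of_real_mult ac_simps)
    also have "\<dots> = - of_real (\<rho>1 * \<rho>2) * cis (a + b - 2 * t0 - 2 * x)"
      unfolding cis_mult by (simp add: algebra_simps)
    finally show ?thesis using 1 2 by (intro exI[of _ "\<rho>1 * \<rho>2"]) auto
  qed
  obtain \<rho> \<rho>' where \<rho>: "\<rho> > 0" "theta \<tau> (t + of_real x - of_real b) * theta \<tau> (t + of_real x - of_real a) = - of_real \<rho> * cis (a + b - 2 * t0 - 2 * x)"
    and \<rho>': "\<rho>' > 0" "theta \<tau> (t + of_real y - of_real b) * theta \<tau> (t + of_real y - of_real a) = - of_real \<rho>' * cis (a + b - 2 * t0 - 2 * y)"
    using den[of x] den[of y] by blast
  define X where "X = - of_real \<rho> * cis (a + b - 2 * t0 - 2 * x)"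
  define Y where "Y = - of_real \<rho>' * cis (a + b - 2 * t0 - 2 * y)"
  have XY0: "X \<noteq> 0" "Y \<noteq> 0" using \<rho> \<rho>' by (auto simp: X_def Y_def)
  have "of_real r / X = of_real r / Y" using eq r(1) \<rho>(2) \<rho>'(2) by (simp add: X_def Y_def)
  then have XY: "X = Y" using XY0 r(2) by (simp add: field_simps)
  then have "norm X = norm Y" by simp
  then have "\<rho> = \<rho>'" using \<rho> \<rho>' by (simp add: X_def Y_def norm_mult)
  then have "cis (a + b - 2 * t0 - 2 * x) = cis (a + b - 2 * t0 - 2 * y)"
    using XY \<rho> by (simp add: X_def Y_def)
  then have "cis (a + b - 2 * t0 - 2 * x) / cis (a + b - 2 * t0 - 2 * y) = 1" by simp
  then have "cis (2 * y - 2 * x) = 1" unfolding cis_divide by (simp add: algebra_simps)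
  then obtain n :: int where n: "2 * y - 2 * x = of_int n * (2 * pi)" unfolding cis_eq_1_iff by blast
  then have yx: "y - x = of_int n * pi" by simp
  have "n = 0"
  proof (rule ccontr)
    assume "n \<noteq> 0"
    then have "1 \<le> \<bar>n\<bar>" by linarith
    then have "1 \<le> \<bar>real_of_int n\<bar>" by linarith
    then have "pi \<le> \<bar>of_int n * pi\<bar>" by (simp add: abs_mult)
    then show False using yx xy by linarith
  qed
  then show ?thesis using yx by simp
qed

section \<open>Cyclic orders\<close>

lemma lift_angle_abs: "lift_angle (abs_halfangle x) = x rmod pi"
  by (rule lift_angle.abs_eq)

lemma lift_angle_eq_iff: "lift_angle a = lift_angle b \<longleftrightarrow> a = b"
  by transfer (simp add: rcong_def)

lemma abs_lift_angle: "abs_halfangle (lift_angle a) = a"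
  by (subst lift_angle_eq_iff[symmetric]) (simp add: lift_angle_abs lift_angle_bounds)

lemma abs_halfangle_add: "abs_halfangle (x + y) = abs_halfangle x + abs_halfangle y"
  by (rule plus_halfangle.abs_eq[symmetric])

lemma abs_halfangle_diff: "abs_halfangle (x - y) = abs_halfangle x - abs_halfangle y"
  by (rule minus_halfangle.abs_eq[symmetric])

lemma abs_halfangle_0_iff: "abs_halfangle x = 0 \<longleftrightarrow> (\<exists>n::int. x = of_int n * pi)"
proof -
  have "abs_halfangle x = 0 \<longleftrightarrow> [x = 0] (rmod pi)"
    unfolding zero_halfangle_def by (simp add: halfangle.abs_eq_iff)
  also have "\<dots> \<longleftrightarrow> [0 = x] (rmod pi)" by (rule rcong_sym_iff)
  finally show ?thesis by (simp add: rcong_altdef)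
qed

lemma lift_angle_0 [simp]: "lift_angle 0 = 0"
  by transfer simp

lemma lift_angle_0_iff: "lift_angle a = 0 \<longleftrightarrow> a = 0"
  using lift_angle_eq_iff[of a 0] by simp

lemma rmod_pi_cases:
  assumes "- pi < x" "x < pi"
  shows "x rmod pi = (if 0 \<le> x then x else x + pi)"
proof (cases "0 \<le> x")
  case True
  then show ?thesis using assms by (simp add: rmod_idem)
next
  case False
  have "x rmod pi = x + pi"
    by (rule rmod_unique[of _ _ _ "-1"]) (use assms False in auto)
  then show ?thesis using False by simp
qed

lemma lift_angle_diff:
  "lift_angle (b - a) = (if lift_angle (a - p) \<le> lift_angle (b - p)
     then lift_angle (b - p) - lift_angle (a - p) else lift_angle (b - p) - lift_angle (a - p) + pi)"
proof -
  have *: "lift_angle (x - y) = (lift_angle x - lift_angle y) rmod pi" for x y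
    by transfer (simp add: rmod_diff)
  have "lift_angle (b - a) = lift_angle ((b - p) - (a - p))" by simp
  also have "\<dots> = (lift_angle (b - p) - lift_angle (a - p)) rmod pi" by (rule *)
  also have "\<dots> = (if 0 \<le> lift_angle (b - p) - lift_angle (a - p) then lift_angle (b - p) - lift_angle (a - p)
       else lift_angle (b - p) - lift_angle (a - p) + pi)"
    using lift_angle_bounds[of "b - p"] lift_angle_bounds[of "a - p"] by (intro rmod_pi_cases) linarith+
  finally show ?thesis by (simp add: le_diff_eq)
qed

text \<open>Cut the circle at \<open>p\<close>.\<close>

lemma cyc_angle_iff:
  fixes p
  defines "u \<equiv> \<lambda>x. lift_angle (x - p)"
  shows "cyc_angle a b c \<longleftrightarrow> (u a < u b \<and> u b < u c) \<or> (u b < u c \<and> u c < u a) \<or> (u c < u a \<and> u a < u b)"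
  using lift_angle_diff[of b a p] lift_angle_diff[of c a p]
    lift_angle_bounds[of "a - p"] lift_angle_bounds[of "b - p"] lift_angle_bounds[of "c - p"]
  unfolding cyc_angle_def u_def by (auto split: if_splits)

lemma cyc_angle_rotate: "cyc_angle a b c \<Longrightarrow> cyc_angle b c a"
  unfolding cyc_angle_iff[of _ _ _ 0] by blast

lemma cyc_sortedI:
  assumes "\<And>i j. i \<le> j \<Longrightarrow> j < r \<Longrightarrow> lift_angle (f i - p) \<le> lift_angle (f j - p)"
  shows "cyc_sorted cyc_angle r f"
  unfolding cyc_sorted_def cyc_angle_iff[of _ _ _ p]
proof (intro allI impI)
  fix i j k assume "i < j" "j < k" "k < r"
  then have "lift_angle (f i - p) \<le> lift_angle (f j - p)" "lift_angle (f j - p) \<le> lift_angle (f k - p)"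
    using assms by auto
  then show "\<not> (lift_angle (f i - p) < lift_angle (f k - p) \<and> lift_angle (f k - p) < lift_angle (f j - p) \<or>
          lift_angle (f k - p) < lift_angle (f j - p) \<and> lift_angle (f j - p) < lift_angle (f i - p) \<or>
          lift_angle (f j - p) < lift_angle (f i - p) \<and> lift_angle (f i - p) < lift_angle (f k - p))"
    by linarith
qed

text \<open>A cyclic order determines a linear order only once a starting point is chosen; with at least
  three values the elements equal to the first one come first or last.\<close>

lemma cyc_sorted_linear:
  assumes cs: "cyc_sorted cyc_angle r f" and last: "f (r - 1) \<noteq> f 0"
    and three: "l < r" "f l \<noteq> f 0" "f l \<noteq> f (r - 1)"
    and jk: "j \<le> k" "k < r"
  shows "lift_angle (f j - f 0) \<le> lift_angle (f k - f 0)"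
proof (rule ccontr)
  define g where "g i = lift_angle (f i - f 0)" for i
  have g0: "g 0 = 0" by (simp add: g_def)
  have gnn: "0 \<le> g i" for i by (simp add: g_def lift_angle_bounds)
  have geq: "g i = g j \<longleftrightarrow> f i = f j" for i j by (simp add: g_def lift_angle_eq_iff)
  have C: "\<not> (g i < g k \<and> g k < g j)" "\<not> (g k < g j \<and> g j < g i)" "\<not> (g j < g i \<and> g i < g k)"
    if "i < j" "j < k" "k < r" for i j k
    using cs that unfolding cyc_sorted_def cyc_angle_iff[of _ _ _ "f 0"] g_def by blast+
  assume "\<not> lift_angle (f j - f 0) \<le> lift_angle (f k - f 0)"
  then have kj: "g k < g j" by (simp add: g_def)
  then have jk': "j < k" using jk by (metis le_neq_implies_less less_irrefl)
  have gl: "g (r - 1) > 0" using last geq[of "r - 1" 0] g0 gnn[of "r - 1"] by (metis less_eq_real_def)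
  have j0: "j > 0" using kj g0 gnn[of k] by (cases j) auto
  have zero: "g k = 0 \<and> g i = g (r - 1)" if i: "0 < i" "i < k" "g k < g i" for i
  proof -
    have gk: "g k = 0" using C(1)[of 0 i k] i jk g0 gnn[of k] by auto
    then have "k \<noteq> r - 1" using gl by auto
    then have kr: "k < r - 1" using jk by linarith
    have "\<not> (g k < g i \<and> g i < g (r - 1))" using C(3)[of i k "r - 1"] i kr jk by auto
    then have "g (r - 1) \<le> g i" using i by auto
    moreover have "\<not> (g 0 < g (r - 1) \<and> g (r - 1) < g i)" using C(1)[of 0 i "r - 1"] i kr by auto
    then have "g i \<le> g (r - 1)" using gl g0 by auto
    ultimately show ?thesis using gk by simp
  qed
  note z = zero[OF j0 jk' kj]
  have gl0: "g l \<noteq> 0" "g l \<noteq> g (r - 1)" using three geq[of l 0] geq[of l "r - 1"] g0 by auto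
  then have glpos: "g l > 0" using gnn[of l] by simp
  have l0: "l > 0" using gl0 g0 by (cases l) auto
  show False
  proof (cases "l < k")
    case True
    then show False using zero[of l] l0 z glpos gl0 by auto
  next
    case False
    then have lk: "k < l" using z gl0 by (metis linorder_neqE_nat)
    have "l \<noteq> r - 1" using gl0 by auto
    then have lr: "l < r - 1" using three(1) by linarith
    have "\<not> (g 0 < g (r - 1) \<and> g (r - 1) < g l)" using C(1)[of 0 l "r - 1"] l0 lr by auto
    then have "g l < g j" using gl g0 gl0 z by auto
    moreover have "\<not> (g 0 < g l \<and> g l < g j)" using C(1)[of 0 j l] j0 jk' lk three by auto
    ultimately show False using glpos g0 by auto
  qed
qed

lemma cyc_sorted_rotate:
  assumes C: "\<And>a b c. C a b c \<Longrightarrow> C b c a" and cs: "cyc_sorted C r f" and s: "s < r"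
  shows "cyc_sorted C r (\<lambda>i. f ((s + i) mod r))"
  unfolding cyc_sorted_def
proof (intro allI impI notI)
  fix i j k assume ijk: "i < j" "j < k" "k < r" and CC: "C (f ((s + i) mod r)) (f ((s + k) mod r)) (f ((s + j) mod r))"
  have no: "\<not> C (f a) (f c) (f b)" if "a < b" "b < c" "c < r" for a b c
    using cs that unfolding cyc_sorted_def by blast
  have m: "(s + i) mod r = (if s + i < r then s + i else s + i - r)" if "i < r" for i
    using s that by (simp add: mod_if)
  let ?i = "(s + i) mod r" and ?j = "(s + j) mod r" and ?k = "(s + k) mod r"
  have lt: "?i < r" "?j < r" "?k < r" using s by auto
  consider "?i < ?j" "?j < ?k" | "?k < ?i" "?i < ?j" | "?j < ?k" "?k < ?i"
  proof -
    have mm: "?i = (if s + i < r then s + i else s + i - r)" "?j = (if s + j < r then s + j else s + j - r)"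
      "?k = (if s + k < r then s + k else s + k - r)"
      using m ijk by auto
    show thesis
    proof (cases "s + k < r")
      case True
      then show thesis using mm ijk by (intro that(1)) simp_all
    next
      case k: False
      show thesis
      proof (cases "s + j < r")
        case True
        then show thesis using mm ijk s k by (intro that(2)) simp_all
      next
        case j: False
        show thesis
        proof (cases "s + i < r")
          case True
          then show thesis using mm ijk s k j by (intro that(3)) simp_all
        next
          case False
          then show thesis using mm ijk s k j by (intro that(1)) simp_all
        qed
      qed
    qed
  qed
  then show False
  proof cases
    case 1 then show False using no[of ?i ?j ?k] CC lt by blast
  next
    case 2 then show False using no[of ?k ?i ?j] C[OF CC] lt by blast
  next
    case 3 then show False using no[of ?j ?k ?i] C[OF C[OF CC]] lt by blast
  qed
qed

lemma sorting_enumeration: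
  fixes u :: "'a \<Rightarrow> real"
  assumes "finite X"
  obtains T where "bij_betw T {..<card X} X" "\<And>i j. i \<le> j \<Longrightarrow> j < card X \<Longrightarrow> u (T i) \<le> u (T j)"
proof -
  obtain xs where xs: "set xs = X" "distinct xs" using finite_distinct_list[OF assms] by blast
  define ys where "ys = sort_key u xs"
  have ys: "set ys = X" "distinct ys" "sorted (map u ys)" "length ys = card X"
    using xs distinct_card[OF xs(2)] by (auto simp: ys_def)
  show ?thesis
  proof (rule that[of "\<lambda>i. ys ! i"])
    show "bij_betw (\<lambda>i. ys ! i) {..<card X} X"
      using ys by (intro bij_betw_nth) auto
    show "u (ys ! i) \<le> u (ys ! j)" if "i \<le> j" "j < card X" for i j
      using sorted_nth_mono[OF ys(3) that(1)] that ys(4) by simp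
  qed
qed

section \<open>Directions of lattice vectors\<close>

text \<open>Halving the arguments identifies the directions of vectors with half-angles, and the cyclic
  order of directions with that of half-angles.\<close>

definition direction :: "int \<times> int \<Rightarrow> halfangle" where
  "direction v = abs_halfangle (Arg2pi (cvec v) / 2)"

definition cross :: "int \<times> int \<Rightarrow> int \<times> int \<Rightarrow> int" where
  "cross u v = fst u * snd v - snd u * fst v"

lemma cvec_eq_0_iff: "cvec v = 0 \<longleftrightarrow> v = 0"
  by (cases v) (auto simp: cvec_def complex_eq_iff zero_prod_def)

lemma Arg2pi_bounds: "0 \<le> Arg2pi z" "Arg2pi z < 2 * pi"
  using Arg2pi by auto

lemma Arg2pi_quotient:
  assumes "u \<noteq> 0" "v \<noteq> 0"
  shows "Arg2pi (cvec v / cvec u) = 2 * lift_angle (direction v - direction u)"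
proof -
  define a where "a = Arg2pi (cvec u)"
  define b where "b = Arg2pi (cvec v)"
  have nz: "cvec u \<noteq> 0" "cvec v \<noteq> 0" using assms by (auto simp: cvec_eq_0_iff)
  have bd: "0 \<le> a" "a < 2 * pi" "0 \<le> b" "b < 2 * pi"
    unfolding a_def b_def by (rule Arg2pi_bounds)+
  have "lift_angle (direction v - direction u) = (b / 2 - a / 2) rmod pi"
    unfolding direction_def a_def b_def abs_halfangle_diff[symmetric] lift_angle_abs ..
  also have "\<dots> = (if 0 \<le> b / 2 - a / 2 then b / 2 - a / 2 else b / 2 - a / 2 + pi)"
    using bd by (intro rmod_pi_cases) auto
  finally have L: "lift_angle (direction v - direction u) = (if a \<le> b then (b - a) / 2 else (b - a) / 2 + pi)"
    by (auto simp: field_simps)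
  show ?thesis
  proof (cases "a \<le> b")
    case True
    then have "Arg2pi (cvec v / cvec u) = b - a"
      using Arg2pi_divide[OF nz] by (simp add: a_def b_def)
    then show ?thesis using L True by simp
  next
    case False
    have "Arg2pi (cvec v / cvec u) = b - a + 2 * pi"
    proof (rule Arg2pi_unique[of "norm (cvec v / cvec u)"])
      have eu: "cvec u = of_real (norm (cvec u)) * exp (\<i> * of_real a)"
        and ev: "cvec v = of_real (norm (cvec v)) * exp (\<i> * of_real b)"
        unfolding a_def b_def by (rule Arg2pi_eq)+
      have e: "exp (\<i> * of_real (b - a + 2 * pi)) = exp (\<i> * of_real b) / exp (\<i> * of_real a)"
      proof -
        have "\<i> * of_real (b - a + 2 * pi) = (\<i> * of_real b - \<i> * of_real a) + 2 * of_real pi * \<i>"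
          by (simp add: algebra_simps)
        then show ?thesis by (simp only: exp_add exp_diff exp_two_pi_i mult_1_right)
      qed
      have "of_real (norm (cvec v / cvec u)) * (exp (\<i> * of_real b) / exp (\<i> * of_real a)) =
        (of_real (norm (cvec v)) * exp (\<i> * of_real b)) / (of_real (norm (cvec u)) * exp (\<i> * of_real a))"
        by (simp add: norm_divide)
      then show "of_real (norm (cvec v / cvec u)) * exp (\<i> * of_real (b - a + 2 * pi)) = cvec v / cvec u"
        unfolding e using eu ev by metis
    qed (use nz bd False in auto)
    then show ?thesis using L False by simp
  qed
qed

lemma cyc_direction_iff:
  assumes "u \<noteq> 0" "v \<noteq> 0" "w \<noteq> 0"
  shows "cyc_direction u v w \<longleftrightarrow> cyc_angle (direction u) (direction v) (direction w)"
  unfolding cyc_direction_def cyc_angle_def Arg2pi_quotient[OF assms(1,2)] Arg2pi_quotient[OF assms(1,3)] by simp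

lemma cross_eq_sin:
  assumes "u \<noteq> 0" "v \<noteq> 0"
  shows "of_int (cross u v) = norm (cvec u) * norm (cvec v) * sin (2 * lift_angle (direction v - direction u))"
proof -
  have nz: "cvec u \<noteq> 0" using assms by (simp add: cvec_eq_0_iff)
  define q where "q = cvec v / cvec u"
  have v: "cvec v = q * cvec u" using nz by (simp add: q_def)
  have "(of_int (cross u v) :: real) = Im (cnj (cvec u) * cvec v)"
    by (simp add: cross_def cvec_def algebra_simps)
  also have "cnj (cvec u) * cvec v = of_real ((norm (cvec u))\<^sup>2) * q"
    unfolding v complex_norm_square by (simp add: algebra_simps)
  also have "Im \<dots> = (norm (cvec u))\<^sup>2 * Im q" by simp
  also have "Im q = norm q * sin (Arg2pi q)" by (simp add: sin_Arg2pi)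
  also have "(norm (cvec u))\<^sup>2 * (norm q * sin (Arg2pi q)) = norm (cvec u) * norm (cvec v) * sin (Arg2pi q)"
    unfolding v norm_mult by (simp add: power2_eq_square)
  finally show ?thesis unfolding q_def Arg2pi_quotient[OF assms] .
qed

lemma direction_eqD:
  assumes "u \<noteq> 0" "v \<noteq> 0" "direction u = direction v"
  obtains t where "t > 0" "plane_point v = t *\<^sub>R plane_point u"
proof -
  have "lift_angle (direction u) = lift_angle (direction v)" using assms(3) by simp
  moreover have l: "lift_angle (direction w) = Arg2pi (cvec w) / 2" for w
    unfolding direction_def lift_angle_abs using Arg2pi_bounds[of "cvec w"] by (simp add: rmod_idem)
  ultimately have "Arg2pi (cvec v) = Arg2pi (cvec u)" by simp
  moreover have "cvec u \<noteq> 0" "cvec v \<noteq> 0" using assms by (simp_all add: cvec_eq_0_iff)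
  ultimately obtain t where t: "0 < t" "cvec v = of_real t * cvec u" using Arg2pi_eq_iff by blast
  then have "plane_point v = t *\<^sub>R plane_point u"
    by (simp add: plane_point_def cvec_def complex_eq_iff)
  then show ?thesis using that t(1) by blast
qed

lemma plane_point_add: "plane_point (u + v) = plane_point u + plane_point v"
  and plane_point_0 [simp]: "plane_point 0 = 0"
  and plane_point_diff: "plane_point (u - v) = plane_point u - plane_point v"
  by (auto simp: plane_point_def zero_prod_def)

lemma plane_point_sum: "plane_point (sum f A) = (\<Sum>x\<in>A. plane_point (f x))"
  by (induction A rule: infinite_finite_induct) (auto simp: plane_point_add)

section \<open>Barycentric coordinates with positive weights\<close>

text \<open>Move \<open>x\<close> a little away from the mean \<open>y\<close> of the points. The new
  point is a barycentre with nonnegative weights, and \<open>x\<close> lies between it and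
  \<open>y\<close>.\<close>

lemma interior_convex_hull_positive:
  fixes P :: "nat \<Rightarrow> 'a :: euclidean_space"
  assumes x: "x \<in> interior (convex hull (P ` {..<r}))"
  obtains wt where "\<And>j. j < r \<Longrightarrow> wt j > 0" "(\<Sum>j<r. wt j) = 1" "(\<Sum>j<r. wt j *\<^sub>R P j) = x"
proof -
  have r: "r > 0" using x by (cases r) auto
  define y where "y = (\<Sum>j<r. (1 / real r) *\<^sub>R P j)"
  obtain \<epsilon> where \<epsilon>: "\<epsilon> > 0" "ball x \<epsilon> \<subseteq> convex hull (P ` {..<r})"
    using x by (meson mem_interior)
  define \<delta> where "\<delta> = \<epsilon> / (2 * (norm (x - y) + 1))"
  have \<delta>: "\<delta> > 0" using \<epsilon>(1) by (simp add: \<delta>_def add_nonneg_pos)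
  have "norm (\<delta> *\<^sub>R (x - y)) < \<epsilon>"
  proof -
    have "norm (x - y) / (2 * (norm (x - y) + 1)) < 1"
      using norm_ge_zero[of "x - y"] by (simp add: divide_less_eq add_nonneg_pos)
    then have "\<epsilon> * (norm (x - y) / (2 * (norm (x - y) + 1))) < \<epsilon> * 1"
      using \<epsilon>(1) by (intro mult_strict_left_mono) auto
    moreover have "norm (\<delta> *\<^sub>R (x - y)) = \<epsilon> * (norm (x - y) / (2 * (norm (x - y) + 1)))"
      using \<epsilon>(1) norm_ge_zero[of "x - y"] unfolding \<delta>_def norm_scaleR by (subst abs_of_pos) (auto intro!: divide_pos_pos add_nonneg_pos)
    ultimately show ?thesis by simp
  qed
  then have "x + \<delta> *\<^sub>R (x - y) \<in> convex hull (P ` {..<r})"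
    using \<epsilon>(2) by (auto simp: dist_norm subset_iff)
  (* Weights of the point beyond x on the line from y to x. *)
  then obtain \<mu> where \<mu>: "\<And>j. j < r \<Longrightarrow> \<mu> j \<ge> 0" "(\<Sum>j<r. \<mu> j) = 1" "(\<Sum>j<r. \<mu> j *\<^sub>R P j) = x + \<delta> *\<^sub>R (x - y)"
  proof -
    obtain u where u: "\<forall>p\<in>P ` {..<r}. 0 \<le> u p" "sum u (P ` {..<r}) = 1"
      "(\<Sum>p\<in>P ` {..<r}. u p *\<^sub>R p) = x + \<delta> *\<^sub>R (x - y)"
      using \<open>x + \<delta> *\<^sub>R (x - y) \<in> _\<close> unfolding convex_hull_finite[OF finite_imageI[OF finite_lessThan]] by blast
    define n where "n p = card {j. j < r \<and> P j = p}" for p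
    define \<mu> where "\<mu> j = u (P j) / real (n (P j))" for j
    have np: "n (P j) > 0" if "j < r" for j using that by (auto simp: n_def card_gt_0_iff)
    have sum_eq: "(\<Sum>j<r. \<mu> j *\<^sub>R h (P j)) = (\<Sum>p\<in>P ` {..<r}. u p *\<^sub>R h p)" for h :: "'a \<Rightarrow> 'b :: real_vector"
    proof -
      have "(\<Sum>j<r. \<mu> j *\<^sub>R h (P j)) = (\<Sum>p\<in>P ` {..<r}. \<Sum>j | j \<in> {..<r} \<and> P j = p. \<mu> j *\<^sub>R h (P j))"
        by (rule sum.image_gen) simp
      also have "\<dots> = (\<Sum>p\<in>P ` {..<r}. u p *\<^sub>R h p)"
      proof (intro sum.cong refl)
        fix p assume "p \<in> P ` {..<r}"
        then have "n p > 0" using np by auto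
        have "(\<Sum>j | j \<in> {..<r} \<and> P j = p. \<mu> j *\<^sub>R h (P j)) = (\<Sum>j | j \<in> {..<r} \<and> P j = p. (u p / real (n p)) *\<^sub>R h p)"
          by (intro sum.cong refl) (auto simp: \<mu>_def)
        also have "\<dots> = real (n p) *\<^sub>R ((u p / real (n p)) *\<^sub>R h p)"
          by (simp add: n_def sum_constant_scaleR)
        finally show "(\<Sum>j | j \<in> {..<r} \<and> P j = p. \<mu> j *\<^sub>R h (P j)) = u p *\<^sub>R h p" using \<open>n p > 0\<close> by simp
      qed
      finally show ?thesis .
    qed
    show ?thesis
    proof (rule that[of \<mu>])
      show "\<mu> j \<ge> 0" if "j < r" for j using u(1) that by (simp add: \<mu>_def)
      show "(\<Sum>j<r. \<mu> j) = 1" using sum_eq[of "\<lambda>_. 1 :: real"] u(2) by simp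
      show "(\<Sum>j<r. \<mu> j *\<^sub>R P j) = x + \<delta> *\<^sub>R (x - y)" using sum_eq[of "\<lambda>p. p"] u(3) by simp
    qed
  qed
  define wt where "wt j = (\<mu> j + \<delta> / real r) / (1 + \<delta>)" for j
  show ?thesis
  proof (rule that[of wt])
    show "wt j > 0" if "j < r" for j
      using \<mu>(1)[OF that] \<delta> r by (auto simp: wt_def intro!: divide_pos_pos add_nonneg_pos)
    have "(\<Sum>j<r. wt j) = (1 + \<delta>) / (1 + \<delta>)"
      unfolding wt_def sum_divide_distrib[symmetric] sum.distrib \<mu>(2) using r by simp
    then show "(\<Sum>j<r. wt j) = 1" using \<delta> by simp
    have "(1 + \<delta>) *\<^sub>R (\<Sum>j<r. wt j *\<^sub>R P j) = (\<Sum>j<r. (\<mu> j + \<delta> / real r) *\<^sub>R P j)"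
      unfolding scaleR_sum_right wt_def using \<delta> by simp
    also have "\<dots> = (x + \<delta> *\<^sub>R (x - y)) + \<delta> *\<^sub>R y"
    proof -
      have "\<delta> *\<^sub>R y = (\<Sum>j<r. (\<delta> / real r) *\<^sub>R P j)"
        unfolding y_def scaleR_sum_right by simp
      then show ?thesis unfolding \<mu>(3)[symmetric] scaleR_add_left sum.distrib by simp
    qed
    also have "\<dots> = (1 + \<delta>) *\<^sub>R x" by (simp add: algebra_simps)
    finally show "(\<Sum>j<r. wt j *\<^sub>R P j) = x" using \<delta> by simp
  qed
qed

text \<open>A maximum principle: a linear form which is maximal at a vertex of weight zero is also
  maximal at its two neighbours.\<close>

lemma weighted_sum_interior:
  fixes P :: "nat \<Rightarrow> 'a :: euclidean_space"
  assumes int: "interior (convex hull (P ` {..<r})) \<noteq> {}"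
    and wt: "\<And>j. j < r \<Longrightarrow> wt j \<ge> 0" "(\<Sum>j<r. wt j) = 1"
    and flat: "\<And>j. j < r \<Longrightarrow> wt j = 0 \<Longrightarrow> P ((j + 1) mod r) - P j = P j - P ((j + r - 1) mod r)"
  shows "(\<Sum>j<r. wt j *\<^sub>R P j) \<in> interior (convex hull (P ` {..<r}))"
proof (rule ccontr)
  define N where "N = convex hull (P ` {..<r})"
  define x where "x = (\<Sum>j<r. wt j *\<^sub>R P j)"
  assume "(\<Sum>j<r. wt j *\<^sub>R P j) \<notin> interior (convex hull (P ` {..<r}))"
  then have xi: "x \<notin> interior N" by (simp add: x_def N_def)
  have r: "r > 0" using int by (cases r) auto
  have PN: "P j \<in> N" if "j < r" for j unfolding N_def using that by (intro hull_inc) auto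
  have cN: "convex N" by (simp add: N_def)
  have xN: "x \<in> N"
    unfolding x_def by (rule convex_sum[OF finite_lessThan cN]) (use wt PN in auto)
  have "x \<notin> rel_interior N"
    using xi int rel_interior_nonempty_interior unfolding N_def by blast
  then obtain a where a: "a \<noteq> 0" "\<And>y. y \<in> N \<Longrightarrow> a \<bullet> x \<le> a \<bullet> y"
    using supporting_hyperplane_rel_boundary[OF cN xN] by metis
  define f where "f j = a \<bullet> P j - a \<bullet> x" for j
  have f0: "f j \<ge> 0" if "j < r" for j using a(2)[OF PN[OF that]] by (simp add: f_def)
  have "(\<Sum>j<r. wt j * f j) = a \<bullet> x - (\<Sum>j<r. wt j) * (a \<bullet> x)"
    unfolding x_def f_def by (simp add: inner_sum_right right_diff_distrib sum_subtractf sum_distrib_right)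
  then have "(\<Sum>j<r. wt j * f j) = 0" using wt(2) by simp
  then have "\<forall>j\<in>{..<r}. wt j * f j = 0"
    using wt(1) f0 by (subst (asm) sum_nonneg_eq_0_iff) auto
  then have lf: "wt j = 0 \<or> f j = 0" if "j < r" for j using that by auto
  define m where "m = Max (f ` {..<r})"
  have m: "f j \<le> m" if "j < r" for j unfolding m_def using that by (intro Max_ge) auto
  obtain j0 where j0: "j0 < r" "f j0 = m"
  proof -
    have "m \<in> f ` {..<r}" unfolding m_def using r by (intro Max_in) auto
    then show ?thesis using that by blast
  qed
  have m0: "m = 0"
  proof (rule ccontr)
    assume "m \<noteq> 0"
    then have mpos: "m > 0" using f0[OF j0(1)] j0(2) by simp
    have next_max: "f ((j + 1) mod r) = m" if j: "j < r" "f j = m" for j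
    proof -
      have "wt j = 0" using lf[OF j(1)] j(2) mpos by auto
      then have "a \<bullet> (P ((j + 1) mod r) - P j) = a \<bullet> (P j - P ((j + r - 1) mod r))" using flat[OF j(1)] by simp
      then have "f ((j + 1) mod r) - f j = f j - f ((j + r - 1) mod r)" by (simp add: f_def inner_diff_right)
      moreover have "f ((j + 1) mod r) \<le> m" "f ((j + r - 1) mod r) \<le> m" using m r by auto
      ultimately show ?thesis using j(2) by linarith
    qed
    have all: "f ((j0 + n) mod r) = m" for n
    proof (induction n)
      case (Suc n)
      have "f (((j0 + n) mod r + 1) mod r) = m" using next_max[OF _ Suc] r by simp
      then show ?case by (simp add: mod_Suc_eq)
    qed (use j0 in simp)
    have "f j = m" if "j < r" for j
    proof -
      have "(j0 + (r - j0 + j)) mod r = j" using that j0(1) by simp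
      then show ?thesis using all[of "r - j0 + j"] by simp
    qed
    then have "wt j = 0" if "j < r" for j using lf[OF that] that mpos by auto
    then show False using wt(2) by simp
  qed
  then have "f j = 0" if "j < r" for j using m[OF that] f0[OF that] by simp
  then have "P ` {..<r} \<subseteq> {y. a \<bullet> y = a \<bullet> x}" by (auto simp: f_def)
  then have "N \<subseteq> {y. a \<bullet> y = a \<bullet> x}" unfolding N_def by (intro hull_minimal convex_hyperplane)
  then have "interior N \<subseteq> interior {y. a \<bullet> y = a \<bullet> x}" by (rule interior_mono)
  then show False using int a(1) unfolding N_def[symmetric] by simp
qed

section \<open>Closed polygons with cyclically ordered sides\<close>

text \<open>The partial sums increase from 0 and then decrease to 0.\<close>

lemma unimodal_partial_sums:
  fixes a :: "nat \<Rightarrow> int"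
  assumes "\<And>i. i < m \<Longrightarrow> a i \<ge> 0" "\<And>i. m \<le> i \<Longrightarrow> i < r \<Longrightarrow> a i \<le> 0" "(\<Sum>i<r. a i) = 0" "n \<le> r"
  shows "(\<Sum>i<n. a i) \<ge> 0"
proof (cases "n \<le> m")
  case True
  then show ?thesis using assms(1) by (intro sum_nonneg) auto
next
  case False
  have "(\<Sum>i<r. a i) = (\<Sum>i<n. a i) + (\<Sum>i\<in>{n..<r}. a i)"
    using assms(4) by (metis atLeast0LessThan le0 sum.atLeastLessThan_concat)
  moreover have "(\<Sum>i\<in>{n..<r}. a i) \<le> 0" using assms(2) False by (intro sum_nonpos) auto
  ultimately show ?thesis using assms(3) by linarith
qed

text \<open>The classes of the train-tracks of the torus, without the graph: they are nonzero and sum up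
  to zero.\<close>

locale cyclic_vectors =
  fixes X :: "'a set" and w :: "'a \<Rightarrow> int \<times> int"
  assumes finite_X: "finite X" and nonzero: "x \<in> X \<Longrightarrow> w x \<noteq> 0" and sum_zero: "(\<Sum>x\<in>X. w x) = 0"
begin

abbreviation "r \<equiv> card X"
abbreviation "dir x \<equiv> direction (w x)"

definition enum :: "(nat \<Rightarrow> 'a) \<Rightarrow> bool" where
  "enum T \<longleftrightarrow> bij_betw T {..<r} X \<and> cyc_sorted (\<lambda>a b c. cyc_direction (w a) (w b) (w c)) r T"

text \<open>The index is taken modulo \<open>r\<close> so that the walk can start anywhere.\<close>

definition walk :: "(nat \<Rightarrow> 'a) \<Rightarrow> nat \<Rightarrow> int \<times> int" where
  "walk T n = (\<Sum>i<n. w (T (i mod r)))"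

definition polygon :: "(nat \<Rightarrow> 'a) \<Rightarrow> (real \<times> real) set" where
  "polygon T = convex hull ((plane_point \<circ> walk T) ` {..<r})"

lemma enumD:
  assumes "enum T"
  shows "i < r \<Longrightarrow> T i \<in> X" "inj_on T {..<r}" "T ` {..<r} = X"
    "cyc_sorted cyc_angle r (\<lambda>i. dir (T i))"
proof -
  have bij: "bij_betw T {..<r} X" using assms by (simp add: enum_def)
  then show T: "i < r \<Longrightarrow> T i \<in> X" for i by (auto simp: bij_betw_def)
  show "inj_on T {..<r}" "T ` {..<r} = X" using bij by (auto simp: bij_betw_def)
  show "cyc_sorted cyc_angle r (\<lambda>i. dir (T i))"
    using assms T nonzero unfolding enum_def cyc_sorted_def
    by (metis (no_types, lifting) cyc_direction_iff order.strict_trans)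
qed

lemma enumI:
  assumes bij: "bij_betw T {..<r} X" and cs: "cyc_sorted cyc_angle r (\<lambda>i. dir (T i))"
  shows "enum T"
  unfolding enum_def
proof
  have T: "i < r \<Longrightarrow> w (T i) \<noteq> 0" for i using bij nonzero by (auto simp: bij_betw_def)
  show "cyc_sorted (\<lambda>a b c. cyc_direction (w a) (w b) (w c)) r T"
    using cs T unfolding cyc_sorted_def by (metis (no_types, lifting) cyc_direction_iff order.strict_trans)
qed (rule bij)

lemma sum_enum: "enum T \<Longrightarrow> (\<Sum>i<r. h (T i)) = (\<Sum>x\<in>X. h x)"
  unfolding enum_def by (intro sum.reindex_bij_betw) auto

lemma walk_r: "enum T \<Longrightarrow> walk T r = 0"
  using sum_enum[of T w] sum_zero by (simp add: walk_def)

lemma walk_add: "walk T (s + n) = walk T s + (\<Sum>i<n. w (T ((s + i) mod r)))"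
  by (induction n) (auto simp: walk_def algebra_simps)

lemma bij_rotation:
  assumes "s < r"
  shows "bij_betw (\<lambda>i. (s + i) mod r) {..<r} {..<r}"
proof -
  have "inj_on (\<lambda>i. (s + i) mod r) {..<r}"
  proof (rule inj_onI)
    fix i j assume ij: "i \<in> {..<r}" "j \<in> {..<r}" "(s + i) mod r = (s + j) mod r"
    have m: "(s + i) mod r = (if s + i < r then s + i else s + i - r)" if "i < r" for i
    proof (cases "s + i < r")
      case False
      then show ?thesis using assms that le_mod_geq[of r "s + i"] mod_less[of "s + i - r" r] by simp
    qed simp
    have "(if s + i < r then s + i else s + i - r) = (if s + j < r then s + j else s + j - r)"
      using m[of i] m[of j] ij by simp
    then show "i = j" using ij(1,2) assms unfolding lessThan_iff by (auto split: if_splits)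
  qed
  moreover have "(\<lambda>i. (s + i) mod r) ` {..<r} \<subseteq> {..<r}" using assms by auto
  ultimately show ?thesis
    by (simp add: bij_betw_def endo_inj_surj)
qed

lemma enum_rotate:
  assumes T: "enum T" and s: "s < r"
  shows "enum (\<lambda>i. T ((s + i) mod r))"
proof (rule enumI)
  show "bij_betw (\<lambda>i. T ((s + i) mod r)) {..<r} X"
    using bij_betw_trans[OF bij_rotation[OF s], of T X] T by (simp add: enum_def o_def)
  show "cyc_sorted cyc_angle r (\<lambda>i. dir (T ((s + i) mod r)))"
    using cyc_sorted_rotate[OF cyc_angle_rotate enumD(4)[OF T] s] .
qed

lemma walk_rotate:
  assumes "s < r"
  shows "walk (\<lambda>i. T ((s + i) mod r)) n = walk T (s + n) - walk T s"
proof -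
  have "walk (\<lambda>i. T ((s + i) mod r)) n = (\<Sum>i<n. w (T ((s + i) mod r)))"
    by (simp add: walk_def mod_add_right_eq)
  then show ?thesis by (simp add: walk_add)
qed

lemma walk_periodic:
  assumes "enum T"
  shows "walk T (n + r) = walk T n"
proof -
  have "walk T (r + n) = walk T r + (\<Sum>i<n. w (T ((r + i) mod r)))" by (rule walk_add)
  then show ?thesis using walk_r[OF assms] by (simp add: add.commute walk_def)
qed

lemma walk_mod:
  assumes "enum T"
  shows "walk T n = walk T (n mod r)"
proof -
  have "walk T (n mod r + k * r) = walk T (n mod r)" for k
    by (induction k) (use walk_periodic[OF assms, of "n mod r + _ * r"] in \<open>auto simp: algebra_simps\<close>)
  then show ?thesis by (metis mod_div_mult_eq)
qed

lemma walk_in_polygon: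
  assumes "enum T" "r > 0"
  shows "plane_point (walk T n) \<in> polygon T"
  unfolding polygon_def walk_mod[OF assms(1), of n] using assms(2) by (intro hull_inc) auto

lemma polygon_rotate:
  assumes T: "enum T" and s: "s < r"
  shows "polygon (\<lambda>i. T ((s + i) mod r)) = (\<lambda>x. - plane_point (walk T s) + x) ` polygon T"
proof -
  have "(plane_point \<circ> walk (\<lambda>i. T ((s + i) mod r))) ` {..<r} =
     (\<lambda>x. - plane_point (walk T s) + x) ` ((plane_point \<circ> walk T) ` {..<r})"
  proof -
    have "(plane_point \<circ> walk (\<lambda>i. T ((s + i) mod r))) ` {..<r} =
       (\<lambda>i. - plane_point (walk T s) + plane_point (walk T ((s + i) mod r))) ` {..<r}"
      by (rule image_cong) (auto simp: walk_rotate[OF s] plane_point_diff walk_mod[OF T, of "s + _"])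
    also have "\<dots> = (\<lambda>i. - plane_point (walk T s) + plane_point (walk T i)) ` ((\<lambda>i. (s + i) mod r) ` {..<r})"
      by (simp add: image_image)
    also have "(\<lambda>i. (s + i) mod r) ` {..<r} = {..<r}"
      using bij_rotation[OF s] by (simp add: bij_betw_def)
    finally show ?thesis by (simp add: image_image)
  qed
  then show ?thesis unfolding polygon_def by (simp only: convex_hull_translation)
qed

text \<open>For vectors with sum zero, this amounts to a positive area of the polygon.\<close>

definition nondegenerate :: bool where
  "nondegenerate \<longleftrightarrow> (\<exists>x\<in>X. \<exists>y\<in>X. \<exists>z\<in>X. dir x \<noteq> dir y \<and> dir y \<noteq> dir z \<and> dir x \<noteq> dir z)"

lemma third_direction:
  assumes nondegenerate
  shows "\<exists>x\<in>X. dir x \<noteq> a \<and> dir x \<noteq> b"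
  using assms unfolding nondegenerate_def by metis

text \<open>If there are only two directions, the components of the vectors orthogonal to one of them have
  the same sign and sum up to zero. Then the polygon lies on a line.\<close>

lemma interior_imp_nondegenerate:
  assumes T: "enum T" and int: "interior (polygon T) \<noteq> {}"
  shows nondegenerate
proof (rule ccontr)
  assume nd: "\<not> nondegenerate"
  have r: "r > 0" using int by (cases "r = 0") (auto simp: polygon_def)
  define v where "v = w (T 0)"
  have v: "v \<noteq> 0" using nonzero[OF enumD(1)[OF T r]] by (simp add: v_def)
  have c0: "cross v (w x) = 0" if "x \<in> X" "dir x = dir (T 0)" for x
    using cross_eq_sin[OF v nonzero[OF that(1)]] that(2) by (simp add: v_def)
  have "cross v (w x) = 0" if x: "x \<in> X" for x
  proof (rule ccontr)
    assume ne: "cross v (w x) \<noteq> 0"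
    then have dx: "dir x \<noteq> dir (T 0)" using c0[OF x] by blast
    define \<sigma> where "\<sigma> = sgn (sin (2 * lift_angle (dir x - direction v)))"
    have "of_int (cross v (w x)) \<noteq> (0 :: real)" using ne by simp
    then have \<sigma>0: "\<sigma> \<noteq> 0" unfolding cross_eq_sin[OF v nonzero[OF x]] \<sigma>_def by (auto simp: sgn_0_0)
    have same: "\<sigma> * of_int (cross v (w y)) \<ge> 0" if y: "y \<in> X" for y
    proof (cases "dir y = dir (T 0)")
      case False
      then have "dir y = dir x"
        using nd dx x y enumD(1)[OF T r] unfolding nondegenerate_def by metis
      then show ?thesis
        unfolding cross_eq_sin[OF v nonzero[OF y]] \<sigma>_def 
        by (cases "0 < sin (2 * lift_angle (dir x - direction v))") (auto simp: sgn_if mult_nonneg_nonpos)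
    qed (use c0[OF y] in simp)
    have "(\<Sum>y\<in>X. \<sigma> * of_int (cross v (w y))) = \<sigma> * of_int (cross v (\<Sum>y\<in>X. w y))"
      by (simp add: cross_def sum_distrib_left sum_subtractf fst_sum snd_sum right_diff_distrib)
    also have "\<dots> = 0" using sum_zero by (simp add: cross_def)
    finally have "\<forall>y\<in>X. \<sigma> * of_int (cross v (w y)) = 0"
      using same finite_X by (subst (asm) sum_nonneg_eq_0_iff) auto
    then show False using x ne \<sigma>0 by auto
  qed
  then have cw: "cross v (walk T n) = 0" for n
  proof (induction n)
    case (Suc n)
    have "T (n mod r) \<in> X" using enumD(1)[OF T] r by simp
    then have "cross v (w (T (n mod r))) = 0" using \<open>\<And>x. x \<in> X \<Longrightarrow> cross v (w x) = 0\<close> by blast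
    then show ?case using Suc by (simp add: walk_def cross_def algebra_simps)
  qed (simp add: walk_def cross_def)
  define a :: "real \<times> real" where "a = (- of_int (snd v), of_int (fst v))"
  have a0: "a \<noteq> 0" using v by (cases v) (auto simp: a_def zero_prod_def)
  have in_cross: "a \<bullet> plane_point u = of_int (cross v u)" for u
    by (simp add: a_def plane_point_def cross_def)
  have "(plane_point \<circ> walk T) ` {..<r} \<subseteq> {y. a \<bullet> y = 0}"
    unfolding image_subset_iff comp_apply mem_Collect_eq in_cross cw by simp
  then have "polygon T \<subseteq> {y. a \<bullet> y = 0}" unfolding polygon_def by (intro hull_minimal convex_hyperplane)
  then have "interior (polygon T) \<subseteq> interior {y. a \<bullet> y = 0}" by (rule interior_mono)
  then show False using int a0 by simp
qed

text \<open>A group consists of consecutive indices with equal values of \<open>f\<close>, read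
  cyclically.\<close>

lemma exists_group_start:
  assumes T: "enum T" and x: "x \<in> X" and y: "y \<in> X" "f y \<noteq> f x"
  obtains s where "s < r" "f (T s) = f x" "f (T ((s + r - 1) mod r)) \<noteq> f x"
proof -
  have r: "r > 0" using x finite_X by (auto simp: card_gt_0_iff)
  define h where "h n = f (T (n mod r))" for n
  have "\<exists>n. h (Suc n) = f x \<and> h n \<noteq> f x"
  proof (rule ccontr)
    assume "\<nexists>n. h (Suc n) = f x \<and> h n \<noteq> f x"
    then have down: "h n = f x" if "h (Suc n) = f x" for n using that by blast
    obtain i j where ij: "i < r" "T i = x" "j < r" "T j = y"
      using x y enumD(3)[OF T] by (metis imageE lessThan_iff)
    have hi: "h (i + r) = f x" using ij by (simp add: h_def)
    have "h (i + r - k) = f x" if "k \<le> i + r" for k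
      using that
    proof (induction k)
      case (Suc k)
      have "Suc (i + r - Suc k) = i + r - k" using Suc.prems by simp
      then show ?case using Suc down[of "i + r - Suc k"] by simp
    qed (use hi in simp)
    then have "h j = f x" using ij by (metis diff_diff_cancel le_add2 less_imp_le order_trans diff_le_self)
    then show False using ij y by (simp add: h_def)
  qed
  then obtain n where n: "h (Suc n) = f x" "h n \<noteq> f x" by blast
  define s where "s = Suc n mod r"
  have "(s + r - 1) mod r = n mod r"
  proof -
    have "s + r - 1 = s + (r - 1)" using r by simp
    then have "(s + r - 1) mod r = (Suc n + (r - 1)) mod r" by (simp add: s_def mod_add_left_eq)
    also have "Suc n + (r - 1) = n + r" using r by simp
    finally show ?thesis by simp
  qed
  then show ?thesis using that[of s] n r by (simp add: s_def h_def)
qed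

text \<open>From the side \<open>T j\<close> on, the sides turn away from its direction by less than
  \<open>pi\<close>, then by more: the height above the line of this side first increases,
  then decreases, and it comes back to 0.\<close>

lemma left_of_side:
  assumes T: "enum T" and nd: nondegenerate and j: "j < r"
  shows "cross (w (T j)) (walk T n - walk T j) \<ge> 0"
proof -
  define S where "S i = T ((j + i) mod r)" for i
  have S: "enum S" unfolding S_def by (rule enum_rotate[OF T j])
  have r: "r > 0" using j by simp
  define v where "v = w (T j)"
  have S0: "S 0 = T j" using j by (simp add: S_def)
  have v: "v \<noteq> 0" using nonzero[OF enumD(1)[OF T j]] by (simp add: v_def)
  define a where "a i = cross v (w (S i))" for i
  define g where "g i = lift_angle (dir (S i) - dir (S 0))" for i
  have SX: "S i \<in> X" if "i < r" for i using enumD(1)[OF S that] .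
  have ag: "of_int (a i) = norm (cvec v) * norm (cvec (w (S i))) * sin (2 * g i)" if "i < r" for i
    unfolding a_def g_def S0 v_def[symmetric] using cross_eq_sin[OF v nonzero[OF SX[OF that]]] by (simp add: v_def)
  have gb: "0 \<le> g i" "g i < pi" for i by (simp_all add: g_def lift_angle_bounds)
  define R where "R = Suc (Max {i. i < r \<and> dir (S i) \<noteq> dir (S 0)})"
  have ne: "{i. i < r \<and> dir (S i) \<noteq> dir (S 0)} \<noteq> {}"
  proof -
    obtain y where y: "y \<in> X" "dir y \<noteq> dir (S 0)" using third_direction[OF nd] by blast
    then obtain i where "i < r" "S i = y" using enumD(3)[OF S] by (metis imageE lessThan_iff)
    then show ?thesis using y by blast
  qed
  have fin: "finite {i. i < r \<and> dir (S i) \<noteq> dir (S 0)}" by simp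
  have R1: "R - 1 < r" "dir (S (R - 1)) \<noteq> dir (S 0)" using Max_in[OF fin ne] by (auto simp: R_def)
  have R2: "dir (S i) = dir (S 0)" if "R \<le> i" "i < r" for i
  proof (rule ccontr)
    assume "dir (S i) \<noteq> dir (S 0)"
    then have "i \<le> Max {i. i < r \<and> dir (S i) \<noteq> dir (S 0)}" using that fin by (intro Max_ge) auto
    then show False using that by (simp add: R_def)
  qed
  have Rr: "R \<le> r" using R1 by (simp add: R_def)
  have csR: "cyc_sorted cyc_angle R (\<lambda>i. dir (S i))"
    using enumD(4)[OF S] Rr unfolding cyc_sorted_def by (meson order_less_le_trans)
  obtain l where l: "l < R" "dir (S l) \<noteq> dir (S 0)" "dir (S l) \<noteq> dir (S (R - 1))"
  proof -
    obtain y where y: "y \<in> X" "dir y \<noteq> dir (S 0)" "dir y \<noteq> dir (S (R - 1))" using third_direction[OF nd] by blast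
    then obtain i where i: "i < r" "S i = y" using enumD(3)[OF S] by (metis imageE lessThan_iff)
    then have "i < R" using R2[of i] y by (metis not_le)
    then show ?thesis using that i y by blast
  qed
  have mono: "g i \<le> g k" if "i \<le> k" "k < R" for i k
    unfolding g_def by (rule cyc_sorted_linear[OF csR R1(2) l that])
  have pos: "a i \<ge> 0" if "i < r" "g i \<le> pi / 2" for i
  proof -
    have "sin (2 * g i) \<ge> 0" using gb[of i] that by (intro sin_ge_zero) auto
    then have "(of_int (a i) :: real) \<ge> 0" unfolding ag[OF that(1)] by simp
    then show ?thesis by simp
  qed
  have neg: "a i \<le> 0" if "i < r" "g i = 0 \<or> pi / 2 \<le> g i" for i
  proof -
    have "sin (2 * g i) \<le> 0"
    proof (cases "g i = 0")
      case False
      then have "sin (2 * g i - pi) \<ge> 0" using gb[of i] that by (intro sin_ge_zero) auto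
      then show ?thesis by (simp add: sin_diff)
    qed simp
    then have "(of_int (a i) :: real) \<le> 0" unfolding ag[OF that(1)] by (simp add: mult_nonneg_nonpos)
    then show ?thesis by simp
  qed
  have "\<exists>m. (\<forall>i<m. a i \<ge> 0) \<and> (\<forall>i. m \<le> i \<longrightarrow> i < r \<longrightarrow> a i \<le> 0)"
  proof (cases "\<exists>i<R. g i > pi / 2")
    case True
    define m where "m = (LEAST i. i < R \<and> g i > pi / 2)"
    have m: "m < R" "g m > pi / 2" using LeastI_ex[of "\<lambda>i. i < R \<and> g i > pi / 2"] True by (auto simp: m_def)
    have "a i \<ge> 0" if "i < m" for i
      using not_less_Least[of i "\<lambda>i. i < R \<and> g i > pi / 2"] that m Rr by (intro pos) (auto simp: m_def)
    moreover have "a i \<le> 0" if "m \<le> i" "i < r" for i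
    proof (rule neg[OF that(2)])
      show "g i = 0 \<or> pi / 2 \<le> g i"
      proof (cases "i < R")
        case True then show ?thesis using mono[OF that(1)] m by auto
      next
        case False then show ?thesis using R2[of i] that by (simp add: g_def)
      qed
    qed
    ultimately show ?thesis by blast
  next
    case False
    have "a i \<ge> 0" if i: "i < R" for i
    proof (rule pos)
      show "i < r" using i Rr by simp
      show "g i \<le> pi / 2" using False i by (metis not_le_imp_less)
    qed
    moreover have "a i \<le> 0" if "R \<le> i" "i < r" for i using R2[OF that] that by (intro neg) (auto simp: g_def)
    ultimately show ?thesis by blast
  qed
  then obtain m where m: "\<And>i. i < m \<Longrightarrow> a i \<ge> 0" "\<And>i. m \<le> i \<Longrightarrow> i < r \<Longrightarrow> a i \<le> 0" by blast
  have crs_add: "cross v (x + y) = cross v x + cross v y" for x y by (simp add: cross_def algebra_simps)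
  have cw: "(\<Sum>i<n. a i) = cross v (walk S n)" if "n \<le> r" for n
    using that
  proof (induction n)
    case (Suc n)
    then show ?case by (simp add: a_def walk_def crs_add)
  qed (simp add: walk_def cross_def)
  have tot: "(\<Sum>i<r. a i) = 0" using cw[of r] walk_r[OF S] by (simp add: cross_def)
  (* The position of n after the rotation that starts at j. *)
  define n' where "n' = (n + (r - j)) mod r"
  have n': "n' < r" using r by (simp add: n'_def)
  have "walk S n' = walk T (j + n') - walk T j"
    unfolding S_def by (rule walk_rotate[OF j])
  also have "walk T (j + n') = walk T ((j + n') mod r)" by (rule walk_mod[OF T])
  also have "(j + n') mod r = n mod r"
  proof -
    have "(j + n') mod r = (j + (n + (r - j))) mod r" by (simp add: n'_def mod_add_right_eq)
    also have "j + (n + (r - j)) = n + r" using j by simp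
    finally show ?thesis by simp
  qed
  also have "walk T (n mod r) = walk T n" by (rule walk_mod[OF T, symmetric])
  finally have "walk T n - walk T j = walk S n'" ..
  moreover have "0 \<le> (\<Sum>i<n'. a i)" by (rule unimodal_partial_sums[OF m tot]) (use n' in auto)
  ultimately show ?thesis using cw[of n'] n' by (simp add: v_def)
qed

text \<open>Enumerations that start with the same group of parallel sides agree up to the order within
  each group. A vertex of one polygon inside a group lies on the segment between the vertices
  of the other polygon at the two ends of this group.\<close>

lemma polygon_subset_of_group_start:
  assumes T: "enum T" and T': "enum T'" and nd: nondegenerate and r: "r > 0"
    and d: "dir (T 0) = d" "dir (T' 0) = d" "dir (T (r - 1)) \<noteq> d" "dir (T' (r - 1)) \<noteq> d"
  shows "polygon T' \<subseteq> polygon T"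
proof -
  define key where "key x = lift_angle (dir x - d)" for x
  have mono: "key (S i) \<le> key (S j)" if S: "enum S" "dir (S 0) = d" "dir (S (r - 1)) \<noteq> d" and ij: "i \<le> j" "j < r" for S i j
  proof -
    obtain y where y: "y \<in> X" "dir y \<noteq> dir (S 0)" "dir y \<noteq> dir (S (r - 1))" using third_direction[OF nd] by blast
    then obtain l where l: "l < r" "S l = y" using enumD(3)[OF S(1)] by (metis imageE lessThan_iff)
    have "lift_angle (dir (S i) - dir (S 0)) \<le> lift_angle (dir (S j) - dir (S 0))"
      using cyc_sorted_linear[OF enumD(4)[OF S(1)] _ l(1) _ _ ij] S y l by metis
    then show ?thesis using S(2) by (simp add: key_def)
  qed
  have initial: "\<exists>m\<le>r. plane_point (\<Sum>x\<in>A. w x) = plane_point (walk T m)"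
    if A: "A \<subseteq> X" "\<And>x y. x \<in> X \<Longrightarrow> y \<in> A \<Longrightarrow> key x \<le> key y \<Longrightarrow> x \<in> A" for A
  proof -
    define I where "I = {i. i < r \<and> T i \<in> A}"
    have down: "i \<in> I" if "i \<le> j" "j \<in> I" for i j
      using that A(2)[of "T i" "T j"] mono[OF T d(1,3), of i j] enumD(1)[OF T] by (auto simp: I_def)
    have finI: "finite I" by (simp add: I_def)
    define m where "m = card I"
    have "I = {..<m}"
    proof (cases "I = {}")
      case False
      define M where "M = Max I"
      have "I = {..M}" using down[of _ M] Max_in[OF finI False] Max_ge[OF finI] by (auto simp: M_def)
      then have "I = {..<Suc M}" "m = Suc M" unfolding m_def by auto
      then show ?thesis by simp
    qed (simp add: m_def)
    then have m: "m \<le> r" and I: "\<And>i. i < r \<Longrightarrow> T i \<in> A \<longleftrightarrow> i < m"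
    proof -
      show "m \<le> r" using card_mono[of "{..<r}" I] by (auto simp: m_def I_def)
      show "\<And>i. i < r \<Longrightarrow> T i \<in> A \<longleftrightarrow> i < m" using \<open>I = {..<m}\<close> unfolding I_def by auto
    qed
    have "A = T ` {..<m}"
    proof (intro equalityI subsetI)
      fix x assume x: "x \<in> A"
      then obtain i where "i < r" "T i = x" using A(1) enumD(3)[OF T] by (metis imageE lessThan_iff subsetD)
      then show "x \<in> T ` {..<m}" using I x by auto
    qed (use I m in auto)
    moreover have "inj_on T {..<m}" using enumD(2)[OF T] m by (meson inj_on_subset lessThan_subset_iff)
    ultimately have "(\<Sum>x\<in>A. w x) = (\<Sum>i<m. w (T i))" by (simp add: sum.reindex)
    also have "\<dots> = walk T m" unfolding walk_def using m by (intro sum.cong) auto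
    finally show ?thesis using m by auto
  qed
  have "plane_point (walk T' n) \<in> polygon T" if n: "n < r" for n
  proof -
    define \<kappa> where "\<kappa> = key (T' n)"
    (* The sides before the group of the n-th side, this group, and its part that has been
       walked. *)
    define A where "A = {x\<in>X. key x < \<kappa>}"
    define D where "D = {x\<in>X. key x = \<kappa>}"
    define D' where "D' = {x\<in>D. x \<in> T' ` {..<n}}"
    have finA: "finite A" and finD: "finite D" and finD': "finite D'" using finite_X by (auto simp: A_def D_def D'_def)
    have T'n: "T' n \<in> D" using enumD(1)[OF T' n] by (simp add: D_def \<kappa>_def)
    have split: "T' ` {..<n} = A \<union> D'"
    proof (intro equalityI subsetI)
      fix x assume "x \<in> T' ` {..<n}"
      then obtain i where i: "i < n" "x = T' i" by blast
      have "x \<in> X" using enumD(1)[OF T', of i] i n by simp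
      moreover have "key x \<le> \<kappa>" using mono[OF T' d(2,4), of i n] i n by (simp add: \<kappa>_def)
      ultimately show "x \<in> A \<union> D'" using i by (auto simp: A_def D'_def D_def)
    next
      fix x assume "x \<in> A \<union> D'"
      then show "x \<in> T' ` {..<n}"
      proof
        assume x: "x \<in> A"
        then obtain i where i: "i < r" "T' i = x" using enumD(3)[OF T'] by (auto simp: A_def) (metis imageE lessThan_iff)
        have "i < n"
        proof (rule ccontr)
          assume "\<not> i < n"
          then have "\<kappa> \<le> key x" using mono[OF T' d(2,4), of n i] i by (simp add: \<kappa>_def)
          then show False using x by (simp add: A_def)
        qed
        then show ?thesis using i by blast
      qed (auto simp: D'_def)
    qed
    have AD: "A \<inter> D' = {}" "A \<inter> D = {}" "D' \<subseteq> D" by (auto simp: A_def D_def D'_def)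
    have inj': "inj_on T' {..<n}" using enumD(2)[OF T'] n by (meson inj_on_subset lessThan_subset_iff less_imp_le)
    have "walk T' n = (\<Sum>i<n. w (T' i))" unfolding walk_def using n by (intro sum.cong) auto
    also have "\<dots> = (\<Sum>x\<in>T' ` {..<n}. w x)" using inj' by (simp add: sum.reindex)
    also have "\<dots> = (\<Sum>x\<in>A. w x) + (\<Sum>x\<in>D'. w x)" unfolding split using finA finD' AD by (simp add: sum.union_disjoint)
    finally have W: "plane_point (walk T' n) = plane_point (\<Sum>x\<in>A. w x) + plane_point (\<Sum>x\<in>D'. w x)"
      by (simp add: plane_point_add)
    have "\<exists>t>0. plane_point (w x) = t *\<^sub>R plane_point (w (T' n))" if "x \<in> D" for x
    proof -
      have "dir x = dir (T' n)" using that by (simp add: D_def \<kappa>_def key_def lift_angle_eq_iff)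
      then show ?thesis
        using direction_eqD[of "w (T' n)" "w x"] nonzero that T'n by (metis (no_types, lifting) D_def mem_Collect_eq)
    qed
    then obtain t where t: "\<And>x. x \<in> D \<Longrightarrow> t x > 0" "\<And>x. x \<in> D \<Longrightarrow> plane_point (w x) = t x *\<^sub>R plane_point (w (T' n))"
      by metis
    define s where "s = sum t D' / sum t D"
    have tD: "sum t D > 0" using t(1) T'n finD by (intro sum_pos) auto
    have tD': "0 \<le> sum t D'" "sum t D' \<le> sum t D"
    proof -
      have t0: "\<And>x. x \<in> D \<Longrightarrow> 0 \<le> t x" using t(1) by (simp add: less_imp_le)
      show "0 \<le> sum t D'" using t0 AD(3) by (intro sum_nonneg) auto
      show "sum t D' \<le> sum t D" using t0 by (intro sum_mono2[OF finD AD(3)]) auto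
    qed
    have s: "0 \<le> s" "s \<le> 1" using tD tD' by (auto simp: s_def)
    have pD': "plane_point (\<Sum>x\<in>D'. w x) = sum t D' *\<^sub>R plane_point (w (T' n))"
      unfolding plane_point_sum scaleR_sum_left using t(2) AD(3) by (intro sum.cong) auto
    have pD: "plane_point (\<Sum>x\<in>D. w x) = sum t D *\<^sub>R plane_point (w (T' n))"
      unfolding plane_point_sum scaleR_sum_left using t(2) by (intro sum.cong) auto
    have "plane_point (\<Sum>x\<in>D'. w x) = s *\<^sub>R plane_point (\<Sum>x\<in>D. w x)"
      unfolding pD' pD s_def using tD by simp
    then have "plane_point (walk T' n) = (1 - s) *\<^sub>R plane_point (\<Sum>x\<in>A. w x) + s *\<^sub>R plane_point (\<Sum>x\<in>A \<union> D. w x)"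
      unfolding W using finA finD AD by (simp add: sum.union_disjoint plane_point_add algebra_simps)
    moreover have "\<exists>m\<le>r. plane_point (\<Sum>x\<in>A. w x) = plane_point (walk T m)"
      by (rule initial) (auto simp: A_def)
    moreover have "\<exists>m\<le>r. plane_point (\<Sum>x\<in>A \<union> D. w x) = plane_point (walk T m)"
      by (rule initial) (auto simp: A_def D_def)
    ultimately obtain m m' where "plane_point (walk T' n) = (1 - s) *\<^sub>R plane_point (walk T m) + s *\<^sub>R plane_point (walk T m')"
      by metis
    then show ?thesis
      using convexD[OF convex_convex_hull, of "plane_point (walk T m)" _ "plane_point (walk T m')" "1 - s" s]
        walk_in_polygon[OF T r] s unfolding polygon_def by (metis add.commute diff_add_cancel diff_ge_0_iff_ge)
  qed
  then show ?thesis
    unfolding polygon_def[of T'] by (intro hull_minimal) (auto simp: polygon_def)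
qed

lemma polygon_unique:
  assumes T: "enum T" and T': "enum T'" and nd: nondegenerate
  obtains c where "polygon T' = (\<lambda>x. plane_point c + x) ` polygon T"
proof -
  obtain x where x: "x \<in> X" using third_direction[OF nd] by blast
  obtain y where y: "y \<in> X" "dir y \<noteq> dir x" using third_direction[OF nd] by blast
  have r: "r > 0" using x finite_X by (auto simp: card_gt_0_iff)
  obtain s where s: "s < r" "dir (T s) = dir x" "dir (T ((s + r - 1) mod r)) \<noteq> dir x"
    using exists_group_start[OF T x y(1), of dir, OF y(2)] by metis
  obtain s' where s': "s' < r" "dir (T' s') = dir x" "dir (T' ((s' + r - 1) mod r)) \<noteq> dir x"
    using exists_group_start[OF T' x y(1), of dir, OF y(2)] by metis
  define S where "S = (\<lambda>i. T ((s + i) mod r))"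
  define S' where "S' = (\<lambda>i. T' ((s' + i) mod r))"
  have S: "enum S" "enum S'" unfolding S_def S'_def using enum_rotate T T' s s' by blast+
  have e: "s + (r - 1) = s + r - 1" "s' + (r - 1) = s' + r - 1" using r by auto
  have "dir (S 0) = dir x" "dir (S' 0) = dir x" "dir (S (r - 1)) \<noteq> dir x" "dir (S' (r - 1)) \<noteq> dir x"
    using s s' unfolding S_def S'_def e by auto
  then have "polygon S = polygon S'"
    using polygon_subset_of_group_start[OF S nd r] polygon_subset_of_group_start[OF S(2,1) nd r] by blast
  then have eq: "(\<lambda>y. - plane_point (walk T s) + y) ` polygon T = (\<lambda>y. - plane_point (walk T' s') + y) ` polygon T'"
    unfolding S_def S'_def polygon_rotate[OF T s(1)] polygon_rotate[OF T' s'(1)] .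
  have "polygon T' = (\<lambda>y. plane_point (walk T' s') + y) ` ((\<lambda>y. - plane_point (walk T' s') + y) ` polygon T')"
    by (simp add: image_image)
  also have "\<dots> = (\<lambda>y. plane_point (walk T' s' - walk T s) + y) ` polygon T"
    unfolding eq[symmetric] by (simp add: image_image plane_point_diff algebra_simps)
  finally show ?thesis using that by blast
qed

end

text \<open>The translation can be iterated.\<close>

lemma translation_subset_bounded:
  fixes c :: "'a :: real_normed_vector"
  assumes "bounded N" "N \<noteq> {}" "(\<lambda>x. c + x) ` N \<subseteq> N"
  shows "c = 0"
proof (rule ccontr)
  assume c: "c \<noteq> 0"
  obtain x where x: "x \<in> N" using assms(2) by blast
  have n: "real n *\<^sub>R c + x \<in> N" for n
  proof (induction n)
    case (Suc n)
    then have "c + (real n *\<^sub>R c + x) \<in> N" using assms(3) by blast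
    then show ?case by (simp add: algebra_simps)
  qed (use x in simp)
  obtain B where B: "\<And>y. y \<in> N \<Longrightarrow> norm y \<le> B" using assms(1) bounded_iff by blast
  obtain n where "B + norm x < real n * norm c" using reals_Archimedean3[of "norm c"] c by auto
  moreover have "real n * norm c = norm ((real n *\<^sub>R c + x) - x)" by simp
  moreover have "\<dots> \<le> norm (real n *\<^sub>R c + x) + norm x" by (rule norm_triangle_ineq4)
  ultimately show False using B[OF n[of n]] by linarith
qed

context cyclic_vectors
begin

definition side_path :: "(nat \<Rightarrow> 'a) \<Rightarrow> (nat \<Rightarrow> int \<times> int) \<Rightarrow> bool" where
  "side_path T P \<longleftrightarrow> (\<forall>j<r. P (Suc j) = P j + w (T j))"

abbreviation "hull_of P \<equiv> convex hull ((plane_point \<circ> P) ` {..<r})"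

lemma side_path_walk:
  assumes "side_path T P" "j \<le> r"
  shows "P j = P 0 + walk T j"
  using assms(2)
proof (induction j)
  case (Suc j)
  then show ?case using assms(1) by (simp add: side_path_def walk_def)
qed (simp add: walk_def)

lemma hull_side_path:
  assumes "side_path T P"
  shows "hull_of P = (\<lambda>x. plane_point (P 0) + x) ` polygon T"
proof -
  have "(plane_point \<circ> P) ` {..<r} = (\<lambda>x. plane_point (P 0) + x) ` ((plane_point \<circ> walk T) ` {..<r})"
    unfolding image_image
  proof (rule image_cong[OF refl])
    fix n assume "n \<in> {..<r}"
    then have "P n = P 0 + walk T n" by (intro side_path_walk[OF assms]) simp
    then show "(plane_point \<circ> P) n = plane_point (P 0) + (plane_point \<circ> walk T) n"
      by (simp only: comp_apply plane_point_add)
  qed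
  then show ?thesis unfolding polygon_def by (simp only: convex_hull_translation)
qed

lemma hull_interior_nondegenerate:
  assumes "enum T" "side_path T P" "interior (hull_of P) \<noteq> {}"
  shows nondegenerate
proof (rule interior_imp_nondegenerate[OF assms(1)])
  show "interior (polygon T) \<noteq> {}"
    using assms(3) unfolding hull_side_path[OF assms(2)] interior_translation by blast
qed

lemma side_path_exists:
  assumes T: "enum T" "side_path T P" and T': "enum T'" and nd: nondegenerate
  obtains P' where "side_path T' P'" "hull_of P' = hull_of P"
proof -
  obtain c where c: "polygon T' = (\<lambda>x. plane_point c + x) ` polygon T"
    using polygon_unique[OF T(1) T' nd] by blast
  define P' where "P' n = P 0 - c + walk T' n" for n
  have sp: "side_path T' P'"
    unfolding side_path_def P'_def walk_def by (simp add: algebra_simps)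
  have "hull_of P' = hull_of P"
    unfolding hull_side_path[OF sp] hull_side_path[OF T(2)] c
    by (simp add: image_image P'_def walk_def plane_point_diff)
  then show ?thesis using that sp by blast
qed

text \<open>The line of the side at this point supports the polygon.\<close>

lemma side_path_frontier:
  assumes T: "enum T" and P: "side_path T P" and nd: nondegenerate and j: "j < r"
  shows "plane_point (P j) \<in> frontier (hull_of P)"
proof -
  define v where "v = w (T j)"
  have v: "v \<noteq> 0" using nonzero[OF enumD(1)[OF T j]] by (simp add: v_def)
  define a :: "real \<times> real" where "a = (- of_int (snd v), of_int (fst v))"
  have a0: "a \<noteq> 0" using v by (cases v) (auto simp: a_def zero_prod_def)
  have in_cross: "a \<bullet> plane_point u = of_int (cross v u)" for u
    by (simp add: a_def plane_point_def cross_def)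
  have "a \<bullet> plane_point (P j) \<le> a \<bullet> plane_point (P n)" if n: "n < r" for n
  proof -
    have "P n = P 0 + walk T n" "P j = P 0 + walk T j" using side_path_walk[OF P] n j by (meson less_imp_le)+
    then have "P n - P j = walk T n - walk T j" by (metis add_diff_cancel_left)
    then have "0 \<le> cross v (P n - P j)" using left_of_side[OF T nd j, of n] by (simp add: v_def)
    then have "cross v (P j) \<le> cross v (P n)" by (simp add: cross_def algebra_simps)
    then show ?thesis unfolding in_cross by simp
  qed
  then have "hull_of P \<subseteq> {y. a \<bullet> y \<ge> a \<bullet> plane_point (P j)}"
    by (intro hull_minimal convex_halfspace_ge) auto
  then have "interior (hull_of P) \<subseteq> interior {y. a \<bullet> y \<ge> a \<bullet> plane_point (P j)}" by (rule interior_mono)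
  then have "interior (hull_of P) \<subseteq> {y. a \<bullet> y > a \<bullet> plane_point (P j)}" using a0 by simp
  then have "plane_point (P j) \<notin> interior (hull_of P)" by auto
  moreover have "plane_point (P j) \<in> hull_of P" using j by (intro hull_inc) auto
  ultimately show ?thesis unfolding frontier_def using closure_subset by blast
qed

lemma compact_hull_of: "compact (hull_of P)"
  by (intro finite_imp_compact_convex_hull finite_imageI) simp

text \<open>The two polygons are translates of each other, and one of them is contained in the other.\<close>

lemma hull_of_frontier_path:
  assumes T: "enum T" "side_path T P" and T': "enum T'" "side_path T' P'" and nd: nondegenerate
    and fr: "\<And>j. j < r \<Longrightarrow> plane_point (P' j) \<in> frontier (hull_of P)"
  shows "hull_of P' = hull_of P"
proof -
  obtain c where c: "polygon T' = (\<lambda>x. plane_point c + x) ` polygon T"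
    using polygon_unique[OF T(1) T'(1) nd] by blast
  define d where "d = plane_point (P' 0) + plane_point c - plane_point (P 0)"
  have eq: "hull_of P' = (\<lambda>x. d + x) ` hull_of P"
    unfolding hull_side_path[OF T'(2)] hull_side_path[OF T(2)] c d_def by (simp add: image_image algebra_simps)
  have cl: "closed (hull_of P)" by (rule compact_imp_closed[OF compact_hull_of])
  have "hull_of P' \<subseteq> hull_of P"
    using fr frontier_subset_closed[OF cl] by (intro hull_minimal convex_convex_hull) auto
  moreover obtain x where "x \<in> X" using third_direction[OF nd] by blast
  then have "r > 0" using finite_X by (auto simp: card_gt_0_iff)
  then have "hull_of P \<noteq> {}" by auto
  ultimately have "d = 0"
    using translation_subset_bounded[OF compact_imp_bounded[OF compact_hull_of]] eq by metis
  then show ?thesis using eq by simp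
qed

end

section \<open>The map phi of a cyclically ordered family of vectors\<close>

lemma gap_of_lifts:
  fixes f :: "nat \<Rightarrow> halfangle"
  assumes mono: "\<And>i j. i \<le> j \<Longrightarrow> j < r \<Longrightarrow> lift_angle (f i - f 0) \<le> lift_angle (f j - f 0)"
    and last: "f (r - 1) \<noteq> f 0" and j: "j < r"
  shows "lift_angle (f j - f ((j + r - 1) mod r)) =
    (if j = 0 then pi - lift_angle (f (r - 1) - f 0) else lift_angle (f j - f 0) - lift_angle (f (j - 1) - f 0))"
proof (cases "j = 0")
  case True
  have "lift_angle (f (r - 1) - f 0) \<noteq> 0" using last by (simp add: lift_angle_0_iff)
  then have "0 < lift_angle (f (r - 1) - f 0)" using lift_angle_bounds(1)[of "f (r - 1) - f 0"] by simp
  then show ?thesis using True j lift_angle_diff[of "f 0" "f (r - 1)" "f 0"] by simp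
next
  case False
  have "(j + r - 1) mod r = ((j - 1) + r) mod r" using False by simp
  also have "\<dots> = j - 1" using j by simp
  finally have "(j + r - 1) mod r = j - 1" .
  then show ?thesis using False mono[of "j - 1" j] j lift_angle_diff[of "f j" "f (j - 1)" "f 0"] by simp
qed

lemma summation_by_parts:
  fixes Q :: "nat \<Rightarrow> 'a :: real_vector"
  assumes "r > 0" "Q r = Q 0" "g 0 = 0"
  shows "(\<Sum>j<r. (if j = 0 then c - g (r - 1) else g j - g (j - 1)) *\<^sub>R Q j) =
    c *\<^sub>R Q 0 - (\<Sum>j<r. g j *\<^sub>R (Q (Suc j) - Q j))"
proof -
  have *: "(\<Sum>j<Suc n. (if j = 0 then d else g j - g (j - 1)) *\<^sub>R Q j) =
    d *\<^sub>R Q 0 + g n *\<^sub>R Q (Suc n) - (\<Sum>j<Suc n. g j *\<^sub>R (Q (Suc j) - Q j))" for n d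
  proof (induction n)
    case 0
    then show ?case using assms(3) by simp
  next
    case (Suc n)
    have "(\<Sum>j<Suc (Suc n). (if j = 0 then d else g j - g (j - 1)) *\<^sub>R Q j) =
      (\<Sum>j<Suc n. (if j = 0 then d else g j - g (j - 1)) *\<^sub>R Q j) + (g (Suc n) - g n) *\<^sub>R Q (Suc n)"
      by (subst sum.lessThan_Suc) simp
    also have "\<dots> = d *\<^sub>R Q 0 + g (Suc n) *\<^sub>R Q (Suc (Suc n)) -
       ((\<Sum>j<Suc n. g j *\<^sub>R (Q (Suc j) - Q j)) + g (Suc n) *\<^sub>R (Q (Suc (Suc n)) - Q (Suc n)))"
      unfolding Suc by (simp add: algebra_simps)
    finally show ?case by (subst (2) sum.lessThan_Suc)
  qed
  obtain n where n: "r = Suc n" using assms(1) gr0_conv_Suc by blast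
  have "(\<Sum>j<r. (if j = 0 then c - g (r - 1) else g j - g (j - 1)) *\<^sub>R Q j) =
    (c - g n) *\<^sub>R Q 0 + g n *\<^sub>R Q r - (\<Sum>j<r. g j *\<^sub>R (Q (Suc j) - Q j))"
    using *[of "c - g n" n] unfolding n diff_Suc_1 .
  then show ?thesis unfolding assms(2) by (simp add: scaleR_diff_left)
qed

lemma cyc_direction_distinct:
  assumes "u \<noteq> 0" "v \<noteq> 0" "w \<noteq> 0" "cyc_direction u v w"
  shows "u \<noteq> v" "v \<noteq> w" "u \<noteq> w"
proof -
  have "cyc_angle (direction u) (direction v) (direction w)" using assms cyc_direction_iff by blast
  then show "u \<noteq> v" "v \<noteq> w" "u \<noteq> w" unfolding cyc_angle_iff[of _ _ _ 0] by auto
qed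

context cyclic_vectors
begin

text \<open>The maps of \<open>X_per\<close>, for abstract vectors.\<close>

definition monotone_map :: "('a \<Rightarrow> halfangle) \<Rightarrow> bool" where
  "monotone_map \<alpha> \<longleftrightarrow>
     (\<forall>x\<in>X. \<forall>y\<in>X. \<forall>z\<in>X. cyc_direction (w x) (w y) (w z) \<longrightarrow> \<not> cyc_angle (\<alpha> x) (\<alpha> z) (\<alpha> y)) \<and>
     (\<forall>x\<in>X. \<forall>y\<in>X. w x \<noteq> w y \<longrightarrow> \<alpha> x \<noteq> \<alpha> y)"

definition admissible ::
    "(real \<times> real) set \<Rightarrow> ('a \<Rightarrow> halfangle) \<Rightarrow> (nat \<Rightarrow> 'a) \<Rightarrow> (nat \<Rightarrow> int \<times> int) \<Rightarrow> bool" where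
  "admissible N \<alpha> T P \<longleftrightarrow> enum T \<and> cyc_sorted cyc_angle r (\<alpha> \<circ> T) \<and> side_path T P \<and>
     (\<forall>j<r. plane_point (P j) \<in> frontier N)"

text \<open>The value of \<open>phi\<close> for a given enumeration.\<close>

definition gap_sum :: "('a \<Rightarrow> halfangle) \<Rightarrow> (nat \<Rightarrow> 'a) \<Rightarrow> (nat \<Rightarrow> int \<times> int) \<Rightarrow> real \<times> real" where
  "gap_sum \<alpha> T P =
     (\<Sum>j<r. (lift_angle (\<alpha> (T j) - \<alpha> (T ((j + r - 1) mod r))) / pi) *\<^sub>R plane_point (P j))"

lemma monotone_map_eqD: "monotone_map \<alpha> \<Longrightarrow> x \<in> X \<Longrightarrow> y \<in> X \<Longrightarrow> \<alpha> x = \<alpha> y \<Longrightarrow> w x = w y"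
  unfolding monotone_map_def by blast

text \<open>Different directions have different half-angles.\<close>

lemma third_value:
  assumes "monotone_map \<alpha>" nondegenerate
  shows "\<exists>x\<in>X. \<alpha> x \<noteq> a \<and> \<alpha> x \<noteq> b"
proof -
  obtain x y z where xyz: "x \<in> X" "y \<in> X" "z \<in> X" "dir x \<noteq> dir y" "dir y \<noteq> dir z" "dir x \<noteq> dir z"
    using assms(2) unfolding nondegenerate_def by blast
  then have "\<alpha> x \<noteq> \<alpha> y" "\<alpha> y \<noteq> \<alpha> z" "\<alpha> x \<noteq> \<alpha> z" using monotone_map_eqD[OF assms(1)] by metis+
  then show ?thesis using xyz(1-3) by metis
qed

lemma side_path_closed:
  assumes "enum T" "side_path T P"
  shows "P r = P 0"
  using side_path_walk[OF assms(2), of r] walk_r[OF assms(1)] by simp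

lemma side_path_next:
  assumes "enum T" "side_path T P" "j < r"
  shows "P ((j + 1) mod r) = P j + w (T j)"
proof (cases "Suc j = r")
  case True
  then have "(j + 1) mod r = 0" by simp
  moreover have "P (Suc j) = P j + w (T j)" using assms by (simp add: side_path_def)
  ultimately show ?thesis using side_path_closed[OF assms(1,2)] True by simp
next
  case False
  then have "(j + 1) mod r = Suc j" using assms(3) by simp
  then show ?thesis using assms by (simp add: side_path_def)
qed

text \<open>Only the cyclic order of an enumeration matters.\<close>

lemma admissible_rotate:
  assumes A: "admissible N \<alpha> T P" and s: "s < r"
  obtains T' P' where "admissible N \<alpha> T' P'" "gap_sum \<alpha> T' P' = gap_sum \<alpha> T P"
    "T' 0 = T s" "T' (r - 1) = T ((s + r - 1) mod r)"
proof -
  have T: "enum T" and cs: "cyc_sorted cyc_angle r (\<alpha> \<circ> T)" and P: "side_path T P"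
    and fr: "\<And>j. j < r \<Longrightarrow> plane_point (P j) \<in> frontier N"
    using A by (auto simp: admissible_def)
  have r: "r > 0" using s by simp
  define T' where "T' i = T ((s + i) mod r)" for i
  define P' where "P' i = P s + walk T' i" for i
  have T': "enum T'" unfolding T'_def by (rule enum_rotate[OF T s])
  have P'_eq: "P' i = P ((s + i) mod r)" for i
  proof -
    have "P ((s + i) mod r) = P 0 + walk T ((s + i) mod r)"
      by (rule side_path_walk[OF P]) (use r in \<open>simp add: less_imp_le\<close>)
    also have "walk T ((s + i) mod r) = walk T (s + i)" by (rule walk_mod[OF T, symmetric])
    finally have "P ((s + i) mod r) = P 0 + walk T (s + i)" .
    moreover have "P s = P 0 + walk T s" by (rule side_path_walk[OF P]) (use s in simp)
    moreover have "walk T' i = walk T (s + i) - walk T s" unfolding T'_def by (rule walk_rotate[OF s])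
    ultimately show ?thesis by (simp add: P'_def)
  qed
  have A': "admissible N \<alpha> T' P'"
    unfolding admissible_def
  proof (intro conjI allI impI)
    show "enum T'" by (rule T')
    show "cyc_sorted cyc_angle r (\<alpha> \<circ> T')"
      using cyc_sorted_rotate[OF cyc_angle_rotate cs s] by (simp add: T'_def o_def)
    show "side_path T' P'" by (simp add: side_path_def P'_def walk_def algebra_simps)
    show "plane_point (P' j) \<in> frontier N" for j unfolding P'_eq using r by (intro fr) simp
  qed
  have idx: "(s + (j + r - 1) mod r) mod r = ((s + j) mod r + r - 1) mod r" for j
  proof -
    have "(s + (j + r - 1) mod r) mod r = (s + (j + r - 1)) mod r" by (rule mod_add_right_eq)
    also have "s + (j + r - 1) = (s + j) + (r - 1)" using r by simp
    also have "((s + j) + (r - 1)) mod r = ((s + j) mod r + (r - 1)) mod r" by (rule mod_add_left_eq[symmetric])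
    also have "(s + j) mod r + (r - 1) = (s + j) mod r + r - 1" using r by simp
    finally show ?thesis .
  qed
  have "gap_sum \<alpha> T' P' = gap_sum \<alpha> T P"
    unfolding gap_sum_def P'_eq T'_def idx
    by (rule sum.reindex_bij_betw[OF bij_rotation[OF s]])
  moreover have "T' 0 = T s" using s by (simp add: T'_def)
  moreover have "s + (r - 1) = s + r - 1" using r by simp
  then have "T' (r - 1) = T ((s + r - 1) mod r)" by (simp add: T'_def)
  ultimately show ?thesis using that A' by blast
qed

lemma admissible_lifts:
  assumes A: "admissible N \<alpha> T P" and mono: "monotone_map \<alpha>" and nd: nondegenerate
    and last: "\<alpha> (T (r - 1)) \<noteq> \<alpha> (T 0)" and ij: "i \<le> j" "j < r"
  shows "lift_angle (\<alpha> (T i) - \<alpha> (T 0)) \<le> lift_angle (\<alpha> (T j) - \<alpha> (T 0))"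
proof -
  have T: "enum T" and cs: "cyc_sorted cyc_angle r (\<alpha> \<circ> T)" using A by (auto simp: admissible_def)
  obtain y where y: "y \<in> X" "\<alpha> y \<noteq> \<alpha> (T 0)" "\<alpha> y \<noteq> \<alpha> (T (r - 1))" using third_value[OF mono nd] by blast
  then obtain l where "l < r" "T l = y" using enumD(3)[OF T] by (metis imageE lessThan_iff)
  then show ?thesis using cyc_sorted_linear[OF cs, of l i j] last y ij by simp
qed

lemma admissible_sum:
  fixes Q :: "nat \<Rightarrow> 'b :: real_vector"
  assumes A: "admissible N \<alpha> T P" and mono: "monotone_map \<alpha>" and nd: nondegenerate
    and last: "\<alpha> (T (r - 1)) \<noteq> \<alpha> (T 0)" and Q: "Q r = Q 0"
  shows "(\<Sum>j<r. lift_angle (\<alpha> (T j) - \<alpha> (T ((j + r - 1) mod r))) *\<^sub>R Q j) =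
    pi *\<^sub>R Q 0 - (\<Sum>j<r. lift_angle (\<alpha> (T j) - \<alpha> (T 0)) *\<^sub>R (Q (Suc j) - Q j))"
proof -
  have r: "r > 0" using third_value[OF mono nd] finite_X by (auto simp: card_gt_0_iff)
  have "(\<Sum>j<r. lift_angle (\<alpha> (T j) - \<alpha> (T ((j + r - 1) mod r))) *\<^sub>R Q j) =
    (\<Sum>j<r. (if j = 0 then pi - lift_angle (\<alpha> (T (r - 1)) - \<alpha> (T 0))
       else lift_angle (\<alpha> (T j) - \<alpha> (T 0)) - lift_angle (\<alpha> (T (j - 1)) - \<alpha> (T 0))) *\<^sub>R Q j)"
    using gap_of_lifts[of r "\<lambda>j. \<alpha> (T j)", OF admissible_lifts[OF A mono nd last] last]
    by (intro sum.cong) simp_all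
  then show ?thesis
    using summation_by_parts[OF r Q, of "\<lambda>j. lift_angle (\<alpha> (T j) - \<alpha> (T 0))" pi] by simp
qed

lemma total_gap:
  assumes "admissible N \<alpha> T P" "monotone_map \<alpha>" nondegenerate "\<alpha> (T (r - 1)) \<noteq> \<alpha> (T 0)"
  shows "(\<Sum>j<r. lift_angle (\<alpha> (T j) - \<alpha> (T ((j + r - 1) mod r)))) = pi"
  using admissible_sum[OF assms, of "\<lambda>_. 1 :: real"] by simp

text \<open>Summation by parts expresses the barycentre by the sides of the polygon.\<close>

lemma gap_sum_start:
  assumes A: "admissible N \<alpha> T P" and mono: "monotone_map \<alpha>" and nd: nondegenerate
    and last: "\<alpha> (T (r - 1)) \<noteq> \<alpha> (T 0)"
  shows "gap_sum \<alpha> T P = plane_point (P 0) -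
    (1 / pi) *\<^sub>R (\<Sum>x\<in>X. lift_angle (\<alpha> x - \<alpha> (T 0)) *\<^sub>R plane_point (w x))"
proof -
  have T: "enum T" and P: "side_path T P" using A by (auto simp: admissible_def)
  have side: "plane_point (P (Suc j)) - plane_point (P j) = plane_point (w (T j))" if "j < r" for j
    using P that by (simp add: side_path_def plane_point_add)
  have "gap_sum \<alpha> T P = (1 / pi) *\<^sub>R (\<Sum>j<r. lift_angle (\<alpha> (T j) - \<alpha> (T ((j + r - 1) mod r))) *\<^sub>R plane_point (P j))"
    by (simp add: gap_sum_def scaleR_sum_right)
  also have "\<dots> = (1 / pi) *\<^sub>R (pi *\<^sub>R plane_point (P 0) -
      (\<Sum>j<r. lift_angle (\<alpha> (T j) - \<alpha> (T 0)) *\<^sub>R (plane_point (P (Suc j)) - plane_point (P j))))"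
    using admissible_sum[OF A mono nd last, of "\<lambda>j. plane_point (P j)"] side_path_closed[OF T P] by simp
  also have "(\<Sum>j<r. lift_angle (\<alpha> (T j) - \<alpha> (T 0)) *\<^sub>R (plane_point (P (Suc j)) - plane_point (P j))) =
      (\<Sum>j<r. lift_angle (\<alpha> (T j) - \<alpha> (T 0)) *\<^sub>R plane_point (w (T j)))"
    by (rule sum.cong) (simp_all add: side)
  also have "\<dots> = (\<Sum>x\<in>X. lift_angle (\<alpha> x - \<alpha> (T 0)) *\<^sub>R plane_point (w x))"
    by (rule sum.reindex_bij_betw) (use T in \<open>simp add: enum_def\<close>)
  finally show ?thesis by (simp add: scaleR_diff_right)
qed

lemma admissible_group_start:
  assumes A: "admissible N \<alpha> T P" and x: "x \<in> X" and y: "y \<in> X" "f y \<noteq> f x"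
  obtains T' P' where "admissible N \<alpha> T' P'" "gap_sum \<alpha> T' P' = gap_sum \<alpha> T P"
    "f (T' 0) = f x" "f (T' (r - 1)) \<noteq> f x"
proof -
  have T: "enum T" using A by (simp add: admissible_def)
  obtain s where "s < r" "f (T s) = f x" "f (T ((s + r - 1) mod r)) \<noteq> f x"
    using exists_group_start[OF T x y] by blast
  then show ?thesis using admissible_rotate[OF A, of s] that by metis
qed

lemma admissible_hull:
  assumes "enum T\<^sub>0" "side_path T\<^sub>0 P\<^sub>0" nondegenerate "admissible (hull_of P\<^sub>0) \<alpha> T P"
  shows "hull_of P = hull_of P\<^sub>0"
  using assms(4) hull_of_frontier_path[OF assms(1,2) _ _ assms(3), of T P] unfolding admissible_def by blast

text \<open>A gap that vanishes separates equal half-angles, hence equal vectors, and the polygon is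
  straight there; this is the case that \<open>weighted_sum_interior\<close> allows.\<close>

lemma gap_sum_interior:
  assumes T0: "enum T\<^sub>0" "side_path T\<^sub>0 P\<^sub>0" and int: "interior (hull_of P\<^sub>0) \<noteq> {}"
    and mono: "monotone_map \<alpha>" and A0: "admissible (hull_of P\<^sub>0) \<alpha> T P"
  shows "gap_sum \<alpha> T P \<in> interior (hull_of P\<^sub>0)"
proof -
  have nd: nondegenerate by (rule hull_interior_nondegenerate[OF T0 int])
  obtain x y where "x \<in> X" "y \<in> X" "\<alpha> y \<noteq> \<alpha> x" using third_value[OF mono nd] by metis
  then obtain S Q where A: "admissible (hull_of P\<^sub>0) \<alpha> S Q" and gs: "gap_sum \<alpha> S Q = gap_sum \<alpha> T P"
    and last: "\<alpha> (S (r - 1)) \<noteq> \<alpha> (S 0)"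
    using admissible_group_start[OF A0, of x y \<alpha>] by metis
  have S: "enum S" and Q: "side_path S Q" using A by (auto simp: admissible_def)
  have hull: "hull_of Q = hull_of P\<^sub>0" by (rule admissible_hull[OF T0 nd A])
  define wt where "wt j = lift_angle (\<alpha> (S j) - \<alpha> (S ((j + r - 1) mod r))) / pi" for j
  have "(\<Sum>j<r. wt j *\<^sub>R (plane_point \<circ> Q) j) \<in> interior (hull_of Q)"
  proof (rule weighted_sum_interior)
    show "interior (hull_of Q) \<noteq> {}" using int hull by simp
    show "wt j \<ge> 0" for j by (simp add: wt_def lift_angle_bounds)
    show "(\<Sum>j<r. wt j) = 1"
      unfolding wt_def sum_divide_distrib[symmetric] total_gap[OF A mono nd last] by simp
    fix j assume j: "j < r" and "wt j = 0"
    define k where "k = (j + r - 1) mod r"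
    have k: "k < r" using j by (simp add: k_def)
    have "(k + 1) mod r = j"
    proof -
      have "(k + 1) mod r = (j + r - 1 + 1) mod r" unfolding k_def by (rule mod_add_left_eq)
      also have "j + r - 1 + 1 = j + r" using j by simp
      finally show ?thesis using j by simp
    qed
    then have kj: "Q j = Q k + w (S k)" using side_path_next[OF S Q k] by simp
    have "\<alpha> (S j) = \<alpha> (S k)" using \<open>wt j = 0\<close> by (simp add: wt_def k_def lift_angle_0_iff)
    then have "w (S j) = w (S k)" using monotone_map_eqD[OF mono] enumD(1)[OF S] j k by blast
    then have "Q ((j + 1) mod r) - Q j = Q j - Q k" using kj side_path_next[OF S Q j] by simp
    then have "plane_point (Q ((j + 1) mod r)) - plane_point (Q j) = plane_point (Q j) - plane_point (Q k)"
      by (metis plane_point_diff)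
    then show "(plane_point \<circ> Q) ((j + 1) mod r) - (plane_point \<circ> Q) j =
        (plane_point \<circ> Q) j - (plane_point \<circ> Q) ((j + r - 1) mod r)"
      unfolding k_def comp_apply .
  qed
  also have "(\<Sum>j<r. wt j *\<^sub>R (plane_point \<circ> Q) j) = gap_sum \<alpha> S Q"
    by (simp add: wt_def gap_sum_def)
  finally show ?thesis unfolding gs hull .
qed

text \<open>Once the enumerations start at the same direction, the first point is determined by the
  polygon, hence so is the barycentre.\<close>

lemma gap_sum_unique:
  assumes T0: "enum T\<^sub>0" "side_path T\<^sub>0 P\<^sub>0" and nd: nondegenerate and mono: "monotone_map \<alpha>"
    and A: "admissible (hull_of P\<^sub>0) \<alpha> T P" and A': "admissible (hull_of P\<^sub>0) \<alpha> T' P'"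
  shows "gap_sum \<alpha> T P = gap_sum \<alpha> T' P'"
proof -
  obtain x y where xy: "x \<in> X" "y \<in> X" "dir y \<noteq> dir x" using nd unfolding nondegenerate_def by metis
  have r: "r > 0" using xy finite_X by (auto simp: card_gt_0_iff)
  obtain S Q where S: "admissible (hull_of P\<^sub>0) \<alpha> S Q" "gap_sum \<alpha> S Q = gap_sum \<alpha> T P"
    "dir (S 0) = dir x" "dir (S (r - 1)) \<noteq> dir x"
    using admissible_group_start[OF A xy(1,2), of dir, OF xy(3)] by metis
  have SX: "S i \<in> X" if "i < r" for i using S(1) that enumD(1) by (auto simp: admissible_def)
  (* S starts with a group of parallel sides. The second enumeration is rotated to start with
     the half-angle a; its last half-angle is then also that of S, so that it starts with the
     same group. *)
  define a where "a = \<alpha> (S 0)"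
  have lastS: "\<alpha> (S (r - 1)) \<noteq> a"
    using S(3,4) monotone_map_eqD[OF mono SX SX, of "r - 1" 0] r by (auto simp: a_def)
  obtain S' Q' where S': "admissible (hull_of P\<^sub>0) \<alpha> S' Q'" "gap_sum \<alpha> S' Q' = gap_sum \<alpha> T' P'"
    "\<alpha> (S' 0) = a" "\<alpha> (S' (r - 1)) \<noteq> a"
    using admissible_group_start[OF A' SX SX, of 0 "r - 1" \<alpha>] lastS r unfolding a_def by auto
  have SX': "S' i \<in> X" if "i < r" for i using S'(1) that enumD(1) by (auto simp: admissible_def)
  have greatest: "lift_angle (\<alpha> z - a) \<le> lift_angle (\<alpha> (R (r - 1)) - a)"
    if R: "admissible (hull_of P\<^sub>0) \<alpha> R O'" "\<alpha> (R 0) = a" "\<alpha> (R (r - 1)) \<noteq> a" and z: "z \<in> X" for R O' z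
  proof -
    have "enum R" using R(1) by (simp add: admissible_def)
    then obtain i where "i < r" "R i = z" using z enumD(3) by (metis imageE lessThan_iff)
    then show ?thesis using admissible_lifts[OF R(1) mono nd, of i "r - 1"] R by simp
  qed
  have "lift_angle (\<alpha> (S (r - 1)) - a) = lift_angle (\<alpha> (S' (r - 1)) - a)"
    using greatest[OF S(1) _ _ SX'[of "r - 1"]] greatest[OF S'(1) _ _ SX[of "r - 1"]] S' lastS r
    by (intro antisym) (simp_all add: a_def)
  then have "\<alpha> (S (r - 1)) = \<alpha> (S' (r - 1))" by (simp add: lift_angle_eq_iff)
  then have d': "dir (S' (r - 1)) \<noteq> dir x"
    using monotone_map_eqD[OF mono SX SX', of "r - 1" "r - 1"] S(4) r by auto
  have d0': "dir (S' 0) = dir x"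
    using monotone_map_eqD[OF mono SX SX', of 0 0] S(3) S'(3) r by (auto simp: a_def)
  have en: "enum S" "enum S'" "side_path S Q" "side_path S' Q'" using S(1) S'(1) by (auto simp: admissible_def)
  have pol: "polygon S = polygon S'"
    using polygon_subset_of_group_start[OF en(1,2) nd r S(3) d0' S(4) d']
      polygon_subset_of_group_start[OF en(2,1) nd r d0' S(3) d' S(4)] by blast
  define H where "H = hull_of P\<^sub>0"
  have H: "H = (\<lambda>x. plane_point (Q 0) + x) ` polygon S" "H = (\<lambda>x. plane_point (Q' 0) + x) ` polygon S"
    using admissible_hull[OF T0 nd S(1)] admissible_hull[OF T0 nd S'(1)] hull_side_path[OF en(3)] hull_side_path[OF en(4)] pol
    by (auto simp: H_def)
  have "(\<lambda>x. (plane_point (Q' 0) - plane_point (Q 0)) + x) ` H = (\<lambda>x. plane_point (Q' 0) + x) ` polygon S"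
    by (subst H(1)) (simp add: image_image)
  then have "(\<lambda>x. (plane_point (Q' 0) - plane_point (Q 0)) + x) ` H \<subseteq> H" using H(2) by simp
  moreover have "bounded H" "H \<noteq> {}" using compact_imp_bounded[OF compact_hull_of] r by (auto simp: H_def)
  ultimately have "plane_point (Q' 0) - plane_point (Q 0) = 0" using translation_subset_bounded by blast
  then have "gap_sum \<alpha> S Q = gap_sum \<alpha> S' Q'"
    using gap_sum_start[OF S(1) mono nd] gap_sum_start[OF S'(1) mono nd] S' lastS by (simp add: a_def)
  then show ?thesis using S S' by simp
qed

text \<open>Sort by the half-angles. Since the map is monotone, a triple sorted by half-angles is not in
  the reverse cyclic order of directions.\<close>

lemma admissible_exists:
  assumes T0: "enum T\<^sub>0" "side_path T\<^sub>0 P\<^sub>0" and nd: nondegenerate and mono: "monotone_map \<alpha>"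
  shows "\<exists>T P. admissible (hull_of P\<^sub>0) \<alpha> T P"
proof -
  obtain x where x: "x \<in> X" using nd unfolding nondegenerate_def by blast
  define u where "u y = lift_angle (\<alpha> y - \<alpha> x)" for y
  obtain T where T: "bij_betw T {..<r} X" "\<And>i j. i \<le> j \<Longrightarrow> j < r \<Longrightarrow> u (T i) \<le> u (T j)"
    using sorting_enumeration[OF finite_X, of u] by blast
  have TX: "T i \<in> X" if "i < r" for i using T(1) that by (auto simp: bij_betw_def)
  have "enum T"
    unfolding enum_def cyc_sorted_def
  proof (intro conjI allI impI notI)
    fix i j k assume ijk: "i < j" "j < k" "k < r" and C: "cyc_direction (w (T i)) (w (T k)) (w (T j))"
    have X: "T i \<in> X" "T j \<in> X" "T k \<in> X" using ijk TX by auto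
    have no: "\<not> cyc_angle (\<alpha> (T i)) (\<alpha> (T j)) (\<alpha> (T k))"
      using mono X C unfolding monotone_map_def by blast
    have "w (T i) \<noteq> w (T j)" "w (T j) \<noteq> w (T k)"
      using cyc_direction_distinct[OF nonzero[OF X(1)] nonzero[OF X(3)] nonzero[OF X(2)] C] by auto
    then have "\<alpha> (T i) \<noteq> \<alpha> (T j)" "\<alpha> (T j) \<noteq> \<alpha> (T k)" using monotone_map_eqD[OF mono] X by metis+
    then have "u (T i) \<noteq> u (T j)" "u (T j) \<noteq> u (T k)" by (simp_all add: u_def lift_angle_eq_iff)
    then have "u (T i) < u (T j)" "u (T j) < u (T k)"
      using T(2)[of i j] T(2)[of j k] ijk by auto
    then show False using no unfolding cyc_angle_iff[of _ _ _ "\<alpha> x"] u_def by blast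
  qed (rule T(1))
  moreover have "cyc_sorted cyc_angle r (\<alpha> \<circ> T)"
    by (rule cyc_sortedI[of _ _ "\<alpha> x"]) (use T(2) in \<open>simp add: u_def\<close>)
  moreover obtain P where P: "side_path T P" "hull_of P = hull_of P\<^sub>0"
    using side_path_exists[OF T0 \<open>enum T\<close> nd] by blast
  ultimately have "admissible (hull_of P\<^sub>0) \<alpha> T P"
    using side_path_frontier[OF \<open>enum T\<close> P(1) nd] unfolding admissible_def P(2) by blast
  then show ?thesis by blast
qed

text \<open>A point of the interior is a barycentre with positive weights of all the points of the
  path, and positive weights can be realised as gaps between half-angles.\<close>

lemma gap_sum_surjective:
  assumes T: "enum T" "side_path T P" and x: "x \<in> interior (hull_of P)"
  obtains \<alpha> where "monotone_map \<alpha>" "admissible (hull_of P) \<alpha> T P" "gap_sum \<alpha> T P = x"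
proof -
  have nd: nondegenerate using hull_interior_nondegenerate[OF T] x by blast
  obtain wt where wt: "\<And>j. j < r \<Longrightarrow> wt j > 0" "(\<Sum>j<r. wt j) = 1" "(\<Sum>j<r. wt j *\<^sub>R (plane_point \<circ> P) j) = x"
    using interior_convex_hull_positive[OF x] by blast
  have inj: "inj_on T {..<r}" and im: "T ` {..<r} = X" using enumD[OF T(1)] by auto
  have r2: "r > 1"
  proof -
    obtain y z where "y \<in> X" "z \<in> X" "y \<noteq> z" using nd unfolding nondegenerate_def by metis
    then have "card {y, z} \<le> r" by (intro card_mono finite_X) auto
    then show ?thesis using \<open>y \<noteq> z\<close> by simp
  qed
  (* The half-angle of T j is the sum of the weights up to j, scaled to pi. *)
  define S where "S j = (\<Sum>i<Suc j. wt i)" for j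
  have S_Suc: "S (Suc j) = S j + wt (Suc j)" for j by (simp add: S_def)
  have S_less: "S i < S j" if "i < j" "j < r" for i j
    using that
  proof (induction j)
    case (Suc j)
    have "S j < S (Suc j)" using wt(1)[OF Suc.prems(2)] by (simp add: S_Suc)
    moreover have "S i \<le> S j" using Suc by (cases "i = j") auto
    ultimately show ?case by simp
  qed simp
  have S0: "S 0 > 0" "S 0 = wt 0" using wt(1)[of 0] r2 by (auto simp: S_def)
  have S1: "S (r - 1) = 1" using wt(2) r2 by (simp add: S_def)
  have S_le: "S 0 \<le> S j \<and> S j \<le> 1" if "j < r" for j
  proof
    show "S 0 \<le> S j" using S_less[of 0 j] that by (cases "j = 0") auto
    have "j = r - 1 \<or> j < r - 1" using that by linarith
    then show "S j \<le> 1" using S_less[of j "r - 1"] r2 S1 by auto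
  qed
  define \<alpha> where "\<alpha> y = abs_halfangle (pi * S (inv_into {..<r} T y))" for y
  have \<alpha>T: "\<alpha> (T j) = abs_halfangle (pi * S j)" if "j < r" for j
    using inv_into_f_f[OF inj, of j] that by (simp add: \<alpha>_def)
  define u where "u y = lift_angle (\<alpha> y - \<alpha> (T 0))" for y
  have uT: "u (T j) = pi * (S j - S 0)" if j: "j < r" for j
  proof -
    have "pi * (S j - S 0) < pi * 1" using S_le[OF j] S0 by (intro mult_strict_left_mono) auto
    moreover have "0 \<le> pi * (S j - S 0)" using S_le[OF j] by simp
    moreover have "u (T j) = (pi * (S j - S 0)) rmod pi"
      using j r2 by (simp add: u_def \<alpha>T abs_halfangle_diff[symmetric] lift_angle_abs right_diff_distrib)
    ultimately show ?thesis by (simp add: rmod_idem)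
  qed
  have u_less: "u (T i) < u (T j) \<longleftrightarrow> i < j" if "i < r" "j < r" for i j
    using S_less[of i j] S_less[of j i] uT that by (cases i j rule: linorder_cases) auto
  have cs: "cyc_sorted cyc_angle r (\<alpha> \<circ> T)"
  proof (rule cyc_sortedI[of _ _ "\<alpha> (T 0)"])
    fix i j assume "i \<le> j" "j < r"
    then have "\<not> u (T j) < u (T i)" using u_less[of j i] by simp
    then show "lift_angle ((\<alpha> \<circ> T) i - \<alpha> (T 0)) \<le> lift_angle ((\<alpha> \<circ> T) j - \<alpha> (T 0))" by (simp add: u_def)
  qed
  have mono: "monotone_map \<alpha>"
    unfolding monotone_map_def
  proof (intro conjI ballI impI notI)
    fix x y z assume X: "x \<in> X" "y \<in> X" "z \<in> X" and C: "cyc_direction (w x) (w y) (w z)"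
      and C': "cyc_angle (\<alpha> x) (\<alpha> z) (\<alpha> y)"
    obtain i where i: "i < r" "T i = x" using X(1) im by (metis imageE lessThan_iff)
    obtain j where j: "j < r" "T j = y" using X(2) im by (metis imageE lessThan_iff)
    obtain k where k: "k < r" "T k = z" using X(3) im by (metis imageE lessThan_iff)
    note ijk = i j k
    have no: "\<not> cyc_angle (dir (T a)) (dir (T c)) (dir (T b))" if "a < b" "b < c" "c < r" for a b c
      using enumD(4)[OF T(1)] that unfolding cyc_sorted_def by blast
    have D: "cyc_angle (dir x) (dir y) (dir z)" using C cyc_direction_iff nonzero X by blast
    have cases: "(u x < u z \<and> u z < u y) \<or> (u z < u y \<and> u y < u x) \<or> (u y < u x \<and> u x < u z)"
      using C' unfolding cyc_angle_iff[of _ _ _ "\<alpha> (T 0)"] u_def .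
    have "u x < u z \<longleftrightarrow> i < k" "u z < u y \<longleftrightarrow> k < j" "u y < u x \<longleftrightarrow> j < i"
      using u_less[of i k] u_less[of k j] u_less[of j i] ijk by simp_all
    then have "(i < k \<and> k < j) \<or> (k < j \<and> j < i) \<or> (j < i \<and> i < k)"
      using cases by blast
    then show False
      using no[of i k j] no[of k j i] no[of j i k] D cyc_angle_rotate[OF D]
        cyc_angle_rotate[OF cyc_angle_rotate[OF D]] ijk by auto
  next
    fix x y assume X: "x \<in> X" "y \<in> X" and ne: "w x \<noteq> w y" and eq: "\<alpha> x = \<alpha> y"
    obtain i j where ij: "i < r" "T i = x" "j < r" "T j = y" using X im by (metis imageE lessThan_iff)
    have "u x = u y" using eq by (simp add: u_def)
    then have "i = j" using u_less[of i j] u_less[of j i] ij by (metis less_irrefl linorder_neqE_nat)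
    then show False using ij ne by simp
  qed
  have A: "admissible (hull_of P) \<alpha> T P"
    unfolding admissible_def using T cs side_path_frontier[OF T nd] by blast
  have wt1: "wt j < 1" if j: "j < r" for j
  proof -
    obtain k where k: "k < r" "k \<noteq> j" using r2 by (cases "j = 0") (auto intro: that[of 1] that[of 0])
    have "(\<Sum>i\<in>{j, k}. wt i) \<le> (\<Sum>i<r. wt i)"
      using wt(1) j k by (intro sum_mono2) (auto intro: less_imp_le)
    then show ?thesis using wt(1)[OF k(1)] wt(2) k by simp
  qed
  have gap: "lift_angle (\<alpha> (T j) - \<alpha> (T ((j + r - 1) mod r))) / pi = wt j" if j: "j < r" for j
  proof (cases "j = 0")
    case True
    have m: "pi * wt 0 < pi * 1" "0 < pi * wt 0" using wt1[of 0] wt(1)[of 0] r2 by auto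
    have "lift_angle (\<alpha> (T 0) - \<alpha> (T (r - 1))) = (pi * wt 0 - pi) rmod pi"
      using r2 S0 S1 by (simp add: \<alpha>T abs_halfangle_diff[symmetric] lift_angle_abs)
    also have "\<dots> = pi * wt 0" using m by (subst rmod_pi_cases) auto
    finally show ?thesis using True r2 by simp
  next
    case False
    then obtain i where i: "j = Suc i" using gr0_conv_Suc by blast
    have m: "pi * wt j < pi * 1" "0 < pi * wt j" using wt1[OF j] wt(1)[OF j] by auto
    have "lift_angle (\<alpha> (T j) - \<alpha> (T i)) = (pi * wt j) rmod pi"
      using j i by (simp add: \<alpha>T abs_halfangle_diff[symmetric] lift_angle_abs right_diff_distrib[symmetric] S_Suc)
    also have "\<dots> = pi * wt j" using m by (simp add: rmod_idem)
    finally have "lift_angle (\<alpha> (T j) - \<alpha> (T i)) = pi * wt j" .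
    moreover have "(j + r - 1) mod r = i" using i j by simp
    ultimately show ?thesis by simp
  qed
  have "gap_sum \<alpha> T P = x"
    unfolding gap_sum_def wt(3)[symmetric]
  proof (rule sum.cong[OF refl])
    fix j assume "j \<in> {..<r}"
    then show "(lift_angle (\<alpha> (T j) - \<alpha> (T ((j + r - 1) mod r))) / pi) *\<^sub>R plane_point (P j) =
      wt j *\<^sub>R (plane_point \<circ> P) j"
      by (simp only: gap lessThan_iff comp_apply)
  qed
  then show ?thesis using that mono A by blast
qed

text \<open>A constant can be added to all lifts since the vectors sum up to zero.\<close>

lemma gap_sum_lifts:
  assumes A0: "admissible N \<alpha> T P" and mono: "monotone_map \<alpha>" and nd: nondegenerate
  obtains a c where "\<And>x. abs_halfangle (a x) = \<alpha> x"
    "gap_sum \<alpha> T P = plane_point c - (1 / pi) *\<^sub>R (\<Sum>x\<in>X. a x *\<^sub>R plane_point (w x))"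
proof -
  obtain x y where "x \<in> X" "y \<in> X" "\<alpha> y \<noteq> \<alpha> x" using third_value[OF mono nd] by metis
  then obtain S Q where A: "admissible N \<alpha> S Q" and gs: "gap_sum \<alpha> S Q = gap_sum \<alpha> T P"
    and last: "\<alpha> (S (r - 1)) \<noteq> \<alpha> (S 0)"
    using admissible_group_start[OF A0, of x y \<alpha>] by metis
  define a where "a x = lift_angle (\<alpha> x - \<alpha> (S 0)) + lift_angle (\<alpha> (S 0))" for x
  have "abs_halfangle (a x) = \<alpha> x" for x by (simp add: a_def abs_halfangle_add abs_lift_angle)
  moreover have "(\<Sum>x\<in>X. a x *\<^sub>R plane_point (w x)) =
      (\<Sum>x\<in>X. lift_angle (\<alpha> x - \<alpha> (S 0)) *\<^sub>R plane_point (w x)) + lift_angle (\<alpha> (S 0)) *\<^sub>R plane_point (\<Sum>x\<in>X. w x)"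
    by (simp add: a_def scaleR_add_left sum.distrib plane_point_sum scaleR_sum_right)
  then have "gap_sum \<alpha> T P = plane_point (Q 0) - (1 / pi) *\<^sub>R (\<Sum>x\<in>X. a x *\<^sub>R plane_point (w x))"
    using gap_sum_start[OF A mono nd last] gs sum_zero by simp
  ultimately show ?thesis using that by blast
qed

end

section \<open>Periodicity of Fock's operator\<close>

lemma additive_map_zero:
  fixes h :: "int \<times> int \<Rightarrow> 'a :: ab_group_add"
  assumes add: "\<And>z z'. h (z + z') = h z + h z'" and "h (1, 0) = 0" "h (0, 1) = 0"
  shows "h z = 0"
proof -
  have h0: "h 0 = 0" using add[of 0 0] by simp
  have minus: "h (z - z') = h z - h z'" for z z' using add[of "z - z'" z'] by (simp add: algebra_simps)
  have multiple: "h (m * fst u, m * snd u) = 0" if "h u = 0" for m u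
  proof (induction m rule: int_induct[of _ 0])
    case base
    then show ?case using h0 by (simp add: zero_prod_def)
  next
    case (step1 i)
    have "((i + 1) * fst u, (i + 1) * snd u) = (i * fst u, i * snd u) + u"
      by (cases u) (simp add: algebra_simps)
    then show ?case using step1 that add by simp
  next
    case (step2 i)
    have "((i - 1) * fst u, (i - 1) * snd u) = (i * fst u, i * snd u) - u"
      by (cases u) (simp add: algebra_simps)
    then show ?case using step2 that minus by simp
  qed
  have "z = (fst z * 1, fst z * 0) + (snd z * 0, snd z * 1)" by (cases z) simp
  then have "h z = h (fst z * 1, fst z * 0) + h (snd z * 0, snd z * 1)" using add by metis
  then show ?thesis using multiple[of "(1, 0)" "fst z"] multiple[of "(0, 1)" "snd z"] assms(2,3) by simp
qed

context periodic_plane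
begin

lemma half_angle_at_ttrack: "half_angle_at G \<alpha> c = \<alpha> (ttrack c)"
  by (simp add: half_angle_at_def ttrack_def)

text \<open>The Abel map of real lifts projects to that of the half-angles.\<close>

lemma abel_eqs_project:
  assumes "\<And>T. abs_halfangle (a T) = \<alpha> T" "abel_eqs (\<lambda>c. a (ttrack c)) \<eta>"
  shows "abel_eqs (\<lambda>c. \<alpha> (ttrack c)) (\<lambda>v. abs_halfangle (\<eta> v + s))"
  using assms unfolding abel_eqs_def
  by (simp add: abs_halfangle_add abs_halfangle_diff)

text \<open>The half-angles are lifted to the reals, where closed forms are exact.\<close>

lemma abel_map_equations: "abel_eqs (\<lambda>c. \<alpha> (ttrack c)) (abel_map G \<alpha> v0)"
proof -
  have "track_invariant (\<lambda>c. lift_angle (\<alpha> (ttrack c)))" by (rule track_invariantI) simp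
  then obtain \<eta> where "abel_eqs (\<lambda>c. lift_angle (\<alpha> (ttrack c))) \<eta>" using abel_exists by blast
  then have "abel_eqs (\<lambda>c. \<alpha> (ttrack c)) (\<lambda>v. abs_halfangle (\<eta> v + - \<eta> v0))"
    by (rule abel_eqs_project[of "\<lambda>T. lift_angle (\<alpha> T)", OF abs_lift_angle])
  then have "is_abel_map G \<alpha> v0 (\<lambda>v. abs_halfangle (\<eta> v + - \<eta> v0))"
    unfolding is_abel_map_def abel_eqs_def half_angle_at_ttrack by (simp add: zero_halfangle_def)
  then have "is_abel_map G \<alpha> v0 (abel_map G \<alpha> v0)" unfolding abel_map_def by (rule someI[of "is_abel_map G \<alpha> v0"])
  then show ?thesis unfolding is_abel_map_def abel_eqs_def half_angle_at_ttrack by blast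
qed

lemma abel_map_period:
  fixes a :: "'e corner set set \<Rightarrow> real"
  assumes a: "\<And>T. abs_halfangle (a T) = \<alpha> T"
  obtains \<delta> :: "int \<times> int \<Rightarrow> real" where
    "\<And>z e. abel_map G \<alpha> v0 (Vertex (black G (sh z e))) = abel_map G \<alpha> v0 (Vertex (black G e)) + abs_halfangle (\<delta> z)"
    "\<And>z z'. \<delta> (z + z') = \<delta> z + \<delta> z'"
    "(\<Sum>T\<in>torus_tracks G. a T * of_int (fst (track_class G T))) = - \<delta> ey"
    "(\<Sum>T\<in>torus_tracks G. a T * of_int (snd (track_class G T))) = \<delta> ex"
proof -
  have "track_invariant (\<lambda>c. a (ttrack c))" by (rule track_invariantI) simp
  then obtain \<eta> where \<eta>: "abel_eqs (\<lambda>c. a (ttrack c)) \<eta>" using abel_exists by blast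
  obtain \<delta> where \<delta>:
    "\<And>z e. \<eta> (Vertex (white G (sh z e))) = \<eta> (Vertex (white G e)) + \<delta> z"
    "\<And>z e. \<eta> (Vertex (black G (sh z e))) = \<eta> (Vertex (black G e)) + \<delta> z"
    "\<And>z e. \<eta> (Face (lf (sh z e))) = \<eta> (Face (lf e)) + \<delta> z"
    "\<And>z e. \<eta> (Face (rf (sh z e))) = \<eta> (Face (rf e)) + \<delta> z"
    and add: "\<And>z z'. \<delta> (z + z') = \<delta> z + \<delta> z'"
    using abel_period[OF \<eta>] by auto
  have sums: "(\<Sum>T\<in>torus_tracks G. a T * of_int (fst (track_class G T))) = - \<delta> ey"
    "(\<Sum>T\<in>torus_tracks G. a T * of_int (snd (track_class G T))) = \<delta> ex"
    by (rule weighted_classes_periods[OF \<eta> \<delta>])+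
  have proj: "abel_eqs (\<lambda>c. \<alpha> (ttrack c)) (\<lambda>v. abs_halfangle (\<eta> v + 0))"
    by (rule abel_eqs_project[OF a \<eta>])
  have "abel_map G \<alpha> v0 (Vertex (black G (sh z e))) = abel_map G \<alpha> v0 (Vertex (black G e)) + abs_halfangle (\<delta> z)" for z e
  proof -
    have V: "Vertex (black G e') \<in> quad_vertices G" for e'
      by (simp add: quad_vertices_def vertices_def black_vertices_def)
    have "abel_map G \<alpha> v0 (Vertex (black G (sh z e))) - abs_halfangle (\<eta> (Vertex (black G (sh z e))) + 0) =
      abel_map G \<alpha> v0 (Vertex (black G e)) - abs_halfangle (\<eta> (Vertex (black G e)) + 0)"
      by (rule abel_difference[OF abel_map_equations proj V V])
    then show ?thesis unfolding \<delta>(2) by (simp add: abs_halfangle_add algebra_simps)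
  qed
  then show ?thesis using that add sums by blast
qed

lemma side_shift: "side_wr G (sh z e) = shc z (side_wr G e)" "side_br G (sh z e) = shc z (side_br G e)"
  using opposite_entry_shift[of z "CornerB e"] by (simp_all add: side_br_def)

lemma fock_operator_shift:
  "fock_operator G \<alpha> v0 \<tau> t (w + lat z) (b + lat z) =
    (\<Sum>e | white G e = w \<and> black G e = b. edge_coefficient G \<alpha> v0 \<tau> t (sh z e))"
proof -
  have "{e. white G e = w + lat z \<and> black G e = b + lat z} = sh z ` {e. white G e = w \<and> black G e = b}"
  proof (intro equalityI subsetI)
    fix e assume e: "e \<in> {e. white G e = w + lat z \<and> black G e = b + lat z}"
    then have "sh (- z) e \<in> {e. white G e = w \<and> black G e = b}"
      by (simp add: white_shift black_shift lat_uminus)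
    then have "sh z (sh (- z) e) \<in> sh z ` {e. white G e = w \<and> black G e = b}" by (rule imageI)
    then show "e \<in> sh z ` {e. white G e = w \<and> black G e = b}" by simp
  qed (auto simp: white_shift black_shift)
  moreover have "inj (sh z)" using bij_shift bij_is_inj by blast
  then have "inj_on (sh z) {e. white G e = w \<and> black G e = b}" by (rule inj_on_subset) simp
  ultimately show ?thesis unfolding fock_operator_def by (simp add: sum.reindex)
qed

text \<open>The weights of the translates of one edge with no parallel edge detect the quasi-period of
  the Abel map.\<close>

lemma periodic_fock_operator_iff:
  assumes min: "minimal_graph G" and \<tau>: "Re \<tau> = 0" "0 < Im \<tau>" and t: "t - of_real (pi / 2) * \<tau> \<in> \<real>"
    and X: "\<alpha> \<in> X_per G"
    and h: "\<And>z e. abel_map G \<alpha> v0 (Vertex (black G (sh z e))) = abel_map G \<alpha> v0 (Vertex (black G e)) + h z"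
  shows "periodic_operator G (fock_operator G \<alpha> v0 \<tau> t) \<longleftrightarrow> (\<forall>z. h z = 0)"
proof
  have sides: "half_angle_at G \<alpha> (side_wr G (sh z e)) = half_angle_at G \<alpha> (side_wr G e)"
    "half_angle_at G \<alpha> (side_br G (sh z e)) = half_angle_at G \<alpha> (side_br G e)" for z e
    by (simp_all add: half_angle_at_ttrack side_shift)
  {
    assume "\<forall>z. h z = 0"
    then have "h z = 0" for z by blast
    then have "edge_coefficient G \<alpha> v0 \<tau> t (sh z e) = edge_coefficient G \<alpha> v0 \<tau> t e" for z e
      by (simp add: edge_coefficient_def sides h)
    then show "periodic_operator G (fock_operator G \<alpha> v0 \<tau> t)"
      unfolding periodic_operator_def fock_operator_shift by (simp add: fock_operator_def)
  }
  assume per: "periodic_operator G (fock_operator G \<alpha> v0 \<tau> t)"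
  obtain e where e: "\<And>e'. white G e' = white G e \<and> black G e' = black G e \<Longrightarrow> e' = e"
    using exists_single_edge[OF min] by blast
  then have single: "{e'. white G e' = white G e \<and> black G e' = black G e} = {e}" by auto
  define a where "a = lift_angle (half_angle_at G \<alpha> (side_wr G e))"
  define b where "b = lift_angle (half_angle_at G \<alpha> (side_br G e))"
  have "sin (b - a) \<noteq> 0"
  proof -
    have "track_class G (ttrack (side_wr G e)) \<noteq> track_class G (ttrack (side_br G e))"
      using crossing_tracks_class[OF min, of "CornerB e"] by (simp add: side_br_def)
    then have "\<alpha> (ttrack (side_wr G e)) \<noteq> \<alpha> (ttrack (side_br G e))"
      using X torus_tracks_range unfolding X_per_def by blast
    then have ne: "a \<noteq> b" by (simp add: a_def b_def half_angle_at_ttrack lift_angle_eq_iff)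
    have bd: "0 \<le> a" "a < pi" "0 \<le> b" "b < pi" by (simp_all add: a_def b_def lift_angle_bounds)
    show ?thesis
    proof (cases "a < b")
      case True
      then show ?thesis using sin_gt_zero[of "b - a"] bd by simp
    next
      case False
      then have "sin (a - b) > 0" using bd ne by (intro sin_gt_zero) auto
      then show ?thesis using sin_minus[of "a - b"] by simp
    qed
  qed
  show "\<forall>z. h z = 0"
  proof
    fix z
    have "fock_operator G \<alpha> v0 \<tau> t (white G e + lat z) (black G e + lat z) = fock_operator G \<alpha> v0 \<tau> t (white G e) (black G e)"
      using per unfolding periodic_operator_def white_vertices_def black_vertices_def by blast
    then have eq: "edge_coefficient G \<alpha> v0 \<tau> t (sh z e) = edge_coefficient G \<alpha> v0 \<tau> t e"
      unfolding fock_operator_shift unfolding fock_operator_def single by simp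
    have "lift_angle (abel_map G \<alpha> v0 (Vertex (black G (sh z e)))) = lift_angle (abel_map G \<alpha> v0 (Vertex (black G e)))"
      by (rule fock_weight_phase[OF \<tau> t \<open>sin (b - a) \<noteq> 0\<close>])
        (use eq in \<open>simp_all add: lift_angle_bounds edge_coefficient_def sides a_def b_def Let_def\<close>)
    then show "h z = 0" by (simp add: lift_angle_eq_iff h)
  qed
qed

lemma cyclic_tracks:
  assumes "minimal_graph G"
  shows "cyclic_vectors (torus_tracks G) (track_class G)"
  by standard (use finite_torus_tracks track_class_nonzero[OF assms] sum_of_classes in auto)

end

section \<open>The image of phi and the periodic operators\<close>

lemma lattice_point_iff:
  fixes c :: "int \<times> int"
  shows "plane_point c - (1 / pi) *\<^sub>R (- y, x) \<in> range plane_point \<longleftrightarrow> abs_halfangle x = 0 \<and> abs_halfangle y = 0"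
proof
  assume "plane_point c - (1 / pi) *\<^sub>R (- y, x) \<in> range plane_point"
  then obtain d where d: "plane_point c - (1 / pi) *\<^sub>R (- y, x) = plane_point d" by blast
  then have "of_int (fst c) + y / pi = of_int (fst d)" "of_int (snd c) - x / pi = of_int (snd d)"
    by (simp_all add: plane_point_def)
  then have "y = of_int (fst d - fst c) * pi" "x = of_int (snd c - snd d) * pi"
    by (simp_all add: field_simps)
  then show "abs_halfangle x = 0 \<and> abs_halfangle y = 0" unfolding abs_halfangle_0_iff by blast
next
  assume "abs_halfangle x = 0 \<and> abs_halfangle y = 0"
  then obtain m n where mn: "x = of_int m * pi" "y = of_int n * pi" unfolding abs_halfangle_0_iff by blast
  have "plane_point c - (1 / pi) *\<^sub>R (- y, x) = plane_point (fst c + n, snd c - m)"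
    by (simp add: plane_point_def mn)
  then show "plane_point c - (1 / pi) *\<^sub>R (- y, x) \<in> range plane_point" by simp
qed

theorem proposition30:
  fixes G :: "'e periodic_graph"
    and N :: "(real \<times> real) set"
    and v0 :: quad_vertex
    and \<tau> t :: complex
  assumes "periodic_bipartite_plane_graph G"
    and "minimal_graph G"
    and "newton_polygon G N"
    and non_degenerate: "0 < measure lborel N"
    and "v0 \<in> quad_vertices G"
    and "Re \<tau> = 0" and "0 < Im \<tau>"
    and "t - of_real (pi / 2) * \<tau> \<in> \<real>"
  shows "phi G N ` X_per G = interior N \<and>
         (\<forall>\<alpha>\<in>X_per G.
            periodic_operator G (fock_operator G \<alpha> v0 \<tau> t) \<longleftrightarrow> phi G N \<alpha> \<in> range plane_point)"
proof -
  interpret periodic_plane G by standard (rule assms(1))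
  interpret cv: cyclic_vectors "torus_tracks G" "track_class G" by (rule cyclic_tracks[OF assms(2)])
  have cyc: "cyc_track G = (\<lambda>x y z. cyc_direction (track_class G x) (track_class G y) (track_class G z))"
    by (intro ext) (simp add: cyc_track_def)
  have enum: "enumerates_tracks G T \<longleftrightarrow> cv.enum T" for T
    unfolding enumerates_tracks_def cv.enum_def cyc ..
  have sides: "side_by_side G T P \<longleftrightarrow> cv.side_path T P" for T P
    unfolding side_by_side_def cv.side_path_def ..
  have X: "\<alpha> \<in> X_per G \<longleftrightarrow> cv.monotone_map \<alpha>" for \<alpha>
    unfolding X_per_def cv.monotone_map_def cyc by simp
  have adm: "admissible_enumeration G N \<alpha> T P \<longleftrightarrow> cv.admissible N \<alpha> T P" for \<alpha> T P
    unfolding admissible_enumeration_def cv.admissible_def enum sides ..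
  obtain T\<^sub>0 P\<^sub>0 where T0: "cv.enum T\<^sub>0" "cv.side_path T\<^sub>0 P\<^sub>0" and N: "N = cv.hull_of P\<^sub>0"
    using assms(3) unfolding newton_polygon_def enum sides by blast
  (* The measure of a convex set with empty interior is zero. *)
  have int: "interior (cv.hull_of P\<^sub>0) \<noteq> {}"
  proof
    assume "interior (cv.hull_of P\<^sub>0) = {}"
    then have "negligible N" unfolding N using negligible_convex_interior convex_convex_hull by blast
    then have "measure lebesgue N = 0" by (rule negligible_imp_measure0)
    moreover have "closed N" unfolding N by (rule compact_imp_closed[OF cv.compact_hull_of])
    then have "measure lebesgue N = measure lborel N" by (intro measure_completion) simp
    ultimately show False using non_degenerate by simp
  qed
  have nd: cv.nondegenerate by (rule cv.hull_interior_nondegenerate[OF T0 int])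
  have phi: "\<exists>T P. cv.admissible N \<alpha> T P \<and> phi G N \<alpha> = cv.gap_sum \<alpha> T P" if "cv.monotone_map \<alpha>" for \<alpha>
  proof -
    obtain T P where TP: "(SOME (T, P). cv.admissible N \<alpha> T P) = (T, P)" by (metis surj_pair)
    have "\<exists>p. case p of (T, P) \<Rightarrow> cv.admissible N \<alpha> T P"
      using cv.admissible_exists[OF T0 nd that] unfolding N by auto
    then have "case (SOME (T, P). cv.admissible N \<alpha> T P) of (T, P) \<Rightarrow> cv.admissible N \<alpha> T P" by (rule someI_ex)
    then have "cv.admissible N \<alpha> T P" unfolding TP by simp
    moreover have "phi G N \<alpha> = cv.gap_sum \<alpha> T P"
      unfolding phi_def adm TP by (simp add: cv.gap_sum_def Let_def)
    ultimately show ?thesis by blast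
  qed
  have "phi G N ` X_per G = interior N"
  proof (intro equalityI subsetI)
    fix x assume "x \<in> phi G N ` X_per G"
    then obtain \<alpha> where \<alpha>: "cv.monotone_map \<alpha>" "x = phi G N \<alpha>" using X by blast
    obtain T P where TP: "cv.admissible N \<alpha> T P" "phi G N \<alpha> = cv.gap_sum \<alpha> T P" using phi[OF \<alpha>(1)] by blast
    have "cv.gap_sum \<alpha> T P \<in> interior N"
      unfolding N by (rule cv.gap_sum_interior[OF T0 int \<alpha>(1)]) (use TP in \<open>simp only: N\<close>)
    then show "x \<in> interior N" using \<alpha> TP by simp
  next
    fix x assume x: "x \<in> interior N"
    obtain \<alpha> where \<alpha>: "cv.monotone_map \<alpha>" "cv.admissible N \<alpha> T\<^sub>0 P\<^sub>0" "cv.gap_sum \<alpha> T\<^sub>0 P\<^sub>0 = x"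
      using cv.gap_sum_surjective[OF T0, of x] x unfolding N by blast
    obtain T P where TP: "cv.admissible N \<alpha> T P" "phi G N \<alpha> = cv.gap_sum \<alpha> T P" using phi[OF \<alpha>(1)] by blast
    have "cv.gap_sum \<alpha> T P = cv.gap_sum \<alpha> T\<^sub>0 P\<^sub>0"
      using cv.gap_sum_unique[OF T0 nd \<alpha>(1)] TP(1) \<alpha>(2) unfolding N by blast
    then have "x = phi G N \<alpha>" using TP \<alpha>(3) by simp
    then show "x \<in> phi G N ` X_per G" using \<alpha>(1) X by blast
  qed
  moreover have "periodic_operator G (fock_operator G \<alpha> v0 \<tau> t) \<longleftrightarrow> phi G N \<alpha> \<in> range plane_point"
    if \<alpha>: "\<alpha> \<in> X_per G" for \<alpha>
  proof -
    have mono: "cv.monotone_map \<alpha>" using \<alpha> X by blast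
    obtain T P where TP: "cv.admissible N \<alpha> T P" "phi G N \<alpha> = cv.gap_sum \<alpha> T P" using phi[OF mono] by blast
    (* The real lifts connect the barycentre with the periods of the Abel map. *)
    obtain a c where a: "\<And>T. abs_halfangle (a T) = \<alpha> T"
      and gs: "cv.gap_sum \<alpha> T P = plane_point c - (1 / pi) *\<^sub>R (\<Sum>T\<in>torus_tracks G. a T *\<^sub>R plane_point (track_class G T))"
      using cv.gap_sum_lifts[OF TP(1) mono nd] by blast
    obtain \<delta> where \<delta>: "\<And>z e. abel_map G \<alpha> v0 (Vertex (black G (sh z e))) = abel_map G \<alpha> v0 (Vertex (black G e)) + abs_halfangle (\<delta> z)"
      and add: "\<And>z z'. \<delta> (z + z') = \<delta> z + \<delta> z'"
      and sums: "(\<Sum>T\<in>torus_tracks G. a T * of_int (fst (track_class G T))) = - \<delta> ey"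
        "(\<Sum>T\<in>torus_tracks G. a T * of_int (snd (track_class G T))) = \<delta> ex"
      using abel_map_period[of a \<alpha> v0, OF a] by blast
    have "(\<Sum>T\<in>torus_tracks G. a T *\<^sub>R plane_point (track_class G T)) = (- \<delta> ey, \<delta> ex)"
      using sums by (simp add: plane_point_def prod_eq_iff fst_sum snd_sum)
    then have "phi G N \<alpha> \<in> range plane_point \<longleftrightarrow> abs_halfangle (\<delta> ex) = 0 \<and> abs_halfangle (\<delta> ey) = 0"
      unfolding TP(2) gs by (simp only: lattice_point_iff)
    also have "\<dots> \<longleftrightarrow> (\<forall>z. abs_halfangle (\<delta> z) = 0)"
      using additive_map_zero[of "\<lambda>z. abs_halfangle (\<delta> z)"] by (auto simp: add abs_halfangle_add)
    also have "\<dots> \<longleftrightarrow> periodic_operator G (fock_operator G \<alpha> v0 \<tau> t)"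
      using periodic_fock_operator_iff[OF assms(2,6,7,8) \<alpha> \<delta>] by simp
    finally show ?thesis by simp
  qed
  ultimately show ?thesis by blast
qed

end
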